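(* Let $F$ be a field, $0\ne q\in F$, and let $n$ be a positive integer. Let $V$ be a Young permutation module (respectively a signed Young permutation module) for the Hecke algebra $\mathrm{Hec}(n)=\mathrm{Hec}(n)_{F,q}$ and suppose that $\hat\zeta(V)$ (respectively $\hat\zeta_s(V)$) is co-saturated. Then $V$ has the double centraliser property as a $\mathrm{Hec}(n)$-module.
   Context: $\mathrm{Hec}(n)_{F,q}$ is the $F$-algebra with generators $T_1,\dots,T_{n-1}$ satisfying the braid relations and $(T_i-q)(T_i+1)=0$. Modules are left modules. $\mathrm{Par}(n)$ is the set of partitions of $n$ with the dominance order. For $\lambda\in\mathrm{Par}(n)$, $\mathrm{Hec}(\lambda)_{F,q}$ is the subalgebra generated by the $T_i$ with $1\le i<n$ and $i\notin\{\lambda_1,\lambda_1+\lambda_2,\dots\}$. $M(\lambda)=\mathrm{Hec}(n)\otimes_{\mathrm{Hec}(\lambda)}F$, where each $T_i$ acts on $F$ as $q$; $M_s(\lambda)=\mathrm{Hec}(n)\otimes_{\mathrm{Hec}(\lambda)}F_s$, where $F_s=F$ with each $T_i$ acting as $-1$. A Young permutation module (resp. signed Young permutation module) is a module of the form $V=\bigoplus_{\lambda\in\mathrm{Par}(n)}M(\lambda)^{(d_\lambda)}$ (resp. $\bigoplus_\lambda M_s(\lambda)^{(d_\lambda)}$), where $M^{(d)}$ is the direct sum of $d$ copies of $M$; the multiplicities $d_\lambda$ are uniquely determined, and $\zeta(V)$ (resp. $\zeta_s(V)$) is $\{\lambda : d_\lambda\ne0\}$. A partition $\mu$ is a coarsening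 of $\lambda$ if the multiset of parts of $\lambda$ can be partitioned into multisets whose sums are the parts of $\mu$. For $\sigma\subseteq\mathrm{Par}(n)$, $\hat\sigma$ is the set of all partitions that are coarsenings of some $\lambda\in\sigma$. $\sigma$ is co-saturated if $\mu\in\sigma$, $\lambda\in\mathrm{Par}(n)$, $\lambda\ge\mu$ imply $\lambda\in\sigma$. For a ring $S$ and left module $V$, $\mathrm{DEnd}_S(V)$ is the ring of additive maps $V\to V$ commuting with all elements of $\mathrm{End}_S(V)$; $V$ has the double centraliser property if the natural map $S\to\mathrm{DEnd}_S(V)$ given by the action is surjective. *)

theory Defs
  imports
    "HOL-Algebra.Module" "HOL-Algebra.QuotRing" "HOL-Algebra.Generated_Rings"
    "HOL-Algebra.Free_Abelian_Groups" "HOL-Library.Multiset"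
begin

section \<open>Left modules over a ring\<close>

text \<open>The locale \<^locale>\<open>module\<close> requires a commutative ring of scalars.  We reuse its record type;
  the multiplicative fields \<^const>\<open>monoid.mult\<close> and \<^const>\<open>one\<close> of the module carry no meaning.\<close>

locale left_module = R?: ring R + M?: abelian_group M
  for R :: "('r, 'm) ring_scheme" (structure) and M :: "('r, 'v, 'k) module_scheme" (structure) +
  assumes smult_closed [simp, intro]:
      "\<lbrakk>a \<in> carrier R; x \<in> carrier M\<rbrakk> \<Longrightarrow> a \<odot>\<^bsub>M\<^esub> x \<in> carrier M"
    and smult_l_distr:
      "\<lbrakk>a \<in> carrier R; b \<in> carrier R; x \<in> carrier M\<rbrakk> \<Longrightarrow>
        (a \<oplus>\<^bsub>R\<^esub> b) \<odot>\<^bsub>M\<^esub> x = a \<odot>\<^bsub>M\<^esub> x \<oplus>\<^bsub>M\<^esub> b \<odot>\<^bsub>M\<^esub> x"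
    and smult_r_distr:
      "\<lbrakk>a \<in> carrier R; x \<in> carrier M; y \<in> carrier M\<rbrakk> \<Longrightarrow>
        a \<odot>\<^bsub>M\<^esub> (x \<oplus>\<^bsub>M\<^esub> y) = a \<odot>\<^bsub>M\<^esub> x \<oplus>\<^bsub>M\<^esub> a \<odot>\<^bsub>M\<^esub> y"
    and smult_assoc:
      "\<lbrakk>a \<in> carrier R; b \<in> carrier R; x \<in> carrier M\<rbrakk> \<Longrightarrow>
        (a \<otimes>\<^bsub>R\<^esub> b) \<odot>\<^bsub>M\<^esub> x = a \<odot>\<^bsub>M\<^esub> (b \<odot>\<^bsub>M\<^esub> x)"
    and smult_one [simp]: "x \<in> carrier M \<Longrightarrow> \<one>\<^bsub>R\<^esub> \<odot>\<^bsub>M\<^esub> x = x"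

definition lmod_hom ::
    "('r, 'm) ring_scheme \<Rightarrow> ('r, 'a, 'k) module_scheme \<Rightarrow> ('r, 'b, 'l) module_scheme \<Rightarrow> ('a \<Rightarrow> 'b) set" where
  "lmod_hom R M N = {f \<in> hom (add_monoid M) (add_monoid N).
     \<forall>a\<in>carrier R. \<forall>x\<in>carrier M. f (a \<odot>\<^bsub>M\<^esub> x) = a \<odot>\<^bsub>N\<^esub> f x}"

definition lmod_iso ::
    "('r, 'm) ring_scheme \<Rightarrow> ('r, 'a, 'k) module_scheme \<Rightarrow> ('r, 'b, 'l) module_scheme \<Rightarrow> bool" where
  "lmod_iso R M N \<longleftrightarrow> (\<exists>f\<in>lmod_hom R M N. bij_betw f (carrier M) (carrier N))"

definition lmod_direct_sum :: "'i set \<Rightarrow> ('i \<Rightarrow> ('r, 'a) module) \<Rightarrow> ('r, 'i \<Rightarrow> 'a) module" where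
  "lmod_direct_sum I M =
    \<lparr>carrier = {x \<in> \<Pi>\<^sub>E i\<in>I. carrier (M i). finite {i \<in> I. x i \<noteq> \<zero>\<^bsub>M i\<^esub>}},
     monoid.mult = undefined, one = undefined,
     ring.zero = (\<lambda>i\<in>I. \<zero>\<^bsub>M i\<^esub>),
     add = (\<lambda>x y. \<lambda>i\<in>I. x i \<oplus>\<^bsub>M i\<^esub> y i),
     module.smult = (\<lambda>a x. \<lambda>i\<in>I. a \<odot>\<^bsub>M i\<^esub> x i)\<rparr>"

subsection \<open>The double centraliser property\<close>

text \<open>Maps are taken to be extensional on the carrier, so that equality in \<open>DEnd R V\<close> is
  equality of maps \<open>V \<rightarrow> V\<close>.\<close>

definition DEnd :: "('r, 'm) ring_scheme \<Rightarrow> ('r, 'v, 'k) module_scheme \<Rightarrow> ('v \<Rightarrow> 'v) set" where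
  "DEnd R V = {g \<in> extensional (carrier V) \<inter> hom (add_monoid V) (add_monoid V).
     \<forall>f\<in>lmod_hom R V V. \<forall>v\<in>carrier V. g (f v) = f (g v)}"

definition double_centraliser_property ::
    "('r, 'm) ring_scheme \<Rightarrow> ('r, 'v, 'k) module_scheme \<Rightarrow> bool" where
  "double_centraliser_property R V \<longleftrightarrow>
     (\<lambda>a. \<lambda>v\<in>carrier V. a \<odot>\<^bsub>V\<^esub> v) ` carrier R = DEnd R V"

subsection \<open>Induction from a subring\<close>

text \<open>For a subring \<open>A\<close> of \<open>R\<close> and a left \<open>A\<close>-module \<open>N\<close>, the left \<open>R\<close>-module
  \<open>R \<otimes>\<^sub>A N\<close>: the free abelian group on \<open>R \<times> N\<close> modulo the subgroup generated by the
  biadditivity and \<open>A\<close>-balancedness relations, with \<open>R\<close> acting on the first factor.\<close>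

definition tensor_relations ::
    "('r, 'm) ring_scheme \<Rightarrow> 'r set \<Rightarrow> ('r, 'a, 'k) module_scheme \<Rightarrow> (('r \<times> 'a) \<Rightarrow>\<^sub>0 int) set" where
  "tensor_relations R A N =
     {frag_of (x \<oplus>\<^bsub>R\<^esub> y, v) - frag_of (x, v) - frag_of (y, v) | x y v.
        x \<in> carrier R \<and> y \<in> carrier R \<and> v \<in> carrier N}
   \<union> {frag_of (x, v \<oplus>\<^bsub>N\<^esub> w) - frag_of (x, v) - frag_of (x, w) | x v w.
        x \<in> carrier R \<and> v \<in> carrier N \<and> w \<in> carrier N}
   \<union> {frag_of (x \<otimes>\<^bsub>R\<^esub> a, v) - frag_of (x, a \<odot>\<^bsub>N\<^esub> v) | x a v.
        x \<in> carrier R \<and> a \<in> A \<and> v \<in> carrier N}"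

definition induced_module ::
    "('r, 'm) ring_scheme \<Rightarrow> 'r set \<Rightarrow> ('r, 'a, 'k) module_scheme
       \<Rightarrow> ('r, (('r \<times> 'a) \<Rightarrow>\<^sub>0 int) set) module" where
  "induced_module R A N =
    (let G = free_Abelian_group (carrier R \<times> carrier N);
         K = generate G (tensor_relations R A N)
     in \<lparr>carrier = carrier (G Mod K),
         monoid.mult = undefined, one = undefined,
         ring.zero = \<one>\<^bsub>G Mod K\<^esub>,
         add = (\<lambda>X Y. X \<otimes>\<^bsub>G Mod K\<^esub> Y),
         module.smult = (\<lambda>r X. \<Union>c\<in>X. K #>\<^bsub>G\<^esub> frag_extend (\<lambda>(x, v). frag_of (r \<otimes>\<^bsub>R\<^esub> x, v)) c)\<rparr>)"

section \<open>Hecke algebras of type A\<close>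

subsection \<open>Free associative algebras\<close>

text \<open>The free unital associative algebra on \<open>X\<close> has the words over \<open>X\<close> as a basis:
  \<open>Poly_Mapping.single w c\<close> is the word \<open>w\<close> with coefficient \<open>c\<close>.\<close>

definition free_algebra_mult ::
    "('x list \<Rightarrow>\<^sub>0 'f::comm_ring_1) \<Rightarrow> ('x list \<Rightarrow>\<^sub>0 'f) \<Rightarrow> ('x list \<Rightarrow>\<^sub>0 'f)" where
  "free_algebra_mult f g =
     (\<Sum>u\<in>Poly_Mapping.keys f. \<Sum>v\<in>Poly_Mapping.keys g.
        Poly_Mapping.single (u @ v) (Poly_Mapping.lookup f u * Poly_Mapping.lookup g v))"

definition free_algebra :: "'x set \<Rightarrow> ('x list \<Rightarrow>\<^sub>0 'f::comm_ring_1) ring" where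
  "free_algebra X =
    \<lparr>carrier = {f. Poly_Mapping.keys f \<subseteq> lists X},
     monoid.mult = free_algebra_mult, one = Poly_Mapping.single [] 1,
     ring.zero = 0, add = (+)\<rparr>"

text \<open>The value of \<open>f\<close> when every generator is replaced by the scalar \<open>c\<close>.\<close>

definition free_algebra_eval :: "'f::comm_ring_1 \<Rightarrow> ('x list \<Rightarrow>\<^sub>0 'f) \<Rightarrow> 'f" where
  "free_algebra_eval c f =
     (\<Sum>w\<in>Poly_Mapping.keys f. Poly_Mapping.lookup f w * c ^ length w)"

subsection \<open>The algebra \<open>Hec(n)\<close>\<close>

definition hecke_relations :: "nat \<Rightarrow> 'f::field \<Rightarrow> (nat list \<Rightarrow>\<^sub>0 'f) set" where
  "hecke_relations n q =
     {Poly_Mapping.single [i, i + 1, i] 1 - Poly_Mapping.single [i + 1, i, i + 1] 1 | i.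
        1 \<le> i \<and> i + 1 < n}
   \<union> {Poly_Mapping.single [i, j] 1 - Poly_Mapping.single [j, i] 1 | i j.
        1 \<le> i \<and> i + 1 < j \<and> j < n}
   \<union> {free_algebra_mult (Poly_Mapping.single [i] 1 - Poly_Mapping.single [] q)
          (Poly_Mapping.single [i] 1 + Poly_Mapping.single [] 1) | i.
        1 \<le> i \<and> i < n}"

definition hecke_ideal :: "nat \<Rightarrow> 'f::field \<Rightarrow> (nat list \<Rightarrow>\<^sub>0 'f) set" where
  "hecke_ideal n q = Idl\<^bsub>free_algebra {1..<n}\<^esub> (hecke_relations n q)"

definition hecke :: "nat \<Rightarrow> 'f::field \<Rightarrow> (nat list \<Rightarrow>\<^sub>0 'f) set ring" where
  "hecke n q = free_algebra {1..<n} Quot hecke_ideal n q"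

definition hecke_gen :: "nat \<Rightarrow> 'f::field \<Rightarrow> nat \<Rightarrow> (nat list \<Rightarrow>\<^sub>0 'f) set" where
  "hecke_gen n q i = hecke_ideal n q +>\<^bsub>free_algebra {1..<n}\<^esub> Poly_Mapping.single [i] 1"

definition hecke_scalar :: "nat \<Rightarrow> 'f::field \<Rightarrow> 'f \<Rightarrow> (nat list \<Rightarrow>\<^sub>0 'f) set" where
  "hecke_scalar n q c = hecke_ideal n q +>\<^bsub>free_algebra {1..<n}\<^esub> Poly_Mapping.single [] c"

text \<open>The \<open>F\<close>-subalgebra \<open>Hec(\<lambda>)\<close>: the subring generated by the scalars and the relevant \<open>T\<^sub>i\<close>.\<close>

definition hecke_young :: "nat \<Rightarrow> 'f::field \<Rightarrow> nat list \<Rightarrow> (nat list \<Rightarrow>\<^sub>0 'f) set set" where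
  "hecke_young n q lam =
     generate_ring (hecke n q)
       (range (hecke_scalar n q) \<union>
        hecke_gen n q ` {i. 1 \<le> i \<and> i < n \<and> i \<notin> (\<lambda>k. sum_list (take k lam)) ` {1..length lam}})"

text \<open>The one-dimensional module \<open>F\<close> on which every \<open>T\<^sub>i\<close> acts as multiplication by \<open>c\<close>.
  The action is well defined only when \<open>free_algebra_eval c\<close> is constant on cosets, i.e. when \<open>c\<close>
  satisfies the quadratic relation; it is used for \<open>c = q\<close> and \<open>c = - 1\<close>.\<close>

definition hecke_line :: "'f::field \<Rightarrow> ((nat list \<Rightarrow>\<^sub>0 'f) set, 'f) module" where
  "hecke_line c =
    \<lparr>carrier = UNIV, monoid.mult = undefined, one = undefined, ring.zero = 0, add = (+),
     module.smult = (\<lambda>X x. the_elem (free_algebra_eval c ` X) * x)\<rparr>"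

type_synonym 'f hecke_induced = "(((nat list \<Rightarrow>\<^sub>0 'f) set \<times> 'f) \<Rightarrow>\<^sub>0 int) set"

definition young_M ::
    "nat \<Rightarrow> 'f::field \<Rightarrow> nat list \<Rightarrow> ((nat list \<Rightarrow>\<^sub>0 'f) set, 'f hecke_induced) module" where
  "young_M n q lam = induced_module (hecke n q) (hecke_young n q lam) (hecke_line q)"

definition signed_young_M ::
    "nat \<Rightarrow> 'f::field \<Rightarrow> nat list \<Rightarrow> ((nat list \<Rightarrow>\<^sub>0 'f) set, 'f hecke_induced) module" where
  "signed_young_M n q lam = induced_module (hecke n q) (hecke_young n q lam) (hecke_line (- 1))"

section \<open>Partitions\<close>

definition Par :: "nat \<Rightarrow> nat list set" where
  "Par n = {lam. sorted_wrt (\<ge>) lam \<and> 0 \<notin> set lam \<and> sum_list lam = n}"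

definition dominated_by :: "nat list \<Rightarrow> nat list \<Rightarrow> bool"  (infix \<open>\<unlhd>\<close> 50) where
  "mu \<unlhd> lam \<longleftrightarrow> (\<forall>k. sum_list (take k mu) \<le> sum_list (take k lam))"

definition coarsening :: "nat list \<Rightarrow> nat list \<Rightarrow> bool" where
  "coarsening mu lam \<longleftrightarrow>
     (\<exists>P :: nat multiset multiset. sum_mset P = mset lam \<and> image_mset sum_mset P = mset mu)"

definition coarsenings :: "nat \<Rightarrow> nat list set \<Rightarrow> nat list set" where
  "coarsenings n \<sigma> = {mu \<in> Par n. \<exists>lam\<in>\<sigma>. coarsening mu lam}"

definition co_saturated :: "nat \<Rightarrow> nat list set \<Rightarrow> bool" where
  "co_saturated n \<sigma> \<longleftrightarrow> (\<forall>mu\<in>\<sigma>. \<forall>lam\<in>Par n. mu \<unlhd> lam \<longrightarrow> lam \<in> \<sigma>)"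

section \<open>Young permutation modules\<close>

text \<open>\<open>V\<close> is isomorphic to the direct sum of \<open>d \<lambda>\<close> copies of \<open>M(\<lambda>)\<close>, \<open>\<lambda> \<in> Par(n)\<close>.  The index
  \<open>(\<lambda>, i)\<close> is the \<open>i\<close>-th copy of \<open>M(\<lambda>)\<close>.\<close>

definition young_permutation_module ::
    "nat \<Rightarrow> 'f::field \<Rightarrow> (nat list \<Rightarrow> nat) \<Rightarrow> ((nat list \<Rightarrow>\<^sub>0 'f) set, 'v) module \<Rightarrow> bool" where
  "young_permutation_module n q d V \<longleftrightarrow>
     left_module (hecke n q) V \<and>
     lmod_iso (hecke n q)
       (lmod_direct_sum (SIGMA lam:Par n. {..<d lam}) (\<lambda>(lam, i). young_M n q lam)) V"

definition signed_young_permutation_module ::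
    "nat \<Rightarrow> 'f::field \<Rightarrow> (nat list \<Rightarrow> nat) \<Rightarrow> ((nat list \<Rightarrow>\<^sub>0 'f) set, 'v) module \<Rightarrow> bool" where
  "signed_young_permutation_module n q d V \<longleftrightarrow>
     left_module (hecke n q) V \<and>
     lmod_iso (hecke n q)
       (lmod_direct_sum (SIGMA lam:Par n. {..<d lam}) (\<lambda>(lam, i). signed_young_M n q lam)) V"

text \<open>The set \<open>\<zeta>(V)\<close> (or \<open>\<zeta>\<^sub>s(V)\<close>), in terms of the multiplicities \<open>d\<close> in a decomposition of \<open>V\<close>;
  \<open>d\<close> is determined on \<open>Par(n)\<close> by \<open>V\<close>, so this set depends on \<open>V\<close> only.\<close>

definition zeta :: "nat \<Rightarrow> (nat list \<Rightarrow> nat) \<Rightarrow> nat list set" where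
  "zeta n d = {lam \<in> Par n. d lam \<noteq> 0}"

end

theory Submission
  imports Defs "HOL-Library.Function_Algebras" "HOL-Library.List_Lexorder" "HOL-Library.Product_Lexorder"
begin

text \<open>\<open>M(\<lambda>)\<close> is realised as the space of functions on the words with \<open>\<lambda>\<^sub>i\<close> letters \<open>i\<close>, the generator
  \<open>T\<^sub>j\<close> acting on adjacent letters.  If \<open>\<beta>\<close> is a coarsening of \<open>\<lambda>\<close>, merging letters gives a surjection
  \<open>M(\<lambda>) \<rightarrow> M(\<beta>)\<close> whose adjoint embeds \<open>M(\<beta>)\<close> into \<open>M(\<lambda>)\<close>, so a family \<open>g\<close> of maps commuting with all
  homomorphisms between the \<open>M(\<lambda>)\<close> in \<open>V\<close> extends to all coarsenings.  On a co-saturated set one removes a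
  minimal \<open>\<mu>\<close> and subtracts the Hecke algebra element found for the rest; the difference \<open>g\<close> lives on
  \<open>M(\<mu>)\<close>, maps it into the intersection \<open>K\<close> of the kernels of the divided powers of the raising operators
  \<open>E\<^sub>i\<close> and kills the images of their adjoints.  A triangularity argument shows that \<open>K\<close> is generated
  by any of its vectors that is triangular with respect to a suitable word \<open>z\<close>.  Such a vector is \<open>Y z\<close>,
  where \<open>Y\<close> antisymmetrises in blocks and kills every weight not dominated by \<open>\<mu>\<close>.  Hence \<open>g\<close> is
  a sum of operators \<open>a Y b\<close> with \<open>a\<close>, \<open>b\<close> in the Hecke algebra, which vanish on the other weights.  For the
  signed modules \<open>T\<^sub>j\<close> is replaced by \<open>q - 1 - T\<^sub>j\<close>.\<close>

section \<open>Words, the action of the Hecke generators and raising operators\<close>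

text \<open>For arbitrary nonzero \<open>q\<close> over an arbitrary field the modules need not be
  semisimple, so the arguments run by leading words in the lexicographic order instead of
  idempotents. Ordinary powers of raising operators acquire quantum factorials, which may vanish;
  divided powers do not. Lattice words, the possible leading words of vectors in \<open>K\<close>,
  encode standard tableaux; \<open>z\<close> lists the letters of the diagram column by column, the
  blocks are its columns, and every lattice word is reached from \<open>z\<close> by exchanging
  ascents. On the weight of \<open>\<mu>\<close> the operator \<open>Y\<close> has rank one, so
  \<open>a Y b\<close> is a column in \<open>K\<close> times a row in \<open>K\<close>. Of the two
  conditions on the difference \<open>g\<close>, one puts its image into \<open>K\<close> and the
  other its rows, by means of a form for which all \<open>T q j\<close> are self-adjoint.
  Co-saturation enters because raising operators lead from \<open>\<mu>\<close> to strictly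
  dominating shapes, where the difference is already zero. Finally \<open>M(\<lambda>)\<close> is
  compared with functions on words by a map in each direction: their composite on functions is the
  identity, and on the module generation by \<open>young_one\<close> does the rest.\<close>

fun swap_at :: "nat \<Rightarrow> 'a list \<Rightarrow> 'a list" where
  "swap_at 0 (c # d # w) = d # c # w"
| "swap_at (Suc j) (c # w) = c # swap_at j w"
| "swap_at _ w = w"

lemma swap_at_swap_at [simp]: "swap_at j (swap_at j w) = w"
  by (induction j w rule: swap_at.induct) auto

lemma mset_swap_at [simp]: "mset (swap_at j w) = mset w"
  by (induction j w rule: swap_at.induct) auto

lemma length_swap_at [simp]: "length (swap_at j w) = length w"
  by (induction j w rule: swap_at.induct) auto

lemma swap_at_nth:
  "Suc j < length w \<Longrightarrow> p < length w \<Longrightarrow>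
    swap_at j w ! p = (if p = j then w ! Suc j else if p = Suc j then w ! j else w ! p)"
proof (induction j w arbitrary: p rule: swap_at.induct)
  case (1 c d w) then show ?case by (cases p; cases "p - 1") auto
next
  case (2 j c w) then show ?case by (cases p) auto
qed auto

lemma swap_at_same: "Suc j < length w \<Longrightarrow> w ! j = w ! Suc j \<Longrightarrow> swap_at j w = w"
  by (rule nth_equalityI) (auto simp: swap_at_nth)

lemma swap_at_map: "swap_at j (map f w) = map f (swap_at j w)"
  by (induction j w rule: swap_at.induct) auto

text \<open>The Coxeter length of the shortest permutation that takes the sorted word to this one.
  It is the measure of most inductions and the exponent in the invariant form.\<close>

fun inv_count :: "nat list \<Rightarrow> nat" where
  "inv_count [] = 0"
| "inv_count (c # w) = length (filter (\<lambda>d. d < c) w) + inv_count w"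

lemma length_filter_swap_at [simp]: "length (filter P (swap_at j w)) = length (filter P w)"
  by (induction j w rule: swap_at.induct) auto

lemma inv_count_swap_at: "Suc j < length w \<Longrightarrow> w ! j < w ! Suc j \<Longrightarrow> inv_count (swap_at j w) = Suc (inv_count w)"
  by (induction j w rule: swap_at.induct) auto

text \<open>Positions are counted from 0, so \<open>T q j\<close> belongs to the generator \<open>T\<^sub>j\<^sub>+\<^sub>1\<close>.  On words with letters
  \<open>a < b\<close> at the two positions it sends \<open>ab\<close> to \<open>ba\<close>, \<open>aa\<close> to \<open>q aa\<close> and \<open>ba\<close> to \<open>q ab + (q - 1) ba\<close>.\<close>

fun T :: "'f::field \<Rightarrow> nat \<Rightarrow> (nat list \<Rightarrow> 'f) \<Rightarrow> nat list \<Rightarrow> 'f" where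
  "T q 0 v (c # d # w) = (if c < d then q * v (d # c # w) else if c = d then q * v (c # d # w)
     else v (d # c # w) + (q - 1) * v (c # d # w))"
| "T q (Suc j) v (c # w) = T q j (\<lambda>x. v (c # x)) w"
| "T q _ v w = 0"

lemma T_nth:
  "Suc j < length w \<Longrightarrow> T q j v w =
    (if w ! j < w ! Suc j then q * v (swap_at j w) else if w ! j = w ! Suc j then q * v w
     else v (swap_at j w) + (q - 1) * v w)"
  by (induction q j v w rule: T.induct) auto

lemma T_lin: "T q j (\<lambda>w. a * u w + b * v w) w = a * T q j u w + b * T q j v w"
  by (induction j w arbitrary: u v rule: swap_at.induct) (auto simp: algebra_simps)

lemma T_short: "\<not> Suc j < length w \<Longrightarrow> T q j v w = 0"
  by (induction q j v w rule: T.induct) auto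

lemma T_quad: "Suc j < length w \<Longrightarrow> T q j (T q j v) w = (q - 1) * T q j v w + q * v w"
  by (induction j w arbitrary: v rule: swap_at.induct) (auto simp: algebra_simps)

lemma list3_cases:
  assumes "Suc (Suc 0) < length w"
  obtains c d e x where "w = c # d # e # x"
  using assms by (cases w; cases "tl w"; cases "tl (tl w)") auto

lemma T_braid_long:
  "Suc (Suc j) < length w \<Longrightarrow> T q j (T q (Suc j) (T q j v)) w = T q (Suc j) (T q j (T q (Suc j) v)) w"
proof (induction j arbitrary: v w)
  case 0
  then obtain c d e x where w: "w = c # d # e # x" using list3_cases by blast
  \<comment> \<open>With \<open>r + 1\<close> for \<open>q\<close> no subtraction is left, and each
    relative order of the three letters becomes an identity decided by distributivity and AC
    rewriting.\<close>
  obtain r where q: "q = r + 1" by (metis diff_add_cancel)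
  show ?case unfolding w q
    by (cases c d rule: linorder_cases; cases c e rule: linorder_cases; cases d e rule: linorder_cases;
        simp add: distrib_left distrib_right ac_simps)
next
  case (Suc j)
  then obtain c x where w: "w = c # x" by (cases w) auto
  show ?case using Suc.IH[of x "\<lambda>x. v (c # x)"] Suc.prems unfolding w by simp
qed

lemma T_braid: "T q j (T q (Suc j) (T q j v)) = T q (Suc j) (T q j (T q (Suc j) v))"
proof
  fix w
  show "T q j (T q (Suc j) (T q j v)) w = T q (Suc j) (T q j (T q (Suc j) v)) w"
  proof (cases "Suc (Suc j) < length w")
    case False
    then show ?thesis by (cases "Suc j < length w") (auto simp: T_short T_nth)
  qed (rule T_braid_long)
qed

text \<open>Once the two letters moved by \<open>T q j\<close> are stripped off,
  \<open>T q k\<close> is an operator on the remaining tail, and its linearity lets it pass through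
  the coefficients of \<open>T q j\<close>.\<close>

lemma T_comm_long:
  "Suc j < k \<Longrightarrow> Suc k < length w \<Longrightarrow> T q j (T q k v) w = T q k (T q j v) w"
proof (induction j arbitrary: k v w)
  case 0
  then obtain c d e x where w: "w = c # d # e # x" using list3_cases[of w] by force
  obtain k' where k: "k = Suc (Suc k')" using 0 by (cases k; cases "k - 1") auto
  have *: "T q k' (\<lambda>x. a * u x + b * v x) w = a * T q k' u w + b * T q k' v w" for a b u v w
    by (rule T_lin)
  have **: "T q k' (\<lambda>x. a * u x) w = a * T q k' u w"
    "T q k' (\<lambda>x. u x + b * v x) w = T q k' u w + b * T q k' v w" for a b u v w
    using T_lin[of q k' a u 0 u w] T_lin[of q k' 1 u b v w] by auto
  show ?case unfolding w k by (auto simp: ** )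
next
  case (Suc j)
  then obtain c x where w: "w = c # x" by (cases w) auto
  obtain k' where k: "k = Suc k'" using Suc by (cases k) auto
  show ?case using Suc.IH[of k' x "\<lambda>x. v (c # x)"] Suc.prems unfolding w k by simp
qed

lemma T_comm: "Suc j < k \<Longrightarrow> T q j (T q k v) = T q k (T q j v)"
proof
  fix w assume *: "Suc j < k"
  show "T q j (T q k v) w = T q k (T q j v) w"
  proof (cases "Suc k < length w")
    case False
    then show ?thesis by (cases "Suc j < length w") (auto simp: T_short T_nth)
  qed (rule T_comm_long[OF *])
qed

text \<open>The value at \<open>w\<close> of the \<open>k\<close>-th divided power of the quantum raising operator that turns letters \<open>i + 1\<close>
  into \<open>i\<close>.\<close>

primrec E :: "'f::field \<Rightarrow> nat \<Rightarrow> nat list \<Rightarrow> nat \<Rightarrow> (nat list \<Rightarrow> 'f) \<Rightarrow> 'f" where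
  "E q i [] k v = (if k = 0 then v [] else 0)"
| "E q i (c # w) k v =
    (if c = i then inverse q ^ k * E q i w k (\<lambda>x. v (i # x))
        + (if k = 0 then 0 else E q i w (k - 1) (\<lambda>x. v (Suc i # x)))
     else E q i w k (\<lambda>x. v (c # x)))"

lemma E_lin: "E q i w k (\<lambda>w. a * u w + b * v w) = a * E q i w k u + b * E q i w k v"
  by (induction w arbitrary: k u v) (auto simp: algebra_simps)

lemma E_cong: "(\<And>x. length x = length w \<Longrightarrow> u x = v x) \<Longrightarrow> E q i w k u = E q i w k v"
proof (induction w arbitrary: k u v)
  case (Cons c w)
  have "E q i w k' (\<lambda>x. u (c # x)) = E q i w k' (\<lambda>x. v (c # x))" for k' c
    by (rule Cons.IH) (use Cons.prems in auto)
  then show ?case by simp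
qed auto

lemma E_zero: "E q i w k (\<lambda>x. 0) = 0"
  using E_lin[of q i w k 0 "\<lambda>x. 0" 0 "\<lambda>x. 0"] by simp

lemma E_scale: "E q i w k (\<lambda>x. a * u x) = a * E q i w k u"
  using E_lin[of q i w k a u 0 u] by simp

lemma E_add: "E q i w k (\<lambda>x. u x + v x) = E q i w k u + E q i w k v"
  using E_lin[of q i w k 1 u 1 v] by simp

lemma E_0 [simp]: "E q i w 0 v = v w"
  by (induction w arbitrary: v) auto

text \<open>A local check at the two letters moved by \<open>T q j\<close>; on the other letters the
  recursion of \<open>E\<close> is linear in the tail.\<close>

lemma E_T_long:
  assumes "q \<noteq> 0"
  shows "Suc j < length w \<Longrightarrow> T q j (\<lambda>x. E q i x k v) w = E q i w k (T q j v)"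
proof (induction j arbitrary: w k v)
  case 0
  then obtain c d x where w: "w = c # d # x" by (cases w; cases "tl w") auto
  \<comment> \<open>Two letters can absorb at most two of the \<open>k\<close> changes, so the
    exponents 0, 1 and \<open>k' + 2\<close> cover all forms of the recursion.\<close>
  obtain k' where k: "k = 0 \<or> k = Suc 0 \<or> k = Suc (Suc k')" by (metis not0_implies_Suc)
  have sh: "k = 0 \<Longrightarrow> ?case" unfolding w by simp
  have sh1: "k = Suc 0 \<Longrightarrow> ?case" unfolding w
    by (cases "c = i"; cases "d = i"; cases "c = Suc i"; cases "d = Suc i";
        simp add: E_add E_scale; simp add: field_simps assms)
  have sh2: "k = Suc (Suc k') \<Longrightarrow> ?case" unfolding w
    by (cases "c = i"; cases "d = i"; cases "c = Suc i"; cases "d = Suc i";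
        simp add: E_add E_scale; simp add: field_simps assms)
  show ?case using k sh sh1 sh2 by blast
next
  case (Suc j)
  then obtain c x where w: "w = c # x" by (cases w) auto
  have len: "Suc j < length x" using Suc.prems w by simp
  have IH: "E q i x k (T q j v) = T q j (\<lambda>x. E q i x k v) x" for k v using Suc.IH[OF len] by simp
  have sc: "T q j (\<lambda>x. a * u x) x = a * T q j u x" for a u
    using T_lin[of q j a u 0 u x] by simp
  have lin: "T q j (\<lambda>x. a * u x + v x) x = a * T q j u x + T q j v x" for a u v
    using T_lin[of q j a u 1 v x] by simp
  show ?case unfolding w by (cases "c = i"; cases "k = 0") (simp_all only: E.simps T.simps if_True if_False IH lin sc simp_thms add_0_right)
qed

lemma E_T:
  assumes "q \<noteq> 0"
  shows "E q i w k (T q j v) = T q j (\<lambda>x. E q i x k v) w"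
proof (cases "Suc j < length w")
  case False
  have "E q i w k (T q j v) = E q i w k (\<lambda>x. 0)" by (rule E_cong) (use False in \<open>auto simp: T_short\<close>)
  then show ?thesis using False by (simp add: T_short E_zero)
qed (use E_T_long[OF assms] in auto)

text \<open>The \<open>k\<close> copies stand on both sides so that no truncated multiset difference
  occurs.\<close>

lemma E_content:
  "E q i w k v \<noteq> 0 \<Longrightarrow> \<exists>x. v x \<noteq> 0 \<and> mset x + replicate_mset k i = mset w + replicate_mset k (Suc i)"
proof (induction w arbitrary: k v)
  case Nil then show ?case by (auto split: if_splits)
next
  case (Cons c w)
  show ?case
  proof (cases "c = i \<and> k \<noteq> 0 \<and> E q i w (k - 1) (\<lambda>x. v (Suc i # x)) \<noteq> 0")
    case True
    then obtain x where x: "v (Suc i # x) \<noteq> 0" "mset x + replicate_mset (k-1) i = mset w + replicate_mset (k-1) (Suc i)"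
      using Cons.IH[of "k-1" "\<lambda>x. v (Suc i # x)"] by auto
    obtain k' where k: "k = Suc k'" using True by (cases k) auto
    show ?thesis using x True unfolding k by (intro exI[of _ "Suc i # x"]) (simp add: ac_simps)
  next
    case False
    then have "E q i w k (\<lambda>x. v (c # x)) \<noteq> 0" using Cons.prems by (auto split: if_splits)
    from Cons.IH[OF this] obtain x where x: "v (c # x) \<noteq> 0" "mset x + replicate_mset k i = mset w + replicate_mset k (Suc i)" by auto
    then show ?thesis by (intro exI[of _ "c # x"]) auto
  qed
qed

text \<open>Divided powers are jointly injective on negative weights of excess \<open>r\<close>;
  this holds without inverting any quantum integer. Split off the first letter. The component behind
  a leading \<open>i\<close> has excess \<open>r + 1\<close> and goes first: in the equation at
  \<open>i # x\<close> the other summand vanishes by the equation at \<open>Suc i # x\<close>. With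
  it gone, the equation at \<open>i # x\<close> for exponent \<open>k + 1\<close> treats the
  component behind \<open>Suc i\<close>, of excess \<open>r - 1\<close>. At excess 0 the exponent 0
  is allowed, and it gives \<open>v\<close> itself.\<close>

lemma E_highest_weight_zero:
  assumes "q \<noteq> 0"
  shows "(\<And>w. length w = N \<Longrightarrow> v w \<noteq> 0 \<Longrightarrow> count_list w i + r \<le> count_list w (Suc i)) \<Longrightarrow>
    (\<And>k w. k \<ge> r \<Longrightarrow> length w = N \<Longrightarrow> E q i w k v = 0) \<Longrightarrow> length w = N \<Longrightarrow> v w = 0"
proof (induction N arbitrary: v r w)
  case 0
  then show ?case by (metis (no_types, lifting) E_0 add_eq_0_iff_both_eq_0 count_list.simps(1) le_zero_eq length_0_conv order_refl)
next
  case (Suc N)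
  show ?case
  proof (cases r)
    case 0
    then show ?thesis using Suc.prems(2)[of 0 w] Suc.prems(3) by simp
  next
    case (Suc r')
    have comp: "E q i x k (\<lambda>x. v (c # x)) = 0" if "c \<noteq> i" "k \<ge> r" "length x = N" for c k x
      using Suc.prems(2)[of k "c # x"] that by simp
    have other: "v (c # x) = 0" if "c \<noteq> i" "c \<noteq> Suc i" "length x = N" for c x
      by (rule Suc.IH[of "\<lambda>x. v (c # x)" r]) (use that Suc.prems(1) comp in \<open>force+\<close>)
    have compi: "inverse q ^ k * E q i x k (\<lambda>x. v (i # x)) + E q i x (k - 1) (\<lambda>x. v (Suc i # x)) = 0"
      if "k \<ge> r" "length x = N" for k x
      using Suc.prems(2)[of k "i # x"] that \<open>r = Suc r'\<close> by simp
    have i: "v (i # x) = 0" if "length x = N" for x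
    proof (rule Suc.IH[of "\<lambda>x. v (i # x)" "Suc r"])
      show "count_list w i + Suc r \<le> count_list w (Suc i)" if "length w = N" "v (i # w) \<noteq> 0" for w
        using Suc.prems(1)[of "i # w"] that by auto
      show "E q i w k (\<lambda>x. v (i # x)) = 0" if "Suc r \<le> k" "length w = N" for k w
        using compi[of k w] comp[of "Suc i" "k - 1" w] that assms by simp
    qed (use that in auto)
    have si: "v (Suc i # x) = 0" if "length x = N" for x
    proof (rule Suc.IH[of "\<lambda>x. v (Suc i # x)" r'])
      show "count_list w i + r' \<le> count_list w (Suc i)" if "length w = N" "v (Suc i # w) \<noteq> 0" for w
        using Suc.prems(1)[of "Suc i # w"] that \<open>r = Suc r'\<close> by auto
      show "E q i w k (\<lambda>x. v (Suc i # x)) = 0" if "r' \<le> k" "length w = N" for k w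
      proof -
        have "E q i w (Suc k) (\<lambda>x. v (i # x)) = E q i w (Suc k) (\<lambda>x. 0)"
          by (rule E_cong) (use i that in auto)
        then show ?thesis using compi[of "Suc k" w] that \<open>r = Suc r'\<close> by (simp add: E_zero)
      qed
    qed (use that in auto)
    obtain c x where "w = c # x" "length x = N" using Suc.prems(3) by (cases w) auto
    then show ?thesis using other[of c x] i[of x] si[of x] by (cases "c = i"; cases "c = Suc i") auto
  qed
qed

text \<open>Changing an \<open>i\<close> to \<open>i + 1\<close> inside the prefix makes the prefix
  lexicographically larger, where \<open>v\<close> vanishes. Only changes in the suffix survive, and
  \<open>c\<close> is a power of \<open>inverse q\<close> contributed by the letters
  \<open>i\<close> of the prefix.\<close>

lemma E_prefix:
  fixes p u :: "nat list" and v :: "nat list \<Rightarrow> 'f::field"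
  assumes "q \<noteq> 0"
  shows "(\<And>p' u'. length p' = length p \<Longrightarrow> length u' = length u \<Longrightarrow> p < p' \<Longrightarrow> v (p' @ u') = 0) \<Longrightarrow>
    \<exists>c::'f::field. c \<noteq> 0 \<and> E q i (p @ u) k v = c * E q i u k (\<lambda>x. v (p @ x))"
proof (induction p arbitrary: v)
  case Nil show ?case by (auto intro: exI[of _ 1])
next
  case (Cons a p)
  have "\<exists>c. c \<noteq> 0 \<and> E q i (p @ u) k (\<lambda>x. v (a # x)) = c * E q i u k (\<lambda>x. v (a # p @ x))"
    by (rule Cons.IH) (use Cons.prems[of "a # _"] in auto)
  then obtain c where c: "c \<noteq> 0" "E q i (p @ u) k (\<lambda>x. v (a # x)) = c * E q i u k (\<lambda>x. v (a # p @ x))" by auto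
  have z: "E q i (p @ u) (k - 1) (\<lambda>x. v (Suc i # x)) = E q i (p @ u) (k - 1) (\<lambda>x. 0)" if "a = i"
  proof (rule E_cong)
    fix x :: "nat list" assume "length x = length (p @ u)"
    then have x: "x = take (length p) x @ drop (length p) x" "length (take (length p) x) = length p"
      "length (drop (length p) x) = length u" by auto
    show "v (Suc i # x) = 0"
      using Cons.prems[of "Suc i # take (length p) x" "drop (length p) x"] x that by simp
  qed
  show ?case
  proof (cases "a = i")
    case True
    then show ?thesis using c z assms by (intro exI[of _ "inverse q ^ k * c"]) (auto simp: E_zero)
  next
    case False
    then show ?thesis using c by (intro exI[of _ c]) auto
  qed
qed

section \<open>Orbits of words under a braid action\<close>

lemma swap_at_comm: "Suc j < k \<Longrightarrow> swap_at j (swap_at k w) = swap_at k (swap_at j w)"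
proof (induction j arbitrary: k w)
  case 0
  then obtain k' where k: "k = Suc (Suc k')" by (cases k; cases "k - 1") auto
  then show ?case by (cases w; cases "tl w") auto
next
  case (Suc j)
  then obtain k' where k: "k = Suc k'" by (cases k) auto
  then show ?case using Suc by (cases w) auto
qed

lemma swap_at_braid:
  "swap_at j (swap_at (Suc j) (swap_at j w)) = swap_at (Suc j) (swap_at j (swap_at (Suc j) w))" if "Suc (Suc j) < length w"
  using that
proof (induction j arbitrary: w)
  case 0 then show ?case by (auto elim: list3_cases)
next
  case (Suc j) then show ?case by (cases w) auto
qed

lemma not_sorted_descent:
  assumes "\<not> sorted (w :: nat list)"
  shows "\<exists>j. Suc j < length w \<and> w ! Suc j < w ! j"
  using assms by (auto simp: sorted_iff_nth_Suc not_le)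

lemma sorted_inv_count: "sorted w \<longleftrightarrow> inv_count w = 0"
  by (induction w) (auto simp: filter_empty_conv not_less)

lemma inv_count_swap_at_descent:
  assumes "Suc j < length w" "w ! Suc j < w ! j"
  shows "inv_count w = Suc (inv_count (swap_at j w))"
  using inv_count_swap_at[of j "swap_at j w"] assms by (simp add: swap_at_nth)

lemma sorted_mset_unique: "sorted v \<Longrightarrow> sorted w \<Longrightarrow> mset v = mset w \<Longrightarrow> v = (w :: nat list)"
  by (metis properties_for_sort)

text \<open>Bubble sort read backwards: from the sorted word every rearrangement is reached by
  exchanging ascents.\<close>

lemma word_induct [consumes 2, case_names sorted step]:
  assumes "mset w = mset w0" "sorted (w0 :: nat list)" "P w0"
    and step: "\<And>w j. mset w = mset w0 \<Longrightarrow> Suc j < length w \<Longrightarrow> w ! j < w ! Suc j \<Longrightarrow> P w \<Longrightarrow> P (swap_at j w)"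
  shows "P w"
  using assms(1)
proof (induction "inv_count w" arbitrary: w rule: less_induct)
  case less
  show ?case
  proof (cases "sorted w")
    case True then show ?thesis using sorted_mset_unique assms less.prems by blast
  next
    case False
    then obtain j where j: "Suc j < length w" "w ! Suc j < w ! j" using not_sorted_descent by blast
    have "P (swap_at j w)" using less inv_count_swap_at_descent[OF j] by simp
    then show ?thesis using step[of "swap_at j w" j] j less.prems by (simp add: swap_at_nth)
  qed
qed

text \<open>Abstract enough to serve for functions on words, for operators on them and for elements
  of a module. Since \<open>N\<close> carries no scalars, the eigenvalue is a map \<open>s\<close>
  commuting with the action.\<close>

locale braid_action =
  fixes N :: "'a set" and t :: "nat \<Rightarrow> 'a \<Rightarrow> 'a" and s :: "'a \<Rightarrow> 'a" and n :: nat
  assumes t_closed: "Suc j < n \<Longrightarrow> x \<in> N \<Longrightarrow> t j x \<in> N"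
    and s_closed: "x \<in> N \<Longrightarrow> s x \<in> N"
    and t_s: "Suc j < n \<Longrightarrow> x \<in> N \<Longrightarrow> t j (s x) = s (t j x)"
    and braid: "Suc (Suc j) < n \<Longrightarrow> x \<in> N \<Longrightarrow> t j (t (Suc j) (t j x)) = t (Suc j) (t j (t (Suc j) x))"
    and comm: "Suc j < k \<Longrightarrow> Suc k < n \<Longrightarrow> x \<in> N \<Longrightarrow> t j (t k x) = t k (t j x)"
begin

text \<open>A relation, because several chains of ascents lead to one word; that all of them produce
  the same vector is the content of \<open>reach_unique_eigen\<close>.\<close>

inductive reach :: "nat list \<Rightarrow> 'a \<Rightarrow> nat list \<Rightarrow> 'a \<Rightarrow> bool" for w0 v where
  start: "reach w0 v w0 v"
| step: "reach w0 v w x \<Longrightarrow> Suc j < length w \<Longrightarrow> w ! j < w ! Suc j \<Longrightarrow> reach w0 v (swap_at j w) (t j x)"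

context
  fixes w0 :: "nat list" and v :: 'a
  assumes w0: "sorted w0" "length w0 = n" "v \<in> N"
    and eigen: "\<And>j. Suc j < n \<Longrightarrow> w0 ! j = w0 ! Suc j \<Longrightarrow> t j v = s v"
begin

lemma reach_closed: "reach w0 v w x \<Longrightarrow> mset w = mset w0 \<and> length w = n \<and> x \<in> N"
  by (induction rule: reach.induct) (use w0 t_closed in \<open>auto\<close>)

lemma reach_ex: "mset w = mset w0 \<Longrightarrow> \<exists>x. reach w0 v w x"
  by (erule word_induct[OF _ w0(1)]) (auto intro: reach.intros)

lemma reach_descent:
  assumes "reach w0 v (swap_at j w) x" "Suc j < length w" "w ! Suc j < w ! j"
  shows "reach w0 v w (t j x)"
  using step[OF assms(1), of j] assms by (simp add: swap_at_nth)

lemma reach_last: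
  assumes "reach w0 v w x"
  shows "(w = w0 \<and> x = v) \<or>
    (\<exists>j x'. Suc j < n \<and> w ! Suc j < w ! j \<and> reach w0 v (swap_at j w) x' \<and> x' \<in> N \<and> x = t j x')"
  using assms
proof (cases rule: reach.cases)
  case (step w' x' j)
  then show ?thesis using reach_closed[of w' x'] by (intro disjI2 exI[of _ j] exI[of _ x']) (simp add: swap_at_nth)
qed auto

text \<open>Matsumoto's argument. Two possible last steps at distant descents close up to a square,
  at neighbouring descents to a hexagon, and the common predecessor has fewer inversions. The
  eigenvalue statement runs in the same induction because it needs uniqueness for shorter
  chains.\<close>

lemma reach_unique_eigen:
  "(reach w0 v w x \<longrightarrow> reach w0 v w y \<longrightarrow> x = y) \<and>
   (reach w0 v w x \<longrightarrow> Suc j < n \<longrightarrow> w ! j = w ! Suc j \<longrightarrow> t j x = s x)"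
proof (induction "inv_count w" arbitrary: w x y j rule: less_induct)
  case less
  have IHu: "a = b" if "inv_count u < inv_count w" "reach w0 v u a" "reach w0 v u b" for u a b
    using less[of u a b] that by blast
  have IHe: "t i a = s a" if "inv_count u < inv_count w" "reach w0 v u a" "Suc i < n" "u ! i = u ! Suc i" for u a i
    using less[of u a _ i] that by blast
  have inv0: "inv_count w = 0" if "w = w0" using that w0(1) sorted_inv_count[of w] by simp
  have dec: "inv_count (swap_at i w) < inv_count w" if "Suc i < length w" "w ! Suc i < w ! i" for i
    using inv_count_swap_at_descent[OF that] by simp
  have far: "t i x' = t k y'"
    if H: "Suc i < k" "Suc k < n" "length w = n" "mset w = mset w0" "w ! Suc i < w ! i" "w ! Suc k < w ! k"
      "reach w0 v (swap_at i w) x'" "reach w0 v (swap_at k w) y'" for i k x' y'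
  proof -
    let ?u = "swap_at i (swap_at k w)"
    obtain z where z: "reach w0 v ?u z" using reach_ex[of ?u] H by auto
    have zN: "z \<in> N" using reach_closed z by blast
    have "reach w0 v (swap_at k w) (t i z)"
      by (rule reach_descent) (use z H in \<open>auto simp: swap_at_nth\<close>)
    then have y: "y' = t i z" using IHu[of "swap_at k w"] H dec[of k] by auto
    have "reach w0 v (swap_at i w) (t k z)"
      by (rule reach_descent) (use z H swap_at_comm[of i k w] in \<open>auto simp: swap_at_nth\<close>)
    then have x: "x' = t k z" using IHu[of "swap_at i w"] H dec[of i] by auto
    show ?thesis using x y comm[of i k z] H zN by simp
  qed
  \<comment> \<open>Two neighbouring descents mean three strictly decreasing letters; both routes
    come from the word with these letters reversed.\<close>
  have near: "t i x' = t (Suc i) y'"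
    if H: "Suc (Suc i) < n" "length w = n" "mset w = mset w0" "w ! Suc i < w ! i" "w ! Suc (Suc i) < w ! Suc i"
      "reach w0 v (swap_at i w) x'" "reach w0 v (swap_at (Suc i) w) y'" for i x' y'
  proof -
    let ?u = "swap_at i (swap_at (Suc i) (swap_at i w))"
    obtain z where z: "reach w0 v ?u z" using reach_ex[of ?u] H by auto
    have zN: "z \<in> N" using reach_closed z by blast
    have "reach w0 v (swap_at (Suc i) (swap_at i w)) (t i z)"
      by (rule reach_descent) (use z H in \<open>auto simp: swap_at_nth\<close>)
    then have "reach w0 v (swap_at i w) (t (Suc i) (t i z))"
      by (rule reach_descent) (use H in \<open>auto simp: swap_at_nth\<close>)
    then have x: "x' = t (Suc i) (t i z)" using IHu[of "swap_at i w"] H dec[of i] by auto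
    have "reach w0 v (swap_at i (swap_at (Suc i) w)) (t (Suc i) z)"
      by (rule reach_descent) (use z H swap_at_braid[of i w] in \<open>auto simp: swap_at_nth\<close>)
    then have "reach w0 v (swap_at (Suc i) w) (t i (t (Suc i) z))"
      by (rule reach_descent) (use H in \<open>auto simp: swap_at_nth\<close>)
    then have y: "y' = t i (t (Suc i) z)" using IHu[of "swap_at (Suc i) w"] H dec[of "Suc i"] by auto
    show ?thesis using x y braid[of i z] H zN by simp
  qed
  show ?case
  proof (intro conjI impI)
    assume x: "reach w0 v w x" and y: "reach w0 v w y"
    have len: "length w = n" "mset w = mset w0" using reach_closed[OF x] by auto
    show "x = y"
    proof (cases "inv_count w = 0")
      case True
      then show ?thesis using reach_last[OF x] reach_last[OF y] dec len by fastforce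
    next
      case False
      then obtain i x' where i: "Suc i < n" "w ! Suc i < w ! i" "reach w0 v (swap_at i w) x'" "x = t i x'"
        using reach_last[OF x] inv0 by auto
      from False obtain k y' where k: "Suc k < n" "w ! Suc k < w ! k" "reach w0 v (swap_at k w) y'" "y = t k y'"
        using reach_last[OF y] inv0 by auto
      consider "i = k" | "Suc i < k" | "Suc k < i" | "k = Suc i" | "i = Suc k" by linarith
      then show ?thesis
      proof cases
        case 1 then show ?thesis using i k IHu[of "swap_at i w" x' y'] dec len by auto
      next
        case 2 then show ?thesis using far[of i k x' y'] i k len by simp
      next
        case 3 then show ?thesis using far[of k i y' x'] i k len by simp
      next
        case 4 then show ?thesis using near[of i x' y'] i k len by simp
      next
        case 5 then show ?thesis using near[of k y' x'] i k len by simp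
      qed
    qed
  next
    assume x: "reach w0 v w x" and j: "Suc j < n" "w ! j = w ! Suc j"
    have len: "length w = n" "mset w = mset w0" using reach_closed[OF x] by auto
    show "t j x = s x"
    proof (cases "inv_count w = 0")
      case True
      then have "w = w0" "x = v" using reach_last[OF x] dec len by fastforce+
      then show ?thesis using eigen j by simp
    next
      case False
      then obtain k x' where k: "Suc k < n" "w ! Suc k < w ! k" "reach w0 v (swap_at k w) x'" "x = t k x'" "x' \<in> N"
        using reach_last[OF x] inv0 by auto
      have deck: "inv_count (swap_at k w) < inv_count w" using dec k len by auto
      have kj: "k \<noteq> j" using k j by auto
      consider "Suc j < k" | "Suc k < j" | "k = Suc j" | "j = Suc k" using kj by linarith
      then show ?thesis
      proof cases
        case 1
        then have "t j x' = s x'" using IHe[of "swap_at k w" x' j] deck k j len by (simp add: swap_at_nth)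
        then show ?thesis using 1 k j comm[of j k x'] t_s by simp
      next
        case 2
        then have "t j x' = s x'" using IHe[of "swap_at k w" x' j] deck k j len by (simp add: swap_at_nth)
        then show ?thesis using 2 k j comm[of k j x'] t_s by simp
      next
        \<comment> \<open>Locally the letters are \<open>b b a\<close> with \<open>a < b\<close>. In
          \<open>?u\<close> they are \<open>a b b\<close>, with the eigenvalue at \<open>k\<close>,
          and the braid relation carries it over to \<open>j\<close>. The remaining case
          \<open>b a a\<close> is the mirror image.\<close>
        case 3
        let ?u = "swap_at j (swap_at k w)"
        obtain z where z: "reach w0 v ?u z" using reach_ex[of ?u] len by auto
        have zN: "z \<in> N" using reach_closed z by blast
        have d: "inv_count ?u < inv_count w"
          using inv_count_swap_at_descent[of j "swap_at k w"] deck 3 k j len by (auto simp: swap_at_nth)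
        have "reach w0 v (swap_at k w) (t j z)"
          by (rule reach_descent) (use z 3 k j len in \<open>auto simp: swap_at_nth\<close>)
        then have x': "x' = t j z" using IHu[of "swap_at k w"] deck k by auto
        have "t k z = s z" using IHe[of ?u z k] d z k 3 j len by (auto simp: swap_at_nth)
        then show ?thesis using 3 k x' braid[of j z] zN t_s t_closed j by simp
      next
        case 4
        let ?u = "swap_at j (swap_at k w)"
        obtain z where z: "reach w0 v ?u z" using reach_ex[of ?u] len by auto
        have zN: "z \<in> N" using reach_closed z by blast
        have d: "inv_count ?u < inv_count w"
          using inv_count_swap_at_descent[of j "swap_at k w"] deck 4 k j len by (auto simp: swap_at_nth)
        have "reach w0 v (swap_at k w) (t j z)"
          by (rule reach_descent) (use z 4 k j len in \<open>auto simp: swap_at_nth\<close>)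
        then have x': "x' = t j z" using IHu[of "swap_at k w"] deck k by auto
        have "t k z = s z" using IHe[of ?u z k] d z k 4 j len by (auto simp: swap_at_nth)
        then show ?thesis using 4 k x' braid[of k z] zN t_s t_closed j by simp
      qed
    qed
  qed
qed

text \<open>Frobenius reciprocity: a vector on which the stabiliser of a sorted word acts by the eigenvalue \<open>s\<close>
  spreads to a family indexed by all rearrangements of the word.\<close>

lemma word_family:
  obtains m where "m w0 = v" "\<And>w. mset w = mset w0 \<Longrightarrow> m w \<in> N"
    "\<And>w j. mset w = mset w0 \<Longrightarrow> Suc j < n \<Longrightarrow> w ! j < w ! Suc j \<Longrightarrow> t j (m w) = m (swap_at j w)"
    "\<And>w j. mset w = mset w0 \<Longrightarrow> Suc j < n \<Longrightarrow> w ! j = w ! Suc j \<Longrightarrow> t j (m w) = s (m w)"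
proof -
  define m where "m w = (SOME x. reach w0 v w x)" for w
  have m: "reach w0 v w (m w)" if "mset w = mset w0" for w
    unfolding m_def using reach_ex[OF that] by (rule someI_ex)
  have uniq: "x = m w" if "reach w0 v w x" for w x
    using reach_unique_eigen[of w x "m w"] m[of w] reach_closed[OF that] that by blast
  have 1: "m w0 = v" using uniq[OF start] by simp
  have 2: "m w \<in> N" if "mset w = mset w0" for w using reach_closed m that by blast
  have 3: "t j (m w) = m (swap_at j w)" if "mset w = mset w0" "Suc j < n" "w ! j < w ! Suc j" for w j
    by (rule uniq, rule step) (use that m[of w] reach_closed[OF m] in auto)
  have 4: "t j (m w) = s (m w)" if "mset w = mset w0" "Suc j < n" "w ! j = w ! Suc j" for w j
    using reach_unique_eigen[of w "m w" "m w" j] m[of w] that by blast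
  show thesis by (rule that[of m]) (use 1 2 3 4 in auto)
qed

end

end

section \<open>Weight spaces, their homomorphisms and adjoints\<close>

definition scl :: "'f::field \<Rightarrow> (nat list \<Rightarrow> 'f) \<Rightarrow> nat list \<Rightarrow> 'f" where
  "scl c v = (\<lambda>w. c * v w)"

lemma scl_apply: "scl c v w = c * v w" by (simp add: scl_def)

lemmas fun_apply_simps = plus_fun_apply zero_fun_apply minus_apply uminus_apply scl_apply
declare plus_fun_apply [simp del] zero_fun_apply [simp del] minus_apply [simp del] uminus_apply [simp del]
  times_fun_apply [simp del] one_fun_apply [simp del]

lemma scl_simps [simp]: "scl c 0 = 0" "scl 0 v = 0" "scl 1 v = v" "scl a (scl b v) = scl (a * b) v"
  by (auto simp: fun_apply_simps fun_eq_iff)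

lemma scl_add: "scl c (u + v) = scl c u + scl c v"
  by (auto simp: fun_apply_simps fun_eq_iff algebra_simps)

lemma scl_add_left: "scl (a + b) v = scl a v + scl b v"
  by (auto simp: fun_apply_simps fun_eq_iff algebra_simps)

lemma scl_minus: "scl (- 1) v = - v"
  by (auto simp: fun_apply_simps fun_eq_iff)

lemma scl_sum: "scl c (sum f A) = (\<Sum>x\<in>A. scl c (f x))"
  by (induction A rule: infinite_finite_induct) (simp_all add: scl_add)

lemma T_add: "T q j (u + v) = T q j u + T q j v"
  using T_lin[of q j 1 u 1 v] by (auto simp: fun_apply_simps fun_eq_iff plus_fun_def)

lemma T_scl: "T q j (scl c v) = scl c (T q j v)"
  using T_lin[of q j c v 0 v] by (auto simp: fun_apply_simps fun_eq_iff scl_def)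

lemma T_zero [simp]: "T q j 0 = 0"
  using T_scl[of q j 0 0] by simp

lemma sum_fun_apply: "sum f A x = (\<Sum>a\<in>A. f a x)"
  by (induction A rule: infinite_finite_induct) (auto simp: fun_apply_simps)

text \<open>A weight space of the tensor powers of the space with basis the letters. If the
  multiplicities in \<open>\<alpha>\<close> are the parts of \<open>\<lambda>\<close>, it is the
  model of \<open>M(\<lambda>)\<close>.\<close>

definition weight_space :: "nat multiset \<Rightarrow> (nat list \<Rightarrow> 'f::field) set" where
  "weight_space \<alpha> = {v. \<forall>w. mset w \<noteq> \<alpha> \<longrightarrow> v w = 0}"

definition word_vec :: "nat list \<Rightarrow> nat list \<Rightarrow> 'f::field" where
  "word_vec w = (\<lambda>x. if x = w then 1 else 0)"

lemma finite_words: "finite {w. mset w = \<alpha>}"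
proof (rule finite_subset)
  show "{w. mset w = \<alpha>} \<subseteq> {w. set w \<subseteq> set_mset \<alpha> \<and> length w = size \<alpha>}"
    by (auto simp: set_mset_mset[symmetric] simp del: set_mset_mset)
  show "finite {w. set w \<subseteq> set_mset \<alpha> \<and> length w = size \<alpha>}"
    by (rule finite_lists_length_eq) simp
qed

lemma weight_space_zero [simp]: "0 \<in> weight_space \<alpha>" by (simp add: weight_space_def fun_apply_simps fun_apply_simps)
lemma weight_space_add: "u \<in> weight_space \<alpha> \<Longrightarrow> v \<in> weight_space \<alpha> \<Longrightarrow> u + v \<in> weight_space \<alpha>" by (simp add: weight_space_def fun_apply_simps fun_apply_simps)
lemma weight_space_diff: "u \<in> weight_space \<alpha> \<Longrightarrow> v \<in> weight_space \<alpha> \<Longrightarrow> u - v \<in> weight_space \<alpha>" by (simp add: weight_space_def fun_apply_simps fun_apply_simps)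
lemma weight_space_scl: "u \<in> weight_space \<alpha> \<Longrightarrow> scl c u \<in> weight_space \<alpha>" by (simp add: weight_space_def fun_apply_simps)
lemma weight_space_T: "u \<in> weight_space \<alpha> \<Longrightarrow> T q j u \<in> weight_space \<alpha>"
  unfolding weight_space_def
proof (safe)
  fix w assume "\<forall>w. mset w \<noteq> \<alpha> \<longrightarrow> u w = 0" "mset w \<noteq> \<alpha>"
  then show "T q j u w = 0"
    by (cases "Suc j < length w") (auto simp: T_nth T_short)
qed
lemma weight_space_sum: "(\<And>x. x \<in> A \<Longrightarrow> f x \<in> weight_space \<alpha>) \<Longrightarrow> sum f A \<in> weight_space \<alpha>"
  by (induction A rule: infinite_finite_induct) (auto intro: weight_space_add)
lemma weight_space_word_vec: "mset w = \<alpha> \<Longrightarrow> word_vec w \<in> weight_space \<alpha>" by (auto simp: weight_space_def word_vec_def)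

lemma weight_space_expand: "v \<in> weight_space \<alpha> \<Longrightarrow> v = (\<Sum>w | mset w = \<alpha>. scl (v w) (word_vec w))"
  by (rule ext) (auto simp: fun_apply_simps sum_fun_apply word_vec_def weight_space_def finite_words if_distrib sum.delta cong: if_cong)

lemma weight_space_eqI: "u \<in> weight_space \<alpha> \<Longrightarrow> v \<in> weight_space \<alpha> \<Longrightarrow> (\<And>w. mset w = \<alpha> \<Longrightarrow> u w = v w) \<Longrightarrow> u = v"
  by (rule ext) (metis (mono_tags, lifting) weight_space_def mem_Collect_eq)

lemma T_word_vec:
  assumes "Suc j < length w"
  shows "w ! j < w ! Suc j \<Longrightarrow> T q j (word_vec w) = word_vec (swap_at j w)"
    "w ! j = w ! Suc j \<Longrightarrow> T q j (word_vec w) = scl q (word_vec w)"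
    "w ! Suc j < w ! j \<Longrightarrow> T q j (word_vec w) = scl q (word_vec (swap_at j w)) + scl (q - 1) (word_vec w)"
proof -
  have sw: "swap_at j x = w \<longleftrightarrow> x = swap_at j w" for x by auto
  have T: "T q j (word_vec w :: nat list \<Rightarrow> 'a) x = (if length x = length w then (if x ! j < x ! Suc j then q * word_vec w (swap_at j x)
      else if x ! j = x ! Suc j then q * word_vec w x
      else word_vec w (swap_at j x) + (q - 1) * word_vec w x) else 0)" for x
    using assms by (cases "Suc j < length x") (auto simp: T_nth T_short word_vec_def)
  show "w ! j < w ! Suc j \<Longrightarrow> T q j (word_vec w) = word_vec (swap_at j w)"
    by (rule ext) (use assms in \<open>auto simp: T swap_at_nth\<close>, (auto simp: word_vec_def sw swap_at_nth))
  show "w ! j = w ! Suc j \<Longrightarrow> T q j (word_vec w) = scl q (word_vec w)"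
    by (rule ext) (use assms in \<open>auto simp: fun_apply_simps T swap_at_nth swap_at_same\<close>, (auto simp: word_vec_def sw swap_at_nth swap_at_same split: if_splits)?)
  show "w ! Suc j < w ! j \<Longrightarrow> T q j (word_vec w) = scl q (word_vec (swap_at j w)) + scl (q - 1) (word_vec w)"
    by (rule ext) (use assms in \<open>auto simp: fun_apply_simps T swap_at_nth\<close>, (auto simp: word_vec_def sw swap_at_nth split: if_splits)?)
qed

text \<open>Invertibility of \<open>q\<close> allows descents to be removed, which leads from
  \<open>w\<close> to the sorted word; ascents lead from there to all other words.\<close>

lemma weight_space_generated:
  assumes "q \<noteq> 0" "mset w = \<alpha>" "word_vec w \<in> U"
    and add: "\<And>u v. u \<in> U \<Longrightarrow> v \<in> U \<Longrightarrow> u + v \<in> U"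
    and scl: "\<And>c u. u \<in> U \<Longrightarrow> scl c u \<in> U"
    and T: "\<And>j u. Suc j < size \<alpha> \<Longrightarrow> u \<in> U \<Longrightarrow> T q j u \<in> U"
  shows "weight_space \<alpha> \<subseteq> U"
proof -
  have down: "word_vec w \<in> U \<Longrightarrow> mset w = \<alpha> \<Longrightarrow> word_vec (sort w) \<in> U" for w
  proof (induction "inv_count w" arbitrary: w rule: less_induct)
    case less
    show ?case
    proof (cases "sorted w")
      case True then show ?thesis using less by (simp add: sorted_sort_id)
    next
      case False
      then obtain j where j: "Suc j < length w" "w ! Suc j < w ! j" using not_sorted_descent by blast
      have len: "length w = size \<alpha>" using less.prems by auto
      have "word_vec (swap_at j w) = scl (inverse q) (T q j (word_vec w) + scl (1 - q) (word_vec w))"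
        using T_word_vec(3)[OF j, of q] assms(1) by (auto simp: fun_apply_simps fun_eq_iff field_simps)
      then have "word_vec (swap_at j w) \<in> U" using add scl T[of j] less.prems j len by metis
      then have "word_vec (sort (swap_at j w)) \<in> U"
        using less inv_count_swap_at_descent[OF j] by simp
      moreover have "sort (swap_at j w) = sort w" by (metis mset_sort mset_swap_at properties_for_sort sorted_sort)
      ultimately show ?thesis by simp
    qed
  qed
  have 1: "word_vec (sort w) \<in> U" using down assms by blast
  have "word_vec x \<in> U" if "mset x = \<alpha>" for x
  proof -
    have "mset x = mset (sort w)" "sorted (sort w)" using that assms by simp_all
    then show ?thesis
    proof (induction rule: word_induct)
      case (step x j)
      then have "length x = size \<alpha>" using assms by (metis mset_sort size_mset)
      then show ?case using T_word_vec(1)[of j x q] T[of j "word_vec x"] step by simp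
    qed (use 1 in auto)
  qed
  moreover have "0 \<in> U" using scl[OF 1, of 0] by simp
  ultimately have "(\<Sum>w\<in>A. scl (v w) (word_vec w)) \<in> U" if "A \<subseteq> {w. mset w = \<alpha>}" for A v
    using that by (induction A rule: infinite_finite_induct) (auto intro: add scl)
  then show ?thesis using weight_space_expand by (metis subsetI subset_refl)
qed

text \<open>The maps are total on all functions of words, so each condition is relative to the
  source weight space.\<close>

definition hecke_hom :: "'f::field \<Rightarrow> nat multiset \<Rightarrow> nat multiset \<Rightarrow> ((nat list \<Rightarrow> 'f) \<Rightarrow> (nat list \<Rightarrow> 'f)) \<Rightarrow> bool" where
  "hecke_hom q \<alpha> \<beta> f \<longleftrightarrow> (\<forall>u\<in>weight_space \<alpha>. f u \<in> weight_space \<beta>) \<and> (\<forall>u\<in>weight_space \<alpha>. \<forall>v\<in>weight_space \<alpha>. f (u + v) = f u + f v) \<and>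
     (\<forall>c. \<forall>u\<in>weight_space \<alpha>. f (scl c u) = scl c (f u)) \<and>
     (\<forall>j. \<forall>u\<in>weight_space \<alpha>. Suc j < size \<alpha> \<longrightarrow> f (T q j u) = T q j (f u))"

lemma whomD:
  assumes "hecke_hom q \<alpha> \<beta> f"
  shows "u \<in> weight_space \<alpha> \<Longrightarrow> f u \<in> weight_space \<beta>" "u \<in> weight_space \<alpha> \<Longrightarrow> v \<in> weight_space \<alpha> \<Longrightarrow> f (u + v) = f u + f v"
    "u \<in> weight_space \<alpha> \<Longrightarrow> f (scl c u) = scl c (f u)"
    "Suc j < size \<alpha> \<Longrightarrow> u \<in> weight_space \<alpha> \<Longrightarrow> f (T q j u) = T q j (f u)"
  using assms unfolding hecke_hom_def by auto

definition weight_linear :: "nat multiset \<Rightarrow> nat multiset \<Rightarrow> ((nat list \<Rightarrow> 'f::field) \<Rightarrow> (nat list \<Rightarrow> 'f)) \<Rightarrow> bool" where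
  "weight_linear \<alpha> \<beta> f \<longleftrightarrow> (\<forall>u\<in>weight_space \<alpha>. f u \<in> weight_space \<beta>) \<and> (\<forall>u\<in>weight_space \<alpha>. \<forall>v\<in>weight_space \<alpha>. f (u + v) = f u + f v) \<and>
     (\<forall>c. \<forall>u\<in>weight_space \<alpha>. f (scl c u) = scl c (f u))"

lemma hecke_hom_weight_linear: "hecke_hom q \<alpha> \<beta> f \<Longrightarrow> weight_linear \<alpha> \<beta> f"
  by (simp add: hecke_hom_def weight_linear_def)

lemma wlinD:
  assumes "weight_linear \<alpha> \<beta> f"
  shows "u \<in> weight_space \<alpha> \<Longrightarrow> f u \<in> weight_space \<beta>" "u \<in> weight_space \<alpha> \<Longrightarrow> v \<in> weight_space \<alpha> \<Longrightarrow> f (u + v) = f u + f v"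
    "u \<in> weight_space \<alpha> \<Longrightarrow> f (scl c u) = scl c (f u)" "f 0 = 0"
    "u \<in> weight_space \<alpha> \<Longrightarrow> v \<in> weight_space \<alpha> \<Longrightarrow> f (u - v) = f u - f v"
proof -
  show 1: "u \<in> weight_space \<alpha> \<Longrightarrow> f u \<in> weight_space \<beta>" "u \<in> weight_space \<alpha> \<Longrightarrow> v \<in> weight_space \<alpha> \<Longrightarrow> f (u + v) = f u + f v"
    "u \<in> weight_space \<alpha> \<Longrightarrow> f (scl c u) = scl c (f u)" for u v c
    using assms unfolding weight_linear_def by auto
  show "f 0 = 0" using 1(3)[of 0 0] by simp
  show "u \<in> weight_space \<alpha> \<Longrightarrow> v \<in> weight_space \<alpha> \<Longrightarrow> f (u - v) = f u - f v"
    using 1(2)[of u "scl (- 1) v"] 1(3)[of v "- 1"] weight_space_scl[of v \<alpha> "- 1"] by (simp add: scl_minus)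
qed

lemma weight_linear_sum:
  assumes "weight_linear \<alpha> \<beta> f" "\<And>x. x \<in> A \<Longrightarrow> g x \<in> weight_space \<alpha>"
  shows "f (sum g A) = (\<Sum>x\<in>A. f (g x))"
  using assms(2) by (induction A rule: infinite_finite_induct) (auto simp: wlinD[OF assms(1)] weight_space_sum)

lemma weight_linear_expand:
  assumes "weight_linear \<alpha> \<beta> f" "v \<in> weight_space \<alpha>"
  shows "f v = (\<Sum>w | mset w = \<alpha>. scl (v w) (f (word_vec w)))"
proof -
  have "f v = f (\<Sum>w | mset w = \<alpha>. scl (v w) (word_vec w))" using weight_space_expand[OF assms(2)] by simp
  also have "\<dots> = (\<Sum>w | mset w = \<alpha>. f (scl (v w) (word_vec w)))"
    by (rule weight_linear_sum[OF assms(1)]) (auto intro: weight_space_scl weight_space_word_vec)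
  also have "\<dots> = (\<Sum>w | mset w = \<alpha>. scl (v w) (f (word_vec w)))"
    by (rule sum.cong) (auto intro: wlinD(3)[OF assms(1)] weight_space_word_vec)
  finally show ?thesis .
qed

lemma hecke_hom_comp: "hecke_hom q \<alpha> \<beta> f \<Longrightarrow> hecke_hom q \<beta> \<gamma> g \<Longrightarrow> size \<beta> = size \<alpha> \<Longrightarrow> hecke_hom q \<alpha> \<gamma> (\<lambda>u. g (f u))"
  unfolding hecke_hom_def by simp

text \<open>The operators live on functions of all words, so one element acts on every weight space
  at once; this is how a single element can represent a whole family of maps.\<close>

inductive_set alg :: "'f::field \<Rightarrow> nat set \<Rightarrow> ((nat list \<Rightarrow> 'f) \<Rightarrow> (nat list \<Rightarrow> 'f)) set" for q J where
  alg_id: "(\<lambda>v. v) \<in> alg q J"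
| alg_T: "D \<in> alg q J \<Longrightarrow> j \<in> J \<Longrightarrow> (\<lambda>v. T q j (D v)) \<in> alg q J"
| alg_add: "D \<in> alg q J \<Longrightarrow> D' \<in> alg q J \<Longrightarrow> (\<lambda>v. D v + D' v) \<in> alg q J"
| alg_scl: "D \<in> alg q J \<Longrightarrow> (\<lambda>v. scl c (D v)) \<in> alg q J"

lemma alg_zero: "(\<lambda>v. 0) \<in> alg q J"
  using alg_scl[OF alg_id, of 0] by simp

lemma alg_diff: "D \<in> alg q J \<Longrightarrow> D' \<in> alg q J \<Longrightarrow> (\<lambda>v. D v - D' v) \<in> alg q J"
  using alg_add[OF _ alg_scl[of D' _ _ "- 1"]] by (simp add: scl_minus)

lemma alg_sum: "(\<And>x. x \<in> A \<Longrightarrow> D x \<in> alg q J) \<Longrightarrow> (\<lambda>v. \<Sum>x\<in>A. D x v) \<in> alg q J"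
  by (induction A rule: infinite_finite_induct) (auto intro: alg_zero alg_add)

lemma alg_comp: "D \<in> alg q J \<Longrightarrow> D' \<in> alg q J \<Longrightarrow> (\<lambda>v. D (D' v)) \<in> alg q J"
  by (induction rule: alg.induct) (auto intro: alg.intros)

lemma alg_mono: "D \<in> alg q J \<Longrightarrow> J \<subseteq> J' \<Longrightarrow> D \<in> alg q J'"
  by (induction rule: alg.induct) (auto intro: alg.intros)

lemma alg_linear: "D \<in> alg q J \<Longrightarrow> D (u + v) = D u + D v \<and> D (scl c u) = scl c (D u)"
  by (induction rule: alg.induct) (auto simp: T_add T_scl scl_add mult.commute)

lemma alg_weight_space: "D \<in> alg q J \<Longrightarrow> u \<in> weight_space \<alpha> \<Longrightarrow> D u \<in> weight_space \<alpha>"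
  by (induction rule: alg.induct) (auto intro: weight_space_T weight_space_add weight_space_scl)

lemma alg_weight_linear: "D \<in> alg q J \<Longrightarrow> weight_linear \<alpha> \<alpha> D"
  unfolding weight_linear_def using alg_linear alg_weight_space by blast

lemma alg_hecke_hom:
  "D \<in> alg q J \<Longrightarrow> hecke_hom q \<alpha> \<beta> f \<Longrightarrow> u \<in> weight_space \<alpha> \<Longrightarrow> J \<subseteq> {j. Suc j < size \<alpha>} \<Longrightarrow> f (D u) = D (f u)"
proof (induction rule: alg.induct)
  case (alg_T D j) then show ?case using whomD(4)[OF alg_T.prems(1), of j "D u"] alg_weight_space[of D q J u \<alpha>] by auto
next
  case (alg_add D D') then show ?case using whomD(2)[OF alg_add.prems(1)] alg_weight_space by metis
next
  case (alg_scl D c) then show ?case using whomD(3)[OF alg_scl.prems(1)] alg_weight_space by metis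
qed auto

section \<open>The invariant bilinear form and adjoints\<close>

text \<open>At an ascent the two off-diagonal entries of \<open>T q j\<close> are \<open>q\<close>
  and 1, and the exchange raises \<open>inv_count\<close> by one; the weight
  \<open>q ^ inv_count w\<close> compensates exactly this and makes \<open>T q j\<close>
  self-adjoint.\<close>

definition form :: "'f::field \<Rightarrow> nat multiset \<Rightarrow> (nat list \<Rightarrow> 'f) \<Rightarrow> (nat list \<Rightarrow> 'f) \<Rightarrow> 'f" where
  "form q \<alpha> u v = (\<Sum>w | mset w = \<alpha>. q ^ inv_count w * u w * v w)"

lemma form_add: "form q \<alpha> (u + v) x = form q \<alpha> u x + form q \<alpha> v x" "form q \<alpha> x (u + v) = form q \<alpha> x u + form q \<alpha> x v"
  by (simp_all add: fun_apply_simps form_def algebra_simps sum.distrib)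

lemma form_scl: "form q \<alpha> (scl c v) x = c * form q \<alpha> v x" "form q \<alpha> x (scl c v) = c * form q \<alpha> x v"
  by (simp_all add: fun_apply_simps form_def algebra_simps sum_distrib_left)

lemma form_zero [simp]: "form q \<alpha> 0 v = 0" "form q \<alpha> v 0 = 0"
  by (simp_all add: fun_apply_simps form_def)

lemma form_word_vec: "mset w = \<alpha> \<Longrightarrow> form q \<alpha> (word_vec w) v = q ^ inv_count w * v w"
  by (simp add: form_def word_vec_def finite_words if_distrib if_distribR sum.delta' cong: if_cong)

lemma form_sym: "form q \<alpha> u v = form q \<alpha> v u"
  by (simp add: form_def ac_simps)

lemma form_sum: "form q \<alpha> (sum f A) v = (\<Sum>x\<in>A. form q \<alpha> (f x) v)"
  by (induction A rule: infinite_finite_induct) (auto simp: form_add)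

lemma form_nondegenerate:
  assumes "q \<noteq> 0" "u \<in> weight_space \<alpha>" "v \<in> weight_space \<alpha>" "\<And>x. x \<in> weight_space \<alpha> \<Longrightarrow> form q \<alpha> x u = form q \<alpha> x v"
  shows "u = v"
  using assms(2,3)
proof (rule weight_space_eqI)
  fix w assume "mset w = \<alpha>"
  then show "u w = v w" using assms(4)[of "word_vec w"] weight_space_word_vec[of w \<alpha>] assms(1) by (simp add: form_word_vec)
qed

lemma form_T: "form q \<alpha> (T q j u) v = form q \<alpha> u (T q j v)"
proof (cases "Suc j < size \<alpha>")
  case False
  have "T q j u w = 0" if "mset w = \<alpha>" for w and u :: "nat list \<Rightarrow> 'a"
    using that False by (intro T_short) auto
  then show ?thesis by (simp add: form_def)
next
  case True
  let ?W = "{w. mset w = \<alpha>}"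
  \<comment> \<open>\<open>k\<close> and \<open>d\<close> are the off-diagonal and diagonal entries
    of \<open>T q j\<close> times the weight of the form. Self-adjointness is the symmetry
    \<open>k (swap_at j w) = k w\<close>.\<close>
  define k where "k w = (if w ! j < w ! Suc j then q ^ Suc (inv_count w) else if w ! j = w ! Suc j then 0
     else q ^ inv_count w)" for w
  define d where "d w = (if w ! j < w ! Suc j then 0 else if w ! j = w ! Suc j then q * q ^ inv_count w
     else (q - 1) * q ^ inv_count w)" for w
  have len: "Suc j < length w" if "mset w = \<alpha>" for w using that True by auto
  have k: "k (swap_at j w) = k w" if "mset w = \<alpha>" for w
    using inv_count_swap_at[of j w] inv_count_swap_at_descent[of j w] len[OF that]
    by (auto simp: k_def swap_at_nth)
  have T: "q ^ inv_count w * T q j u w = k w * u (swap_at j w) + d w * u w" if "mset w = \<alpha>" for w u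
    using len[OF that] by (auto simp: T_nth k_def d_def algebra_simps)
  have bij: "bij_betw (swap_at j) ?W ?W"
    by (rule bij_betwI[of _ _ _ "swap_at j"]) auto
  have "(\<Sum>w\<in>?W. k w * u (swap_at j w) * v w) = (\<Sum>w\<in>?W. k (swap_at j w) * u (swap_at j (swap_at j w)) * v (swap_at j w))"
    using sum.reindex_bij_betw[OF bij, of "\<lambda>w. k w * u (swap_at j w) * v w"] by simp
  also have "\<dots> = (\<Sum>w\<in>?W. k w * u w * v (swap_at j w))" using k by (intro sum.cong) auto
  finally have 1: "(\<Sum>w\<in>?W. k w * u (swap_at j w) * v w) = (\<Sum>w\<in>?W. k w * u w * v (swap_at j w))" .
  have "form q \<alpha> (T q j u) v = (\<Sum>w\<in>?W. k w * u (swap_at j w) * v w + d w * u w * v w)"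
    unfolding form_def by (intro sum.cong) (auto simp: T algebra_simps)
  also have "\<dots> = (\<Sum>w\<in>?W. k w * u w * v (swap_at j w) + d w * u w * v w)"
    using 1 by (simp add: sum.distrib)
  also have "\<dots> = (\<Sum>w\<in>?W. u w * (q ^ inv_count w * T q j v w))"
    by (intro sum.cong) (auto simp: T algebra_simps)
  also have "\<dots> = form q \<alpha> u (T q j v)" unfolding form_def by (simp add: ac_simps)
  finally show ?thesis .
qed

text \<open>The transpose with respect to the two forms, read off on basis words; the division is by
  the norm of \<open>word_vec w\<close>.\<close>

definition adjoint :: "'f::field \<Rightarrow> nat multiset \<Rightarrow> nat multiset \<Rightarrow> ((nat list \<Rightarrow> 'f) \<Rightarrow> (nat list \<Rightarrow> 'f)) \<Rightarrow>
    ((nat list \<Rightarrow> 'f) \<Rightarrow> (nat list \<Rightarrow> 'f))" where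
  "adjoint q \<alpha> \<beta> f v = (\<lambda>w. if mset w = \<alpha> then inverse (q ^ inv_count w) * form q \<beta> (f (word_vec w)) v else 0)"

lemma adjoint_weight_space: "adjoint q \<alpha> \<beta> f v \<in> weight_space \<alpha>" by (simp add: adjoint_def weight_space_def)

lemma adjoint_weight_linear: "weight_linear \<beta> \<alpha> (adjoint q \<alpha> \<beta> f)"
  unfolding weight_linear_def using adjoint_weight_space by (auto simp: fun_apply_simps adjoint_def fun_eq_iff form_add form_scl algebra_simps)

lemma form_adjoint:
  assumes "q \<noteq> 0" "weight_linear \<alpha> \<beta> f" "u \<in> weight_space \<alpha>"
  shows "form q \<beta> (f u) v = form q \<alpha> u (adjoint q \<alpha> \<beta> f v)"
proof -
  have "form q \<beta> (f u) v = (\<Sum>w | mset w = \<alpha>. u w * form q \<beta> (f (word_vec w)) v)"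
    by (subst weight_linear_expand[OF assms(2,3)]) (simp add: form_sum form_scl)
  also have "\<dots> = form q \<alpha> u (adjoint q \<alpha> \<beta> f v)"
    unfolding form_def[of q \<alpha>] by (intro sum.cong) (use assms in \<open>auto simp: adjoint_def\<close>)
  finally show ?thesis .
qed

lemma adjoint_hecke_hom:
  assumes "q \<noteq> 0" "hecke_hom q \<alpha> \<beta> f" "size \<beta> = size \<alpha>"
  shows "hecke_hom q \<beta> \<alpha> (adjoint q \<alpha> \<beta> f)"
proof -
  have "adjoint q \<alpha> \<beta> f (T q j v) = T q j (adjoint q \<alpha> \<beta> f v)" if "Suc j < size \<beta>" "v \<in> weight_space \<beta>" for j v
  proof (rule form_nondegenerate[OF assms(1)])
    fix x :: "nat list \<Rightarrow> 'a" assume x: "x \<in> weight_space \<alpha>"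
    show "form q \<alpha> x (adjoint q \<alpha> \<beta> f (T q j v)) = form q \<alpha> x (T q j (adjoint q \<alpha> \<beta> f v))"
      using whomD(4)[OF assms(2), of j x] that assms x
      by (simp add: form_adjoint[OF assms(1) hecke_hom_weight_linear[OF assms(2)], symmetric] form_T[symmetric] weight_space_T)
  qed (auto simp: adjoint_weight_space weight_space_T)
  then show ?thesis using adjoint_weight_linear[of \<beta> \<alpha> q f] unfolding hecke_hom_def weight_linear_def by blast
qed

text \<open>A vector killed by the adjoint is orthogonal to the image of \<open>f\<close>, which is
  the whole weight space.\<close>

lemma adjoint_inj:
  assumes "q \<noteq> 0" "weight_linear \<alpha> \<beta> f" "f ` weight_space \<alpha> = weight_space \<beta>" "v \<in> weight_space \<beta>" "adjoint q \<alpha> \<beta> f v = 0"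
  shows "v = 0"
proof (rule form_nondegenerate[OF assms(1)])
  fix x :: "nat list \<Rightarrow> 'a" assume "x \<in> weight_space \<beta>"
  then obtain u where "u \<in> weight_space \<alpha>" "x = f u" using assms(3) by blast
  then show "form q \<beta> x v = form q \<beta> x 0" using form_adjoint[OF assms(1,2), of u v] assms(5) by simp
qed (use assms in auto)

text \<open>The generators are self-adjoint, so transposition reverses products and stays in the
  algebra, by one operator for all weights simultaneously.\<close>

lemma alg_adjoint:
  "D \<in> alg q J \<Longrightarrow> \<exists>D'\<in>alg q J. \<forall>\<alpha> u v. form q \<alpha> (D u) v = form q \<alpha> u (D' v)"
proof (induction rule: alg.induct)
  case alg_id then show ?case by (intro bexI[of _ "\<lambda>v. v"]) (auto intro: alg.alg_id)
next
  case (alg_T D j)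
  then obtain D' where D': "D' \<in> alg q J" "\<And>\<alpha> u v. form q \<alpha> (D u) v = form q \<alpha> u (D' v)" by blast
  have "(\<lambda>v. D' (T q j v)) \<in> alg q J"
    using alg_comp[OF D'(1) alg.alg_T[OF alg.alg_id alg_T(2)]] by simp
  then show ?case using D' by (intro bexI[of _ "\<lambda>v. D' (T q j v)"]) (auto simp: form_T)
next
  case (alg_add D E)
  then obtain D' E' where "D' \<in> alg q J" "\<And>\<alpha> u v. form q \<alpha> (D u) v = form q \<alpha> u (D' v)"
    "E' \<in> alg q J" "\<And>\<alpha> u v. form q \<alpha> (E u) v = form q \<alpha> u (E' v)" by blast
  then show ?case by (intro bexI[of _ "\<lambda>v. D' v + E' v"]) (auto simp: form_add intro: alg.alg_add)
next
  case (alg_scl D c)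
  then obtain D' where "D' \<in> alg q J" "\<And>\<alpha> u v. form q \<alpha> (D u) v = form q \<alpha> u (D' v)" by blast
  then show ?case by (intro bexI[of _ "\<lambda>v. scl c (D' v)"]) (auto simp: form_scl intro: alg.alg_scl)
qed

lemma E_hecke_hom:
  assumes "q \<noteq> 0" "\<alpha> + replicate_mset k i = \<beta> + replicate_mset k (Suc i)"
  shows "hecke_hom q \<alpha> \<beta> (\<lambda>v w. E q i w k v)"
proof -
  have "E q i w k u = 0" if "u \<in> weight_space \<alpha>" "mset w \<noteq> \<beta>" for u w
  proof (rule ccontr)
    assume "E q i w k u \<noteq> 0"
    from E_content[OF this] obtain x where "u x \<noteq> 0"
      "mset x + replicate_mset k i = mset w + replicate_mset k (Suc i)" by blast
    then show False using that assms(2) unfolding weight_space_def by (metis (mono_tags, lifting) add_right_cancel mem_Collect_eq)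
  qed
  then show ?thesis unfolding hecke_hom_def
    by (auto simp: fun_apply_simps weight_space_def fun_eq_iff plus_fun_def E_add scl_def E_scale E_T[OF assms(1)])
qed

section \<open>Letter maps and the dominance order on words\<close>

lemma T_quad_weight_space: "u \<in> weight_space \<alpha> \<Longrightarrow> Suc j < size \<alpha> \<Longrightarrow> T q j (T q j u) = scl (q - 1) (T q j u) + scl q u"
  by (rule weight_space_eqI[of _ \<alpha>]) (auto simp: fun_apply_simps T_quad intro: weight_space_T weight_space_add weight_space_scl)

lemma weight_linear_eqI:
  assumes "weight_linear \<alpha> \<beta> f" "weight_linear \<alpha> \<beta> g" "\<And>w. mset w = \<alpha> \<Longrightarrow> f (word_vec w) = g (word_vec w)" "u \<in> weight_space \<alpha>"
  shows "f u = g u"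
  using weight_linear_expand[OF assms(1,4)] weight_linear_expand[OF assms(2,4)] assms(3) by simp

lemma weight_linear_T: "weight_linear \<alpha> \<alpha> (T q j)"
  by (auto simp: weight_linear_def weight_space_T T_add T_scl)

lemma weight_linear_comp: "weight_linear \<alpha> \<beta> f \<Longrightarrow> weight_linear \<beta> \<gamma> g \<Longrightarrow> weight_linear \<alpha> \<gamma> (\<lambda>u. g (f u))"
  unfolding weight_linear_def by simp

text \<open>\<open>word_family\<close> spreads \<open>v\<close> along ascents and so prescribes the
  images of all words. Equivariance at a descent comes from the quadratic relation applied to the
  word before the exchange.\<close>

lemma word_hom:
  assumes q: "q \<noteq> 0" and w0: "sorted w0" "mset w0 = \<alpha>" and v: "v \<in> weight_space \<beta>" "size \<beta> = size \<alpha>"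
    and eigen: "\<And>j. Suc j < size \<alpha> \<Longrightarrow> w0 ! j = w0 ! Suc j \<Longrightarrow> T q j v = scl q v"
  shows "\<exists>f. hecke_hom q \<alpha> \<beta> f \<and> f (word_vec w0) = v"
proof -
  interpret braid_action "weight_space \<beta>" "T q" "scl q" "size \<alpha>"
    by unfold_locales (auto simp: weight_space_T weight_space_scl T_scl T_braid intro: T_comm)
  have len: "length w0 = size \<alpha>" using w0 by auto
  obtain m where m: "m w0 = v" "\<And>w. mset w = mset w0 \<Longrightarrow> m w \<in> weight_space \<beta>"
    "\<And>w j. mset w = mset w0 \<Longrightarrow> Suc j < size \<alpha> \<Longrightarrow> w ! j < w ! Suc j \<Longrightarrow> T q j (m w) = m (swap_at j w)"
    "\<And>w j. mset w = mset w0 \<Longrightarrow> Suc j < size \<alpha> \<Longrightarrow> w ! j = w ! Suc j \<Longrightarrow> T q j (m w) = scl q (m w)"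
    by (rule word_family[OF w0(1) len v(1) eigen], assumption, assumption, rule that; blast)
  define f where "f u = (\<Sum>w | mset w = \<alpha>. scl (u w) (m w))" for u
  have lin: "weight_linear \<alpha> \<beta> f" unfolding weight_linear_def f_def
    by (auto simp: fun_apply_simps scl_add_left sum.distrib scl_sum mult.assoc w0 m intro!: weight_space_sum weight_space_scl)
  have f_word_vec: "f (word_vec w) = m w" if "mset w = \<alpha>" for w
  proof -
    have "f (word_vec w) = (\<Sum>x | mset x = \<alpha>. if x = w then m w else 0)"
      unfolding f_def by (intro sum.cong) (auto simp: word_vec_def)
    then show ?thesis using that by (simp add: finite_words)
  qed
  have "f (T q j u) = T q j (f u)" if j: "Suc j < size \<alpha>" and u: "u \<in> weight_space \<alpha>" for j u
  proof (rule weight_linear_eqI[OF weight_linear_comp[OF weight_linear_T lin] weight_linear_comp[OF lin weight_linear_T] _ u])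
    fix w assume w: "mset w = \<alpha>"
    have len: "Suc j < length w" using w j by auto
    consider "w ! j < w ! Suc j" | "w ! j = w ! Suc j" | "w ! Suc j < w ! j" by linarith
    then show "f (T q j (word_vec w)) = T q j (f (word_vec w))"
    proof cases
      case 1 then show ?thesis using m(3)[of w j] w j w0 by (simp add: T_word_vec len f_word_vec)
    next
      case 2 then show ?thesis using m(4)[of w j] w j w0 by (simp add: T_word_vec len f_word_vec wlinD[OF lin] weight_space_word_vec)
    next
      case 3
      have m': "T q j (m (swap_at j w)) = m w" using m(3)[of "swap_at j w" j] 3 w j w0 len by (simp add: swap_at_nth)
      have "T q j (m w) = scl (q - 1) (m w) + scl q (m (swap_at j w))"
        using T_quad_weight_space[OF m(2)[of "swap_at j w"], of j q] w w0 j v by (simp add: m')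
      then show ?thesis using 3 w
        by (simp add: T_word_vec len f_word_vec wlinD[OF lin] weight_space_word_vec weight_space_scl add.commute)
    qed
  qed
  then have "hecke_hom q \<alpha> \<beta> f" using lin unfolding hecke_hom_def weight_linear_def by blast
  then show ?thesis using f_word_vec[OF w0(2)] m(1) by auto
qed

text \<open>Equal neighbours in the sorted word stay equal after relabelling, so the relabelled word
  has the required eigenvalues; it generates the target, hence surjectivity. Injective
  \<open>h\<close> compares contents of one shape, other \<open>h\<close> merge letters as a
  coarsening does.\<close>

lemma letter_map_hom:
  assumes "q \<noteq> 0"
  shows "\<exists>f. hecke_hom q \<alpha> (image_mset h \<alpha>) f \<and> f ` weight_space \<alpha> = weight_space (image_mset h \<alpha>)"
proof -
  obtain w where "mset w = \<alpha>" using ex_mset by blast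
  then obtain w0 where w0: "sorted w0" "mset w0 = \<alpha>" by (metis mset_sort sorted_sort)
  have "\<exists>f. hecke_hom q \<alpha> (image_mset h \<alpha>) f \<and> f (word_vec w0) = word_vec (map h w0)"
  proof (rule word_hom[OF assms w0])
    show "T q j (word_vec (map h w0)) = scl q (word_vec (map h w0))" if "Suc j < size \<alpha>" "w0 ! j = w0 ! Suc j" for j
      by (rule T_word_vec(2)) (use that w0 in auto)
  qed (use w0 in \<open>auto intro: weight_space_word_vec\<close>)
  then obtain f where f: "hecke_hom q \<alpha> (image_mset h \<alpha>) f" "f (word_vec w0) = word_vec (map h w0)" by blast
  have "weight_space (image_mset h \<alpha>) \<subseteq> f ` weight_space \<alpha>"
  proof (rule weight_space_generated[OF assms, where w = "map h w0"])
    show "word_vec (map h w0) \<in> f ` weight_space \<alpha>" using f(2) weight_space_word_vec[OF w0(2)] by (metis imageI)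
  next
    fix u v assume "u \<in> f ` weight_space \<alpha>" "v \<in> f ` weight_space \<alpha>"
    then obtain x y where "x \<in> weight_space \<alpha>" "y \<in> weight_space \<alpha>" "u = f x" "v = f y" by blast
    then show "u + v \<in> f ` weight_space \<alpha>" using whomD(2)[OF f(1), of x y] weight_space_add[of x \<alpha> y] by (metis imageI)
  next
    fix c u assume "u \<in> f ` weight_space \<alpha>"
    then obtain x where "x \<in> weight_space \<alpha>" "u = f x" by blast
    then show "scl c u \<in> f ` weight_space \<alpha>" using whomD(3)[OF f(1), of x c] weight_space_scl[of x \<alpha> c] by (metis imageI)
  next
    fix j u assume "u \<in> f ` weight_space \<alpha>" "Suc j < size (image_mset h \<alpha>)"
    then obtain x where "x \<in> weight_space \<alpha>" "u = f x" "Suc j < size \<alpha>" by auto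
    then show "T q j u \<in> f ` weight_space \<alpha>" using whomD(4)[OF f(1), of j x] weight_space_T[of x \<alpha> q j] by (metis imageI)
  qed (use w0 in auto)
  then show ?thesis using f(1) whomD(1)[OF f(1)] by blast
qed

section \<open>Bruhat order on words and leading terms\<close>

definition prefix_count :: "nat \<Rightarrow> nat \<Rightarrow> nat list \<Rightarrow> nat" where
  "prefix_count p i x = length (filter (\<lambda>c. c \<le> i) (take p x))"

text \<open>Bruhat order on the rearrangements of a word, through its counting criterion. The
  smaller word, with small letters further left, is the first argument.\<close>

definition word_dom :: "nat list \<Rightarrow> nat list \<Rightarrow> bool" where
  "word_dom x z \<longleftrightarrow> length x = length z \<and> (\<forall>p i. prefix_count p i z \<le> prefix_count p i x)"

lemma word_dom_refl [simp]: "word_dom x x" by (simp add: word_dom_def)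

lemma word_dom_trans: "word_dom x y \<Longrightarrow> word_dom y z \<Longrightarrow> word_dom x z"
  unfolding word_dom_def by (metis le_trans)

lemma prefix_count_Suc: "p < length x \<Longrightarrow> prefix_count (Suc p) i x = prefix_count p i x + (if x ! p \<le> i then 1 else 0)"
  by (simp add: prefix_count_def take_Suc_conv_app_nth)

lemma prefix_count_swap_at:
  assumes "Suc j < length x"
  shows "prefix_count p i (swap_at j x) = (if p = Suc j then prefix_count j i x + (if x ! Suc j \<le> i then 1 else 0) else prefix_count p i x)"
  using assms
proof (induction j x arbitrary: p rule: swap_at.induct)
  case (1 c d w) then show ?case by (cases p; cases "p - 1") (auto simp: prefix_count_def)
next
  case (2 j c w) then show ?case by (cases p) (auto simp: prefix_count_def)
qed auto

text \<open>The lexicographic order extends the Bruhat order, so leading words may be taken as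
  lexicographic maxima.\<close>

lemma word_dom_imp_le: "word_dom x z \<Longrightarrow> x \<le> z"
proof (induction x arbitrary: z)
  case (Cons a x)
  then obtain b y where z: "z = b # y" unfolding word_dom_def by (cases z) auto
  have cz: "prefix_count p i (b # y) \<le> prefix_count p i (a # x)" for p i using Cons.prems z by (auto simp: word_dom_def)
  have "a \<le> b" using cz[of 1 b] by (auto simp: prefix_count_def split: if_splits)
  moreover have "x \<le> y" if "a = b"
  proof (rule Cons.IH)
    have "prefix_count p i y \<le> prefix_count p i x" for p i using cz[of "Suc p" i] that by (auto simp: prefix_count_def split: if_splits)
    then show "word_dom x y" using Cons.prems z by (auto simp: word_dom_def)
  qed
  ultimately show ?case unfolding z by auto
qed (auto simp: word_dom_def)

text \<open>The lifting property at an ascent of \<open>z\<close>. Only the prefix of length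
  \<open>j + 1\<close> is affected, and its counts are controlled by those of the neighbouring
  lengths.\<close>

lemma word_dom_swap_at:
  assumes "word_dom x z" "Suc j < length z" "z ! j < z ! Suc j"
  shows "word_dom x (swap_at j z)" "word_dom (swap_at j x) (swap_at j z)"
proof -
  have len: "Suc j < length x" "length x = length z" using assms unfolding word_dom_def by auto
  have le: "prefix_count p i z \<le> prefix_count p i x" for p i using assms unfolding word_dom_def by auto
  have key: "prefix_count j i z + (if z ! Suc j \<le> i then 1 else 0) \<le> prefix_count (Suc j) i x \<and>
     prefix_count j i z + (if z ! Suc j \<le> i then 1 else 0) \<le> prefix_count j i x + (if x ! Suc j \<le> i then 1 else 0)" for i
    using le[of j i] le[of "Suc (Suc j)" i] le[of "Suc j" i] assms(3) len prefix_count_Suc[of "Suc j" z i] prefix_count_Suc[of "Suc j" x i] prefix_count_Suc[of j z i]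
      prefix_count_Suc[of j x i] by (auto split: if_splits)
  show "word_dom x (swap_at j z)" unfolding word_dom_def using le key len assms(2) by (auto simp: prefix_count_swap_at)
  show "word_dom (swap_at j x) (swap_at j z)" unfolding word_dom_def using le key len assms(2) by (auto simp: prefix_count_swap_at)
qed

lemma swap_at_less: "Suc j < length z \<Longrightarrow> z ! j < z ! Suc j \<Longrightarrow> z < swap_at j z"
  by (induction j z rule: swap_at.induct) auto

text \<open>At an ascent the leading word moves up to \<open>swap_at j z\<close> with its
  coefficient unchanged: the diagonal term of \<open>T q j\<close> involves
  \<open>v (swap_at j z)\<close>, which is 0 because that word is lexicographically above
  \<open>z\<close>.\<close>

lemma T_lead:
  assumes "\<And>x. v x \<noteq> 0 \<Longrightarrow> word_dom x z" "Suc j < length z" "z ! j < z ! Suc j"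
  shows "T q j v x \<noteq> 0 \<Longrightarrow> word_dom x (swap_at j z)" "T q j v (swap_at j z) = v z"
proof -
  show "word_dom x (swap_at j z)" if "T q j v x \<noteq> 0"
  proof -
    have "Suc j < length x" using that T_short by metis
    then have "v x \<noteq> 0 \<or> v (swap_at j x) \<noteq> 0" using that by (auto simp: T_nth split: if_splits)
    then show ?thesis using assms(1)[of x] assms(1)[of "swap_at j x"] word_dom_swap_at[of _ z j] assms(2,3)
      by (metis swap_at_swap_at)
  qed
  have "v (swap_at j z) = 0" using assms(1)[of "swap_at j z"] word_dom_imp_le[of "swap_at j z" z] swap_at_less[OF assms(2,3)] by (meson leD)
  then show "T q j v (swap_at j z) = v z" using assms(2,3) by (auto simp: T_nth swap_at_nth)
qed

section \<open>Lattice words and standard tableaux\<close>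

text \<open>The Yamanouchi condition, read from the right end of the word.\<close>

definition lattice_word :: "nat list \<Rightarrow> bool" where
  "lattice_word s \<longleftrightarrow> (\<forall>p i. count_list (drop p s) (Suc i) \<le> count_list (drop p s) i)"

lemma lattice_word_mono: "lattice_word s \<Longrightarrow> i \<le> k \<Longrightarrow> count_list (drop p s) k \<le> count_list (drop p s) i"
proof (induction k)
  case (Suc k)
  then show ?case by (cases "i = Suc k") (auto simp: lattice_word_def intro: le_trans)
qed simp

lemma drop_swap_at:
  "Suc j < length s \<Longrightarrow> drop p (swap_at j s) = (if p \<le> j then swap_at (j - p) (drop p s)
     else if p = Suc j then s ! j # drop (Suc (Suc j)) s else drop p s)"
proof (induction j s arbitrary: p rule: swap_at.induct)
  case (1 c d w) then show ?case by (cases p; cases "p - 1") auto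
next
  case (2 j c w) then show ?case by (cases p) auto
qed auto

lemma count_list_mset: "count_list xs x = count (mset xs) x"
  by (simp add: count_mset)

text \<open>The box filled by position \<open>p\<close>: its column is the number of equal letters
  to the right, its row is the letter. Reading a lattice word from right to left builds a standard
  tableau.\<close>

definition cell :: "nat list \<Rightarrow> nat \<Rightarrow> nat \<times> nat" where
  "cell s p = (count_list (drop (Suc p) s) (s ! p), s ! p)"

lemma cell_fst_less: "p < length s \<Longrightarrow> fst (cell s p) < count (mset s) (s ! p)"
proof -
  assume p: "p < length s"
  have "count_list s (s ! p) = count_list (take p s) (s ! p) + count_list (drop p s) (s ! p)"
    by (metis append_take_drop_id count_list_append)
  then show ?thesis using p by (simp add: cell_def Cons_nth_drop_Suc[symmetric] count_mset)
qed

text \<open>In the wrong order the two cells cannot belong to an ascent or to equal letters, by the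
  lattice condition. At the resulting descent the columns differ strictly, which is just what keeps
  the suffix starting with the moved letter lattice when the letters are consecutive.\<close>

lemma lattice_descent:
  assumes "lattice_word s" "Suc j < length s" "\<not> cell s (Suc j) < cell s j"
  shows "s ! Suc j < s ! j \<and> lattice_word (swap_at j s)"
proof -
  let ?a = "s ! j" and ?b = "s ! Suc j" and ?r = "drop (Suc (Suc j)) s"
  have d1: "drop (Suc j) s = ?b # ?r" using assms(2) by (simp add: Cons_nth_drop_Suc)
  have d0: "drop j s = ?a # ?b # ?r" using assms(2) d1 by (metis Cons_nth_drop_Suc Suc_lessD)
  have cj: "cell s j = (count_list (?b # ?r) ?a, ?a)" "cell s (Suc j) = (count_list ?r ?b, ?b)"
    using d1 by (simp_all add: cell_def)
  have n: "\<not> (count_list ?r ?b, ?b) < (count_list (?b # ?r) ?a, ?a)" using assms(3) cj by simp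
  have ab: "?b < ?a"
  proof (rule ccontr)
    assume "\<not> ?b < ?a"
    then have "count_list (?b # ?r) ?b \<le> count_list (?b # ?r) ?a"
      using lattice_word_mono[OF assms(1), of ?a ?b "Suc j"] d1 by simp
    then show False using n by (auto simp: less_prod_def split: if_splits)
  qed
  then have less: "count_list ?r ?a < count_list ?r ?b"
    using n by (auto simp: less_prod_def split: if_splits)
  have "count_list (?a # ?r) (Suc i) \<le> count_list (?a # ?r) i" for i
  proof (cases "Suc i = ?a")
    case True
    show ?thesis
    proof (cases "?b = i")
      case True then show ?thesis using less \<open>Suc i = ?a\<close> by auto
    next
      case False
      have "count_list (drop j s) (Suc i) \<le> count_list (drop j s) i" using assms(1) by (auto simp: lattice_word_def)
      then show ?thesis unfolding d0 using False True ab by auto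
    qed
  next
    case False
    have "count_list ?r (Suc i) \<le> count_list ?r i" using assms(1) by (auto simp: lattice_word_def)
    then show ?thesis using False by auto
  qed
  moreover have "count_list (swap_at k x) i = count_list x i" for k i and x :: "nat list"
    unfolding count_list_mset by simp
  ultimately have "lattice_word (swap_at j s)"
    using assms(1,2) unfolding lattice_word_def by (auto simp: drop_swap_at)
  then show ?thesis using ab by blast
qed

section \<open>Highest weight vectors\<close>

lemma list_less_append:
  fixes p p' :: "nat list"
  shows "length p = length p' \<Longrightarrow> p < p' \<Longrightarrow> p @ a < p' @ b"
proof (induction p arbitrary: p')
  case (Cons c p) then show ?case by (cases p') auto
qed simp

lemma E_alg:
  assumes "q \<noteq> 0"
  shows "D \<in> alg q J \<Longrightarrow> E q i w k (D v) = D (\<lambda>x. E q i x k v) w"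
proof (induction arbitrary: w rule: alg.induct)
  case (alg_T D j) then show ?case using E_T[OF assms, of i w k j "D v"] by simp
next
  case (alg_add D D') then show ?case by (simp add: plus_fun_def E_add)
next
  case (alg_scl D c) then show ?case by (simp add: scl_def E_scale)
qed simp

text \<open>Gaussian elimination: subtracting the matching \<open>e\<close> lowers the leading
  position. The values lie in an abstract group because the lemma serves both for scalar vectors and
  for matrices given as families of rows.\<close>

lemma triangular:
  fixes \<K> \<D> :: "('w::linorder \<Rightarrow> 'a::ab_group_add) set"
  assumes fin: "finite S" and supp: "\<And>f x. f \<in> \<K> \<Longrightarrow> f x \<noteq> 0 \<Longrightarrow> x \<in> S"
    and diff: "\<And>f g. f \<in> \<K> \<Longrightarrow> g \<in> \<K> \<Longrightarrow> (\<lambda>x. f x - g x) \<in> \<K>"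
    and zero: "(\<lambda>x. 0) \<in> \<D>" and add: "\<And>f g. f \<in> \<D> \<Longrightarrow> g \<in> \<D> \<Longrightarrow> (\<lambda>x. f x + g x) \<in> \<D>"
    and lead: "\<And>f w. f \<in> \<K> \<Longrightarrow> f w \<noteq> 0 \<Longrightarrow> (\<And>x. w < x \<Longrightarrow> f x = 0) \<Longrightarrow>
       \<exists>e\<in>\<D> \<inter> \<K>. e w = f w \<and> (\<forall>x>w. e x = 0)"
  shows "\<K> \<subseteq> \<D>"
proof
  fix f assume "f \<in> \<K>"
  then show "f \<in> \<D>"
  \<comment> \<open>The measure counts the positions up to the leading one; it is 0 for the zero
    function.\<close>
  proof (induction "card {x \<in> S. \<exists>y. f y \<noteq> 0 \<and> x \<le> y}" arbitrary: f rule: less_induct)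
    case less
    show ?case
    proof (cases "\<exists>x. f x \<noteq> 0")
      case False
      then have "f = (\<lambda>x. 0)" by auto
      then show ?thesis using zero by simp
    next
      case True
      define w where "w = Max {x. f x \<noteq> 0}"
      have sub: "{x. f x \<noteq> 0} \<subseteq> S" using supp less.prems by blast
      then have finf: "finite {x. f x \<noteq> 0}" using fin finite_subset by blast
      have w: "f w \<noteq> 0" using Max_in[OF finf] True unfolding w_def by auto
      have gt: "f x = 0" if "w < x" for x
        using Max_ge[OF finf, of x] that unfolding w_def by (metis leD mem_Collect_eq)
      obtain e where e: "e \<in> \<D>" "e \<in> \<K>" "e w = f w" "\<And>x. w < x \<Longrightarrow> e x = 0"
        using lead[OF less.prems w gt] by auto
      let ?g = "\<lambda>x. f x - e x"
      have g: "y < w" if "?g y \<noteq> 0" for y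
        using that gt[of y] e(3) e(4)[of y] by (metis diff_self linorder_cases)
      have "{x \<in> S. \<exists>y. ?g y \<noteq> 0 \<and> x \<le> y} \<subset> {x \<in> S. \<exists>y. f y \<noteq> 0 \<and> x \<le> y}"
      proof
        show "{x \<in> S. \<exists>y. ?g y \<noteq> 0 \<and> x \<le> y} \<subseteq> {x \<in> S. \<exists>y. f y \<noteq> 0 \<and> x \<le> y}"
        proof (clarify, intro conjI exI)
          fix x y assume "f y - e y \<noteq> 0" "x \<le> y"
          then show "x \<le> w" using g[of y] by simp
        qed (use w in auto)
        have "w \<notin> {x \<in> S. \<exists>y. ?g y \<noteq> 0 \<and> x \<le> y}" using g by (auto dest: leD)
        moreover have "w \<in> {x \<in> S. \<exists>y. f y \<noteq> 0 \<and> x \<le> y}" using w sub by auto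
        ultimately show "{x \<in> S. \<exists>y. ?g y \<noteq> 0 \<and> x \<le> y} \<noteq> {x \<in> S. \<exists>y. f y \<noteq> 0 \<and> x \<le> y}" by blast
      qed
      then have "card {x \<in> S. \<exists>y. ?g y \<noteq> 0 \<and> x \<le> y} < card {x \<in> S. \<exists>y. f y \<noteq> 0 \<and> x \<le> y}"
        using fin by (intro psubset_card_mono) auto
      then have "?g \<in> \<D>" using less.hyps[of ?g] diff[OF less.prems e(2)] by blast
      from add[OF this e(1)] show ?thesis by simp
    qed
  qed
qed

locale lattice_content =
  fixes \<alpha> :: "nat multiset" and q :: "'f::field"
  assumes anti: "\<And>i. count \<alpha> (Suc i) \<le> count \<alpha> i" and q0: "q \<noteq> 0"
begin

abbreviation n where "n \<equiv> size \<alpha>"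
abbreviation \<A> where "\<A> \<equiv> alg q {j. Suc j < n}"

lemma anti_le: "i \<le> k \<Longrightarrow> count \<alpha> k \<le> count \<alpha> i"
  by (rule lift_Suc_antimono_le[of "count \<alpha>"]) (use anti in auto)

text \<open>The cells of the Young diagram in decreasing lexicographic order; the reading word lists their
  letters, and a block consists of the positions with the same first coordinate.\<close>

definition cells :: "(nat \<times> nat) set" where "cells = {(k, i). k < count \<alpha> i}"
definition cell_list where "cell_list = rev (sorted_list_of_set cells)"
definition reading_word where "reading_word = map snd cell_list"
definition block_of where "block_of p = fst (cell_list ! p)"

lemma cells_image: "cells = (\<lambda>(i, k). (k, i)) ` (SIGMA i:set_mset \<alpha>. {..<count \<alpha> i})"
proof (intro equalityI subsetI)
  fix x assume "x \<in> cells"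
  then obtain k i where x: "x = (k, i)" "k < count \<alpha> i" unfolding cells_def by auto
  then have "i \<in># \<alpha>" by (metis count_greater_zero_iff gr_implies_not0 gr0I)
  then show "x \<in> (\<lambda>(i, k). (k, i)) ` (SIGMA i:set_mset \<alpha>. {..<count \<alpha> i})" using x by (force simp: image_iff)
qed (auto simp: cells_def)

lemma finite_cells: "finite cells"
  unfolding cells_image by (intro finite_imageI finite_SigmaI) auto

lemma card_cells: "card cells = n"
proof -
  have "card cells = card (SIGMA i:set_mset \<alpha>. {..<count \<alpha> i})"
    unfolding cells_image by (rule card_image) (auto simp: inj_on_def)
  then show ?thesis by (simp add: size_multiset_overloaded_eq)
qed

lemma set_cell_list: "set cell_list = cells" and length_cell_list: "length cell_list = n" and distinct_cell_list: "distinct cell_list"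
  using finite_cells card_cells by (simp_all add: cell_list_def)

lemma cell_list_desc: "i < j \<Longrightarrow> j < n \<Longrightarrow> cell_list ! j < cell_list ! i"
proof -
  have "sorted_wrt (\<lambda>x y. y < x) cell_list"
    unfolding cell_list_def sorted_wrt_rev by (simp add: strict_sorted_list_of_set)
  then show "i < j \<Longrightarrow> j < n \<Longrightarrow> cell_list ! j < cell_list ! i"
    using sorted_wrt_nth_less[of "\<lambda>x y. y < x" cell_list i j] length_cell_list by simp
qed

lemma cell_list_unique:
  assumes "length L = n" "set L \<subseteq> cells" "\<And>j. Suc j < n \<Longrightarrow> L ! Suc j < L ! j"
  shows "L = cell_list"
proof -
  have "sorted_wrt (\<lambda>x y. y < x) L"
    by (subst sorted_wrt_iff_nth_Suc_transp) (use assms in \<open>auto simp: transp_def\<close>)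
  then have s: "sorted_wrt (<) (rev L)" by (simp add: sorted_wrt_rev)
  then have "distinct (rev L)" using strict_sorted_iff by blast
  then have "card (set L) = n" using assms(1) distinct_card[of L] by simp
  then have "set L = cells" using assms(2) finite_cells card_cells by (intro card_subset_eq) auto
  then have "sorted_list_of_set cells = rev L"
    using sorted_list_of_set_unique[OF finite_cells, of "rev L"] s assms(1) card_cells by simp
  then show ?thesis unfolding cell_list_def by simp
qed

lemma length_reading_word: "length reading_word = n" by (simp add: reading_word_def length_cell_list)

lemma mset_reading_word: "mset reading_word = \<alpha>"
proof (rule multiset_eqI)
  fix i
  have "mset cell_list = mset_set cells" using mset_set_set[OF distinct_cell_list] set_cell_list by simp
  then have "count (mset reading_word) i = card (snd -` {i} \<inter> cells)"
    unfolding reading_word_def using finite_cells by (simp add: count_image_mset)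
  also have "snd -` {i} \<inter> cells = {..<count \<alpha> i} \<times> {i}" by (auto simp: cells_def)
  finally show "count (mset reading_word) i = count \<alpha> i" by simp
qed

text \<open>The cells of any word of content \<open>\<alpha>\<close> lie in the diagram. There are
  \<open>n\<close> of them, so in strictly decreasing order they exhaust it in the order of
  \<open>cell_list\<close>.\<close>

lemma lattice_eq_reading_word:
  assumes "mset s = \<alpha>" "\<And>j. Suc j < n \<Longrightarrow> cell s (Suc j) < cell s j"
  shows "s = reading_word"
proof -
  have len: "length s = n" using assms by auto
  have "map (cell s) [0..<n] = cell_list"
  proof (rule cell_list_unique)
    show "set (map (cell s) [0..<n]) \<subseteq> cells"
    proof
      fix x assume "x \<in> set (map (cell s) [0..<n])"
      then obtain p where "p < n" "x = cell s p" by auto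
      then show "x \<in> cells" using cell_fst_less[of p s] len assms(1) by (auto simp: cells_def cell_def)
    qed
  qed (use assms in auto)
  then have "reading_word = map snd (map (cell s) [0..<n])" unfolding reading_word_def by simp
  also have "\<dots> = s" using len by (auto simp: cell_def intro!: nth_equalityI)
  finally show ?thesis by simp
qed

text \<open>A lattice word other than \<open>reading_word\<close> has two neighbouring cells in the
  wrong order; exchanging them gives a lattice word with fewer inversions, and \<open>T_lead\<close>
  leads back. Only the leading word of \<open>l\<close> matters here.\<close>

lemma lead_reach:
  assumes l: "l reading_word \<noteq> 0" "\<And>x. l x \<noteq> 0 \<Longrightarrow> word_dom x reading_word"
  shows "lattice_word s \<Longrightarrow> mset s = \<alpha> \<Longrightarrow> \<exists>D\<in>\<A>. D l s \<noteq> 0 \<and> (\<forall>x. D l x \<noteq> 0 \<longrightarrow> word_dom x s)"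
proof (induction "inv_count s" arbitrary: s rule: less_induct)
  case less
  show ?case
  proof (cases "s = reading_word")
    case True
    then show ?thesis using l by (intro bexI[of _ "\<lambda>v. v"]) (auto intro: alg.intros)
  next
    case False
    have len: "length s = n" using less.prems by auto
    obtain j where j: "Suc j < n" "\<not> cell s (Suc j) < cell s j" using lattice_eq_reading_word less.prems(2) False by blast
    then have d: "s ! Suc j < s ! j" "lattice_word (swap_at j s)" using lattice_descent[of s j] less.prems len by auto
    have "inv_count (swap_at j s) < inv_count s" using inv_count_swap_at_descent[of j s] j d len by simp
    then obtain D where D: "D \<in> \<A>" "D l (swap_at j s) \<noteq> 0" "\<And>x. D l x \<noteq> 0 \<Longrightarrow> word_dom x (swap_at j s)"
      using less.hyps[of "swap_at j s"] d less.prems by auto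
    have *: "Suc j < length (swap_at j s)" "swap_at j s ! j < swap_at j s ! Suc j" using j d len by (auto simp: swap_at_nth)
    show ?thesis
      using T_lead(1)[OF D(3) *] T_lead(2)[where q = q, OF D(3) *] D(1,2) j by (intro bexI[of _ "\<lambda>v. T q j (D v)"]) (auto intro: alg.intros)
  qed
qed

text \<open>All divided powers are imposed, since at roots of unity or in positive characteristic
  the first power does not control the others. Classically this is a Specht module as described by
  the kernel intersection theorem.\<close>

definition K where "K = {v \<in> weight_space \<alpha>. \<forall>i k w. 1 \<le> k \<longrightarrow> E q i w k v = 0}"

lemma K_weight_space: "v \<in> K \<Longrightarrow> v \<in> weight_space \<alpha>" by (simp add: K_def)

lemma K_diff: "u \<in> K \<Longrightarrow> v \<in> K \<Longrightarrow> u - v \<in> K"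
  using E_lin[of q _ _ _ 1 u "- 1" v] using weight_space_diff[of u \<alpha> v] by (auto simp: K_def fun_diff_def)

lemma K_alg: "v \<in> K \<Longrightarrow> D \<in> \<A> \<Longrightarrow> D v \<in> K"
  unfolding K_def
proof (safe)
  fix i k :: nat and w assume v: "v \<in> weight_space \<alpha>" "\<forall>i k w. 1 \<le> k \<longrightarrow> E q i w k v = 0" and D: "D \<in> \<A>" and k: "1 \<le> k"
  have "(\<lambda>x. E q i x k v) = 0" using v k by (auto simp: zero_fun_def)
  then show "E q i w k (D v) = 0" using E_alg[OF q0 D, of i w k v] wlinD(4)[OF alg_weight_linear[OF D]] by (simp add: fun_apply_simps)
qed (rule alg_weight_space)

text \<open>Freeze the prefix of the maximal word, which \<open>E_prefix\<close> permits by
  maximality. A suffix with more letters \<open>i + 1\<close> than \<open>i\<close> would carry a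
  vector of negative weight killed by all divided powers with \<open>k \<ge> 1\<close>; by
  \<open>E_highest_weight_zero\<close> with excess 1 that vector is zero, contrary to
  \<open>v w \<noteq> 0\<close>.\<close>

lemma K_lead:
  assumes v: "v \<in> K" "v w \<noteq> 0" and max: "\<And>x. w < x \<Longrightarrow> v x = 0"
  shows "mset w = \<alpha>" "lattice_word w"
proof -
  show mw: "mset w = \<alpha>" using v unfolding K_def weight_space_def by blast
  show "lattice_word w" unfolding lattice_word_def
  proof (intro allI, rule ccontr)
    fix p i assume c: "\<not> count_list (drop p w) (Suc i) \<le> count_list (drop p w) i"
    let ?P = "take p w" and ?t = "drop p w"
    have "v (?P @ ?t) = 0"
    proof (rule E_highest_weight_zero[OF q0, where i = i and r = 1 and N = "length ?t" and v = "\<lambda>x. v (?P @ x)"])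
      fix x assume "v (?P @ x) \<noteq> 0"
      then have "mset (?P @ x) = mset (?P @ ?t)" using v mw unfolding K_def weight_space_def by (metis (mono_tags, lifting) append_take_drop_id mem_Collect_eq)
      then have "mset ?P + mset x = mset ?P + mset ?t" by (simp only: mset_append)
      then have "mset x = mset ?t" by (rule add_left_imp_eq)
      then show "count_list x i + 1 \<le> count_list x (Suc i)" using c by (metis Suc_eq_plus1 count_list_mset not_less_eq_eq)
    next
      fix k :: nat and u :: "nat list" assume "1 \<le> k" "length u = length ?t"
      have "\<exists>c. c \<noteq> 0 \<and> E q i (?P @ u) k v = c * E q i u k (\<lambda>x. v (?P @ x))"
      proof (rule E_prefix[OF q0])
        fix p' u' :: "nat list" assume "length p' = length ?P" "?P < p'"
        then have "w < p' @ u'" using list_less_append[of ?P p' ?t u'] by simp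
        then show "v (p' @ u') = 0" by (rule max)
      qed
      then show "E q i u k (\<lambda>x. v (?P @ x)) = 0" using v(1) \<open>1 \<le> k\<close> unfolding K_def by auto
    qed simp
    then show False using v(2) by simp
  qed
qed

text \<open>Leading words in \<open>K\<close> are lattice words, and \<open>lead_reach\<close>
  provides for each of them a vector \<open>D l\<close> with this leading word; elimination then
  exhausts \<open>K\<close>.\<close>

lemma K_generated:
  assumes l: "l \<in> K" "l reading_word \<noteq> 0" "\<And>x. l x \<noteq> 0 \<Longrightarrow> word_dom x reading_word" and v: "v \<in> K"
  shows "\<exists>D\<in>\<A>. v = D l"
proof -
  have "K \<subseteq> (\<lambda>D. D l) ` \<A>"
  proof (rule triangular[OF finite_words[of \<alpha>]])
    show "x \<in> {w. mset w = \<alpha>}" if "f \<in> K" "f x \<noteq> 0" for f x using that unfolding K_def weight_space_def by blast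
    show "(\<lambda>x. f x - g x) \<in> K" if "f \<in> K" "g \<in> K" for f g using K_diff[OF that] by (simp add: fun_diff_def)
    show "(\<lambda>x. 0) \<in> (\<lambda>D. D l) ` \<A>" using imageI[OF alg_zero, where f = "\<lambda>D. D l"] by (simp add: zero_fun_def)
    show "(\<lambda>x. f x + g x) \<in> (\<lambda>D. D l) ` \<A>" if "f \<in> (\<lambda>D. D l) ` \<A>" "g \<in> (\<lambda>D. D l) ` \<A>" for f g
    proof -
      from that obtain D D' where "D \<in> \<A>" "D' \<in> \<A>" "f = D l" "g = D' l" by blast
      then show ?thesis using imageI[OF alg_add[of D q _ D'], where f = "\<lambda>D. D l"] by (simp add: plus_fun_def)
    qed
  next
    fix f w assume f: "f \<in> K" "f w \<noteq> 0" "\<And>x. w < x \<Longrightarrow> f x = 0"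
    obtain D where D: "D \<in> \<A>" "D l w \<noteq> 0" "\<And>x. D l x \<noteq> 0 \<Longrightarrow> word_dom x w"
      using lead_reach[of l w] l K_lead[OF f] by auto
    let ?D = "\<lambda>v. scl (f w / D l w) (D v)"
    have "?D \<in> \<A>" using D(1) by (rule alg.intros)
    moreover have "D l x = 0" if "w < x" for x using D(3)[of x] word_dom_imp_le[of x w] that by (meson leD)
    ultimately show "\<exists>e\<in>(\<lambda>D. D l) ` \<A> \<inter> K. e w = f w \<and> (\<forall>x>w. e x = 0)"
      using D(2) K_alg[OF l(1), of ?D] by (intro bexI[of _ "?D l"]) (auto simp: fun_apply_simps)
  qed
  then show ?thesis using v by blast
qed

end

section \<open>The block antisymmetriser\<close>

lemma T_minus: "T q j (u - v) = T q j u - T q j v"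
  using T_add[of q j u "scl (- 1) v"] T_scl[of q j "- 1" v] by (simp add: scl_minus)

text \<open>This is \<open>- q T\<^sub>j\<^sup>-\<^sup>1\<close>, which satisfies the same relations as \<open>T\<^sub>j\<close>.\<close>

definition S :: "'f::field \<Rightarrow> nat \<Rightarrow> (nat list \<Rightarrow> 'f) \<Rightarrow> nat list \<Rightarrow> 'f" where
  "S q j v = scl (q - 1) v - T q j v"

lemma T_quad_length:
  assumes "\<And>w. length w \<noteq> n \<Longrightarrow> u w = 0" "Suc j < n"
  shows "T q j (T q j u) = scl (q - 1) (T q j u) + scl q u"
proof
  fix w
  show "T q j (T q j u) w = (scl (q - 1) (T q j u) + scl q u) w"
  proof (cases "length w = n")
    case True then show ?thesis using assms by (simp add: fun_apply_simps T_quad)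
  next
    case False
    then have "u w = 0" "u (swap_at j w) = 0" using assms by simp_all
    then show ?thesis by (cases "Suc j < length w") (simp_all add: fun_apply_simps T_nth T_short)
  qed
qed

text \<open>After expansion the two sides differ by \<open>q - 1\<close> times a difference of two
  quadratic relations. These fail on words too short for the operators, hence the condition on the
  support of \<open>u\<close>.\<close>

lemma S_braid:
  assumes "\<And>w. length w \<noteq> n \<Longrightarrow> u w = 0" "Suc (Suc j) < n"
  shows "S q j (S q (Suc j) (S q j u)) = S q (Suc j) (S q j (S q (Suc j) u))"
proof
  fix w
  have a: "T q j (T q j u) w = (q - 1) * T q j u w + q * u w"
    "T q (Suc j) (T q (Suc j) u) w = (q - 1) * T q (Suc j) u w + q * u w"
    using T_quad_length[of n u j q] T_quad_length[of n u "Suc j" q] assms by (simp_all add: fun_apply_simps)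
  show "S q j (S q (Suc j) (S q j u)) w = S q (Suc j) (S q j (S q (Suc j) u)) w"
    unfolding S_def by (simp add: fun_apply_simps T_minus T_scl T_braid a) (simp add: algebra_simps)
qed

lemma S_comm: "Suc j < k \<Longrightarrow> S q j (S q k u) = S q k (S q j u)"
  unfolding S_def by (rule ext) (simp add: fun_apply_simps T_minus T_scl T_comm[of j k] algebra_simps)

lemma S_length:
  assumes "\<And>w. length w \<noteq> n \<Longrightarrow> u w = 0" "length w \<noteq> n"
  shows "S q j u w = 0"
proof -
  have "u w = 0" "u (swap_at j w) = 0" using assms by simp_all
  then show ?thesis unfolding S_def by (cases "Suc j < length w") (simp_all add: fun_apply_simps T_nth T_short)
qed

text \<open>Takes the place of the identity, which does not belong to the operators with values
  supported on length \<open>n\<close>.\<close>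

definition restrict_len :: "nat \<Rightarrow> (nat list \<Rightarrow> 'f::field) \<Rightarrow> nat list \<Rightarrow> 'f" where
  "restrict_len n v = (\<lambda>w. if length w = n then v w else 0)"

lemma restrict_len_weight_space: "v \<in> weight_space \<beta> \<Longrightarrow> size \<beta> = n \<Longrightarrow> restrict_len n v = v"
  by (rule ext) (auto simp: restrict_len_def weight_space_def)

lemma S_alg: "D \<in> alg q J \<Longrightarrow> j \<in> J \<Longrightarrow> (\<lambda>v. S q j (D v)) \<in> alg q J"
  unfolding S_def by (rule alg_diff) (auto intro: alg.intros)

text \<open>At a descent \<open>S\<close> yields a single word where \<open>T\<close> yields two.
  This is the reason for building the antisymmetriser from \<open>S\<close> and applying it to a
  word that decreases in every block.\<close>

lemma S_word_vec_descent:
  assumes "Suc j < length w" "w ! Suc j < w ! j"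
  shows "S q j (word_vec w) = scl (- q) (word_vec (swap_at j w))"
  unfolding S_def T_word_vec(3)[OF assms] by (auto simp: fun_apply_simps fun_eq_iff)

lemma alg_supp:
  assumes "D \<in> alg q J" "\<And>w j. w \<in> W \<Longrightarrow> j \<in> J \<Longrightarrow> swap_at j w \<in> W" "\<And>w. v w \<noteq> 0 \<Longrightarrow> w \<in> W" "D v w \<noteq> 0"
  shows "w \<in> W"
  using assms(1,4)
proof (induction arbitrary: w rule: alg.induct)
  case alg_id then show ?case using assms(3) by simp
next
  case (alg_T D j)
  have "Suc j < length w" using alg_T.prems T_short by metis
  then have "D v w \<noteq> 0 \<or> D v (swap_at j w) \<noteq> 0" using alg_T.prems by (auto simp: T_nth split: if_splits)
  then show ?case using alg_T.IH assms(2)[of "swap_at j w" j] alg_T.hyps by auto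
next
  case (alg_add D D')
  then have "D v w \<noteq> 0 \<or> D' v w \<noteq> 0" by (auto simp: fun_apply_simps)
  then show ?case using alg_add.IH by blast
next
  case (alg_scl D c) then show ?case by (auto simp: fun_apply_simps)
qed

context lattice_content
begin

definition block_pos where "block_pos = {j. Suc j < n \<and> block_of j = block_of (Suc j)}"
text \<open>The Young subgroup of permutations preserving the blocks, in one-line notation.\<close>

definition X where "X = {x. mset x = mset [0..<n] \<and> (\<forall>p<n. block_of (x ! p) = block_of p)}"

lemma block_pos_sub: "block_pos \<subseteq> {j. Suc j < n}" by (auto simp: block_pos_def)

lemma block_of_antitone: "i \<le> j \<Longrightarrow> j < n \<Longrightarrow> block_of j \<le> block_of i"
  using cell_list_desc[of i j] by (cases "i = j") (auto simp: block_of_def less_prod_def)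

lemma reading_word_nth: "p < n \<Longrightarrow> reading_word ! p = snd (cell_list ! p)"
  by (simp add: reading_word_def length_cell_list)

lemma reading_word_block_desc: "i < j \<Longrightarrow> j < n \<Longrightarrow> block_of i = block_of j \<Longrightarrow> reading_word ! j < reading_word ! i"
  using cell_list_desc[of i j] by (auto simp: block_of_def less_prod_def reading_word_nth)

lemma X_perm: "x \<in> X \<Longrightarrow> length x = n \<and> set x = {..<n} \<and> distinct x"
proof -
  assume "x \<in> X"
  then have m: "mset x = mset [0..<n]" by (simp add: X_def)
  have "length x = n" using mset_eq_length[OF m] by (metis length_upt minus_nat.diff_0)
  moreover have "set x = {..<n}" using mset_eq_setD[OF m] by (metis atLeast_upt)
  moreover have "distinct x" using mset_eq_imp_distinct_iff[OF m] by (metis distinct_upt)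
  ultimately show ?thesis by blast
qed

lemma X_swap_at: "x \<in> X \<Longrightarrow> j \<in> block_pos \<Longrightarrow> swap_at j x \<in> X"
  using X_perm[of x] by (auto simp: X_def block_pos_def swap_at_nth)

lemma X_finite: "finite X"
  by (rule finite_subset[OF _ finite_words[of "mset [0..<n]"]]) (auto simp: X_def)

lemma X_id: "[0..<n] \<in> X" by (simp add: X_def)

text \<open>Block numbers decrease weakly along the positions, so an ascent exchanged on the way to
  an element of \<open>X\<close> lies inside a block. Hence inductions along ascents stay in
  \<open>X\<close>.\<close>

lemma X_step:
  assumes "swap_at j x \<in> X" "mset x = mset [0..<n]" "Suc j < n" "x ! j < x ! Suc j"
  shows "j \<in> block_pos" "x \<in> X"
proof -
  have len: "length x = n" using mset_eq_length[OF assms(2)] by simp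
  have lt: "x ! Suc j < n" using mset_eq_setD[OF assms(2)] nth_mem[of "Suc j" x] len assms(3) by auto
  have b: "block_of (x ! Suc j) = block_of j" "block_of (x ! j) = block_of (Suc j)"
  proof -
    have all: "\<And>p. p < n \<Longrightarrow> block_of (swap_at j x ! p) = block_of p" using assms(1) unfolding X_def by blast
    show "block_of (x ! Suc j) = block_of j" "block_of (x ! j) = block_of (Suc j)"
      using all[of j] all[of "Suc j"] assms(3) len by (simp_all add: swap_at_nth)
  qed
  have "block_of (Suc j) \<le> block_of j" using block_of_antitone[of j "Suc j"] assms(3) by simp
  moreover have "block_of j \<le> block_of (Suc j)" using block_of_antitone[of "x ! j" "x ! Suc j"] assms(4) b lt by simp
  ultimately show "j \<in> block_pos" using assms(3) by (simp add: block_pos_def)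
  then have "swap_at j (swap_at j x) \<in> X" using X_swap_at assms(1) by blast
  then show "x \<in> X" by simp
qed

text \<open>Block and letter together determine the cell, and the cells are distinct.\<close>

lemma X_nonid: "x \<in> X \<Longrightarrow> map ((!) reading_word) x = reading_word \<Longrightarrow> x = [0..<n]"
proof (rule nth_equalityI)
  assume x: "x \<in> X" "map ((!) reading_word) x = reading_word"
  note p = X_perm[OF x(1)]
  then show "length x = length [0..<n]" by simp
  fix i assume i: "i < length x"
  have xi: "x ! i < n" using p i nth_mem[of i x] by auto
  have "reading_word ! (x ! i) = reading_word ! i" using arg_cong[OF x(2), of "\<lambda>l. l ! i"] i by simp
  moreover have "block_of (x ! i) = block_of i" using x(1) i p by (simp add: X_def)
  ultimately have "cell_list ! (x ! i) = cell_list ! i" using xi i p by (simp add: block_of_def reading_word_nth prod_eq_iff)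
  then show "x ! i = [0..<n] ! i" using distinct_cell_list length_cell_list xi i p nth_eq_iff_index_eq by (metis add_0 nth_upt)
qed

text \<open>\<open>Y\<close> sums, over the Young subgroup of the blocks, the products of the
  \<open>S q j\<close> along reduced words. Pairing \<open>x\<close> with \<open>swap_at j x\<close>
  factors out \<open>1 + S q j\<close>, which equals \<open>q - T q j\<close>.\<close>

lemma antisymmetriser:
  obtains Y where "Y \<in> alg q block_pos" "Y (word_vec reading_word) reading_word \<noteq> 0"
    "\<And>j \<beta> v. j \<in> block_pos \<Longrightarrow> size \<beta> = n \<Longrightarrow> v \<in> weight_space \<beta> \<Longrightarrow> \<exists>u\<in>weight_space \<beta>. Y v = scl q u - T q j u"
proof -
  \<comment> \<open>Products along reduced words come from \<open>word_family\<close> for the word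
    \<open>0, ..., n - 1\<close> of distinct letters: its rearrangements are the permutations, and
    with no equal neighbours the eigenvalue map can be the identity.\<close>
  define N where "N = {D :: (nat list \<Rightarrow> 'f) \<Rightarrow> (nat list \<Rightarrow> 'f). \<forall>v w. length w \<noteq> n \<longrightarrow> D v w = 0}"
  interpret braid_action N "\<lambda>j D v. S q j (D v)" "\<lambda>D. D" n
  proof
    fix j x assume "x \<in> N"
    then show "(\<lambda>v. S q j (x v)) \<in> N" unfolding N_def by (auto intro: S_length)
  next
    fix j x assume "x \<in> N" "Suc (Suc j) < n"
    then show "(\<lambda>v. S q j (S q (Suc j) (S q j (x v)))) = (\<lambda>v. S q (Suc j) (S q j (S q (Suc j) (x v))))"
      unfolding N_def by (intro ext fun_cong[OF S_braid]) auto
  qed (auto intro!: ext S_comm)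
  have "\<exists>m. m [0..<n] = restrict_len n \<and>
    (\<forall>w j. mset w = mset [0..<n] \<longrightarrow> Suc j < n \<longrightarrow> w ! j < w ! Suc j \<longrightarrow> (\<lambda>v. S q j (m w v)) = m (swap_at j w))"
    by (rule word_family[of "[0..<n]" "restrict_len n"]) (auto simp: N_def restrict_len_def)
  then obtain m :: "nat list \<Rightarrow> (nat list \<Rightarrow> 'f) \<Rightarrow> nat list \<Rightarrow> 'f" where m: "m [0..<n] = restrict_len n"
    "\<And>w j. mset w = mset [0..<n] \<Longrightarrow> Suc j < n \<Longrightarrow> w ! j < w ! Suc j \<Longrightarrow> (\<lambda>v. S q j (m w v)) = m (swap_at j w)"
    by blast
  have m_step: "S q j (m w v) = m (swap_at j w) v" if "mset w = mset [0..<n]" "Suc j < n" "w ! j < w ! Suc j" for w j v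
    using fun_cong[OF m(2)[OF that]] by simp
  have m_alg: "x \<in> X \<longrightarrow> (\<exists>D\<in>alg q block_pos. \<forall>v. m x v = D (restrict_len n v))" if "mset x = mset [0..<n]" for x
    using that sorted_upt
  proof (induction rule: word_induct)
    case sorted show ?case using m(1) by (intro impI bexI[of _ "\<lambda>v. v"]) (auto intro: alg.intros)
  next
    case (step w j)
    show ?case
    proof
      assume "swap_at j w \<in> X"
      moreover have "Suc j < n" using step mset_eq_length[OF step(1)] by simp
      ultimately have *: "j \<in> block_pos" "w \<in> X" "Suc j < n" using X_step[of j w] step by auto
      then obtain D where D: "D \<in> alg q block_pos" "\<And>v. m w v = D (restrict_len n v)" using step by blast
      show "\<exists>D\<in>alg q block_pos. \<forall>v. m (swap_at j w) v = D (restrict_len n v)"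
        using m_step[OF step(1) *(3) step(3)] D(2) by (intro bexI[OF _ S_alg[OF D(1) *(1)]]) auto
    qed
  qed
  \<comment> \<open>Each product sends \<open>reading_word\<close> to a multiple of one word. Its
    factor is left open: for \<open>x\<close> other than the identity that word differs from
    \<open>reading_word\<close>, so it cannot affect the coefficient wanted.\<close>
  have m_reading_word: "x \<in> X \<longrightarrow> (\<exists>c. m x (word_vec reading_word) = scl c (word_vec (map ((!) reading_word) x)))" if "mset x = mset [0..<n]" for x
    using that sorted_upt
  proof (induction rule: word_induct)
    case sorted
    have "map ((!) reading_word) [0..<n] = reading_word" by (metis length_reading_word map_nth)
    then show ?case using m(1) restrict_len_weight_space[OF weight_space_word_vec[OF mset_reading_word]] by (intro impI exI[of _ 1]) simp
  next
    case (step w j)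
    show ?case
    proof
      assume "swap_at j w \<in> X"
      moreover have len: "length w = n" using mset_eq_length[OF step(1)] by simp
      ultimately have *: "j \<in> block_pos" "w \<in> X" "Suc j < n" using X_step[of j w] step by auto
      then obtain c where c: "m w (word_vec reading_word) = scl c (word_vec (map ((!) reading_word) w))" using step by blast
      have lt: "w ! Suc j < n" using X_perm[OF *(2)] nth_mem[of "Suc j" w] *(3) by auto
      have "block_of (w ! j) = block_of (w ! Suc j)" using * by (auto simp: X_def block_pos_def)
      then have desc: "map ((!) reading_word) w ! Suc j < map ((!) reading_word) w ! j"
        using reading_word_block_desc[OF step(3) lt] len *(3) by simp
      have "S q j (scl c u) = scl c (S q j u)" for u
        by (auto simp: S_def T_scl fun_apply_simps fun_eq_iff algebra_simps)
      then have "m (swap_at j w) (word_vec reading_word) = scl c (scl (- q) (word_vec (swap_at j (map ((!) reading_word) w))))"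
        using m_step[OF step(1) *(3) step(3), symmetric] c S_word_vec_descent[of j "map ((!) reading_word) w" q] desc len *(3) by simp
      then show "\<exists>c. m (swap_at j w) (word_vec reading_word) = scl c (word_vec (map ((!) reading_word) (swap_at j w)))"
        by (auto simp: swap_at_map)
    qed
  qed
  have "\<forall>x. \<exists>D. x \<in> X \<longrightarrow> D \<in> alg q block_pos \<and> (\<forall>v. m x v = D (restrict_len n v))"
    using m_alg unfolding X_def by blast
  then obtain DD where DD: "\<And>x. x \<in> X \<Longrightarrow> DD x \<in> alg q block_pos" "\<And>x v. x \<in> X \<Longrightarrow> m x v = DD x (restrict_len n v)"
    by metis
  \<comment> \<open>\<open>DD x\<close> instead of \<open>m x\<close>, since \<open>m x\<close> cuts
    off the words of other lengths and need not lie in \<open>alg\<close>; on weights of size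
    \<open>n\<close> the two agree.\<close>
  define Y where "Y v = (\<Sum>x\<in>X. DD x v)" for v
  have Y_alg: "Y \<in> alg q block_pos" unfolding Y_def[abs_def] by (rule alg_sum) (rule DD)
  have Y_m: "Y v = (\<Sum>x\<in>X. m x v)" if "v \<in> weight_space \<beta>" "size \<beta> = n" for v \<beta>
    unfolding Y_def using DD(2) restrict_len_weight_space[OF that] by simp
  have "Y (word_vec reading_word) reading_word = (\<Sum>x\<in>X. if x = [0..<n] then 1 else 0)"
    unfolding Y_m[OF weight_space_word_vec[OF mset_reading_word] refl] sum_fun_apply
  proof (rule sum.cong)
    fix x assume x: "x \<in> X"
    show "m x (word_vec reading_word) reading_word = (if x = [0..<n] then 1 else 0)"
    proof (cases "x = [0..<n]")
      case True
      then have "m x (word_vec reading_word) = word_vec reading_word" using m(1) restrict_len_weight_space[OF weight_space_word_vec[OF mset_reading_word] refl] by simp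
      then show ?thesis using True by (simp add: word_vec_def)
    next
      case False
      obtain c where "m x (word_vec reading_word) = scl c (word_vec (map ((!) reading_word) x))" using m_reading_word x unfolding X_def by blast
      then show ?thesis using X_nonid[OF x] False by (auto simp: fun_apply_simps word_vec_def)
    qed
  qed simp
  then have Y_reading_word: "Y (word_vec reading_word) reading_word \<noteq> 0" using X_finite X_id by simp
  have Y_div: "\<exists>u\<in>weight_space \<beta>. Y v = scl q u - T q j u" if j: "j \<in> block_pos" and \<beta>: "size \<beta> = n" and v: "v \<in> weight_space \<beta>" for j \<beta> v
  proof (intro bexI)
    define A where "A = {x \<in> X. x ! j < x ! Suc j}"
    define B where "B = {x \<in> X. x ! Suc j < x ! j}"
    let ?u = "\<Sum>x\<in>A. m x v"
    have jn: "Suc j < n" using j by (simp add: block_pos_def)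
    have fin: "finite A" "finite B" using X_finite by (simp_all add: A_def B_def)
    have XAB: "X = A \<union> B"
    proof -
      have "x ! j \<noteq> x ! Suc j" if "x \<in> X" for x using X_perm[OF that] jn by (simp add: nth_eq_iff_index_eq)
      then show ?thesis unfolding A_def B_def by (auto simp: neq_iff)
    qed
    have disj: "A \<inter> B = {}" unfolding A_def B_def by auto
    have bij: "bij_betw (swap_at j) A B"
    proof -
      have "swap_at j x \<in> X \<and> swap_at j x ! j = x ! Suc j \<and> swap_at j x ! Suc j = x ! j" if "x \<in> X" for x
        using X_swap_at[OF that j] X_perm[OF that] jn by (simp add: swap_at_nth)
      then show ?thesis unfolding A_def B_def by (intro bij_betwI[of _ _ _ "swap_at j"]) auto
    qed
    have 1: "Y v = (\<Sum>x\<in>A. m x v) + (\<Sum>x\<in>B. m x v)"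
      using Y_m[OF v \<beta>] sum.union_disjoint[OF fin disj, of "\<lambda>x. m x v"] XAB by simp
    have 2: "(\<Sum>x\<in>B. m x v) = (\<Sum>x\<in>A. m (swap_at j x) v)"
      using sum.reindex_bij_betw[OF bij, of "\<lambda>x. m x v"] by simp
    have 3: "(\<Sum>x\<in>A. m (swap_at j x) v) = (\<Sum>x\<in>A. S q j (m x v))"
    proof (rule sum.cong)
      fix x assume "x \<in> A"
      then show "m (swap_at j x) v = S q j (m x v)" using m_step[of x j v] jn by (simp add: A_def X_def)
    qed simp
    have "(\<Sum>x\<in>C. S q j (m x v)) = S q j (\<Sum>x\<in>C. m x v)" if "finite C" for C
      using that by (induction C) (auto simp: S_def T_add scl_add)
    then have "Y v = ?u + S q j ?u" using 1 2 3 fin by simp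
    then show "Y v = scl q ?u - T q j ?u"
      by (simp add: S_def fun_eq_iff fun_apply_simps algebra_simps)
    show "?u \<in> weight_space \<beta>"
    proof (rule weight_space_sum)
      fix x assume "x \<in> A"
      then have "x \<in> X" by (simp add: A_def)
      then show "m x v \<in> weight_space \<beta>" using DD[of x] restrict_len_weight_space[OF v \<beta>] alg_weight_space[OF _ v] by simp
    qed
  qed
  show thesis by (rule that[OF Y_alg Y_reading_word Y_div])
qed

section \<open>Words with distinct letters in each block, and dominance\<close>

definition block_inj :: "nat list \<Rightarrow> bool" where "block_inj w \<longleftrightarrow> (\<forall>p p'. p < p' \<longrightarrow> p' < n \<longrightarrow> block_of p = block_of p' \<longrightarrow> w ! p \<noteq> w ! p')"

lemma block_inj_swap_at:
  assumes "block_inj w" "j \<in> block_pos" "length w = n"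
  shows "block_inj (swap_at j w)"
  unfolding block_inj_def
proof (intro allI impI)
  have inj: "w ! a \<noteq> w ! b" if "a \<noteq> b" "a < n" "b < n" "block_of a = block_of b" for a b
    using assms(1) that unfolding block_inj_def by (metis linorder_neqE_nat)
  fix p p' assume "p < p'" "p' < n" "block_of p = block_of p'"
  define r where "r p = (if p = j then Suc j else if p = Suc j then j else p)" for p
  have j: "Suc j < n" "block_of j = block_of (Suc j)" using assms(2) by (auto simp: block_pos_def)
  have r: "swap_at j w ! p = w ! r p" "r p < n" "block_of (r p) = block_of p" if "p < n" for p
    using that j assms(3) by (auto simp: swap_at_nth r_def)
  have "r p \<noteq> r p'" using \<open>p < p'\<close> by (auto simp: r_def)
  then show "swap_at j w ! p \<noteq> swap_at j w ! p'"
    using inj[of "r p" "r p'"] r[of p] r[of p'] \<open>p < p'\<close> \<open>p' < n\<close> \<open>block_of p = block_of p'\<close> by simp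
qed

lemma block_inj_decreasing:
  fixes w :: "nat list"
  assumes "\<And>j. j \<in> block_pos \<Longrightarrow> w ! Suc j < w ! j"
  shows "block_inj w"
proof -
  have "w ! p' < w ! p" if "p < p'" "p' < n" "block_of p = block_of p'" for p p'
    using that
  proof (induction p' rule: less_induct)
    case (less p')
    then obtain r where r: "p' = Suc r" by (cases p') auto
    have "block_of p' \<le> block_of r" "block_of r \<le> block_of p" using block_of_antitone[of r p'] block_of_antitone[of p r] less.prems r by auto
    then have "block_of r = block_of p" "r \<in> block_pos" using less.prems r by (auto simp: block_pos_def)
    then have "w ! p' < w ! r" using assms r by blast
    moreover have "w ! r < w ! p" if "r \<noteq> p"
      using less.IH[of r] that less.prems r \<open>block_of r = block_of p\<close> by simp
    ultimately show ?case by (cases "r = p") auto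
  qed
  then show ?thesis unfolding block_inj_def by fastforce
qed

text \<open>The column lengths of the diagram, that is, the conjugate partition.\<close>

definition block_size where "block_size k = card {i. k < count \<alpha> i}"

lemma finite_block_size: "finite {i. k < count \<alpha> i}"
proof (rule finite_subset)
  show "{i. k < count \<alpha> i} \<subseteq> set_mset \<alpha>" by (auto simp flip: count_greater_zero_iff)
qed simp

lemma block_size_iff: "k < count \<alpha> i \<longleftrightarrow> i < block_size k"
proof -
  let ?A = "{i. k < count \<alpha> i}"
  have down: "i' \<in> ?A" if "i \<in> ?A" "i' \<le> i" for i i' using anti_le[OF that(2)] that(1) by auto
  show ?thesis
  proof
    assume "k < count \<alpha> i"
    then have "{..i} \<subseteq> ?A" using down by auto
    then have "card {..i} \<le> block_size k" unfolding block_size_def using finite_block_size by (intro card_mono) auto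
    then show "i < block_size k" by simp
  next
    assume i: "i < block_size k"
    show "k < count \<alpha> i"
    proof (rule ccontr)
      assume "\<not> k < count \<alpha> i"
      then have "?A \<subseteq> {..<i}" using down by (metis (mono_tags, lifting) lessThan_iff mem_Collect_eq not_le subsetI)
      then have "block_size k \<le> i" unfolding block_size_def using card_mono[of "{..<i}" ?A] by simp
      then show False using i by simp
    qed
  qed
qed

lemma card_block: "card {p. p < n \<and> block_of p = k} = block_size k"
proof -
  have "bij_betw (\<lambda>p. reading_word ! p) {p. p < n \<and> block_of p = k} {i. k < count \<alpha> i}"
    unfolding bij_betw_def
  proof
    show "inj_on (\<lambda>p. reading_word ! p) {p. p < n \<and> block_of p = k}"
      by (rule inj_onI) (metis (mono_tags, lifting) linorder_neqE_nat mem_Collect_eq nat_neq_iff reading_word_block_desc)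
    show "(\<lambda>p. reading_word ! p) ` {p. p < n \<and> block_of p = k} = {i. k < count \<alpha> i}"
    proof (intro equalityI subsetI)
      fix i assume "i \<in> (\<lambda>p. reading_word ! p) ` {p. p < n \<and> block_of p = k}"
      then obtain p where p: "p < n" "block_of p = k" "i = reading_word ! p" by auto
      then have "cell_list ! p \<in> cells" using nth_mem[of p cell_list] by (simp add: set_cell_list length_cell_list)
      then show "i \<in> {i. k < count \<alpha> i}" using p by (auto simp: cells_def block_of_def reading_word_nth)
    next
      fix i assume "i \<in> {i. k < count \<alpha> i}"
      then have "(k, i) \<in> set cell_list" using set_cell_list by (simp add: cells_def)
      then obtain p where "p < n" "cell_list ! p = (k, i)" by (metis in_set_conv_nth length_cell_list)
      then show "i \<in> (\<lambda>p. reading_word ! p) ` {p. p < n \<and> block_of p = k}" by (force simp: block_of_def reading_word_nth)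
    qed
  qed
  then show ?thesis unfolding block_size_def by (rule bij_betw_same_card)
qed

lemma block_of_less: "p < n \<Longrightarrow> block_of p < n"
proof -
  assume "p < n"
  then have "cell_list ! p \<in> cells" using nth_mem[of p cell_list] by (simp add: set_cell_list length_cell_list)
  then have "block_of p < count \<alpha> (snd (cell_list ! p))" by (simp add: cells_def block_of_def case_prod_beta)
  then show ?thesis using count_le_size[of \<alpha> "snd (cell_list ! p)"] by linarith
qed

text \<open>The cells in the first \<open>a\<close> rows, counted by columns and by rows.\<close>

lemma sum_min_block_size: "(\<Sum>k<n. min a (block_size k)) = (\<Sum>i<a. count \<alpha> i)"
proof -
  have "min a (block_size k) = (\<Sum>i<a. if k < count \<alpha> i then 1 else 0)" for k
  proof -
    have "{..<a} \<inter> {i. k < count \<alpha> i} = {..<min a (block_size k)}" by (auto simp: block_size_iff)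
    then show ?thesis by (simp add: sum.If_cases)
  qed
  then have "(\<Sum>k<n. min a (block_size k)) = (\<Sum>i<a. \<Sum>k<n. if k < count \<alpha> i then 1 else 0)"
    by (simp add: sum.swap[of _ "{..<a}"])
  moreover have "(\<Sum>k<n. if k < count \<alpha> i then 1 else 0) = count \<alpha> i" for i
  proof -
    have "{..<n} \<inter> {k. k < count \<alpha> i} = {..<count \<alpha> i}" using count_le_size[of \<alpha> i] by auto
    then show ?thesis by (simp add: sum.If_cases)
  qed
  ultimately show ?thesis by simp
qed

lemma sum_count_positions:
  assumes "finite A" "length w = n"
  shows "(\<Sum>i\<in>A. count (mset w) i) = (\<Sum>k<n. card {p. p < n \<and> block_of p = k \<and> w ! p \<in> A})"
proof -
  have "count (mset w) i = card {p. p < n \<and> w ! p = i}" for i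
    using assms(2) by (simp add: count_mset count_list_eq_length_filter length_filter_conv_card eq_commute)
  then have "(\<Sum>i\<in>A. count (mset w) i) = (\<Sum>i\<in>A. card {p. p < n \<and> w ! p = i})" by simp
  also have "\<dots> = card (\<Union>i\<in>A. {p. p < n \<and> w ! p = i})"
    by (rule card_UN_disjoint[symmetric]) (use assms in auto)
  also have "(\<Union>i\<in>A. {p. p < n \<and> w ! p = i}) = (\<Union>k\<in>{..<n}. {p. p < n \<and> block_of p = k \<and> w ! p \<in> A})"
    using block_of_less by auto
  also have "card \<dots> = (\<Sum>k<n. card {p. p < n \<and> block_of p = k \<and> w ! p \<in> A})"
    by (rule card_UN_disjoint) auto
  finally show ?thesis .
qed

lemma block_card_le:
  assumes "block_inj w" "finite A"
  shows "card {p. p < n \<and> block_of p = k \<and> w ! p \<in> A} \<le> min (card A) (block_size k)"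
proof -
  have "card {p. p < n \<and> block_of p = k \<and> w ! p \<in> A} \<le> card A"
    by (rule card_inj_on_le[of "\<lambda>p. w ! p"])
       (use assms in \<open>auto simp: inj_on_def block_inj_def, metis linorder_neqE_nat\<close>)
  moreover have "card {p. p < n \<and> block_of p = k \<and> w ! p \<in> A} \<le> block_size k"
    unfolding card_block[symmetric] by (rule card_mono) auto
  ultimately show ?thesis by simp
qed

text \<open>The easy half of the Gale-Ryser theorem: a block holds at most as many letters from
  \<open>A\<close> as the smaller of \<open>card A\<close> and its size.\<close>

lemma block_inj_dominance:
  assumes "block_inj w" "length w = n" "finite A"
  shows "(\<Sum>i\<in>A. count (mset w) i) \<le> (\<Sum>i<card A. count \<alpha> i)"
  unfolding sum_count_positions[OF assms(3,2)] sum_min_block_size[symmetric]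
  by (rule sum_mono) (rule block_card_le[OF assms(1,3)])

text \<open>For content \<open>\<alpha>\<close> the bound for the letters below \<open>?a\<close> is
  attained in total, hence in every block. Taking for \<open>?a\<close> the size of the block in
  question makes its bound the full block.\<close>

lemma block_inj_letters:
  assumes "block_inj w" "mset w = \<alpha>" "p < n"
  shows "w ! p < block_size (block_of p)"
proof -
  have len: "length w = n" using assms(2) by auto
  let ?a = "block_size (block_of p)"
  have eq: "(\<Sum>k<n. card {p. p < n \<and> block_of p = k \<and> w ! p \<in> {..<?a}}) = (\<Sum>k<n. min ?a (block_size k))"
    using sum_count_positions[of "{..<?a}" w] sum_min_block_size[of ?a] len assms(2) by simp
  have "card {p'. p' < n \<and> block_of p' = block_of p \<and> w ! p' \<in> {..<?a}} = min ?a (block_size (block_of p))"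
    by (rule sum_mono_inv[OF eq]) (use block_card_le[OF assms(1), of "{..<?a}"] block_of_less assms(3) in auto)
  then have "card {p'. p' < n \<and> block_of p' = block_of p \<and> w ! p' \<in> {..<?a}} = card {p'. p' < n \<and> block_of p' = block_of p}"
    using card_block by simp
  then have "{p'. p' < n \<and> block_of p' = block_of p \<and> w ! p' \<in> {..<?a}} = {p'. p' < n \<and> block_of p' = block_of p}"
    by (intro card_subset_eq) auto
  then show ?thesis using assms(3) by auto
qed

text \<open>By \<open>block_inj_letters\<close> the pairs of block number and letter are cells of
  the diagram, and they decrease strictly, so they form \<open>cell_list\<close>.\<close>

lemma decreasing_eq_reading_word:
  assumes "mset w = \<alpha>" "\<And>j. j \<in> block_pos \<Longrightarrow> w ! Suc j < w ! j"
  shows "w = reading_word"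
proof -
  have len: "length w = n" using assms(1) by auto
  have inj: "block_inj w" by (rule block_inj_decreasing[OF assms(2)])
  have "map (\<lambda>p. (block_of p, w ! p)) [0..<n] = cell_list"
  proof (rule cell_list_unique)
    show "set (map (\<lambda>p. (block_of p, w ! p)) [0..<n]) \<subseteq> cells"
      using block_inj_letters[OF inj assms(1)] by (auto simp: cells_def block_size_iff)
    fix j assume j: "Suc j < n"
    then show "map (\<lambda>p. (block_of p, w ! p)) [0..<n] ! Suc j < map (\<lambda>p. (block_of p, w ! p)) [0..<n] ! j"
      using block_of_antitone[of j "Suc j"] assms(2)[of j]
      by (cases "block_of j = block_of (Suc j)") (auto simp: less_prod_def block_pos_def)
  qed simp
  then have "reading_word = map snd (map (\<lambda>p. (block_of p, w ! p)) [0..<n])" unfolding reading_word_def by simp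
  also have "\<dots> = w" using len by (auto intro!: nth_equalityI)
  finally show ?thesis by simp
qed

text \<open>Exchanging ascents inside blocks goes up in the Bruhat order and keeps the letters of a
  block distinct; it stops only when all blocks decrease, which is at
  \<open>reading_word\<close>.\<close>

lemma block_inj_word_dom_reading_word: "block_inj w \<Longrightarrow> mset w = \<alpha> \<Longrightarrow> word_dom w reading_word"
proof (induction "card {x. mset x = \<alpha> \<and> w < x}" arbitrary: w rule: less_induct)
  case less
  show ?case
  proof (cases "\<forall>j\<in>block_pos. w ! Suc j < w ! j")
    case True then show ?thesis using decreasing_eq_reading_word less.prems by simp
  next
    case False
    have len: "length w = n" using less.prems by auto
    obtain j where j: "j \<in> block_pos" "\<not> w ! Suc j < w ! j" using False by blast
    then have jn: "Suc j < n" "block_of j = block_of (Suc j)" by (simp_all add: block_pos_def)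
    have "w ! j \<noteq> w ! Suc j" using less.prems(1) jn unfolding block_inj_def by blast
    then have asc: "Suc j < length w" "w ! j < w ! Suc j" using j(2) jn len by simp_all
    have "{x. mset x = \<alpha> \<and> swap_at j w < x} \<subset> {x. mset x = \<alpha> \<and> w < x}"
    proof
      show "{x. mset x = \<alpha> \<and> swap_at j w < x} \<subseteq> {x. mset x = \<alpha> \<and> w < x}"
        using swap_at_less[OF asc] by (blast intro: less_trans)
      have "swap_at j w \<in> {x. mset x = \<alpha> \<and> w < x}" using swap_at_less[OF asc] less.prems(2) by simp
      moreover have "swap_at j w \<notin> {x. mset x = \<alpha> \<and> swap_at j w < x}" by simp
      ultimately show "{x. mset x = \<alpha> \<and> swap_at j w < x} \<noteq> {x. mset x = \<alpha> \<and> w < x}" by blast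
    qed
    then have "card {x. mset x = \<alpha> \<and> swap_at j w < x} < card {x. mset x = \<alpha> \<and> w < x}"
      by (rule psubset_card_mono[rotated]) (rule finite_subset[OF _ finite_words[of \<alpha>]], blast)
    then have "word_dom (swap_at j w) reading_word" using less.hyps[of "swap_at j w"] block_inj_swap_at[OF less.prems(1) j(1) len] less.prems by simp
    moreover have "word_dom w (swap_at j w)" using word_dom_swap_at(1)[of w w j] asc by simp
    ultimately show ?thesis using word_dom_trans by blast
  qed
qed

end

section \<open>Separating a weight from the undominated ones\<close>

context lattice_content
begin

text \<open>The first predicate says that the shape of \<open>\<beta>\<close> is not dominated by that of \<open>\<alpha>\<close>; the second holds
  for the weights reached from \<open>\<alpha>\<close> by raising operators.\<close>

definition bad where
  "bad \<beta> \<longleftrightarrow> size \<beta> = n \<and> (\<exists>A. finite A \<and> (\<Sum>i<card A. count \<alpha> i) < (\<Sum>i\<in>A. count \<beta> i))"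

definition up where
  "up \<beta> \<longleftrightarrow> bad \<beta> \<and> (\<forall>k. (\<Sum>i<k. count \<alpha> i) \<le> (\<Sum>i<k. count \<beta> i))"

text \<open>Turning \<open>k\<close> letters \<open>i + 1\<close> into \<open>i\<close> raises the
  sum of the first \<open>i + 1\<close> multiplicities by \<open>k\<close> and changes no other
  initial sum. With fewer than \<open>k\<close> such letters the operator is zero on this
  weight.\<close>

lemma E_up:
  assumes "1 \<le> k"
  shows "(\<forall>u\<in>weight_space \<alpha>. \<forall>w. E q i w k u = 0) \<or> (\<exists>\<beta>. up \<beta> \<and> hecke_hom q \<alpha> \<beta> (\<lambda>v w. E q i w k v))"
proof (cases "k \<le> count \<alpha> (Suc i)")
  case False
  have "E q i w k u = 0" if "u \<in> weight_space \<alpha>" for u w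
  proof (rule ccontr)
    assume "E q i w k u \<noteq> 0"
    from E_content[OF this] obtain x where x: "u x \<noteq> 0" "mset x + replicate_mset k i = mset w + replicate_mset k (Suc i)" by blast
    then have "mset x = \<alpha>" using that unfolding weight_space_def by blast
    then show False using arg_cong[OF x(2), of "\<lambda>M. count M (Suc i)"] False by simp
  qed
  then show ?thesis by blast
next
  case True
  define \<beta> where "\<beta> = \<alpha> + replicate_mset k i - replicate_mset k (Suc i)"
  have sub: "replicate_mset k (Suc i) \<subseteq># \<alpha> + replicate_mset k i"
    using True by (simp add: subseteq_mset_def)
  then have eq: "\<alpha> + replicate_mset k i = \<beta> + replicate_mset k (Suc i)" by (simp add: \<beta>_def)
  have prefix_count: "count \<beta> l = (if l = i then count \<alpha> l + k else if l = Suc i then count \<alpha> l - k else count \<alpha> l)" for l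
    by (simp add: \<beta>_def)
  have sum1: "(\<Sum>l<m. count \<beta> l) = (\<Sum>l<m. count \<alpha> l)" if "m \<le> i" for m
    using that by (intro sum.cong) (auto simp: prefix_count)
  have sum2: "(\<Sum>l<Suc i. count \<beta> l) = (\<Sum>l<Suc i. count \<alpha> l) + k" using sum1[of i] by (simp add: prefix_count)
  have sum3: "(\<Sum>l<Suc (Suc i) + m. count \<beta> l) = (\<Sum>l<Suc (Suc i) + m. count \<alpha> l)" for m
  proof (induction m)
    case 0 then show ?case using sum2 True by (simp add: prefix_count)
  qed (simp add: prefix_count)
  have "(\<Sum>l<m. count \<alpha> l) \<le> (\<Sum>l<m. count \<beta> l)" for m
  proof -
    consider "m \<le> i" | "m = Suc i" | "m \<ge> Suc (Suc i)" by linarith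
    then show ?thesis
    proof cases
      case 3
      then obtain m' where m: "m = Suc (Suc i) + m'" using le_Suc_ex by blast
      show ?thesis unfolding m by (rule eq_refl[OF sum3[symmetric]])
    qed (use sum1 sum2 in auto)
  qed
  moreover have "size \<beta> = n" using arg_cong[OF eq, of size] by simp
  moreover have "(\<Sum>l<card {..<Suc i}. count \<alpha> l) < (\<Sum>l\<in>{..<Suc i}. count \<beta> l)"
    using sum2 assms by simp
  ultimately have "up \<beta>" unfolding up_def bad_def by blast
  then show ?thesis using E_hecke_hom[OF q0 eq] by blast
qed

text \<open>Consider the lexicographically largest word of the support. A vector in the image of
  \<open>q - T q j\<close> vanishes at equal neighbours, and its value at an ascent is
  \<open>- q\<close> times the value at the larger exchanged word, so neither can occur
  there.\<close>

lemma antisymmetric_support: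
  assumes u: "u \<in> weight_space \<beta>" "size \<beta> = n" "u w \<noteq> 0"
    and anti: "\<And>j. j \<in> block_pos \<Longrightarrow> \<exists>x\<in>weight_space \<beta>. u = scl q x - T q j x"
  shows "\<exists>w. u w \<noteq> 0 \<and> mset w = \<beta> \<and> (\<forall>j\<in>block_pos. w ! Suc j < w ! j)"
proof -
  have fin: "finite {w. u w \<noteq> 0}"
    by (rule finite_subset[OF _ finite_words[of \<beta>]]) (use u in \<open>auto simp: weight_space_def\<close>)
  define w where "w = Max {w. u w \<noteq> 0}"
  have w: "u w \<noteq> 0" using Max_in[OF fin] u(3) unfolding w_def by auto
  have mw: "mset w = \<beta>" using w u(1) unfolding weight_space_def by blast
  have "w ! Suc j < w ! j" if j: "j \<in> block_pos" for j
  proof (rule ccontr)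
    assume n: "\<not> w ! Suc j < w ! j"
    have len: "Suc j < length w" using j mw u(2) by (auto simp: block_pos_def)
    obtain x where x: "u = scl q x - T q j x" using anti[OF j] by blast
    show False
    proof (cases "w ! j = w ! Suc j")
      case True then show ?thesis using w x len by (simp add: fun_apply_simps T_nth)
    next
      case False
      then have asc: "w ! j < w ! Suc j" using n by simp
      then have uw: "u w = q * x w - q * x (swap_at j w)" "u (swap_at j w) = x (swap_at j w) - x w"
        using fun_cong[OF x, of w] fun_cong[OF x, of "swap_at j w"] len
        by (simp_all add: fun_apply_simps T_nth swap_at_nth) (simp add: algebra_simps)
      have "u w = - q * u (swap_at j w)" unfolding uw by (simp add: algebra_simps)
      then have "u (swap_at j w) \<noteq> 0" using w by auto
      then have "swap_at j w \<le> w" using Max_ge[OF fin, of "swap_at j w"] unfolding w_def by simp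
      then show False using swap_at_less[OF len asc] by (meson leD)
    qed
  qed
  then show ?thesis using w mw by blast
qed

text \<open>On the weight \<open>\<alpha>\<close> the operator \<open>D1 Y D3\<close> has rank one,
  with image spanned by \<open>D1 l\<close> and row \<open>D2 l'\<close>, where \<open>D2\<close> is
  the adjoint of \<open>D3\<close>. Since \<open>l\<close> supplies all leading words of
  \<open>K\<close> and \<open>l'\<close> generates \<open>K\<close>, every matrix whose columns and
  rows lie in \<open>K\<close> is eliminated by such operators.\<close>

lemma separation:
  assumes g: "weight_linear \<alpha> \<alpha> g"
    and out: "\<And>\<beta> f u. up \<beta> \<Longrightarrow> hecke_hom q \<alpha> \<beta> f \<Longrightarrow> u \<in> weight_space \<alpha> \<Longrightarrow> f (g u) = 0"
    and into: "\<And>\<beta> f u. up \<beta> \<Longrightarrow> hecke_hom q \<beta> \<alpha> f \<Longrightarrow> u \<in> weight_space \<beta> \<Longrightarrow> g (f u) = 0"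
  shows "\<exists>D\<in>\<A>. (\<forall>u\<in>weight_space \<alpha>. g u = D u) \<and> (\<forall>\<beta>. bad \<beta> \<longrightarrow> (\<forall>u\<in>weight_space \<beta>. D u = 0))"
proof -
  obtain Y where Y: "Y \<in> alg q block_pos" "Y (word_vec reading_word) reading_word \<noteq> 0"
    and Ydiv: "\<And>j \<beta> v. j \<in> block_pos \<Longrightarrow> size \<beta> = n \<Longrightarrow> v \<in> weight_space \<beta> \<Longrightarrow> \<exists>u\<in>weight_space \<beta>. Y v = scl q u - T q j u"
    by (rule antisymmetriser, rule that; blast)
  have YA: "Y \<in> \<A>" by (rule alg_mono[OF Y(1) block_pos_sub])
  have dz: "word_vec reading_word \<in> weight_space \<alpha>" by (rule weight_space_word_vec[OF mset_reading_word])
  \<comment> \<open>A nonzero value would have a word with distinct letters in each block in its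
    support, and the content of such a word is dominated.\<close>
  have Y_bad: "Y v = 0" if b: "bad \<beta>" and v: "v \<in> weight_space \<beta>" for \<beta> v
  proof (rule ccontr)
    assume "Y v \<noteq> 0"
    then obtain w where "Y v w \<noteq> 0" by (auto simp: fun_eq_iff fun_apply_simps)
    moreover have sz: "size \<beta> = n" using b by (simp add: bad_def)
    ultimately obtain w where w: "mset w = \<beta>" "\<forall>j\<in>block_pos. w ! Suc j < w ! j"
      using antisymmetric_support[OF alg_weight_space[OF Y(1) v] sz _ Ydiv[OF _ sz v]] by blast
    then have "block_inj w" by (intro block_inj_decreasing) auto
    moreover have "length w = n" using w sz by auto
    ultimately show False using b block_inj_dominance[of w] w(1) unfolding bad_def by (metis not_le)
  qed
  define l where "l = Y (word_vec reading_word)"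
  define a where "a = l reading_word"
  have a: "a \<noteq> 0" using Y(2) by (simp add: a_def l_def)
  have lW: "l \<in> weight_space \<alpha>" unfolding l_def by (rule alg_weight_space[OF Y(1) dz])
  \<comment> \<open>Subtract the multiple of \<open>reading_word\<close> that makes the coefficient
    there vanish. What remains is antisymmetric, and the only word of content
    \<open>\<alpha>\<close> that could force it to be nonzero has coefficient 0.\<close>
  have rank1: "Y v = scl (Y v reading_word / a) l" if v: "v \<in> weight_space \<alpha>" for v
  proof -
    define c where "c = Y v reading_word / a"
    define x where "x = v - scl c (word_vec reading_word)"
    have x: "x \<in> weight_space \<alpha>" unfolding x_def using v dz by (intro weight_space_diff weight_space_scl)
    have "Y (v - scl c (word_vec reading_word)) = Y v - Y (scl c (word_vec reading_word))"
      by (rule wlinD(5)[OF alg_weight_linear[OF Y(1)] v weight_space_scl[OF dz]])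
    moreover have "Y (scl c (word_vec reading_word)) = scl c (Y (word_vec reading_word))"
      by (rule wlinD(3)[OF alg_weight_linear[OF Y(1)] dz])
    ultimately have Yx: "Y x = Y v - scl c l" unfolding x_def l_def by simp
    have z: "Y x reading_word = 0" using Yx a by (simp add: fun_apply_simps c_def a_def)
    have "Y x = 0"
    proof (rule ccontr)
      assume "Y x \<noteq> 0"
      then obtain w where "Y x w \<noteq> 0" by (auto simp: fun_eq_iff fun_apply_simps)
      then obtain w where w: "Y x w \<noteq> 0" "mset w = \<alpha>" "\<forall>j\<in>block_pos. w ! Suc j < w ! j"
        using antisymmetric_support[OF alg_weight_space[OF Y(1) x] refl _ Ydiv[OF _ refl x]] by blast
      then have "w = reading_word" using decreasing_eq_reading_word by blast
      then show False using w z by simp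
    qed
    then show ?thesis using Yx unfolding c_def by simp
  qed
  obtain Y' where Y': "Y' \<in> alg q block_pos" "\<And>\<alpha> u v. form q \<alpha> (Y u) v = form q \<alpha> u (Y' v)"
    using alg_adjoint[OF Y(1)] by blast
  have Y'A: "Y' \<in> \<A>" by (rule alg_mono[OF Y'(1) block_pos_sub])
  define l' where "l' = Y' (word_vec reading_word)"
  have l'W: "l' \<in> weight_space \<alpha>" unfolding l'_def by (rule alg_weight_space[OF Y'(1) dz])
  let ?c = "q ^ inv_count reading_word"
  \<comment> \<open>The coefficient functional of the rank one operator is represented by
    \<open>l'\<close> under the form.\<close>
  have Yz: "?c * Y v reading_word = form q \<alpha> v l'" for v
    using Y'(2)[of \<alpha> v "word_vec reading_word"] form_word_vec[OF mset_reading_word, of q "Y v"] form_sym[of q \<alpha> "Y v" "word_vec reading_word"] by (simp add: l'_def)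
  have l'z: "l' reading_word \<noteq> 0"
    using Yz[of "word_vec reading_word"] form_word_vec[OF mset_reading_word, of q l'] Y(2) q0 by simp
  have Y'_bad: "Y' v = 0" if b: "bad \<beta>" and v: "v \<in> weight_space \<beta>" for \<beta> v
  proof (rule form_nondegenerate[OF q0 alg_weight_space[OF Y'(1) v]])
    fix x :: "nat list \<Rightarrow> 'f" assume "x \<in> weight_space \<beta>"
    then show "form q \<beta> x (Y' v) = form q \<beta> x 0" using Y'(2)[of \<beta> x v] Y_bad[OF b] by simp
  qed simp
  \<comment> \<open>Raising operators commute with \<open>D\<close> and move
    \<open>reading_word\<close> into a bad weight, where \<open>D\<close> is zero.\<close>
  have inK: "D (word_vec reading_word) \<in> K" if D: "D \<in> \<A>" and Db: "\<And>\<beta> v. bad \<beta> \<Longrightarrow> v \<in> weight_space \<beta> \<Longrightarrow> D v = 0" for D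
    unfolding K_def
  proof (intro CollectI conjI allI impI)
    show "D (word_vec reading_word) \<in> weight_space \<alpha>" by (rule alg_weight_space[OF D dz])
    fix i k w assume "1 \<le> (k :: nat)"
    then have "(\<lambda>w. E q i w k (word_vec reading_word)) = 0 \<or> (\<exists>\<beta>. bad \<beta> \<and> (\<lambda>w. E q i w k (word_vec reading_word)) \<in> weight_space \<beta>)"
      using E_up[of k i] dz whomD(1) unfolding up_def by (metis (no_types, lifting) ext zero_fun_apply)
    then have "D (\<lambda>w. E q i w k (word_vec reading_word)) = 0" using Db wlinD(4)[OF alg_weight_linear[OF D]] by auto
    then show "E q i w k (D (word_vec reading_word)) = 0" using E_alg[OF q0 D] by (simp add: fun_apply_simps)
  qed
  have lK: "l \<in> K" unfolding l_def by (rule inK[OF YA Y_bad])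
  have l'K: "l' \<in> K" unfolding l'_def by (rule inK[OF Y'A Y'_bad])
  have supp: "word_dom x reading_word" if "D \<in> alg q block_pos" "D (word_vec reading_word) x \<noteq> 0" for D x
  proof -
    have "block_inj reading_word" by (rule block_inj_decreasing) (use reading_word_block_desc in \<open>auto simp: block_pos_def\<close>)
    have "x \<in> {w. block_inj w \<and> mset w = \<alpha>}"
    proof (rule alg_supp[OF that(1) _ _ that(2)])
      show "swap_at j w \<in> {w. block_inj w \<and> mset w = \<alpha>}" if "w \<in> {w. block_inj w \<and> mset w = \<alpha>}" "j \<in> block_pos" for w j
        using block_inj_swap_at[of w j] that by auto
      show "w \<in> {w. block_inj w \<and> mset w = \<alpha>}" if "word_vec reading_word w \<noteq> (0::'f)" for w
        using that \<open>block_inj reading_word\<close> mset_reading_word by (auto simp: word_vec_def split: if_splits)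
    qed
    then show ?thesis using block_inj_word_dom_reading_word by blast
  qed
  have ls: "l reading_word \<noteq> 0" "\<And>x. l x \<noteq> 0 \<Longrightarrow> word_dom x reading_word" using a supp[OF Y(1)] by (auto simp: a_def l_def)
  have l's: "\<And>x. l' x \<noteq> 0 \<Longrightarrow> word_dom x reading_word" using supp[OF Y'(1)] by (auto simp: l'_def)

  \<comment> \<open>The vector representing the functional
    \<open>u \<mapsto> q ^ inv_count w * h u w\<close>: up to this factor, the row with index
    \<open>w\<close> of the matrix of \<open>h\<close>. Elimination runs over \<open>w\<close> with
    whole rows as entries.\<close>
  define row where "row h = (\<lambda>w. adjoint q \<alpha> \<alpha> h (word_vec w))" for h :: "(nat list \<Rightarrow> 'f) \<Rightarrow> nat list \<Rightarrow> 'f"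
  define \<K> where "\<K> = row ` {h. weight_linear \<alpha> \<alpha> h \<and>
      (\<forall>\<beta> f u. up \<beta> \<longrightarrow> hecke_hom q \<alpha> \<beta> f \<longrightarrow> u \<in> weight_space \<alpha> \<longrightarrow> f (h u) = 0) \<and>
      (\<forall>\<beta> f u. up \<beta> \<longrightarrow> hecke_hom q \<beta> \<alpha> f \<longrightarrow> u \<in> weight_space \<beta> \<longrightarrow> h (f u) = 0)}"
  define \<D> where "\<D> = row ` {D \<in> \<A>. \<forall>\<beta>. bad \<beta> \<longrightarrow> (\<forall>u\<in>weight_space \<beta>. D u = 0)}"
  have row_form: "form q \<alpha> u (row h w) = q ^ inv_count w * h u w" if "weight_linear \<alpha> \<alpha> h" "u \<in> weight_space \<alpha>" "mset w = \<alpha>" for h u w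
    using form_adjoint[OF q0 that(1,2), of "word_vec w"] form_word_vec[OF that(3), of q "h u"] form_sym[of q \<alpha> "h u" "word_vec w"]
    by (simp add: row_def)
  have row_out: "row h w = 0" if "mset w \<noteq> \<alpha>" for h w
    using that by (auto simp: row_def adjoint_def form_def word_vec_def fun_eq_iff fun_apply_simps intro!: sum.neutral split: if_splits)
  have row_weight_space: "row h w \<in> weight_space \<alpha>" for h w unfolding row_def by (rule adjoint_weight_space)
  have rowI: "row h w = x" if "weight_linear \<alpha> \<alpha> h" "mset w = \<alpha>" "x \<in> weight_space \<alpha>"
    "\<And>u. u \<in> weight_space \<alpha> \<Longrightarrow> q ^ inv_count w * h u w = form q \<alpha> u x" for h w x
    by (rule form_nondegenerate[OF q0 row_weight_space that(3)]) (use row_form[OF that(1) _ that(2)] that(4) in simp)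
  have weight_linear_minus: "weight_linear \<alpha> \<alpha> (\<lambda>u. h u - h' u)" if "weight_linear \<alpha> \<alpha> h" "weight_linear \<alpha> \<alpha> h'" for h h' :: "(nat list \<Rightarrow> 'f) \<Rightarrow> nat list \<Rightarrow> 'f"
    using that unfolding weight_linear_def by (auto intro!: weight_space_diff simp: fun_eq_iff fun_apply_simps algebra_simps)
  have row_minus: "row (\<lambda>u. h u - h' u) = (\<lambda>w. row h w - row h' w)" for h h'
    by (auto simp: row_def adjoint_def fun_eq_iff fun_apply_simps form_def algebra_simps sum_subtractf)
  have row_plus: "row (\<lambda>u. h u + h' u) = (\<lambda>w. row h w + row h' w)" for h h'
    by (auto simp: row_def adjoint_def fun_eq_iff fun_apply_simps form_def algebra_simps sum.distrib)
  have DK: "\<D> \<subseteq> \<K>"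
  proof
    fix F assume "F \<in> \<D>"
    then obtain D where D: "D \<in> \<A>" "\<forall>\<beta>. bad \<beta> \<longrightarrow> (\<forall>u\<in>weight_space \<beta>. D u = 0)" "F = row D" unfolding \<D>_def by blast
    have "f (D u) = 0" if "up \<beta>" "hecke_hom q \<alpha> \<beta> f" "u \<in> weight_space \<alpha>" for \<beta> f u
      using alg_hecke_hom[OF D(1) that(2,3)] D(2) that whomD(1)[OF that(2,3)] by (auto simp: up_def)
    moreover have "D (f u) = 0" if "up \<beta>" "hecke_hom q \<beta> \<alpha> f" "u \<in> weight_space \<beta>" for \<beta> f u
      using alg_hecke_hom[OF D(1) that(2,3)] D(2) that wlinD(4)[OF hecke_hom_weight_linear[OF that(2)]] by (auto simp: up_def bad_def)
    ultimately show "F \<in> \<K>" unfolding \<K>_def D(3) using alg_weight_linear[OF D(1)] by blast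
  qed
  have "\<K> \<subseteq> \<D>"
  proof (rule triangular[OF finite_words[of \<alpha>]])
    show "x \<in> {w. mset w = \<alpha>}" if "F \<in> \<K>" "F x \<noteq> 0" for F x using that row_out unfolding \<K>_def by blast
    show "(\<lambda>x. F x - G x) \<in> \<K>" if "F \<in> \<K>" "G \<in> \<K>" for F G
    proof -
      obtain h h' where h: "weight_linear \<alpha> \<alpha> h" "\<And>\<beta> f u. up \<beta> \<Longrightarrow> hecke_hom q \<alpha> \<beta> f \<Longrightarrow> u \<in> weight_space \<alpha> \<Longrightarrow> f (h u) = 0"
          "\<And>\<beta> f u. up \<beta> \<Longrightarrow> hecke_hom q \<beta> \<alpha> f \<Longrightarrow> u \<in> weight_space \<beta> \<Longrightarrow> h (f u) = 0" "F = row h"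
        and h': "weight_linear \<alpha> \<alpha> h'" "\<And>\<beta> f u. up \<beta> \<Longrightarrow> hecke_hom q \<alpha> \<beta> f \<Longrightarrow> u \<in> weight_space \<alpha> \<Longrightarrow> f (h' u) = 0"
          "\<And>\<beta> f u. up \<beta> \<Longrightarrow> hecke_hom q \<beta> \<alpha> f \<Longrightarrow> u \<in> weight_space \<beta> \<Longrightarrow> h' (f u) = 0" "G = row h'"
        using \<open>F \<in> \<K>\<close> \<open>G \<in> \<K>\<close> unfolding \<K>_def by blast
      have "f (h u - h' u) = 0" if "up \<beta>" "hecke_hom q \<alpha> \<beta> f" "u \<in> weight_space \<alpha>" for \<beta> f u
        using wlinD(5)[OF hecke_hom_weight_linear[OF that(2)], of "h u" "h' u"] h(2)[OF that] h'(2)[OF that]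
          wlinD(1)[OF h(1) that(3)] wlinD(1)[OF h'(1) that(3)] by simp
      then show ?thesis unfolding \<K>_def h(4) h'(4) row_minus[symmetric]
        using weight_linear_minus[OF h(1) h'(1)] h(3) h'(3) by (intro imageI) simp
    qed
    show "(\<lambda>x. 0) \<in> \<D>" unfolding \<D>_def
      by (rule image_eqI[of _ _ "\<lambda>v. 0"]) (auto simp: alg_zero row_def adjoint_def fun_eq_iff fun_apply_simps)
    show "(\<lambda>x. F x + G x) \<in> \<D>" if "F \<in> \<D>" "G \<in> \<D>" for F G
    proof -
      obtain D D' where "D \<in> \<A>" "\<forall>\<beta>. bad \<beta> \<longrightarrow> (\<forall>u\<in>weight_space \<beta>. D u = 0)" "F = row D"
        "D' \<in> \<A>" "\<forall>\<beta>. bad \<beta> \<longrightarrow> (\<forall>u\<in>weight_space \<beta>. D' u = 0)" "G = row D'"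
        using \<open>F \<in> \<D>\<close> \<open>G \<in> \<D>\<close> unfolding \<D>_def by blast
      then show ?thesis unfolding \<D>_def
        by (intro image_eqI[of _ _ "\<lambda>v. D v + D' v"]) (auto intro: alg_add simp: row_plus)
    qed
  next
    fix F w assume F: "F \<in> \<K>" "F w \<noteq> 0" "\<And>x. w < x \<Longrightarrow> F x = 0"
    obtain h where h: "weight_linear \<alpha> \<alpha> h" "\<And>\<beta> f u. up \<beta> \<Longrightarrow> hecke_hom q \<alpha> \<beta> f \<Longrightarrow> u \<in> weight_space \<alpha> \<Longrightarrow> f (h u) = 0"
      "\<And>\<beta> f u. up \<beta> \<Longrightarrow> hecke_hom q \<beta> \<alpha> f \<Longrightarrow> u \<in> weight_space \<beta> \<Longrightarrow> h (f u) = 0" "F = row h"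
      using F(1) unfolding \<K>_def by blast
    have mw: "mset w = \<alpha>" using F(2) row_out h(4) by blast
    \<comment> \<open>Columns: the raising operators are homomorphisms into \<open>up\<close>
      weights and so annihilate the image of \<open>h\<close>.\<close>
    have hK: "h u \<in> K" if "u \<in> weight_space \<alpha>" for u
      unfolding K_def
    proof (intro CollectI conjI allI impI)
      show "h u \<in> weight_space \<alpha>" by (rule wlinD(1)[OF h(1) that])
      then show "E q i x k (h u) = 0" if "1 \<le> k" for i k x
        using E_up[OF that, of i] h(2)[OF _ _ \<open>u \<in> weight_space \<alpha>\<close>, of _ "\<lambda>v w. E q i w k v"]
        by (metis (no_types, lifting) zero_fun_apply)
    qed
    \<comment> \<open>Rows: the adjoint of a raising operator is a homomorphism out of an
      \<open>up\<close> weight, and \<open>h\<close> kills its image.\<close>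
    have FK: "F w \<in> K"
      unfolding K_def
    proof (intro CollectI conjI allI impI)
      show FW: "F w \<in> weight_space \<alpha>" unfolding h(4) by (rule row_weight_space)
      fix i k x assume k: "1 \<le> (k::nat)"
      show "E q i x k (F w) = 0"
      proof (cases "\<forall>u\<in>weight_space \<alpha>. \<forall>w. E q i w k u = 0")
        case True then show ?thesis using FW by blast
      next
        case False
        then obtain \<beta> where \<beta>: "up \<beta>" "hecke_hom q \<alpha> \<beta> (\<lambda>v w. E q i w k v)" using E_up[OF k, of i] by blast
        let ?E = "\<lambda>v w. E q i w k v"
        have sz: "size \<beta> = size \<alpha>" using \<beta>(1) by (simp add: up_def bad_def)
        have "?E (F w) = 0"
        proof (rule form_nondegenerate[OF q0 whomD(1)[OF \<beta>(2) FW]])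
          fix y :: "nat list \<Rightarrow> 'f" assume y: "y \<in> weight_space \<beta>"
          let ?a = "adjoint q \<alpha> \<beta> ?E y"
          have "form q \<beta> y (?E (F w)) = form q \<alpha> ?a (F w)"
            using form_adjoint[OF q0 hecke_hom_weight_linear[OF \<beta>(2)] FW, of y] by (simp add: form_sym)
          also have "\<dots> = q ^ inv_count w * h ?a w"
            unfolding h(4) by (rule row_form[OF h(1) adjoint_weight_space mw])
          also have "h ?a = 0" by (rule h(3)[OF \<beta>(1) adjoint_hecke_hom[OF q0 \<beta>(2) sz] y])
          finally show "form q \<beta> y (?E (F w)) = form q \<beta> y 0" by (simp add: fun_apply_simps)
        qed simp
        then show ?thesis by (simp add: fun_eq_iff fun_apply_simps)
      qed
    qed
    \<comment> \<open>For a suitable \<open>u\<close> the entry of \<open>h u\<close> at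
      \<open>w\<close> is nonzero. The rows beyond \<open>w\<close> vanish, so \<open>w\<close> is
      the leading word of a vector in \<open>K\<close> and therefore a lattice word.\<close>
    obtain u where u: "u \<in> weight_space \<alpha>" "form q \<alpha> u (F w) \<noteq> 0"
      using form_nondegenerate[OF q0 K_weight_space[OF FK] weight_space_zero] F(2) by auto
    have huw: "h u w \<noteq> 0" using u row_form[OF h(1) u(1) mw] h(4) by auto
    have hgt: "h u x = 0" if "w < x" for x
    proof (cases "mset x = \<alpha>")
      case True
      then show ?thesis using row_form[OF h(1) u(1) True] F(3)[OF that] h(4) q0 by simp
    next
      case False then show ?thesis using wlinD(1)[OF h(1) u(1)] by (simp add: weight_space_def)
    qed
    have lat: "lattice_word w" by (rule K_lead(2)[OF hK[OF u(1)] huw hgt])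
    obtain D1 where D1: "D1 \<in> \<A>" "D1 l w \<noteq> 0" "\<And>x. D1 l x \<noteq> 0 \<Longrightarrow> word_dom x w"
      using lead_reach[of l w, OF ls lat mw] by auto
    obtain D2 where D2: "D2 \<in> \<A>" "F w = D2 l'" using K_generated[OF l'K l'z l's FK] by blast
    obtain D3 where D3: "D3 \<in> \<A>" "\<And>\<alpha> u v. form q \<alpha> (D2 u) v = form q \<alpha> u (D3 v)"
      using alg_adjoint[OF D2(1)] by blast
    \<comment> \<open>Normalisation: \<open>row e x\<close> is \<open>F w\<close> times
      \<open>q ^ inv_count x * t * D1 l x / (?c * a)\<close>, and this factor has to be 1 at
      \<open>x = w\<close>.\<close>
    define t where "t = ?c * a / (q ^ inv_count w * D1 l w)"
    define e where "e v = scl t (D1 (Y (D3 v)))" for v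
    have eA: "e \<in> \<A>" unfolding e_def[abs_def] by (intro alg_scl alg_comp[OF D1(1)] alg_comp[OF YA] D3(1))
    have lin0: "D 0 = 0" if "D \<in> \<A>" for D by (rule wlinD(4)[OF alg_weight_linear[OF that]])
    have ebad: "\<forall>\<beta>. bad \<beta> \<longrightarrow> (\<forall>u\<in>weight_space \<beta>. e u = 0)"
      unfolding e_def using Y_bad alg_weight_space[OF D3(1)] lin0[OF D1(1)] by simp
    have e_val: "q ^ inv_count x * e v x = form q \<alpha> v (scl (q ^ inv_count x * t * D1 l x / (?c * a)) (F w))"
      if v: "v \<in> weight_space \<alpha>" for v x
    proof -
      have D3v: "D3 v \<in> weight_space \<alpha>" by (rule alg_weight_space[OF D3(1) v])
      have "?c * Y (D3 v) reading_word = form q \<alpha> v (F w)"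
        using Yz[of "D3 v"] D3(2)[of \<alpha> l' v] D2(2) by (simp add: form_sym)
      then have y: "Y (D3 v) reading_word = form q \<alpha> v (F w) / ?c" using q0 by (simp add: field_simps)
      have "e v = scl t (D1 (scl (Y (D3 v) reading_word / a) l))" unfolding e_def using rank1[OF D3v] by simp
      also have "\<dots> = scl (t * (Y (D3 v) reading_word / a)) (D1 l)"
        using alg_linear[OF D1(1)] by simp
      finally show ?thesis by (simp add: y fun_apply_simps form_scl)
    qed
    have row_e: "row e x = scl (q ^ inv_count x * t * D1 l x / (?c * a)) (F w)" if "mset x = \<alpha>" for x
      by (rule rowI[OF alg_weight_linear[OF eA] that weight_space_scl[OF K_weight_space[OF FK]] e_val])
    have "row e w = F w" using row_e[OF mw] D1(2) q0 a by (simp add: t_def)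
    moreover have "row e x = 0" if "w < x" for x
    proof (cases "mset x = \<alpha>")
      case True
      have "D1 l x = 0" using D1(3)[of x] word_dom_imp_le[of x w] that by (meson leD)
      then show ?thesis using row_e[OF True] by simp
    qed (rule row_out)
    moreover have "row e \<in> \<D>" unfolding \<D>_def using eA ebad by blast
    ultimately show "\<exists>e\<in>\<D> \<inter> \<K>. e w = F w \<and> (\<forall>x>w. e x = 0)" using DK by blast
  qed
  moreover have "row g \<in> \<K>" unfolding \<K>_def using g out into by blast
  ultimately obtain D where D: "D \<in> \<A>" "\<forall>\<beta>. bad \<beta> \<longrightarrow> (\<forall>u\<in>weight_space \<beta>. D u = 0)" "row g = row D"
    unfolding \<D>_def by blast
  have "g u = D u" if u: "u \<in> weight_space \<alpha>" for u
  proof (rule weight_space_eqI[OF wlinD(1)[OF g u] alg_weight_space[OF D(1) u]])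
    fix w assume w: "mset w = \<alpha>"
    show "g u w = D u w"
      using row_form[OF g u w] row_form[OF alg_weight_linear[OF D(1)] u w] D(3) q0 by simp
  qed
  then show ?thesis using D by blast
qed

end

section \<open>Families commuting with all homomorphisms\<close>

definition shape :: "nat multiset \<Rightarrow> nat list" where
  "shape \<beta> = rev (sort (map (count \<beta>) (sorted_list_of_set (set_mset \<beta>))))"

definition content :: "nat list \<Rightarrow> nat multiset" where
  "content \<mu> = (\<Sum>i<length \<mu>. replicate_mset (\<mu> ! i) i)"

lemma count_content: "count (content \<mu>) i = (if i < length \<mu> then \<mu> ! i else 0)"
  by (simp add: content_def count_sum)

lemma size_content: "size (content \<mu>) = sum_list \<mu>"
  by (simp add: content_def size_multiset_sum sum_list_sum_nth atLeast0LessThan)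

lemma mset_sorted_list_of_set: "finite A \<Longrightarrow> mset (sorted_list_of_set A) = mset_set A"
  using mset_set_set[of "sorted_list_of_set A"] by simp

lemma mset_shape: "mset (shape \<beta>) = image_mset (count \<beta>) (mset_set (set_mset \<beta>))"
  by (simp add: shape_def mset_sorted_list_of_set)

lemma sorted_shape: "sorted_wrt (\<ge>) (shape \<beta>)"
  by (simp add: shape_def sorted_wrt_rev)

lemma desc_unique:
  assumes "sorted_wrt (\<ge>) xs" "sorted_wrt (\<ge>) ys" "mset xs = mset (ys :: nat list)"
  shows "xs = ys"
proof -
  have "sorted (rev xs)" "sorted (rev ys)" using assms by (simp_all add: sorted_wrt_rev)
  then have "rev xs = rev ys" using assms(3) by (intro sorted_mset_unique) auto
  then show ?thesis by simp
qed

lemma shape_content: "\<mu> \<in> Par n \<Longrightarrow> shape (content \<mu>) = \<mu>"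
proof (rule desc_unique[OF sorted_shape])
  assume \<mu>: "\<mu> \<in> Par n"
  then show "sorted_wrt (\<ge>) \<mu>" by (simp add: Par_def)
  have pos: "0 < \<mu> ! i" if "i < length \<mu>" for i using \<mu> that by (auto simp: Par_def in_set_conv_nth intro: gr0I)
  have "set_mset (content \<mu>) = {..<length \<mu>}"
    using pos by (auto simp: count_content set_mset_def split: if_splits)
  then have "mset (shape (content \<mu>)) = image_mset (count (content \<mu>)) (mset_set {..<length \<mu>})" by (simp add: mset_shape)
  also have "\<dots> = image_mset ((!) \<mu>) (mset_set {..<length \<mu>})" by (rule image_mset_cong) (simp add: count_content)
  also have "\<dots> = mset (map ((!) \<mu>) [0..<length \<mu>])" by (simp add: lessThan_atLeast0)
  finally show "mset (shape (content \<mu>)) = mset \<mu>" by (simp only: map_nth)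
qed

lemma shape_Par: "shape \<beta> \<in> Par (size \<beta>)"
proof -
  have "sum_list (shape \<beta>) = sum_mset (mset (shape \<beta>))" by (simp add: sum_mset_sum_list)
  also have "\<dots> = size \<beta>" by (simp add: mset_shape sum_unfold_sum_mset[symmetric] size_multiset_overloaded_eq)
  finally have 1: "sum_list (shape \<beta>) = size \<beta>" .
  have "0 \<notin># mset (shape \<beta>)" unfolding mset_shape by (auto simp: count_eq_zero_iff)
  then show ?thesis using 1 sorted_shape by (simp add: Par_def)
qed

lemma letters:
  obtains ls where "distinct ls" "set ls = set_mset \<beta>" "map (count \<beta>) ls = shape \<beta>"
proof -
  define ls where "ls = rev (sort_key (count \<beta>) (sorted_list_of_set (set_mset \<beta>)))"
  have "map (count \<beta>) ls = shape \<beta>"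
  proof (rule desc_unique[OF _ sorted_shape])
    show "sorted_wrt (\<ge>) (map (count \<beta>) ls)"
      unfolding ls_def rev_map[symmetric] sorted_wrt_rev using sorted_sort_key by simp
    show "mset (map (count \<beta>) ls) = mset (shape \<beta>)" by (simp add: mset_shape ls_def mset_sorted_list_of_set)
  qed
  then show thesis by (intro that[of ls]) (auto simp: ls_def)
qed

lemma sum_le_take:
  fixes f :: "'a \<Rightarrow> nat"
  assumes "sorted_wrt (\<ge>) (map f ls)" "finite A" "\<And>x. x \<in> A \<Longrightarrow> x \<notin> set ls \<Longrightarrow> f x = 0"
  shows "(\<Sum>x\<in>A. f x) \<le> sum_list (take (card A) (map f ls))"
  using assms
proof (induction ls arbitrary: A)
  case Nil then show ?case by simp
next
  case (Cons a ls)
  show ?case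
  proof (cases "A = {}")
    case True then show ?thesis by simp
  next
    case False
    \<comment> \<open>The largest value \<open>f a\<close> is charged to \<open>a\<close> itself if
      \<open>a \<in> A\<close>, otherwise to an arbitrary element of \<open>A\<close>.\<close>
    obtain x where x: "x \<in> A" "a \<in> A \<Longrightarrow> x = a" using False by blast
    have "f x \<le> f a"
    proof (cases "x \<in> set (a # ls)")
      case True then show ?thesis using Cons.prems(1) by auto
    next
      case False then show ?thesis using Cons.prems(3)[OF x(1)] by simp
    qed
    moreover have "(\<Sum>x\<in>A - {x}. f x) \<le> sum_list (take (card (A - {x})) (map f ls))"
    proof (rule Cons.IH)
      show "sorted_wrt (\<ge>) (map f ls)" using Cons.prems(1) by simp
      show "finite (A - {x})" using Cons.prems(2) by simp
      fix y assume y: "y \<in> A - {x}" "y \<notin> set ls"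
      then have "y \<noteq> a" using x(2) by blast
      then show "f y = 0" using Cons.prems(3)[of y] y by simp
    qed
    moreover have "card A = Suc (card (A - {x}))" by (rule card.remove[OF Cons.prems(2) x(1)])
    moreover have "(\<Sum>x\<in>A. f x) = f x + (\<Sum>x\<in>A - {x}. f x)" by (rule sum.remove[OF Cons.prems(2) x(1)])
    ultimately show ?thesis by simp
  qed
qed

lemma sum_count_le_shape:
  assumes "finite A"
  shows "(\<Sum>i\<in>A. count \<beta> i) \<le> sum_list (take (card A) (shape \<beta>))"
proof -
  obtain ls where ls: "distinct ls" "set ls = set_mset \<beta>" "map (count \<beta>) ls = shape \<beta>" by (rule letters)
  show ?thesis unfolding ls(3)[symmetric]
    by (rule sum_le_take) (use assms ls sorted_shape[of \<beta>] in \<open>auto simp: not_in_iff\<close>)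
qed

lemma shape_attained: "\<exists>A. finite A \<and> card A \<le> k \<and> (\<Sum>i\<in>A. count \<beta> i) = sum_list (take k (shape \<beta>))"
proof -
  obtain ls where ls: "distinct ls" "set ls = set_mset \<beta>" "map (count \<beta>) ls = shape \<beta>" by (rule letters)
  have "(\<Sum>i\<in>set (take k ls). count \<beta> i) = sum_list (map (count \<beta>) (take k ls))"
    using ls(1) by (simp add: sum_list_distinct_conv_sum_set)
  also have "map (count \<beta>) (take k ls) = take k (shape \<beta>)" by (simp add: take_map[symmetric] ls(3))
  finally show ?thesis using card_length[of "take k ls"] by (intro exI[of _ "set (take k ls)"]) auto
qed

lemma sum_content: "(\<Sum>i<k. count (content \<mu>) i) = sum_list (take k \<mu>)"
proof -
  have "(\<Sum>i<k. count (content \<mu>) i) = (\<Sum>i<min k (length \<mu>). \<mu> ! i)"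
    by (rule sum.mono_neutral_cong_right) (auto simp: count_content)
  then show ?thesis by (simp add: sum_list_sum_nth atLeast0LessThan min.commute)
qed

text \<open>Listing the letters of \<open>\<beta>\<close> by decreasing multiplicity matches them
  with the indices of the parts of \<open>\<mu>\<close>.\<close>

lemma relabel:
  assumes "shape \<beta> = shape (content \<mu>)" "\<mu> \<in> Par n"
  shows "\<exists>h. image_mset h (content \<mu>) = \<beta>"
proof -
  obtain ls where ls: "distinct ls" "set ls = set_mset \<beta>" "map (count \<beta>) ls = shape \<beta>" by (rule letters)
  have m: "map (count \<beta>) ls = \<mu>" using ls(3) assms shape_content by simp
  then have len: "length ls = length \<mu>" by (metis length_map)
  have eq: "image_mset ((!) ls) (content \<mu>) = (\<Sum>i<length \<mu>. replicate_mset (\<mu> ! i) (ls ! i))"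
  proof -
    have "image_mset h (\<Sum>i<k. replicate_mset (\<mu> ! i) i) = (\<Sum>i<k. replicate_mset (\<mu> ! i) (h i))" for h :: "nat \<Rightarrow> nat" and k
      by (induction k) auto
    then show ?thesis by (simp add: content_def)
  qed
  have "count (image_mset ((!) ls) (content \<mu>)) x = count \<beta> x" for x
  proof (cases "x \<in> set ls")
    case True
    then obtain i where i: "i < length ls" "x = ls ! i" by (auto simp: in_set_conv_nth)
    have "count (image_mset ((!) ls) (content \<mu>)) x = (\<Sum>k<length \<mu>. if k = i then \<mu> ! k else 0)"
      unfolding eq count_sum using i ls(1) len by (intro sum.cong) (auto simp: nth_eq_iff_index_eq)
    also have "\<dots> = \<mu> ! i" using i len by simp
    finally show ?thesis using m i by (metis nth_map)
  next
    case False
    then have "count (image_mset ((!) ls) (content \<mu>)) x = 0"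
      unfolding eq count_sum using len by (intro sum.neutral) (auto simp: in_set_conv_nth)
    then show ?thesis using False ls(2) by (simp add: not_in_iff)
  qed
  then show ?thesis by (intro exI multiset_eqI)
qed

lemma dominated_antisym:
  assumes "mu \<unlhd> lam" "lam \<unlhd> mu" "0 \<notin> set mu" "0 \<notin> set lam"
  shows "mu = lam"
proof -
  have eq: "sum_list (take k mu) = sum_list (take k lam)" for k
    using assms(1,2) unfolding dominated_by_def by (simp add: le_antisym)
  show ?thesis using eq assms(3,4)
  proof (induction mu arbitrary: lam)
    case Nil
    then show ?case using Nil(1)[of 1] by (cases lam) auto
  next
    case (Cons a mu)
    obtain b lam' where lam: "lam = b # lam'" using Cons.prems(1)[of 1] Cons.prems(2) by (cases lam) auto
    have ab: "a = b" using Cons.prems(1)[of 1] lam by simp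
    have "mu = lam'"
      by (rule Cons.IH) (use Cons.prems(1)[of "Suc _"] Cons.prems(2,3) lam ab in auto)
    then show ?case using lam ab by simp
  qed
qed

lemma finite_Par: "finite (Par n)"
proof (rule finite_subset)
  show "Par n \<subseteq> {xs. set xs \<subseteq> {..n} \<and> length xs \<le> n}"
  proof
    fix xs assume xs: "xs \<in> Par n"
    have "length xs \<le> sum_list xs" if "0 \<notin> set xs" for xs :: "nat list"
      using that by (induction xs) auto
    then show "xs \<in> {xs. set xs \<subseteq> {..n} \<and> length xs \<le> n}"
      using xs member_le_sum_list[of _ xs] by (auto simp: Par_def)
  qed
qed (rule finite_lists_length_le, simp)

lemma minimal_Par:
  assumes "\<sigma> \<subseteq> Par n" "\<sigma> \<noteq> {}"
  shows "\<exists>\<mu>\<in>\<sigma>. \<forall>\<nu>\<in>\<sigma>. \<nu> \<unlhd> \<mu> \<longrightarrow> \<nu> = \<mu>"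
proof -
  have tr: "a \<unlhd> c" if "a \<unlhd> b" "b \<unlhd> c" for a b c using that unfolding dominated_by_def by (meson le_trans)
  have "finite \<sigma>" using assms(1) finite_Par finite_subset by blast
  moreover have "\<forall>\<nu>\<in>\<sigma>. 0 \<notin> set \<nu>" using assms(1) by (auto simp: Par_def)
  ultimately show ?thesis using assms(2)
  proof (induction \<sigma> rule: finite_induct)
    case (insert x F)
    show ?case
    proof (cases "F = {}")
      case False
      then obtain m where m: "m \<in> F" "\<And>\<nu>. \<nu> \<in> F \<Longrightarrow> \<nu> \<unlhd> m \<Longrightarrow> \<nu> = m" using insert by auto
      show ?thesis
      proof (cases "x \<unlhd> m")
        case True
        have "\<nu> = x" if "\<nu> \<in> insert x F" "\<nu> \<unlhd> x" for \<nu>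
        proof (cases "\<nu> = x")
          case False
          then have "\<nu> = m" using m(2)[of \<nu>] that tr[OF that(2) True] by blast
          then show ?thesis using dominated_antisym[of \<nu> x] that True insert.prems(1) by blast
        qed
        then show ?thesis by blast
      next
        case False
        then show ?thesis using m by (intro bexI[of _ m]) auto
      qed
    qed auto
  qed simp
qed

text \<open>Minimality of \<open>\<mu>\<close> makes every other shape in \<open>\<sigma>\<close>
  bad, so the correction \<open>D'\<close> leaves those weights alone. Co-saturation puts every
  \<open>up\<close> weight into \<open>\<sigma>\<close> without \<open>\<mu>\<close>, where
  \<open>g - D\<close> already vanishes; commuting with homomorphisms to and from such weights gives
  the two hypotheses of \<open>separation\<close>.\<close>

lemma commuting_family_saturated:
  assumes q: "q \<noteq> (0::'f::field)"
  shows "\<sigma> \<subseteq> Par n \<Longrightarrow> co_saturated n \<sigma> \<Longrightarrow>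
    (\<And>\<beta>. size \<beta> = n \<Longrightarrow> shape \<beta> \<in> \<sigma> \<Longrightarrow> weight_linear \<beta> \<beta> (g \<beta>)) \<Longrightarrow>
    (\<And>\<beta> \<gamma> f u. size \<beta> = n \<Longrightarrow> size \<gamma> = n \<Longrightarrow> shape \<beta> \<in> \<sigma> \<Longrightarrow> shape \<gamma> \<in> \<sigma> \<Longrightarrow> hecke_hom q \<beta> \<gamma> f \<Longrightarrow>
       u \<in> weight_space \<beta> \<Longrightarrow> g \<gamma> (f u) = f (g \<beta> u)) \<Longrightarrow>
    \<exists>D\<in>alg q {j. Suc j < n}. \<forall>\<beta>. size \<beta> = n \<longrightarrow> shape \<beta> \<in> \<sigma> \<longrightarrow> (\<forall>u\<in>weight_space \<beta>. g \<beta> u = D u)"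
proof (induction "card \<sigma>" arbitrary: \<sigma> rule: less_induct)
  case less
  note lin = less.prems(3) and comm = less.prems(4)
  show ?case
  proof (cases "\<sigma> = {}")
    case True then show ?thesis using alg.alg_id by blast
  next
    case False
    obtain \<mu> where \<mu>: "\<mu> \<in> \<sigma>" "\<And>\<nu>. \<nu> \<in> \<sigma> \<Longrightarrow> \<nu> \<unlhd> \<mu> \<Longrightarrow> \<nu> = \<mu>"
      using minimal_Par[OF less.prems(1) False] by blast
    have \<mu>P: "\<mu> \<in> Par n" using \<mu>(1) less.prems(1) by blast
    let ?s = "\<sigma> - {\<mu>}"
    have "finite \<sigma>" using less.prems(1) finite_Par finite_subset by blast
    then have cell_list: "card ?s < card \<sigma>" using \<mu>(1) by (rule card_Diff1_less)
    have co: "co_saturated n ?s"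
      using less.prems(2) \<mu>(2) unfolding co_saturated_def by blast
    have "\<exists>D\<in>alg q {j. Suc j < n}. \<forall>\<beta>. size \<beta> = n \<longrightarrow> shape \<beta> \<in> ?s \<longrightarrow> (\<forall>u\<in>weight_space \<beta>. g \<beta> u = D u)"
    proof (rule less.hyps[OF cell_list _ co])
      show "?s \<subseteq> Par n" using less.prems(1) by blast
      show "weight_linear \<beta> \<beta> (g \<beta>)" if "size \<beta> = n" "shape \<beta> \<in> ?s" for \<beta> using lin that by blast
      show "g \<gamma> (f u) = f (g \<beta> u)" if "size \<beta> = n" "size \<gamma> = n" "shape \<beta> \<in> ?s" "shape \<gamma> \<in> ?s"
        "hecke_hom q \<beta> \<gamma> f" "u \<in> weight_space \<beta>" for \<beta> \<gamma> f u using comm[of \<beta> \<gamma> f u] that by blast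
    qed
    then obtain D where D: "D \<in> alg q {j. Suc j < n}"
      "\<And>\<beta> u. size \<beta> = n \<Longrightarrow> shape \<beta> \<in> ?s \<Longrightarrow> u \<in> weight_space \<beta> \<Longrightarrow> g \<beta> u = D u" by blast
    let ?\<alpha> = "content \<mu>"
    have sz: "size ?\<alpha> = n" using \<mu>P by (simp add: size_content Par_def)
    have sh: "shape ?\<alpha> = \<mu>" by (rule shape_content[OF \<mu>P])
    interpret lattice_content ?\<alpha> q
    proof
      fix i
      have "\<mu> ! Suc i \<le> \<mu> ! i" if "Suc i < length \<mu>" using \<mu>P that by (auto simp: Par_def sorted_wrt_iff_nth_less)
      then show "count ?\<alpha> (Suc i) \<le> count ?\<alpha> i" by (simp add: count_content)
    qed (rule q)
    have bad: "bad \<beta>" if "size \<beta> = n" "shape \<beta> \<in> ?s" for \<beta>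
    proof -
      have "\<not> shape \<beta> \<unlhd> \<mu>" using that \<mu>(2) by blast
      then obtain k where k: "sum_list (take k \<mu>) < sum_list (take k (shape \<beta>))"
        unfolding dominated_by_def by (auto simp: not_le)
      obtain A where A: "finite A" "card A \<le> k" "(\<Sum>i\<in>A. count \<beta> i) = sum_list (take k (shape \<beta>))"
        using shape_attained by blast
      have "(\<Sum>i<card A. count ?\<alpha> i) \<le> (\<Sum>i<k. count ?\<alpha> i)" using A(2) by (intro sum_mono2) auto
      then show ?thesis unfolding bad_def using A k sz that by (intro conjI exI[of _ A]) (auto simp: sum_content)
    qed
    have up: "size \<beta> = n \<and> shape \<beta> \<in> ?s" if "up \<beta>" for \<beta>
    proof -
      have b: "size \<beta> = n" using that sz by (simp add: up_def bad_def)
      have "\<mu> \<unlhd> shape \<beta>" unfolding dominated_by_def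
      proof
        fix k
        have "sum_list (take k \<mu>) \<le> (\<Sum>i<k. count \<beta> i)" using that by (simp add: up_def sum_content)
        also have "\<dots> \<le> sum_list (take k (shape \<beta>))" using sum_count_le_shape[of "{..<k}" \<beta>] by simp
        finally show "sum_list (take k \<mu>) \<le> sum_list (take k (shape \<beta>))" .
      qed
      then have "shape \<beta> \<in> \<sigma>" using less.prems(2) \<mu>(1) shape_Par[of \<beta>] b unfolding co_saturated_def by blast
      moreover have "shape \<beta> \<noteq> \<mu>"
      proof
        assume eq: "shape \<beta> = \<mu>"
        obtain A where A: "finite A" "(\<Sum>i<card A. count ?\<alpha> i) < (\<Sum>i\<in>A. count \<beta> i)"
          using \<open>up \<beta>\<close> unfolding up_def bad_def by blast
        then show False using sum_count_le_shape[OF A(1), of \<beta>] eq by (simp add: sum_content)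
      qed
      ultimately show ?thesis using b by blast
    qed
    let ?g = "\<lambda>u. g ?\<alpha> u - D u"
    have ga: "weight_linear ?\<alpha> ?\<alpha> (g ?\<alpha>)" using lin sz sh \<mu>(1) by simp
    have Da: "weight_linear \<beta> \<beta> D" for \<beta> by (rule alg_weight_linear[OF D(1)])
    have "\<exists>D'\<in>\<A>. (\<forall>u\<in>weight_space ?\<alpha>. ?g u = D' u) \<and> (\<forall>\<beta>. bad \<beta> \<longrightarrow> (\<forall>u\<in>weight_space \<beta>. D' u = 0))"
    proof (rule separation)
      show "weight_linear ?\<alpha> ?\<alpha> ?g" using ga Da[of ?\<alpha>] unfolding weight_linear_def
        by (auto intro!: weight_space_diff simp: fun_eq_iff fun_apply_simps algebra_simps)
    next
      fix \<beta> f and u :: "nat list \<Rightarrow> 'f" assume *: "up \<beta>" "hecke_hom q ?\<alpha> \<beta> f" "u \<in> weight_space ?\<alpha>"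
      note b = up[OF *(1)]
      have "f (?g u) = f (g ?\<alpha> u) - f (D u)"
        by (rule wlinD(5)[OF hecke_hom_weight_linear[OF *(2)] wlinD(1)[OF ga *(3)] wlinD(1)[OF Da *(3)]])
      also have "f (g ?\<alpha> u) = g \<beta> (f u)" using comm[OF sz _ _ _ *(2,3)] b sh \<mu>(1) by simp
      also have "\<dots> = D (f u)" using D(2)[of \<beta> "f u"] b whomD(1)[OF *(2,3)] by simp
      also have "f (D u) = D (f u)" by (rule alg_hecke_hom[OF D(1) *(2,3)]) (simp add: sz)
      finally show "f (?g u) = 0" by simp
    next
      fix \<beta> f and u :: "nat list \<Rightarrow> 'f" assume *: "up \<beta>" "hecke_hom q \<beta> ?\<alpha> f" "u \<in> weight_space \<beta>"
      note b = up[OF *(1)]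
      have "g ?\<alpha> (f u) = f (g \<beta> u)" using comm[OF _ sz _ _ *(2,3)] b sh \<mu>(1) by simp
      also have "\<dots> = f (D u)" using D(2)[of \<beta> u] b *(3) by simp
      also have "\<dots> = D (f u)" by (rule alg_hecke_hom[OF D(1) *(2,3)]) (simp add: b)
      finally show "?g (f u) = 0" by simp
    qed
    then obtain D' where D': "D' \<in> alg q {j. Suc j < n}" "\<And>u. u \<in> weight_space ?\<alpha> \<Longrightarrow> ?g u = D' u"
      "\<And>\<beta> u. bad \<beta> \<Longrightarrow> u \<in> weight_space \<beta> \<Longrightarrow> D' u = 0" using sz by auto
    have res: "g \<beta> u = D u + D' u" if \<beta>: "size \<beta> = n" "shape \<beta> \<in> \<sigma>" and u: "u \<in> weight_space \<beta>" for \<beta> u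
    proof (cases "shape \<beta> = \<mu>")
      case False
      then show ?thesis using D(2)[of \<beta> u] D'(3)[OF bad, of \<beta> u] \<beta> u by simp
    next
      \<comment> \<open>Other contents of shape \<open>\<mu>\<close> are images of
        \<open>content \<mu>\<close> under a letter map, with which all three maps commute.\<close>
      case True
      then obtain h where h: "image_mset h ?\<alpha> = \<beta>" using relabel[of \<beta> \<mu>] sh \<mu>P by auto
      obtain f where f: "hecke_hom q ?\<alpha> \<beta> f" "f ` weight_space ?\<alpha> = weight_space \<beta>" using letter_map_hom[OF q, of ?\<alpha> h] h by auto
      obtain v where v: "v \<in> weight_space ?\<alpha>" "u = f v" using f(2) u by blast
      have Dv: "f (D v) = D u" unfolding v(2) by (rule alg_hecke_hom[OF D(1) f(1) v(1)]) (simp add: sz)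
      have D'v: "f (D' v) = D' u" unfolding v(2) by (rule alg_hecke_hom[OF D'(1) f(1) v(1)]) (simp add: sz)
      have "g \<beta> u = f (g ?\<alpha> v)" unfolding v(2) using comm[OF sz \<beta>(1) _ _ f(1) v(1)] sh \<mu>(1) \<beta>(2) by simp
      also have "g ?\<alpha> v = D v + D' v" using D'(2)[OF v(1)] by (simp add: algebra_simps)
      also have "f \<dots> = f (D v) + f (D' v)"
        by (rule wlinD(2)[OF hecke_hom_weight_linear[OF f(1)] alg_weight_space[OF D(1) v(1)] alg_weight_space[OF D'(1) v(1)]])
      finally show ?thesis using Dv D'v by simp
    qed
    then show ?thesis by (intro bexI[OF _ alg_add[OF D(1) D'(1)]]) blast
  qed
qed

text \<open>The partition \<open>P\<close> witnessing a coarsening, turned into a map between index sets.\<close>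

lemma coarsening_map:
  fixes c :: "'a \<Rightarrow> nat" and b :: "'b \<Rightarrow> nat"
  assumes "finite B" "finite A" "sum_mset P = image_mset c (mset_set A)" "image_mset sum_mset P = image_mset b (mset_set B)"
  shows "\<exists>h. (\<forall>a\<in>A. h a \<in> B) \<and> (\<forall>x\<in>B. (\<Sum>a | a \<in> A \<and> h a = x. c a) = b x)"
  using assms
proof (induction B arbitrary: P A rule: finite_induct)
  case empty
  then have "A = {}" by (simp add: mset_set_empty_iff)
  then show ?case by simp
next
  case (insert x B)
  have "image_mset sum_mset P = add_mset (b x) (image_mset b (mset_set B))" using insert by simp
  then obtain p P' where P: "P = add_mset p P'" "sum_mset p = b x" "image_mset sum_mset P' = image_mset b (mset_set B)"
    by (metis msed_map_invR)
  have "image_mset c (mset_set A) = p + sum_mset P'" using insert.prems(2) P(1) by simp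
  then obtain M1 M2 where M: "mset_set A = M1 + M2" "p = image_mset c M1" "sum_mset P' = image_mset c M2"
    by (metis image_mset_eq_plusD)
  have c1: "count M1 a + count M2 a = (if a \<in> A then 1 else 0)" for a
    using arg_cong[OF M(1), of "\<lambda>M. count M a"] insert.prems(1) by (simp add: count_mset_set' split: if_splits)
  define A1 A2 where "A1 = set_mset M1" and "A2 = set_mset M2"
  have A: "A = A1 \<union> A2" unfolding A1_def A2_def using arg_cong[OF M(1), of set_mset] insert.prems(1) by simp
  have disj: "A1 \<inter> A2 = {}"
  proof -
    have False if "a \<in># M1" "a \<in># M2" for a
      using c1[of a] that by (auto simp: count_greater_zero_iff[symmetric] split: if_splits simp del: count_greater_zero_iff)
    then show ?thesis unfolding A1_def A2_def by blast
  qed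
  have fin: "finite A1" "finite A2" unfolding A1_def A2_def by auto
  have M1: "M1 = mset_set A1"
  proof (rule multiset_eqI)
    fix a show "count M1 a = count (mset_set A1) a"
      using c1[of a] by (cases "a \<in># M1") (auto simp: A1_def count_greater_zero_iff[symmetric] not_in_iff split: if_splits simp del: count_greater_zero_iff)
  qed
  have M2: "M2 = mset_set A2"
  proof (rule multiset_eqI)
    fix a show "count M2 a = count (mset_set A2) a"
      using c1[of a] by (cases "a \<in># M2") (auto simp: A2_def count_greater_zero_iff[symmetric] not_in_iff split: if_splits simp del: count_greater_zero_iff)
  qed
  obtain h where h: "\<forall>a\<in>A2. h a \<in> B" "\<forall>x\<in>B. (\<Sum>a | a \<in> A2 \<and> h a = x. c a) = b x"
    using insert.IH[OF fin(2), of P'] M(3) M2 P(3) by auto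
  define h' where "h' a = (if a \<in> A1 then x else h a)" for a
  have "\<forall>a\<in>A. h' a \<in> insert x B" using h(1) A by (auto simp: h'_def)
  moreover have "(\<Sum>a | a \<in> A \<and> h' a = y. c a) = b y" if "y \<in> insert x B" for y
  proof (cases "y = x")
    case True
    have "{a. a \<in> A \<and> h' a = x} = A1" using A h(1) insert.hyps(2) disj by (auto simp: h'_def)
    then show ?thesis using True P(2) M(2) M1 by (simp add: sum_unfold_sum_mset)
  next
    case False
    then have "{a. a \<in> A \<and> h' a = y} = {a. a \<in> A2 \<and> h a = y}" using A disj by (auto simp: h'_def)
    then show ?thesis using False that h(2) by simp
  qed
  ultimately show ?case by blast
qed

lemma coarsening_letter_map:
  assumes "coarsening (shape \<beta>) (shape \<alpha>)"
  shows "\<exists>h. image_mset h \<alpha> = \<beta>"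
proof -
  obtain P where "sum_mset P = mset (shape \<alpha>)" "image_mset sum_mset P = mset (shape \<beta>)"
    using assms unfolding coarsening_def by blast
  then obtain h where h: "\<forall>a\<in>set_mset \<alpha>. h a \<in> set_mset \<beta>"
    "\<forall>x\<in>set_mset \<beta>. (\<Sum>a | a \<in> set_mset \<alpha> \<and> h a = x. count \<alpha> a) = count \<beta> x"
    using coarsening_map[of "set_mset \<beta>" "set_mset \<alpha>" P "count \<alpha>" "count \<beta>"] unfolding mset_shape by auto
  have "count (image_mset h \<alpha>) x = count \<beta> x" for x
  proof -
    have "count (image_mset h \<alpha>) x = (\<Sum>a | a \<in> set_mset \<alpha> \<and> h a = x. count \<alpha> a)"
      unfolding count_image_mset by (intro sum.cong) auto
    also have "\<dots> = count \<beta> x"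
    proof (cases "x \<in># \<beta>")
      case False
      then have "{a. a \<in> set_mset \<alpha> \<and> h a = x} = {}" using h(1) by auto
      then have "(\<Sum>a | a \<in> set_mset \<alpha> \<and> h a = x. count \<alpha> a) = 0" by (simp only: sum.empty)
      then show ?thesis using False by (simp add: not_in_iff)
    qed (use h(2) in blast)
    finally show ?thesis .
  qed
  then show ?thesis by (intro exI multiset_eqI)
qed

lemma coarsening_refl: "coarsening lam lam"
proof -
  have "sum_mset (image_mset (\<lambda>x. {#x#}) M) = M" for M :: "nat multiset" by (induction M) auto
  moreover have "image_mset sum_mset (image_mset (\<lambda>x. {#x#}) M) = M" for M :: "nat multiset" by (induction M) auto
  ultimately show ?thesis unfolding coarsening_def by blast
qed

text \<open>Each weight whose shape is a coarsening is the image of some \<open>content lam\<close>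
  with \<open>lam \<in> \<Lambda>\<close>, and \<open>g\<close> is transported along that
  surjection; then the saturated case applies.\<close>

theorem commuting_family_in_alg:
  assumes q: "q \<noteq> (0::'f::field)" and \<Lambda>: "\<Lambda> \<subseteq> Par n" "co_saturated n (coarsenings n \<Lambda>)"
    and lin: "\<And>lam. lam \<in> \<Lambda> \<Longrightarrow> weight_linear (content lam) (content lam) (g lam)"
    and comm: "\<And>lam lam' f u. lam \<in> \<Lambda> \<Longrightarrow> lam' \<in> \<Lambda> \<Longrightarrow> hecke_hom q (content lam) (content lam') f \<Longrightarrow> u \<in> weight_space (content lam) \<Longrightarrow>
      g lam' (f u) = f (g lam u)"
  shows "\<exists>D\<in>alg q {j. Suc j < n}. \<forall>lam\<in>\<Lambda>. \<forall>u\<in>weight_space (content lam). g lam u = D u"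
proof -
  let ?s = "coarsenings n \<Lambda>"
  have szc: "size (content lam) = n" if "lam \<in> \<Lambda>" for lam using that \<Lambda>(1) by (auto simp: size_content Par_def)
  have shc: "shape (content lam) = lam" if "lam \<in> \<Lambda>" for lam using that \<Lambda>(1) shape_content by blast
  define cover where "cover \<beta> lam f \<longleftrightarrow> lam \<in> \<Lambda> \<and> hecke_hom q (content lam) \<beta> f \<and> f ` weight_space (content lam) = weight_space \<beta>"
    for \<beta> lam and f :: "(nat list \<Rightarrow> 'f) \<Rightarrow> nat list \<Rightarrow> 'f"
  have ex: "\<exists>lam f. cover \<beta> lam f" if s: "shape \<beta> \<in> ?s" for \<beta>
  proof -
    obtain lam where lam: "lam \<in> \<Lambda>" "coarsening (shape \<beta>) lam" using s unfolding coarsenings_def by blast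
    then obtain h where "image_mset h (content lam) = \<beta>" using coarsening_letter_map[of \<beta> "content lam"] shc by auto
    then show ?thesis unfolding cover_def using letter_map_hom[OF q, of "content lam" h] lam(1) by auto
  qed
  \<comment> \<open>Independence of choices and commutation with \<open>\<phi>\<close> in one
    statement. It is tested after the injective adjoint \<open>?i\<close> of \<open>p'\<close>: both
    composites then run between members of \<open>\<Lambda>\<close>, where \<open>g\<close> commutes
    by assumption.\<close>
  have compat: "p' (g lam' u') = \<phi> (p (g lam u))"
    if c: "cover \<beta> lam p" "cover \<gamma> lam' p'" and sz: "size \<beta> = n" "size \<gamma> = n" and \<phi>: "hecke_hom q \<beta> \<gamma> \<phi>"
      and u: "u \<in> weight_space (content lam)" "u' \<in> weight_space (content lam')" "p' u' = \<phi> (p u)" for \<beta> \<gamma> lam lam' p p' \<phi> u u'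
  proof -
    have p: "hecke_hom q (content lam) \<beta> p" and l: "lam \<in> \<Lambda>" using c(1) by (auto simp: cover_def)
    have p': "hecke_hom q (content lam') \<gamma> p'" "p' ` weight_space (content lam') = weight_space \<gamma>" and l': "lam' \<in> \<Lambda>"
      using c(2) by (auto simp: cover_def)
    let ?i = "adjoint q (content lam') \<gamma> p'"
    have i: "hecke_hom q \<gamma> (content lam') ?i" by (rule adjoint_hecke_hom[OF q p'(1)]) (simp add: sz szc l')
    have e1: "hecke_hom q (content lam) (content lam') (\<lambda>u. ?i (\<phi> (p u)))"
      by (rule hecke_hom_comp[OF hecke_hom_comp[OF p \<phi>] i]) (simp_all add: sz szc l)
    have e2: "hecke_hom q (content lam') (content lam') (\<lambda>u. ?i (p' u))"
      by (rule hecke_hom_comp[OF p'(1) i]) (simp add: sz szc l')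
    have gu: "g lam u \<in> weight_space (content lam)" "g lam' u' \<in> weight_space (content lam')"
      using wlinD(1)[OF lin[OF l] u(1)] wlinD(1)[OF lin[OF l'] u(2)] by auto
    have "?i (\<phi> (p (g lam u))) = ?i (p' (g lam' u'))"
      using comm[OF l l' e1 u(1)] comm[OF l' l' e2 u(2)] u(3) by simp
    moreover have mem: "p' (g lam' u') \<in> weight_space \<gamma>" "\<phi> (p (g lam u)) \<in> weight_space \<gamma>"
      using whomD(1)[OF p'(1) gu(2)] whomD(1)[OF \<phi> whomD(1)[OF p gu(1)]] by auto
    ultimately have "?i (p' (g lam' u') - \<phi> (p (g lam u))) = 0"
      using wlinD(5)[OF hecke_hom_weight_linear[OF i] mem] by simp
    then have "p' (g lam' u') - \<phi> (p (g lam u)) = 0"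
      by (rule adjoint_inj[OF q hecke_hom_weight_linear[OF p'(1)] p'(2) weight_space_diff[OF mem]])
    then show ?thesis by simp
  qed
  have id: "hecke_hom q \<beta> \<beta> (\<lambda>u. u)" for \<beta> by (simp add: hecke_hom_def)
  define L where "L \<beta> = fst (SOME p. cover \<beta> (fst p) (snd p))" for \<beta>
  define F where "F \<beta> = snd (SOME p. cover \<beta> (fst p) (snd p))" for \<beta>
  have LF: "cover \<beta> (L \<beta>) (F \<beta>)" if s: "shape \<beta> \<in> ?s" for \<beta>
  proof -
    have "\<exists>p. cover \<beta> (fst p) (snd p)" using ex[OF s] by (simp only: split_paired_Ex fst_conv snd_conv)
    then show ?thesis unfolding L_def F_def
      by (rule someI_ex[where P = "\<lambda>p. cover \<beta> (fst p) (snd p)"])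
  qed
  define pre where "pre \<beta> v = (SOME u. u \<in> weight_space (content (L \<beta>)) \<and> F \<beta> u = v)" for \<beta> v
  have pre: "pre \<beta> v \<in> weight_space (content (L \<beta>)) \<and> F \<beta> (pre \<beta> v) = v" if "shape \<beta> \<in> ?s" "v \<in> weight_space \<beta>" for \<beta> v
  proof -
    have "v \<in> F \<beta> ` weight_space (content (L \<beta>))" using LF[OF that(1)] that(2) by (simp add: cover_def)
    then have "\<exists>u. u \<in> weight_space (content (L \<beta>)) \<and> F \<beta> u = v" by blast
    then show ?thesis unfolding pre_def
      by (rule someI_ex[where P = "\<lambda>u. u \<in> weight_space (content (L \<beta>)) \<and> F \<beta> u = v"])
  qed
  define G where "G \<beta> v = F \<beta> (g (L \<beta>) (pre \<beta> v))" for \<beta> v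
  \<comment> \<open>\<open>compat\<close> with the identity: the result does not depend on the
    preimage chosen by \<open>pre\<close>.\<close>
  have Geq: "G \<beta> (F \<beta> u) = F \<beta> (g (L \<beta>) u)" if "shape \<beta> \<in> ?s" "size \<beta> = n" "u \<in> weight_space (content (L \<beta>))" for \<beta> u
  proof -
    have "F \<beta> u \<in> weight_space \<beta>" using LF[OF that(1)] that(3) unfolding cover_def by blast
    note p = pre[OF that(1) this]
    show ?thesis unfolding G_def
      by (rule compat[OF LF[OF that(1)] LF[OF that(1)] that(2) that(2) id that(3)]) (use p in auto)
  qed
  have "\<exists>D\<in>alg q {j. Suc j < n}. \<forall>\<beta>. size \<beta> = n \<longrightarrow> shape \<beta> \<in> ?s \<longrightarrow> (\<forall>u\<in>weight_space \<beta>. G \<beta> u = D u)"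
  proof (rule commuting_family_saturated[OF q _ \<Lambda>(2)])
    show "?s \<subseteq> Par n" by (auto simp: coarsenings_def)
  next
    fix \<beta> assume \<beta>: "size \<beta> = n" "shape \<beta> \<in> ?s"
    note c = LF[OF \<beta>(2)]
    have f: "weight_linear (content (L \<beta>)) \<beta> (F \<beta>)" and l: "L \<beta> \<in> \<Lambda>" using c hecke_hom_weight_linear unfolding cover_def by blast+
    note gl = lin[OF l]
    show "weight_linear \<beta> \<beta> (G \<beta>)"
      unfolding weight_linear_def
    proof (intro conjI ballI allI)
      fix v :: "nat list \<Rightarrow> 'f" assume v: "v \<in> weight_space \<beta>"
      show "G \<beta> v \<in> weight_space \<beta>" unfolding G_def using pre[OF \<beta>(2) v] wlinD(1)[OF f wlinD(1)[OF gl]] by blast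
      obtain u where u: "u \<in> weight_space (content (L \<beta>))" "v = F \<beta> u" using pre[OF \<beta>(2) v] by metis
      show "G \<beta> (scl c v) = scl c (G \<beta> v)" for c
        using Geq[OF \<beta>(2,1) u(1)] Geq[OF \<beta>(2,1) weight_space_scl[OF u(1)], of c] u
          wlinD(3)[OF f u(1), of c] wlinD(3)[OF gl u(1), of c] wlinD(3)[OF f wlinD(1)[OF gl u(1)], of c] by simp
      fix v' :: "nat list \<Rightarrow> 'f" assume v': "v' \<in> weight_space \<beta>"
      obtain u' where u': "u' \<in> weight_space (content (L \<beta>))" "v' = F \<beta> u'" using pre[OF \<beta>(2) v'] by metis
      show "G \<beta> (v + v') = G \<beta> v + G \<beta> v'"
        using Geq[OF \<beta>(2,1) u(1)] Geq[OF \<beta>(2,1) u'(1)] Geq[OF \<beta>(2,1) weight_space_add[OF u(1) u'(1)]] u u'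
          wlinD(2)[OF f u(1) u'(1)] wlinD(2)[OF gl u(1) u'(1)] wlinD(2)[OF f wlinD(1)[OF gl u(1)] wlinD(1)[OF gl u'(1)]] by simp
    qed
  next
    fix \<beta> \<gamma> f and v :: "nat list \<Rightarrow> 'f"
    assume \<beta>: "size \<beta> = n" and \<gamma>: "size \<gamma> = n" and s: "shape \<beta> \<in> ?s" "shape \<gamma> \<in> ?s" and f: "hecke_hom q \<beta> \<gamma> f" and v: "v \<in> weight_space \<beta>"
    show "G \<gamma> (f v) = f (G \<beta> v)"
      unfolding G_def
      by (rule compat[OF LF[OF s(1)] LF[OF s(2)] \<beta> \<gamma> f])
         (use pre[OF s(1) v] pre[OF s(2) whomD(1)[OF f v]] in auto)
  qed
  then obtain D where D: "D \<in> alg q {j. Suc j < n}"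
    "\<And>\<beta> u. size \<beta> = n \<Longrightarrow> shape \<beta> \<in> ?s \<Longrightarrow> u \<in> weight_space \<beta> \<Longrightarrow> G \<beta> u = D u" by blast
  have "g lam u = D u" if l: "lam \<in> \<Lambda>" and u: "u \<in> weight_space (content lam)" for lam u
  proof -
    have s: "shape (content lam) \<in> ?s" using l \<Lambda>(1) coarsening_refl by (auto simp: shc coarsenings_def)
    \<comment> \<open>The identity is a cover as well, so comparing it with the chosen one shows
      that \<open>G\<close> extends \<open>g\<close>.\<close>
    have c: "cover (content lam) lam (\<lambda>u. u)" using l id by (auto simp: cover_def)
    have "g lam u = G (content lam) u"
      unfolding G_def
      using compat[OF LF[OF s] c szc[OF l] szc[OF l] id, of "pre (content lam) u" u] pre[OF s u] u by simp
    then show ?thesis using D(2)[OF szc[OF l] s u] by simp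
  qed
  then show ?thesis using D(1) by blast
qed

section \<open>The Hecke algebra acting on functions of words\<close>

text \<open>With concatenation as addition of exponents, the convolution product of finitely supported functions
  is the product of the free algebra.\<close>

instantiation list :: (type) monoid_add
begin
definition "zero_list = ([] :: 'a list)"
definition "plus_list xs ys = xs @ (ys :: 'a list)"
instance by standard (auto simp: zero_list_def plus_list_def)
end

lemma poly_mapping_expand: "f = (\<Sum>u\<in>Poly_Mapping.keys f. Poly_Mapping.single u (Poly_Mapping.lookup f u))"
proof (rule poly_mapping_eqI)
  fix k
  show "Poly_Mapping.lookup f k = Poly_Mapping.lookup (\<Sum>u\<in>Poly_Mapping.keys f. Poly_Mapping.single u (Poly_Mapping.lookup f u)) k"
    by (cases "k \<in> Poly_Mapping.keys f") (auto simp: lookup_sum lookup_single when_def sum.delta in_keys_iff)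
qed

lemma free_algebra_mult_times: "free_algebra_mult f g = f * g"
proof -
  have "f * g = (\<Sum>u\<in>Poly_Mapping.keys f. Poly_Mapping.single u (Poly_Mapping.lookup f u)) *
     (\<Sum>v\<in>Poly_Mapping.keys g. Poly_Mapping.single v (Poly_Mapping.lookup g v))"
    using poly_mapping_expand[of f] poly_mapping_expand[of g] by simp
  then show ?thesis
    by (simp add: free_algebra_mult_def sum_product mult_single plus_list_def)
qed

lemma free_algebra_simps [simp]:
  "f \<in> carrier (free_algebra X) \<longleftrightarrow> Poly_Mapping.keys f \<subseteq> lists X"
  "monoid.mult (free_algebra X) = (*)" "one (free_algebra X) = 1"
  "ring.zero (free_algebra X) = 0" "add (free_algebra X) = (+)"
  by (auto simp: free_algebra_def free_algebra_mult_times fun_eq_iff zero_list_def[symmetric] single_one)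

lemma ring_free_algebra: "ring (free_algebra X :: (_ \<Rightarrow>\<^sub>0 'f::comm_ring_1) ring)"
proof (rule ringI)
  have add: "Poly_Mapping.keys (x + y) \<subseteq> lists X"
    if "Poly_Mapping.keys x \<subseteq> lists X" "Poly_Mapping.keys y \<subseteq> lists X" for x y :: "'a list \<Rightarrow>\<^sub>0 'f"
    using keys_add[of x y] that by blast
  show "abelian_group (free_algebra X :: (_ \<Rightarrow>\<^sub>0 'f) ring)"
  proof (rule abelian_groupI, unfold free_algebra_simps)
    fix x :: "'a list \<Rightarrow>\<^sub>0 'f" assume x: "Poly_Mapping.keys x \<subseteq> lists X"
    show "\<exists>y\<in>carrier (free_algebra X). y + x = 0"
      by (rule bexI[of _ "- x"]) (use x in simp_all)
  qed (simp_all add: add add.assoc add.commute)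
  show "monoid (free_algebra X :: (_ \<Rightarrow>\<^sub>0 'f) ring)"
  proof (rule monoidI, unfold free_algebra_simps)
    fix x y :: "'a list \<Rightarrow>\<^sub>0 'f" assume xy: "Poly_Mapping.keys x \<subseteq> lists X" "Poly_Mapping.keys y \<subseteq> lists X"
    show "Poly_Mapping.keys (x * y) \<subseteq> lists X"
    proof
      fix w assume "w \<in> Poly_Mapping.keys (x * y)"
      then obtain a b where "w = a + b" "a \<in> Poly_Mapping.keys x" "b \<in> Poly_Mapping.keys y"
        using keys_mult[of x y] by blast
      then show "w \<in> lists X" using xy by (auto simp: plus_list_def)
    qed
  next
    show "Poly_Mapping.keys (1 :: 'a list \<Rightarrow>\<^sub>0 'f) \<subseteq> lists X"
      by (simp add: zero_list_def keys_one)
  qed (simp_all add: mult.assoc)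
qed (simp_all add: distrib_left distrib_right)

abbreviation FA :: "nat \<Rightarrow> (nat list \<Rightarrow>\<^sub>0 'f::field) ring" where "FA n \<equiv> free_algebra {1..<n}"

lemma hecke_relations_carrier: "hecke_relations n q \<subseteq> carrier (FA n)"
proof
  fix f :: "nat list \<Rightarrow>\<^sub>0 'a" assume f: "f \<in> hecke_relations n q"
  interpret R: ring "FA n :: (nat list \<Rightarrow>\<^sub>0 'a) ring" by (rule ring_free_algebra)
  have s: "Poly_Mapping.single u c \<in> carrier (FA n)" if "set u \<subseteq> {1..<n}" for u and c :: 'a
    using that by auto
  have m: "a - b \<in> carrier (FA n)" if "a \<in> carrier (FA n)" "b \<in> carrier (FA n)" for a b :: "nat list \<Rightarrow>\<^sub>0 'a"
    using keys_diff[of a b] that by auto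
  have p: "a + b \<in> carrier (FA n)" "a * b \<in> carrier (FA n)"
    if "a \<in> carrier (FA n)" "b \<in> carrier (FA n)" for a b :: "nat list \<Rightarrow>\<^sub>0 'a"
    using R.a_closed[OF that] R.m_closed[OF that] by simp_all
  from f consider
    i where "1 \<le> i" "i + 1 < n" "f = Poly_Mapping.single [i, i + 1, i] 1 - Poly_Mapping.single [i + 1, i, i + 1] 1"
    | i j where "1 \<le> i" "i + 1 < j" "j < n" "f = Poly_Mapping.single [i, j] 1 - Poly_Mapping.single [j, i] 1"
    | i where "1 \<le> i" "i < n" "f = (Poly_Mapping.single [i] 1 - Poly_Mapping.single [] q) *
        (Poly_Mapping.single [i] 1 + Poly_Mapping.single [] 1)"
    unfolding hecke_relations_def free_algebra_mult_times by blast
  then show "f \<in> carrier (FA n)"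
  proof cases
    case 1 show ?thesis unfolding 1(3) by (intro m s) (use 1 in auto)
  next
    case 2 show ?thesis unfolding 2(4) by (intro m s) (use 2 in auto)
  next
    case 3 show ?thesis unfolding 3(3) by (intro m p s) (use 3 in auto)
  qed
qed

lemma ideal_hecke: "ideal (hecke_ideal n q) (FA n)"
  unfolding hecke_ideal_def by (rule ring.genideal_ideal[OF ring_free_algebra hecke_relations_carrier])

definition hecke_class :: "nat \<Rightarrow> 'f::field \<Rightarrow> (nat list \<Rightarrow>\<^sub>0 'f) \<Rightarrow> (nat list \<Rightarrow>\<^sub>0 'f) set" where
  "hecke_class n q f = hecke_ideal n q +>\<^bsub>FA n\<^esub> f"

lemma hecke_class_carrier: "f \<in> carrier (FA n) \<Longrightarrow> hecke_class n q f \<in> carrier (hecke n q)"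
  by (auto simp: hecke_def FactRing_def A_RCOSETS_def' hecke_class_def simp del: free_algebra_simps(1))

lemma hecke_carrierE:
  assumes "X \<in> carrier (hecke n q)" obtains f where "f \<in> carrier (FA n)" "X = hecke_class n q f"
  using assms by (auto simp: hecke_def FactRing_def A_RCOSETS_def' hecke_class_def simp del: free_algebra_simps(1))

lemma hecke_class_mult:
  "f \<in> carrier (FA n) \<Longrightarrow> g \<in> carrier (FA n) \<Longrightarrow> hecke_class n q f \<otimes>\<^bsub>hecke n q\<^esub> hecke_class n q g = hecke_class n q (f * g)"
  using ideal.rcoset_mult_add[OF ideal_hecke, of f n g] by (simp add: hecke_def FactRing_def hecke_class_def)

lemma hecke_class_add:
  "f \<in> carrier (FA n) \<Longrightarrow> g \<in> carrier (FA n) \<Longrightarrow> hecke_class n q f \<oplus>\<^bsub>hecke n q\<^esub> hecke_class n q g = hecke_class n q (f + g)"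
  using ideal.a_rcos_sum[OF ideal_hecke, of f n g] by (simp add: hecke_def FactRing_def hecke_class_def)

lemma hecke_class_one: "\<one>\<^bsub>hecke n q\<^esub> = hecke_class n q 1"
  by (simp add: hecke_def FactRing_def hecke_class_def)

lemma ring_hecke: "ring (hecke n q)"
  unfolding hecke_def by (rule ideal.quotient_is_ring[OF ideal_hecke])

lemma hecke_class_mem: "g \<in> hecke_class n q f \<longleftrightarrow> (\<exists>i\<in>hecke_ideal n q. g = i + f)"
  by (auto simp: hecke_class_def a_r_coset_def' )

lemma hecke_class_self: "f \<in> carrier (FA n) \<Longrightarrow> f \<in> hecke_class n q f"
  using additive_subgroup.zero_closed[OF ideal.axioms(1)[OF ideal_hecke[of n q]]] by (auto simp: hecke_class_mem)

lemma single_carrier: "set u \<subseteq> {1..<n} \<Longrightarrow> Poly_Mapping.single u c \<in> carrier (FA n)"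
  by auto

lemma hecke_scalar_hecke_class: "hecke_scalar n q c = hecke_class n q (Poly_Mapping.single [] c)"
  by (simp add: hecke_scalar_def hecke_class_def)

lemma hecke_gen_hecke_class: "hecke_gen n q i = hecke_class n q (Poly_Mapping.single [i] 1)"
  by (simp add: hecke_gen_def hecke_class_def)

lemma hecke_scalar_carrier [simp]: "hecke_scalar n q c \<in> carrier (hecke n q)"
  unfolding hecke_scalar_hecke_class by (rule hecke_class_carrier) auto

lemma hecke_gen_carrier [simp]: "1 \<le> i \<Longrightarrow> i < n \<Longrightarrow> hecke_gen n q i \<in> carrier (hecke n q)"
  unfolding hecke_gen_hecke_class by (rule hecke_class_carrier) auto

text \<open>Classes are sums of scalar multiples of words, and a word is built by multiplying on the
  left with one generator at a time.\<close>

lemma hecke_induct [consumes 1, case_names scalar gen add]: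
  assumes X: "X \<in> carrier (hecke n q)"
    and scalar: "\<And>c. P (hecke_scalar n q c)"
    and gen: "\<And>i Y. 1 \<le> i \<Longrightarrow> i < n \<Longrightarrow> Y \<in> carrier (hecke n q) \<Longrightarrow> P Y \<Longrightarrow> P (hecke_gen n q i \<otimes>\<^bsub>hecke n q\<^esub> Y)"
    and add: "\<And>X Y. X \<in> carrier (hecke n q) \<Longrightarrow> Y \<in> carrier (hecke n q) \<Longrightarrow> P X \<Longrightarrow> P Y \<Longrightarrow> P (X \<oplus>\<^bsub>hecke n q\<^esub> Y)"
  shows "P X"
proof -
  have single: "P (hecke_class n q (Poly_Mapping.single u c))" if "set u \<subseteq> {1..<n}" for u c
    using that
  proof (induction u)
    case Nil then show ?case using scalar[of c] by (simp add: hecke_scalar_hecke_class)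
  next
    case (Cons i u)
    have "Poly_Mapping.single (i # u) c = Poly_Mapping.single [i] 1 * Poly_Mapping.single u c"
      by (simp add: mult_single plus_list_def)
    then have "hecke_class n q (Poly_Mapping.single (i # u) c) = hecke_gen n q i \<otimes>\<^bsub>hecke n q\<^esub> hecke_class n q (Poly_Mapping.single u c)"
      unfolding hecke_gen_hecke_class using Cons.prems by (subst hecke_class_mult) auto
    then show ?case using gen[of i "hecke_class n q (Poly_Mapping.single u c)"] Cons hecke_class_carrier[OF single_carrier[of u n c]] by simp
  qed
  obtain f where f: "f \<in> carrier (FA n)" "X = hecke_class n q f" using X by (rule hecke_carrierE)
  let ?g = "\<lambda>A. (\<Sum>u\<in>A. Poly_Mapping.single u (Poly_Mapping.lookup f u))"
  have "?g A \<in> carrier (FA n) \<and> P (hecke_class n q (?g A))" if "A \<subseteq> Poly_Mapping.keys f" for A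
    using finite_subset[OF that finite_keys] that
  proof (induction A rule: finite_induct)
    case empty
    then show ?case using single[of "[]" 0] by simp
  next
    case (insert u A)
    have u: "set u \<subseteq> {1..<n}" using insert.prems f(1) by auto
    have IH: "?g A \<in> carrier (FA n)" "P (hecke_class n q (?g A))" using insert by auto
    note s = single_carrier[OF u, of "Poly_Mapping.lookup f u"]
    have "?g (insert u A) = Poly_Mapping.single u (Poly_Mapping.lookup f u) + ?g A" using insert by simp
    moreover have "Poly_Mapping.single u (Poly_Mapping.lookup f u) + ?g A \<in> carrier (FA n)"
      using ring.ring_simprules(1)[OF ring_free_algebra s IH(1)] by simp
    moreover have "P (hecke_class n q (Poly_Mapping.single u (Poly_Mapping.lookup f u) + ?g A))"
      using add[OF hecke_class_carrier[OF s] hecke_class_carrier[OF IH(1)] single[OF u] IH(2)] hecke_class_add[OF s IH(1), of q] by simp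
    ultimately show ?case by simp
  qed
  from this[OF subset_refl] show ?thesis using f(2) poly_mapping_expand[of f] by simp
qed

section \<open>Evaluating noncommutative polynomials at operators\<close>

text \<open>\<open>foldr\<close> makes the last letter of a word act first, as a left action
  requires.\<close>

definition act :: "(nat \<Rightarrow> (nat list \<Rightarrow> 'f) \<Rightarrow> (nat list \<Rightarrow> 'f)) \<Rightarrow> (nat list \<Rightarrow>\<^sub>0 'f::field) \<Rightarrow> (nat list \<Rightarrow> 'f) \<Rightarrow> (nat list \<Rightarrow> 'f)" where
  "act t f v = (\<Sum>u\<in>Poly_Mapping.keys f. scl (Poly_Mapping.lookup f u) (foldr t u v))"

lemma act_superset:
  assumes "finite A" "Poly_Mapping.keys f \<subseteq> A"
  shows "act t f v = (\<Sum>u\<in>A. scl (Poly_Mapping.lookup f u) (foldr t u v))"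
  unfolding act_def using assms by (intro sum.mono_neutral_left) (auto simp: in_keys_iff)

lemma act_add: "act t (f + g) v = act t f v + act t g v"
proof -
  let ?A = "Poly_Mapping.keys f \<union> Poly_Mapping.keys g"
  have "Poly_Mapping.keys (f + g) \<subseteq> ?A" by (rule keys_add)
  then show ?thesis
    using act_superset[of ?A "f + g" t v] act_superset[of ?A f t v] act_superset[of ?A g t v]
    by (simp add: lookup_add scl_add_left sum.distrib)
qed

lemma act_zero [simp]: "act t 0 v = 0" by (simp add: act_def)

lemma act_minus: "act t (f - g) v = act t f v - act t g v"
  using act_add[of t "f - g" g v] by simp

lemma act_single: "act t (Poly_Mapping.single u c) v = scl c (foldr t u v)"
  using act_superset[of "{u}" "Poly_Mapping.single u c" t v] by (simp add: keys_single)

lemma act_sum: "act t (\<Sum>a\<in>A. F a) v = (\<Sum>a\<in>A. act t (F a) v)"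
  by (induction A rule: infinite_finite_induct) (auto simp: act_add)

lemma act_one: "act t 1 v = v"
  using act_single[of t "[]" 1 v] by (simp add: single_one[symmetric] zero_list_def)

locale linear_action =
  fixes t :: "nat \<Rightarrow> (nat list \<Rightarrow> 'f::field) \<Rightarrow> (nat list \<Rightarrow> 'f)"
  assumes t_add: "t i (u + v) = t i u + t i v" and t_scl: "t i (scl c u) = scl c (t i u)"
begin

lemma t_0: "t i 0 = 0" using t_scl[of i 0 0] by simp

lemma foldr_scl: "foldr t u (scl c v) = scl c (foldr t u v)"
  by (induction u) (auto simp: t_scl)

lemma foldr_add: "foldr t u (v + w) = foldr t u v + foldr t u w"
  by (induction u) (auto simp: t_add)

lemma foldr_zero: "foldr t u 0 = 0"
  by (induction u) (auto simp: t_0)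

lemma foldr_sum: "foldr t u (sum g A) = (\<Sum>a\<in>A. foldr t u (g a))"
  by (induction A rule: infinite_finite_induct) (auto simp: foldr_add foldr_zero)

lemma act_mult: "act t (f * g) v = act t f (act t g v)"
proof -
  have "act t f (act t g v) = (\<Sum>a\<in>Poly_Mapping.keys f. \<Sum>b\<in>Poly_Mapping.keys g.
      scl (Poly_Mapping.lookup f a * Poly_Mapping.lookup g b) (foldr t a (foldr t b v)))"
    by (simp add: act_def foldr_sum foldr_scl scl_sum)
  then show ?thesis
    unfolding free_algebra_mult_times[symmetric] free_algebra_mult_def by (simp add: act_sum act_single)
qed

lemma act_linear: "act t f (u + v) = act t f u + act t f v" "act t f (scl c u) = scl c (act t f u)"
  by (simp_all add: act_def foldr_add foldr_scl scl_add sum.distrib scl_sum mult.commute)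

lemma act_0: "act t f 0 = 0" using act_linear(2)[of f 0 0] by simp

end

text \<open>The length is fixed because on words too short for \<open>T q j\<close> the operator is
  zero and the quadratic relation fails.\<close>

definition word_space :: "nat \<Rightarrow> (nat list \<Rightarrow> 'f::field) set" where
  "word_space n = {v. \<forall>w. length w \<noteq> n \<longrightarrow> v w = 0}"

lemma word_space_closed: "0 \<in> word_space n" "u \<in> word_space n \<Longrightarrow> v \<in> word_space n \<Longrightarrow> u + v \<in> word_space n" "u \<in> word_space n \<Longrightarrow> scl c u \<in> word_space n"
  by (auto simp: word_space_def fun_apply_simps)

lemma word_space_sum: "(\<And>a. a \<in> A \<Longrightarrow> F a \<in> word_space n) \<Longrightarrow> sum F A \<in> word_space n"
  by (induction A rule: infinite_finite_induct) (auto intro: word_space_closed)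

lemma weight_space_word_space: "v \<in> weight_space \<alpha> \<Longrightarrow> size \<alpha> = n \<Longrightarrow> v \<in> word_space n"
  by (auto simp: weight_space_def word_space_def)

locale hecke_action = linear_action t for t :: "nat \<Rightarrow> (nat list \<Rightarrow> 'f::field) \<Rightarrow> (nat list \<Rightarrow> 'f)" +
  fixes q :: 'f and n :: nat
  assumes t_word_space: "v \<in> word_space n \<Longrightarrow> t i v \<in> word_space n"
    and quad: "1 \<le> i \<Longrightarrow> i < n \<Longrightarrow> v \<in> word_space n \<Longrightarrow> t i (t i v) = scl (q - 1) (t i v) + scl q v"
    and braid: "1 \<le> i \<Longrightarrow> i + 1 < n \<Longrightarrow> v \<in> word_space n \<Longrightarrow> t i (t (i + 1) (t i v)) = t (i + 1) (t i (t (i + 1) v))"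
    and comm: "1 \<le> i \<Longrightarrow> i + 1 < j \<Longrightarrow> j < n \<Longrightarrow> v \<in> word_space n \<Longrightarrow> t i (t j v) = t j (t i v)"
begin

lemma act_word_space: "v \<in> word_space n \<Longrightarrow> act t f v \<in> word_space n"
proof -
  assume v: "v \<in> word_space n"
  have "foldr t u v \<in> word_space n" for u by (induction u) (auto simp: v t_word_space)
  then show ?thesis unfolding act_def by (intro word_space_sum word_space_closed)
qed

lemma act_relations:
  assumes "f \<in> hecke_relations n q" "v \<in> word_space n"
  shows "act t f v = 0"
proof -
  from assms(1) consider
    i where "1 \<le> i" "i + 1 < n" "f = Poly_Mapping.single [i, i + 1, i] 1 - Poly_Mapping.single [i + 1, i, i + 1] 1"
    | i j where "1 \<le> i" "i + 1 < j" "j < n" "f = Poly_Mapping.single [i, j] 1 - Poly_Mapping.single [j, i] 1"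
    | i where "1 \<le> i" "i < n" "f = (Poly_Mapping.single [i] 1 - Poly_Mapping.single [] q) *
        (Poly_Mapping.single [i] 1 + Poly_Mapping.single [] 1)"
    unfolding hecke_relations_def free_algebra_mult_times by blast
  then show ?thesis
  proof cases
    case 1 show ?thesis unfolding 1(3) using braid[OF 1(1,2) assms(2)] by (simp add: act_minus act_single)
  next
    case 2 show ?thesis unfolding 2(4) using comm[OF 2(1-3) assms(2)] by (simp add: act_minus act_single)
  next
    case 3
    have "act t f v = t i (t i v) + t i v - scl q (t i v) - scl q v"
      unfolding 3(3) by (simp add: act_mult act_minus act_add act_single t_add scl_add algebra_simps)
    then show ?thesis using quad[OF 3(1,2) assms(2)] by (auto simp: fun_eq_iff fun_apply_simps algebra_simps)
  qed
qed

text \<open>The polynomials annihilating \<open>word_space n\<close> form a two-sided ideal, as the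
  space is stable under the action, and this ideal contains the relations.\<close>

lemma act_ideal:
  assumes "f \<in> hecke_ideal n q" "v \<in> word_space n"
  shows "act t f v = 0"
proof -
  interpret R: ring "FA n" by (rule ring_free_algebra)
  let ?J = "{f \<in> carrier (FA n). \<forall>v\<in>word_space n. act t f v = 0}"
  have inv: "\<ominus>\<^bsub>FA n\<^esub> f = - f" if "f \<in> carrier (FA n)" for f
    by (rule R.minus_equality) (use that in auto)
  have "ideal ?J (FA n)"
  proof (rule idealI[OF ring_free_algebra])
    show "subgroup ?J (add_monoid (FA n))"
    proof (rule group.subgroupI[OF R.a_group])
      show "inv\<^bsub>add_monoid (FA n)\<^esub> a \<in> ?J" if "a \<in> ?J" for a
      proof -
        have "inv\<^bsub>add_monoid (FA n)\<^esub> a = - a" using inv[of a] that unfolding a_inv_def by blast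
        then show ?thesis using that act_minus[of t 0 a] by auto
      qed
      show "a \<otimes>\<^bsub>add_monoid (FA n)\<^esub> b \<in> ?J" if "a \<in> ?J" "b \<in> ?J" for a b
        using that R.a_closed[of a b] by (auto simp: act_add)
      have "0 \<in> ?J" by simp
      then show "?J \<noteq> {}" by blast
    qed auto
    show "x \<otimes>\<^bsub>FA n\<^esub> a \<in> ?J" "a \<otimes>\<^bsub>FA n\<^esub> x \<in> ?J" if "a \<in> ?J" "x \<in> carrier (FA n)" for a x
      using that R.m_closed[of x a] R.m_closed[of a x] act_word_space by (auto simp: act_mult act_0)
  qed
  then have "hecke_ideal n q \<subseteq> ?J"
    unfolding hecke_ideal_def by (rule R.genideal_minimal) (use hecke_relations_carrier act_relations in blast)
  then show ?thesis using assms by blast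
qed

text \<open>By \<open>act_ideal\<close> the chosen representative does not influence the value on
  \<open>word_space n\<close>; elsewhere it may.\<close>

definition rho where "rho X v = act t (SOME f. f \<in> X) v"

lemma rho_hecke_class:
  assumes "f \<in> carrier (FA n)" "v \<in> word_space n"
  shows "rho (hecke_class n q f) v = act t f v"
proof -
  have "(SOME g. g \<in> hecke_class n q f) \<in> hecke_class n q f" using hecke_class_self[OF assms(1)] by (rule someI)
  then obtain i where "i \<in> hecke_ideal n q" "(SOME g. g \<in> hecke_class n q f) = i + f" by (auto simp: hecke_class_mem)
  then show ?thesis using act_ideal assms(2) by (simp add: rho_def act_add)
qed

lemma rho_simps:
  assumes "v \<in> word_space n"
  shows "rho (hecke_scalar n q c) v = scl c v" "1 \<le> i \<Longrightarrow> i < n \<Longrightarrow> rho (hecke_gen n q i) v = t i v"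
    "rho \<one>\<^bsub>hecke n q\<^esub> v = v"
    "X \<in> carrier (hecke n q) \<Longrightarrow> Y \<in> carrier (hecke n q) \<Longrightarrow> rho (X \<oplus>\<^bsub>hecke n q\<^esub> Y) v = rho X v + rho Y v"
    "X \<in> carrier (hecke n q) \<Longrightarrow> Y \<in> carrier (hecke n q) \<Longrightarrow> rho (X \<otimes>\<^bsub>hecke n q\<^esub> Y) v = rho X (rho Y v)"
    "X \<in> carrier (hecke n q) \<Longrightarrow> rho X v \<in> word_space n"
proof -
  interpret R: ring "FA n" by (rule ring_free_algebra)
  show "rho (hecke_scalar n q c) v = scl c v"
    unfolding hecke_scalar_hecke_class by (subst rho_hecke_class) (auto simp: assms act_single)
  show "1 \<le> i \<Longrightarrow> i < n \<Longrightarrow> rho (hecke_gen n q i) v = t i v"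
    unfolding hecke_gen_hecke_class by (subst rho_hecke_class) (auto simp: assms act_single)
  show "rho \<one>\<^bsub>hecke n q\<^esub> v = v"
    unfolding hecke_class_one using R.one_closed by (subst rho_hecke_class) (auto simp: assms act_one)
  show "X \<in> carrier (hecke n q) \<Longrightarrow> Y \<in> carrier (hecke n q) \<Longrightarrow> rho (X \<oplus>\<^bsub>hecke n q\<^esub> Y) v = rho X v + rho Y v"
  proof -
    assume "X \<in> carrier (hecke n q)" "Y \<in> carrier (hecke n q)"
    then obtain f g where "f \<in> carrier (FA n)" "X = hecke_class n q f" "g \<in> carrier (FA n)" "Y = hecke_class n q g"
      by (metis hecke_carrierE)
    then show ?thesis using R.a_closed[of f g] assms by (simp add: hecke_class_add rho_hecke_class act_add)
  qed
  show "X \<in> carrier (hecke n q) \<Longrightarrow> Y \<in> carrier (hecke n q) \<Longrightarrow> rho (X \<otimes>\<^bsub>hecke n q\<^esub> Y) v = rho X (rho Y v)"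
  proof -
    assume "X \<in> carrier (hecke n q)" "Y \<in> carrier (hecke n q)"
    then obtain f g where "f \<in> carrier (FA n)" "X = hecke_class n q f" "g \<in> carrier (FA n)" "Y = hecke_class n q g"
      by (metis hecke_carrierE)
    then show ?thesis using R.m_closed[of f g] assms by (simp add: hecke_class_mult rho_hecke_class act_mult act_word_space)
  qed
  show "X \<in> carrier (hecke n q) \<Longrightarrow> rho X v \<in> word_space n" unfolding rho_def using assms act_word_space by blast
qed

lemma rho_linear: "rho X (u + v) = rho X u + rho X v" "rho X (scl c u) = scl c (rho X u)" "rho X 0 = 0"
  unfolding rho_def by (rule act_linear act_0)+

end

lemma hecke_action_T: "hecke_action (\<lambda>i. T q (i - 1)) q n"
proof
  fix v :: "nat list \<Rightarrow> 'a" and i :: nat assume v: "v \<in> word_space n"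
  show "T q (i - 1) v \<in> word_space n"
    unfolding word_space_def
  proof safe
    fix w :: "nat list" assume "length w \<noteq> n"
    then have "v w = 0" "v (swap_at (i - 1) w) = 0" using v by (auto simp: word_space_def)
    then show "T q (i - 1) v w = 0" by (cases "Suc (i - 1) < length w") (auto simp: T_nth T_short)
  qed
next
  fix v :: "nat list \<Rightarrow> 'a" and i :: nat assume "1 \<le> i" "i < n" "v \<in> word_space n"
  then show "T q (i - 1) (T q (i - 1) v) = scl (q - 1) (T q (i - 1) v) + scl q v"
    by (intro T_quad_length[of n]) (auto simp: word_space_def)
next
  fix v :: "nat list \<Rightarrow> 'a" and i :: nat assume "1 \<le> i"
  then obtain j where "i = Suc j" by (cases i) auto
  then show "T q (i - 1) (T q (i + 1 - 1) (T q (i - 1) v)) = T q (i + 1 - 1) (T q (i - 1) (T q (i + 1 - 1) v))"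
    using T_braid[of q j v] by simp
next
  fix v :: "nat list \<Rightarrow> 'a" and i j :: nat assume "1 \<le> i" "i + 1 < j"
  then show "T q (i - 1) (T q (j - 1) v) = T q (j - 1) (T q (i - 1) v)" by (intro T_comm) auto
qed (auto simp: T_add T_scl)

lemma hecke_action_S: "hecke_action (\<lambda>i. S q (i - 1)) q n"
proof
  fix v :: "nat list \<Rightarrow> 'a" and i :: nat assume v: "v \<in> word_space n"
  then show "S q (i - 1) v \<in> word_space n" using S_length[of n v] unfolding word_space_def by blast
next
  fix v :: "nat list \<Rightarrow> 'a" and i :: nat assume i: "1 \<le> i" "i < n" "v \<in> word_space n"
  then have "T q (i - 1) (T q (i - 1) v) = scl (q - 1) (T q (i - 1) v) + scl q v"
    by (intro T_quad_length[of n]) (auto simp: word_space_def)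
  then show "S q (i - 1) (S q (i - 1) v) = scl (q - 1) (S q (i - 1) v) + scl q v"
    by (auto simp: S_def T_minus T_scl fun_eq_iff fun_apply_simps algebra_simps)
next
  fix v :: "nat list \<Rightarrow> 'a" and i :: nat assume i: "1 \<le> i" "i + 1 < n" "v \<in> word_space n"
  then obtain j where "i = Suc j" by (cases i) auto
  then show "S q (i - 1) (S q (i + 1 - 1) (S q (i - 1) v)) = S q (i + 1 - 1) (S q (i - 1) (S q (i + 1 - 1) v))"
    using S_braid[of n v j q] i by (simp add: word_space_def)
next
  fix v :: "nat list \<Rightarrow> 'a" and i j :: nat assume "1 \<le> i" "i + 1 < j"
  then show "S q (i - 1) (S q (j - 1) v) = S q (j - 1) (S q (i - 1) v)" by (intro S_comm) auto
qed (auto simp: S_def T_add T_scl scl_add fun_eq_iff fun_apply_simps algebra_simps)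

section \<open>The sign twist\<close>

lemma weight_space_induct [consumes 1, case_names zero add]:
  assumes v: "v \<in> weight_space \<alpha>" and zero: "P 0"
    and add: "\<And>u c w. u \<in> weight_space \<alpha> \<Longrightarrow> mset w = \<alpha> \<Longrightarrow> P u \<Longrightarrow> P (u + scl c (word_vec w))"
  shows "P v"
proof -
  let ?g = "\<lambda>A. \<Sum>w\<in>A. scl (v w) (word_vec w)"
  have "?g A \<in> weight_space \<alpha> \<and> P (?g A)" if "A \<subseteq> {w. mset w = \<alpha>}" for A
    using finite_subset[OF that finite_words] that
  proof (induction A rule: finite_induct)
    case (insert w A)
    then have "P (?g A + scl (v w) (word_vec w))" by (intro add) auto
    then show ?case using insert by (auto simp: add.commute intro: weight_space_add weight_space_scl weight_space_word_vec)
  qed (simp add: zero)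
  from this[OF subset_refl] show ?thesis using weight_space_expand[OF v] by simp
qed

lemma single_Nil_central: "Poly_Mapping.single [] c * f = f * (Poly_Mapping.single [] c :: nat list \<Rightarrow>\<^sub>0 'f::field)"
proof -
  have "Poly_Mapping.single [] c * (\<Sum>u\<in>Poly_Mapping.keys f. Poly_Mapping.single u (Poly_Mapping.lookup f u)) =
     (\<Sum>u\<in>Poly_Mapping.keys f. Poly_Mapping.single u (Poly_Mapping.lookup f u)) * Poly_Mapping.single [] c"
    by (simp add: sum_distrib_left sum_distrib_right mult_single plus_list_def mult.commute)
  then show ?thesis using poly_mapping_expand[of f] by simp
qed

lemma hecke_class_eqI:
  assumes "f \<in> carrier (FA n)" "g \<in> carrier (FA n)" "f - g \<in> hecke_ideal n q"
  shows "hecke_class n q f = hecke_class n q g"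
proof -
  interpret R: ring "FA n :: (nat list \<Rightarrow>\<^sub>0 'a) ring" by (rule ring_free_algebra)
  interpret I: ideal "hecke_ideal n q" "FA n" by (rule ideal_hecke)
  have "h \<in> hecke_class n q f \<longleftrightarrow> h \<in> hecke_class n q g" for h
  proof -
    have neg: "- i \<in> hecke_ideal n q" if "i \<in> hecke_ideal n q" for i
    proof -
      have "\<ominus>\<^bsub>FA n\<^esub> i = - i" by (rule R.minus_equality) (use that I.a_Hcarr in auto)
      then show ?thesis using I.a_inv_closed[OF that] by simp
    qed
    have add: "i + j \<in> hecke_ideal n q" if "i \<in> hecke_ideal n q" "j \<in> hecke_ideal n q" for i j
      using I.a_closed[OF that] by simp
    show ?thesis
    proof
      assume "h \<in> hecke_class n q f"
      then obtain i where "i \<in> hecke_ideal n q" "h = i + f" by (auto simp: hecke_class_mem)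
      then have "i + (f - g) \<in> hecke_ideal n q" "h = (i + (f - g)) + g" using add assms(3) by auto
      then show "h \<in> hecke_class n q g" unfolding hecke_class_mem by blast
    next
      assume "h \<in> hecke_class n q g"
      then obtain i where "i \<in> hecke_ideal n q" "h = i + g" by (auto simp: hecke_class_mem)
      then have "i + (- (f - g)) \<in> hecke_ideal n q" "h = (i + (- (f - g))) + f"
        using add[OF _ neg[OF assms(3)]] by (blast, simp)
      then show "h \<in> hecke_class n q f" unfolding hecke_class_mem by blast
    qed
  qed
  then show ?thesis by blast
qed

text \<open>In the signed case \<open>T\<close> becomes \<open>q - 1 - T\<close>, which interchanges
  the roots \<open>q\<close> and \<open>- 1\<close> of the quadratic relation. The generator has
  index \<open>j + 1\<close> because positions are counted from 0.\<close>

definition twisted_poly :: "bool \<Rightarrow> 'f::field \<Rightarrow> nat \<Rightarrow> (nat list \<Rightarrow>\<^sub>0 'f)" where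
  "twisted_poly sg q j = (if sg then Poly_Mapping.single [] (q - 1) - Poly_Mapping.single [Suc j] 1 else Poly_Mapping.single [Suc j] 1)"

definition twisted_gen :: "bool \<Rightarrow> nat \<Rightarrow> 'f::field \<Rightarrow> nat \<Rightarrow> (nat list \<Rightarrow>\<^sub>0 'f) set" where
  "twisted_gen sg n q j = hecke_class n q (twisted_poly sg q j)"

lemma keys_diff_carrier: "a \<in> carrier (FA n) \<Longrightarrow> b \<in> carrier (FA n) \<Longrightarrow> a - b \<in> carrier (FA n)"
  using keys_diff[of a b] by auto

lemma twisted_poly_carrier: "Suc j < n \<Longrightarrow> twisted_poly sg q j \<in> carrier (FA n)"
  unfolding twisted_poly_def
  by (cases sg; simp only: if_True if_False; intro keys_diff_carrier single_carrier; simp)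

context
  fixes n :: nat and q :: "'f::field"
begin

interpretation R: ring "FA n :: (nat list \<Rightarrow>\<^sub>0 'f) ring" by (rule ring_free_algebra)
interpretation I: ideal "hecke_ideal n q" "FA n" by (rule ideal_hecke)

lemma ideal_closed:
  "i \<in> hecke_ideal n q \<Longrightarrow> j \<in> hecke_ideal n q \<Longrightarrow> i + j \<in> hecke_ideal n q"
  "i \<in> hecke_ideal n q \<Longrightarrow> f \<in> carrier (FA n) \<Longrightarrow> f * i \<in> hecke_ideal n q"
  "i \<in> hecke_ideal n q \<Longrightarrow> - i \<in> hecke_ideal n q"
  "i \<in> hecke_ideal n q \<Longrightarrow> j \<in> hecke_ideal n q \<Longrightarrow> i - j \<in> hecke_ideal n q"
proof -
  show 1: "i \<in> hecke_ideal n q \<Longrightarrow> j \<in> hecke_ideal n q \<Longrightarrow> i + j \<in> hecke_ideal n q" for i j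
    using I.a_closed by simp
  show "i \<in> hecke_ideal n q \<Longrightarrow> f \<in> carrier (FA n) \<Longrightarrow> f * i \<in> hecke_ideal n q" for i f
    using I.I_l_closed[of i f] by simp
  show 2: "- i \<in> hecke_ideal n q" if "i \<in> hecke_ideal n q" for i
  proof -
    have "\<ominus>\<^bsub>FA n\<^esub> i = - i" by (rule R.minus_equality) (use that I.a_Hcarr in auto)
    then show ?thesis using I.a_inv_closed[OF that] by simp
  qed
  show "i \<in> hecke_ideal n q \<Longrightarrow> j \<in> hecke_ideal n q \<Longrightarrow> i - j \<in> hecke_ideal n q" for i j
    using 1[of i "- j"] 2[of j] by simp
qed

lemma relation_mem: "f \<in> hecke_relations n q \<Longrightarrow> f \<in> hecke_ideal n q"
  unfolding hecke_ideal_def using R.genideal_self[OF hecke_relations_carrier] by blast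

lemma
  assumes "1 \<le> i"
  shows rel_quad: "i < n \<Longrightarrow> Poly_Mapping.single [i] 1 * Poly_Mapping.single [i] 1 - Poly_Mapping.single [] (q - 1) * Poly_Mapping.single [i] 1
        - Poly_Mapping.single [] q \<in> hecke_ideal n q"
    and rel_braid: "i + 1 < n \<Longrightarrow> Poly_Mapping.single [i] 1 * (Poly_Mapping.single [i + 1] 1 * Poly_Mapping.single [i] 1)
        - Poly_Mapping.single [i + 1] 1 * (Poly_Mapping.single [i] 1 * Poly_Mapping.single [i + 1] 1) \<in> hecke_ideal n q"
    and rel_comm: "i + 1 < j \<Longrightarrow> j < n \<Longrightarrow> Poly_Mapping.single [i] 1 * Poly_Mapping.single [j] 1
        - Poly_Mapping.single [j] 1 * Poly_Mapping.single [i] 1 \<in> hecke_ideal n q"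
proof -
  assume i: "i < n"
  have "free_algebra_mult (Poly_Mapping.single [i] 1 - Poly_Mapping.single [] q)
          (Poly_Mapping.single [i] 1 + Poly_Mapping.single [] 1) \<in> hecke_ideal n q"
    by (rule relation_mem) (use i assms in \<open>auto simp: hecke_relations_def\<close>)
  moreover have "free_algebra_mult (Poly_Mapping.single [i] 1 - Poly_Mapping.single [] q)
          (Poly_Mapping.single [i] 1 + Poly_Mapping.single [] 1) =
      Poly_Mapping.single [i] 1 * Poly_Mapping.single [i] 1 - Poly_Mapping.single [] (q - 1) * Poly_Mapping.single [i] 1
        - Poly_Mapping.single [] q"
    by (simp add: free_algebra_mult_times algebra_simps mult_single plus_list_def single_diff)
  ultimately show "Poly_Mapping.single [i] 1 * Poly_Mapping.single [i] 1 - Poly_Mapping.single [] (q - 1) * Poly_Mapping.single [i] 1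
        - Poly_Mapping.single [] q \<in> hecke_ideal n q" by simp
next
  assume i: "i + 1 < n"
  have "Poly_Mapping.single [i, i + 1, i] 1 - Poly_Mapping.single [i + 1, i, i + 1] 1 \<in> hecke_ideal n q"
    by (rule relation_mem) (use i assms in \<open>auto simp: hecke_relations_def\<close>)
  then show "Poly_Mapping.single [i] 1 * (Poly_Mapping.single [i + 1] 1 * Poly_Mapping.single [i] 1)
        - Poly_Mapping.single [i + 1] 1 * (Poly_Mapping.single [i] 1 * Poly_Mapping.single [i + 1] 1) \<in> hecke_ideal n q"
    by (simp add: mult_single plus_list_def)
next
  assume i: "i + 1 < j" "j < n"
  have "Poly_Mapping.single [i, j] 1 - Poly_Mapping.single [j, i] 1 \<in> hecke_ideal n q"
    by (rule relation_mem) (use i assms in \<open>auto simp: hecke_relations_def\<close>)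
  then show "Poly_Mapping.single [i] 1 * Poly_Mapping.single [j] 1
        - Poly_Mapping.single [j] 1 * Poly_Mapping.single [i] 1 \<in> hecke_ideal n q"
    by (simp add: mult_single plus_list_def)
qed

lemma FA_mult: "f \<in> carrier (FA n) \<Longrightarrow> g \<in> carrier (FA n) \<Longrightarrow> f * g \<in> carrier (FA n :: (nat list \<Rightarrow>\<^sub>0 'f) ring)"
  using R.m_closed by simp

lemma FA_add: "f \<in> carrier (FA n) \<Longrightarrow> g \<in> carrier (FA n) \<Longrightarrow> f + g \<in> carrier (FA n :: (nat list \<Rightarrow>\<^sub>0 'f) ring)"
  using R.a_closed by simp

lemma twisted_gen_quad:
  assumes "Suc j < n"
  shows "twisted_gen sg n q j \<otimes>\<^bsub>hecke n q\<^esub> twisted_gen sg n q j =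
    (hecke_scalar n q (q - 1) \<otimes>\<^bsub>hecke n q\<^esub> twisted_gen sg n q j) \<oplus>\<^bsub>hecke n q\<^esub> hecke_scalar n q q"
proof -
  define c where "c = (Poly_Mapping.single [] (q - 1) :: nat list \<Rightarrow>\<^sub>0 'f)"
  define d where "d = (Poly_Mapping.single [] q :: nat list \<Rightarrow>\<^sub>0 'f)"
  define A where "A = (Poly_Mapping.single [Suc j] 1 :: nat list \<Rightarrow>\<^sub>0 'f)"
  let ?t = "twisted_poly sg q j"
  have t: "?t \<in> carrier (FA n)" by (rule twisted_poly_carrier[OF assms])
  have c: "c \<in> carrier (FA n)" and d: "d \<in> carrier (FA n)"
    unfolding c_def d_def by (rule single_carrier, simp)+
  have rel: "A * A - c * A - d \<in> hecke_ideal n q"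
    unfolding A_def c_def d_def using rel_quad[of "Suc j"] assms by simp
  have cA: "c * A = A * c" unfolding c_def by (rule single_Nil_central)
  have "?t * ?t - (c * ?t + d) = A * A - c * A - d"
    by (cases sg) (simp_all add: twisted_poly_def A_def[symmetric] c_def[symmetric] algebra_simps cA)
  then have "hecke_class n q (?t * ?t) = hecke_class n q (c * ?t + d)"
    using rel by (intro hecke_class_eqI FA_mult FA_add t c d) (simp only:)
  then show ?thesis
    unfolding twisted_gen_def hecke_scalar_hecke_class c_def[symmetric] d_def[symmetric]
    by (simp only: hecke_class_mult[OF t t] hecke_class_mult[OF c t] hecke_class_add[OF FA_mult[OF c t] d])
qed

lemma twisted_gen_braid:
  assumes "Suc (Suc j) < n"
  shows "twisted_gen sg n q j \<otimes>\<^bsub>hecke n q\<^esub> (twisted_gen sg n q (Suc j) \<otimes>\<^bsub>hecke n q\<^esub> twisted_gen sg n q j) =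
    twisted_gen sg n q (Suc j) \<otimes>\<^bsub>hecke n q\<^esub> (twisted_gen sg n q j \<otimes>\<^bsub>hecke n q\<^esub> twisted_gen sg n q (Suc j))"
proof -
  define c where "c = (Poly_Mapping.single [] (q - 1) :: nat list \<Rightarrow>\<^sub>0 'f)"
  define d where "d = (Poly_Mapping.single [] q :: nat list \<Rightarrow>\<^sub>0 'f)"
  define A where "A = (Poly_Mapping.single [Suc j] 1 :: nat list \<Rightarrow>\<^sub>0 'f)"
  define B where "B = (Poly_Mapping.single [Suc (Suc j)] 1 :: nat list \<Rightarrow>\<^sub>0 'f)"
  let ?t = "twisted_poly sg q j" and ?s = "twisted_poly sg q (Suc j)"
  have t: "?t \<in> carrier (FA n)" "?s \<in> carrier (FA n)" using assms by (intro twisted_poly_carrier; simp)+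
  have c: "c \<in> carrier (FA n)" unfolding c_def by (rule single_carrier) simp
  have r1: "A * A - c * A - d \<in> hecke_ideal n q" "B * B - c * B - d \<in> hecke_ideal n q"
    unfolding A_def B_def c_def d_def using rel_quad[of "Suc j"] rel_quad[of "Suc (Suc j)"] assms by simp_all
  have r2: "A * (B * A) - B * (A * B) \<in> hecke_ideal n q"
    unfolding A_def B_def using rel_braid[of "Suc j"] assms by simp
  have cx: "x * c = c * x" for x unfolding c_def by (rule single_Nil_central[symmetric])
  have cA: "A * c = c * A" "B * c = c * B" "A * (c * x) = c * (A * x)" "B * (c * x) = c * (B * x)" for x
    using cx by (metis mult.assoc)+
  have "?t * (?s * ?t) - ?s * (?t * ?s) \<in> hecke_ideal n q"
  proof (cases sg)
    case True
    \<comment> \<open>The cubic terms give the braid relation and the lower ones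
      \<open>q - 1\<close> times two quadratic relations, whose constants \<open>d\<close>
      cancel.\<close>
    have "?t * (?s * ?t) - ?s * (?t * ?s) =
      c * (A * A - c * A - d) - c * (B * B - c * B - d) - (A * (B * A) - B * (A * B))"
      using True by (simp add: twisted_poly_def A_def[symmetric] B_def[symmetric] c_def[symmetric] algebra_simps cA)
    then show ?thesis
      using ideal_closed(4)[OF ideal_closed(4)[OF ideal_closed(2)[OF r1(1) c] ideal_closed(2)[OF r1(2) c]] r2]
      by (simp only:)
  next
    case False then show ?thesis using r2 by (simp add: twisted_poly_def A_def B_def)
  qed
  then have "hecke_class n q (?t * (?s * ?t)) = hecke_class n q (?s * (?t * ?s))"
    by (intro hecke_class_eqI FA_mult t)
  then show ?thesis
    unfolding twisted_gen_def by (simp only: hecke_class_mult[OF t(2) t(1)] hecke_class_mult[OF t(1) t(2)] hecke_class_mult[OF t(1) FA_mult[OF t(2,1)]] hecke_class_mult[OF t(2) FA_mult[OF t(1,2)]])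
qed

lemma twisted_gen_comm:
  assumes "Suc j < k" "Suc k < n"
  shows "twisted_gen sg n q j \<otimes>\<^bsub>hecke n q\<^esub> twisted_gen sg n q k = twisted_gen sg n q k \<otimes>\<^bsub>hecke n q\<^esub> twisted_gen sg n q j"
proof -
  define c where "c = (Poly_Mapping.single [] (q - 1) :: nat list \<Rightarrow>\<^sub>0 'f)"
  define A where "A = (Poly_Mapping.single [Suc j] 1 :: nat list \<Rightarrow>\<^sub>0 'f)"
  define B where "B = (Poly_Mapping.single [Suc k] 1 :: nat list \<Rightarrow>\<^sub>0 'f)"
  let ?t = "twisted_poly sg q j" and ?s = "twisted_poly sg q k"
  have t: "?t \<in> carrier (FA n)" "?s \<in> carrier (FA n)" using assms by (intro twisted_poly_carrier; simp)+
  have r: "A * B - B * A \<in> hecke_ideal n q" unfolding A_def B_def using rel_comm[of "Suc j" "Suc k"] assms by simp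
  have cA: "A * c = c * A" "B * c = c * B" unfolding c_def using single_Nil_central[of "q - 1"] by simp_all
  have "?t * ?s - ?s * ?t = A * B - B * A"
    by (cases sg) (simp_all add: twisted_poly_def A_def[symmetric] B_def[symmetric] c_def[symmetric] algebra_simps cA)
  then have "hecke_class n q (?t * ?s) = hecke_class n q (?s * ?t)" using r by (intro hecke_class_eqI FA_mult t) simp
  then show ?thesis unfolding twisted_gen_def by (simp only: hecke_class_mult[OF t(1) t(2)] hecke_class_mult[OF t(2) t(1)])
qed

lemma scalar_central:
  assumes "X \<in> carrier (hecke n q)"
  shows "hecke_scalar n q c \<otimes>\<^bsub>hecke n q\<^esub> X = X \<otimes>\<^bsub>hecke n q\<^esub> hecke_scalar n q c"
proof -
  obtain f where f: "f \<in> carrier (FA n)" "X = hecke_class n q f" using assms by (rule hecke_carrierE)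
  have s: "Poly_Mapping.single [] c \<in> carrier (FA n)" by (rule single_carrier) simp
  show ?thesis unfolding hecke_scalar_hecke_class f(2) by (simp only: hecke_class_mult[OF f(1) s] hecke_class_mult[OF s f(1)] single_Nil_central)
qed

lemma scalar_add: "hecke_scalar n q a \<oplus>\<^bsub>hecke n q\<^esub> hecke_scalar n q b = hecke_scalar n q (a + b)"
proof -
  have s: "Poly_Mapping.single [] c \<in> carrier (FA n)" for c :: 'f by (rule single_carrier) simp
  show ?thesis unfolding hecke_scalar_hecke_class by (simp only: hecke_class_add[OF s s] single_add)
qed

lemma scalar_mult: "hecke_scalar n q a \<otimes>\<^bsub>hecke n q\<^esub> hecke_scalar n q b = hecke_scalar n q (a * b)"
proof -
  have s: "Poly_Mapping.single [] c \<in> carrier (FA n)" for c :: 'f by (rule single_carrier) simp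
  show ?thesis unfolding hecke_scalar_hecke_class by (simp add: hecke_class_mult[OF s s] mult_single plus_list_def del: free_algebra_simps)
qed

lemma scalar_one: "hecke_scalar n q 1 = \<one>\<^bsub>hecke n q\<^esub>"
  unfolding hecke_scalar_hecke_class hecke_class_one by (simp add: zero_list_def[symmetric] single_one)

lemma twisted_gen_carrier: "Suc j < n \<Longrightarrow> twisted_gen sg n q j \<in> carrier (hecke n q)"
  unfolding twisted_gen_def by (rule hecke_class_carrier[OF twisted_poly_carrier])

lemma gen_twisted_gen:
  assumes "Suc j < n"
  shows "twisted_gen False n q j = hecke_gen n q (Suc j)"
    "twisted_gen True n q j = hecke_scalar n q (q - 1) \<oplus>\<^bsub>hecke n q\<^esub> (hecke_scalar n q (- 1) \<otimes>\<^bsub>hecke n q\<^esub> hecke_gen n q (Suc j))"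
    "hecke_gen n q (Suc j) = hecke_scalar n q (q - 1) \<oplus>\<^bsub>hecke n q\<^esub> (hecke_scalar n q (- 1) \<otimes>\<^bsub>hecke n q\<^esub> twisted_gen True n q j)"
proof -
  have s: "Poly_Mapping.single [] c \<in> carrier (FA n)" for c :: 'f by (rule single_carrier) simp
  have g: "Poly_Mapping.single [Suc j] 1 \<in> carrier (FA n :: (nat list \<Rightarrow>\<^sub>0 'f) ring)" by (rule single_carrier) (use assms in auto)
  have m: "Poly_Mapping.single [] (- 1) * f = - f" for f :: "nat list \<Rightarrow>\<^sub>0 'f"
  proof -
    have "Poly_Mapping.single [] (- 1) = (- 1 :: nat list \<Rightarrow>\<^sub>0 'f)"
      using single_uminus[of "[] :: nat list" "1::'f"] by (simp add: zero_list_def[symmetric] single_one)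
    then show ?thesis by simp
  qed
  show "twisted_gen False n q j = hecke_gen n q (Suc j)" by (simp add: twisted_gen_def twisted_poly_def hecke_gen_hecke_class)
  show "twisted_gen True n q j = hecke_scalar n q (q - 1) \<oplus>\<^bsub>hecke n q\<^esub> (hecke_scalar n q (- 1) \<otimes>\<^bsub>hecke n q\<^esub> hecke_gen n q (Suc j))"
    unfolding twisted_gen_def hecke_scalar_hecke_class hecke_gen_hecke_class
    by (simp only: hecke_class_mult[OF s g] hecke_class_add[OF s FA_mult[OF s g]]) (simp add: m twisted_poly_def)
  have t: "twisted_poly True q j \<in> carrier (FA n)" by (rule twisted_poly_carrier[OF assms])
  show "hecke_gen n q (Suc j) = hecke_scalar n q (q - 1) \<oplus>\<^bsub>hecke n q\<^esub> (hecke_scalar n q (- 1) \<otimes>\<^bsub>hecke n q\<^esub> twisted_gen True n q j)"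
    unfolding twisted_gen_def hecke_scalar_hecke_class hecke_gen_hecke_class
    by (simp only: hecke_class_mult[OF s t] hecke_class_add[OF s FA_mult[OF s t]]) (simp add: m twisted_poly_def)
qed

end

text \<open>The operator by which an original generator acts. Under it the twisted generators act as
  the plain \<open>T q j\<close>, so signed and unsigned modules share the theory of words.\<close>

definition twisted_T :: "bool \<Rightarrow> 'f::field \<Rightarrow> nat \<Rightarrow> (nat list \<Rightarrow> 'f) \<Rightarrow> nat list \<Rightarrow> 'f" where
  "twisted_T sg q = (\<lambda>i. if sg then S q (i - 1) else T q (i - 1))"

lemma hecke_action_twisted_T: "hecke_action (twisted_T sg q) q n"
  using hecke_action_T[of q n] hecke_action_S[of q n] by (cases sg) (simp_all add: twisted_T_def)

lemma twisted_T_weight_space: "u \<in> weight_space \<alpha> \<Longrightarrow> twisted_T sg q i u \<in> weight_space \<alpha>"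
  by (auto simp: twisted_T_def S_def weight_space_T weight_space_diff weight_space_scl)

lemma rho_weight_space:
  assumes "r \<in> carrier (hecke n q)" "u \<in> weight_space \<alpha>" "size \<alpha> = n"
  shows "hecke_action.rho (twisted_T sg q) r u \<in> weight_space \<alpha>"
proof -
  interpret A: hecke_action "twisted_T sg q" q n by (rule hecke_action_twisted_T)
  have v: "u \<in> word_space n" by (rule weight_space_word_space[OF assms(2,3)])
  show ?thesis
    using assms(1)
  proof (induction rule: hecke_induct)
    case (scalar c) then show ?case using A.rho_simps(1)[OF v] weight_space_scl[OF assms(2)] by simp
  next
    case (gen i Y)
    have "A.rho (hecke_gen n q i \<otimes>\<^bsub>hecke n q\<^esub> Y) u = twisted_T sg q i (A.rho Y u)"
      using A.rho_simps(5)[OF v hecke_gen_carrier[OF gen(1,2)] gen(3)] A.rho_simps(2)[OF A.rho_simps(6)[OF v gen(3)] gen(1,2)] by simp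
    then show ?case using gen twisted_T_weight_space by simp
  next
    case (add X Y)
    then show ?case using A.rho_simps(4)[OF v add(1,2)] weight_space_add by simp
  qed
qed

section \<open>Modules that are sums of realised cyclic modules\<close>

definition initial_word :: "nat list \<Rightarrow> nat list" where "initial_word lam = sorted_list_of_multiset (content lam)"

lemma initial_word [simp]: "sorted (initial_word lam)" "mset (initial_word lam) = content lam"
  by (simp_all add: initial_word_def)

lemma size_content_Par: "lam \<in> Par n \<Longrightarrow> size (content lam) = n"
  by (simp add: size_content Par_def)

lemma length_initial_word: "lam \<in> Par n \<Longrightarrow> length (initial_word lam) = n"
  by (metis size_content_Par size_mset initial_word(2))

definition eigenvalue :: "bool \<Rightarrow> 'f::field \<Rightarrow> 'f" where
  "eigenvalue sg q = (if sg then - 1 else q)"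

text \<open>The coordinates \<open>p x\<close> and the vectors \<open>cyc x\<close> are dual to each
  other: the former separate the summands, the latter generate. Generation is stated as an induction
  principle, ready for the comparison of two additive maps on \<open>V\<close>.\<close>

locale hecke_structure = left_module "hecke n q" V
  for n :: nat and q :: "'f::field" and V :: "((nat list \<Rightarrow>\<^sub>0 'f) set, 'v) module" +
  fixes sg :: bool and I :: "'i set" and lam :: "'i \<Rightarrow> nat list"
    and p :: "'i \<Rightarrow> 'v \<Rightarrow> nat list \<Rightarrow> 'f" and cyc :: "'i \<Rightarrow> 'v"
  assumes q0: "q \<noteq> 0" and lamP: "x \<in> I \<Longrightarrow> lam x \<in> Par n"
    and p_weight_space: "x \<in> I \<Longrightarrow> v \<in> carrier V \<Longrightarrow> p x v \<in> weight_space (content (lam x))"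
    and p_add: "x \<in> I \<Longrightarrow> v \<in> carrier V \<Longrightarrow> v' \<in> carrier V \<Longrightarrow> p x (v \<oplus>\<^bsub>V\<^esub> v') = p x v + p x v'"
    and p_rho: "x \<in> I \<Longrightarrow> r \<in> carrier (hecke n q) \<Longrightarrow> v \<in> carrier V \<Longrightarrow>
      p x (r \<odot>\<^bsub>V\<^esub> v) = hecke_action.rho (twisted_T sg q) r (p x v)"
    and cyc_closed: "x \<in> I \<Longrightarrow> cyc x \<in> carrier V"
    and cyc_eigen: "x \<in> I \<Longrightarrow> Suc j < n \<Longrightarrow> initial_word (lam x) ! j = initial_word (lam x) ! Suc j \<Longrightarrow>
      hecke_gen n q (Suc j) \<odot>\<^bsub>V\<^esub> cyc x = hecke_scalar n q (eigenvalue sg q) \<odot>\<^bsub>V\<^esub> cyc x"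
    and p_cyc: "x \<in> I \<Longrightarrow> y \<in> I \<Longrightarrow> p y (cyc x) = (if x = y then word_vec (initial_word (lam x)) else 0)"
    and generated: "\<And>P v. v \<in> carrier V \<Longrightarrow> P \<zero>\<^bsub>V\<^esub> \<Longrightarrow>
      (\<And>r x. r \<in> carrier (hecke n q) \<Longrightarrow> x \<in> I \<Longrightarrow> P (r \<odot>\<^bsub>V\<^esub> cyc x)) \<Longrightarrow>
      (\<And>a b. a \<in> carrier V \<Longrightarrow> b \<in> carrier V \<Longrightarrow> P a \<Longrightarrow> P b \<Longrightarrow> P (a \<oplus>\<^bsub>V\<^esub> b)) \<Longrightarrow>
      (\<And>a. a \<in> carrier V \<Longrightarrow> P a \<Longrightarrow> P (\<ominus>\<^bsub>V\<^esub> a)) \<Longrightarrow> P v"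
begin

interpretation A: hecke_action "twisted_T sg q" q n by (rule hecke_action_twisted_T)

abbreviation H where "H \<equiv> hecke n q"
abbreviation sc where "sc \<equiv> hecke_scalar n q"
abbreviation wt where "wt x \<equiv> content (lam x)"

lemma size_wt: "x \<in> I \<Longrightarrow> size (wt x) = n"
  using size_content_Par lamP by blast

lemma weight_space_word_space_wt: "x \<in> I \<Longrightarrow> u \<in> weight_space (wt x) \<Longrightarrow> u \<in> word_space n"
  by (rule weight_space_word_space[OF _ size_wt])

lemma smult_zero_right: "r \<in> carrier H \<Longrightarrow> r \<odot>\<^bsub>V\<^esub> \<zero>\<^bsub>V\<^esub> = \<zero>\<^bsub>V\<^esub>"
  using smult_r_distr[of r "\<zero>\<^bsub>V\<^esub>" "\<zero>\<^bsub>V\<^esub>"] smult_closed[of r "\<zero>\<^bsub>V\<^esub>"]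
  by (metis M.r_zero M.zero_closed M.add.l_cancel_one)

lemma sc_zero: "v \<in> carrier V \<Longrightarrow> sc 0 \<odot>\<^bsub>V\<^esub> v = \<zero>\<^bsub>V\<^esub>"
  using smult_l_distr[of "sc 0" "sc 0" v] smult_closed[of "sc 0" v] scalar_add[of n q 0 0]
  by (metis M.add.l_cancel_one add_0 hecke_scalar_carrier)

lemma sc_one: "v \<in> carrier V \<Longrightarrow> sc 1 \<odot>\<^bsub>V\<^esub> v = v"
  by (simp add: scalar_one)

lemma sc_mult: "v \<in> carrier V \<Longrightarrow> sc a \<odot>\<^bsub>V\<^esub> (sc b \<odot>\<^bsub>V\<^esub> v) = sc (a * b) \<odot>\<^bsub>V\<^esub> v"
  by (simp add: smult_assoc[symmetric] scalar_mult)

lemma sc_add: "v \<in> carrier V \<Longrightarrow> sc a \<odot>\<^bsub>V\<^esub> v \<oplus>\<^bsub>V\<^esub> sc b \<odot>\<^bsub>V\<^esub> v = sc (a + b) \<odot>\<^bsub>V\<^esub> v"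
  by (simp add: smult_l_distr[symmetric] scalar_add)

lemma sc_comm: "r \<in> carrier H \<Longrightarrow> v \<in> carrier V \<Longrightarrow> r \<odot>\<^bsub>V\<^esub> (sc a \<odot>\<^bsub>V\<^esub> v) = sc a \<odot>\<^bsub>V\<^esub> (r \<odot>\<^bsub>V\<^esub> v)"
  by (simp add: smult_assoc[symmetric] scalar_central)

text \<open>The eigenvalue becomes \<open>q\<close> in both cases: in the signed one it is
  \<open>(q - 1) - (- 1)\<close>.\<close>

lemma twisted_gen_eigen:
  assumes x: "x \<in> I" and j: "Suc j < n" "initial_word (lam x) ! j = initial_word (lam x) ! Suc j"
  shows "twisted_gen sg n q j \<odot>\<^bsub>V\<^esub> cyc x = sc q \<odot>\<^bsub>V\<^esub> cyc x"
proof (cases sg)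
  case False
  then show ?thesis using cyc_eigen[OF assms] gen_twisted_gen(1)[OF j(1), of q] by (simp add: eigenvalue_def)
next
  case True
  have g: "hecke_gen n q (Suc j) \<in> carrier H" using j by simp
  have "twisted_gen True n q j \<odot>\<^bsub>V\<^esub> cyc x = sc (q - 1) \<odot>\<^bsub>V\<^esub> cyc x \<oplus>\<^bsub>V\<^esub> sc (- 1) \<odot>\<^bsub>V\<^esub> (hecke_gen n q (Suc j) \<odot>\<^bsub>V\<^esub> cyc x)"
    unfolding gen_twisted_gen(2)[OF j(1)] using g cyc_closed[OF x] by (simp add: smult_l_distr smult_assoc)
  also have "\<dots> = sc q \<odot>\<^bsub>V\<^esub> cyc x"
    using cyc_eigen[OF assms] True cyc_closed[OF x] by (simp add: eigenvalue_def sc_mult sc_add)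
  finally show ?thesis using True by simp
qed

definition orbit_elem where
  "orbit_elem x = (SOME m. m (initial_word (lam x)) = cyc x \<and> (\<forall>w. mset w = wt x \<longrightarrow> m w \<in> carrier V) \<and>
    (\<forall>w j. mset w = wt x \<longrightarrow> Suc j < n \<longrightarrow> w ! j < w ! Suc j \<longrightarrow> twisted_gen sg n q j \<odot>\<^bsub>V\<^esub> m w = m (swap_at j w)) \<and>
    (\<forall>w j. mset w = wt x \<longrightarrow> Suc j < n \<longrightarrow> w ! j = w ! Suc j \<longrightarrow> twisted_gen sg n q j \<odot>\<^bsub>V\<^esub> m w = sc q \<odot>\<^bsub>V\<^esub> m w))"

lemma orbit_elem:
  assumes x: "x \<in> I"
  shows "orbit_elem x (initial_word (lam x)) = cyc x" "mset w = wt x \<Longrightarrow> orbit_elem x w \<in> carrier V"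
    "mset w = wt x \<Longrightarrow> Suc j < n \<Longrightarrow> w ! j < w ! Suc j \<Longrightarrow> twisted_gen sg n q j \<odot>\<^bsub>V\<^esub> orbit_elem x w = orbit_elem x (swap_at j w)"
    "mset w = wt x \<Longrightarrow> Suc j < n \<Longrightarrow> w ! j = w ! Suc j \<Longrightarrow> twisted_gen sg n q j \<odot>\<^bsub>V\<^esub> orbit_elem x w = sc q \<odot>\<^bsub>V\<^esub> orbit_elem x w"
proof -
  interpret braid_action "carrier V" "\<lambda>j v. twisted_gen sg n q j \<odot>\<^bsub>V\<^esub> v" "\<lambda>v. sc q \<odot>\<^bsub>V\<^esub> v" n
  proof
    fix j v assume "Suc (Suc j) < n" "v \<in> carrier V"
    then show "twisted_gen sg n q j \<odot>\<^bsub>V\<^esub> (twisted_gen sg n q (Suc j) \<odot>\<^bsub>V\<^esub> (twisted_gen sg n q j \<odot>\<^bsub>V\<^esub> v)) =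
       twisted_gen sg n q (Suc j) \<odot>\<^bsub>V\<^esub> (twisted_gen sg n q j \<odot>\<^bsub>V\<^esub> (twisted_gen sg n q (Suc j) \<odot>\<^bsub>V\<^esub> v))"
      using twisted_gen_braid[where j = j and n = n and sg = sg and q = q] by (simp add: smult_assoc[symmetric] twisted_gen_carrier)
  next
    fix j k v assume "Suc j < k" "Suc k < n" "v \<in> carrier V"
    then show "twisted_gen sg n q j \<odot>\<^bsub>V\<^esub> (twisted_gen sg n q k \<odot>\<^bsub>V\<^esub> v) = twisted_gen sg n q k \<odot>\<^bsub>V\<^esub> (twisted_gen sg n q j \<odot>\<^bsub>V\<^esub> v)"
      using twisted_gen_comm[where j = j and k = k and n = n and sg = sg and q = q] by (simp add: smult_assoc[symmetric] twisted_gen_carrier)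
  qed (auto simp: twisted_gen_carrier sc_comm)
  let ?P = "\<lambda>m. m (initial_word (lam x)) = cyc x \<and> (\<forall>w. mset w = wt x \<longrightarrow> m w \<in> carrier V) \<and>
    (\<forall>w j. mset w = wt x \<longrightarrow> Suc j < n \<longrightarrow> w ! j < w ! Suc j \<longrightarrow> twisted_gen sg n q j \<odot>\<^bsub>V\<^esub> m w = m (swap_at j w)) \<and>
    (\<forall>w j. mset w = wt x \<longrightarrow> Suc j < n \<longrightarrow> w ! j = w ! Suc j \<longrightarrow> twisted_gen sg n q j \<odot>\<^bsub>V\<^esub> m w = sc q \<odot>\<^bsub>V\<^esub> m w)"
  have "\<exists>m. ?P m"
  proof (rule word_family[of "initial_word (lam x)" "cyc x"])
    show "length (initial_word (lam x)) = n" by (rule length_initial_word[OF lamP[OF x]])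
    show "twisted_gen sg n q j \<odot>\<^bsub>V\<^esub> cyc x = sc q \<odot>\<^bsub>V\<^esub> cyc x" if "Suc j < n" "initial_word (lam x) ! j = initial_word (lam x) ! Suc j" for j
      by (rule twisted_gen_eigen[OF x that])
  next
    fix m assume "m (initial_word (lam x)) = cyc x" "\<And>w. mset w = mset (initial_word (lam x)) \<Longrightarrow> m w \<in> carrier V"
      "\<And>w j. mset w = mset (initial_word (lam x)) \<Longrightarrow> Suc j < n \<Longrightarrow> w ! j < w ! Suc j \<Longrightarrow> twisted_gen sg n q j \<odot>\<^bsub>V\<^esub> m w = m (swap_at j w)"
      "\<And>w j. mset w = mset (initial_word (lam x)) \<Longrightarrow> Suc j < n \<Longrightarrow> w ! j = w ! Suc j \<Longrightarrow> twisted_gen sg n q j \<odot>\<^bsub>V\<^esub> m w = sc q \<odot>\<^bsub>V\<^esub> m w"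
    then have "?P m" by (simp only: initial_word(2)) blast
    then show ?thesis by blast
  qed (simp_all add: cyc_closed x)
  then have *: "?P (orbit_elem x)" unfolding orbit_elem_def by (rule someI_ex[where P = ?P])
  show "orbit_elem x (initial_word (lam x)) = cyc x" "mset w = wt x \<Longrightarrow> orbit_elem x w \<in> carrier V"
    "mset w = wt x \<Longrightarrow> Suc j < n \<Longrightarrow> w ! j < w ! Suc j \<Longrightarrow> twisted_gen sg n q j \<odot>\<^bsub>V\<^esub> orbit_elem x w = orbit_elem x (swap_at j w)"
    "mset w = wt x \<Longrightarrow> Suc j < n \<Longrightarrow> w ! j = w ! Suc j \<Longrightarrow> twisted_gen sg n q j \<odot>\<^bsub>V\<^esub> orbit_elem x w = sc q \<odot>\<^bsub>V\<^esub> orbit_elem x w"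
    using * by blast+
qed

text \<open>The linear extension of \<open>word \<mapsto> orbit_elem x word\<close>; it turns out to
  be a homomorphism into \<open>V\<close> and a section of \<open>p x\<close>.\<close>

definition orbit_map where "orbit_map x u = (\<Oplus>\<^bsub>V\<^esub>w\<in>{w. mset w = wt x}. sc (u w) \<odot>\<^bsub>V\<^esub> orbit_elem x w)"

lemma smult_finsum:
  assumes "finite B" "r \<in> carrier H" "f \<in> B \<rightarrow> carrier V"
  shows "r \<odot>\<^bsub>V\<^esub> (\<Oplus>\<^bsub>V\<^esub>w\<in>B. f w) = (\<Oplus>\<^bsub>V\<^esub>w\<in>B. r \<odot>\<^bsub>V\<^esub> f w)"
  using assms(1,3)
proof (induction B rule: finite_induct)
  case empty then show ?case using assms(2) smult_zero_right by simp
next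
  case (insert b B)
  then have "f \<in> B \<rightarrow> carrier V" "f b \<in> carrier V" by auto
  moreover from this have "(\<lambda>w. r \<odot>\<^bsub>V\<^esub> f w) \<in> B \<rightarrow> carrier V" using assms(2) by auto
  ultimately show ?case using insert assms(2) by (simp add: smult_r_distr)
qed

lemma term_closed: "x \<in> I \<Longrightarrow> (\<lambda>w. sc (u w) \<odot>\<^bsub>V\<^esub> orbit_elem x w) \<in> {w. mset w = wt x} \<rightarrow> carrier V"
  using orbit_elem(2) by auto

lemma orbit_map_closed: "x \<in> I \<Longrightarrow> orbit_map x u \<in> carrier V"
  unfolding orbit_map_def by (rule M.finsum_closed[OF term_closed])

lemma orbit_map_add: "x \<in> I \<Longrightarrow> orbit_map x (u + u') = orbit_map x u \<oplus>\<^bsub>V\<^esub> orbit_map x u'"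
proof -
  assume x: "x \<in> I"
  have "orbit_map x (u + u') = (\<Oplus>\<^bsub>V\<^esub>w\<in>{w. mset w = wt x}. sc (u w) \<odot>\<^bsub>V\<^esub> orbit_elem x w \<oplus>\<^bsub>V\<^esub> sc (u' w) \<odot>\<^bsub>V\<^esub> orbit_elem x w)"
    unfolding orbit_map_def
  proof (rule M.finsum_cong')
    show "(\<lambda>w. sc (u w) \<odot>\<^bsub>V\<^esub> orbit_elem x w \<oplus>\<^bsub>V\<^esub> sc (u' w) \<odot>\<^bsub>V\<^esub> orbit_elem x w) \<in> {w. mset w = wt x} \<rightarrow> carrier V"
      using orbit_elem(2)[OF x] by auto
    fix w assume "w \<in> {w. mset w = wt x}"
    then show "sc ((u + u') w) \<odot>\<^bsub>V\<^esub> orbit_elem x w = sc (u w) \<odot>\<^bsub>V\<^esub> orbit_elem x w \<oplus>\<^bsub>V\<^esub> sc (u' w) \<odot>\<^bsub>V\<^esub> orbit_elem x w"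
      using orbit_elem(2)[OF x] by (simp add: sc_add fun_apply_simps)
  qed simp
  also have "\<dots> = orbit_map x u \<oplus>\<^bsub>V\<^esub> orbit_map x u'" unfolding orbit_map_def by (rule M.finsum_addf[OF term_closed[OF x] term_closed[OF x]])
  finally show ?thesis .
qed

lemma orbit_map_scl: "x \<in> I \<Longrightarrow> orbit_map x (scl c u) = sc c \<odot>\<^bsub>V\<^esub> orbit_map x u"
proof -
  assume x: "x \<in> I"
  have "sc c \<odot>\<^bsub>V\<^esub> orbit_map x u = (\<Oplus>\<^bsub>V\<^esub>w\<in>{w. mset w = wt x}. sc c \<odot>\<^bsub>V\<^esub> (sc (u w) \<odot>\<^bsub>V\<^esub> orbit_elem x w))"
    unfolding orbit_map_def by (rule smult_finsum[OF finite_words _ term_closed[OF x]]) simp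
  also have "\<dots> = orbit_map x (scl c u)"
    unfolding orbit_map_def
  proof (rule M.finsum_cong')
    fix w assume "w \<in> {w. mset w = wt x}"
    then show "sc c \<odot>\<^bsub>V\<^esub> (sc (u w) \<odot>\<^bsub>V\<^esub> orbit_elem x w) = sc (scl c u w) \<odot>\<^bsub>V\<^esub> orbit_elem x w"
      using orbit_elem(2)[OF x] by (simp add: sc_mult fun_apply_simps)
  qed (simp_all add: term_closed[OF x])
  finally show ?thesis by simp
qed

lemma orbit_map_0: "x \<in> I \<Longrightarrow> orbit_map x 0 = \<zero>\<^bsub>V\<^esub>"
  using orbit_map_scl[of x 0 0] sc_zero[OF orbit_map_closed] by simp

lemma orbit_map_word_vec: "x \<in> I \<Longrightarrow> mset w = wt x \<Longrightarrow> orbit_map x (word_vec w) = orbit_elem x w"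
proof -
  assume x: "x \<in> I" and w: "mset w = wt x"
  have "orbit_map x (word_vec w) = (\<Oplus>\<^bsub>V\<^esub>y\<in>{w. mset w = wt x}. if w = y then orbit_elem x y else \<zero>\<^bsub>V\<^esub>)"
    unfolding orbit_map_def
  proof (rule M.finsum_cong')
    fix y assume "y \<in> {w. mset w = wt x}"
    then show "sc (word_vec w y) \<odot>\<^bsub>V\<^esub> orbit_elem x y = (if w = y then orbit_elem x y else \<zero>\<^bsub>V\<^esub>)"
      using orbit_elem(2)[OF x] by (simp add: word_vec_def sc_zero sc_one)
  qed (use orbit_elem(2)[OF x] in auto)
  also have "\<dots> = orbit_elem x w" by (rule M.finsum_singleton) (use w finite_words orbit_elem(2)[OF x] in auto)
  finally show ?thesis .
qed

lemma orbit_map_twisted_gen: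
  assumes x: "x \<in> I" and j: "Suc j < n" and u: "u \<in> weight_space (wt x)"
  shows "twisted_gen sg n q j \<odot>\<^bsub>V\<^esub> orbit_map x u = orbit_map x (T q j u)"
  using u
proof (induction rule: weight_space_induct)
  case zero
  show ?case using smult_zero_right[OF twisted_gen_carrier[OF j]] orbit_map_0[OF x] by simp
next
  case (add u c w)
  note t = twisted_gen_carrier[OF j, of sg q]
  have len: "Suc j < length w" using add(2) size_wt[OF x] j by (metis size_mset)
  note mw = orbit_elem(2)[OF x add(2)]
  have base: "twisted_gen sg n q j \<odot>\<^bsub>V\<^esub> orbit_elem x w = orbit_map x (T q j (word_vec w))"
  proof -
    consider "w ! j < w ! Suc j" | "w ! j = w ! Suc j" | "w ! Suc j < w ! j" by linarith
    then show ?thesis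
    proof cases
      case 1 then show ?thesis using orbit_elem(3)[OF x add(2) j 1] by (simp add: T_word_vec(1)[OF len] orbit_map_word_vec[OF x] add(2))
    next
      case 2 then show ?thesis using orbit_elem(4)[OF x add(2) j 2] by (simp add: T_word_vec(2)[OF len] orbit_map_word_vec[OF x] orbit_map_scl[OF x] add(2))
    next
      case 3
      let ?w = "swap_at j w"
      have w': "mset ?w = wt x" using add(2) by simp
      have asc: "?w ! j < ?w ! Suc j" using 3 len by (simp add: swap_at_nth)
      have m: "twisted_gen sg n q j \<odot>\<^bsub>V\<^esub> orbit_elem x ?w = orbit_elem x w" using orbit_elem(3)[OF x w' j asc] by simp
      note mw' = orbit_elem(2)[OF x w']
      \<comment> \<open>At a descent \<open>orbit_elem x w\<close> is itself the image of the
        exchanged element, so the quadratic relation in the Hecke algebra applies.\<close>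
      have "twisted_gen sg n q j \<odot>\<^bsub>V\<^esub> orbit_elem x w = (twisted_gen sg n q j \<otimes>\<^bsub>H\<^esub> twisted_gen sg n q j) \<odot>\<^bsub>V\<^esub> orbit_elem x ?w"
        using m t mw' by (simp add: smult_assoc)
      also have "\<dots> = sc (q - 1) \<odot>\<^bsub>V\<^esub> orbit_elem x w \<oplus>\<^bsub>V\<^esub> sc q \<odot>\<^bsub>V\<^esub> orbit_elem x ?w"
        unfolding twisted_gen_quad[OF j] using t mw' m by (simp add: smult_l_distr smult_assoc)
      also have "\<dots> = orbit_map x (scl (q - 1) (word_vec w) + scl q (word_vec ?w))"
        using w' add(2) by (simp add: orbit_map_add[OF x] orbit_map_scl[OF x] orbit_map_word_vec[OF x])
      finally show ?thesis using 3 by (simp add: T_word_vec(3)[OF len] add.commute)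
    qed
  qed
  have "twisted_gen sg n q j \<odot>\<^bsub>V\<^esub> orbit_map x (u + scl c (word_vec w)) = twisted_gen sg n q j \<odot>\<^bsub>V\<^esub> orbit_map x u \<oplus>\<^bsub>V\<^esub> sc c \<odot>\<^bsub>V\<^esub> (twisted_gen sg n q j \<odot>\<^bsub>V\<^esub> orbit_elem x w)"
    using t mw orbit_map_closed[OF x] add(2) by (simp add: orbit_map_add[OF x] orbit_map_scl[OF x] orbit_map_word_vec[OF x] smult_r_distr sc_comm)
  also have "\<dots> = orbit_map x (T q j (u + scl c (word_vec w)))"
    unfolding add(3) base by (simp add: orbit_map_add[OF x] orbit_map_scl[OF x] T_add T_scl)
  finally show ?case .
qed

lemma hecke_hom_rho:
  assumes f: "hecke_hom q \<alpha> \<beta> f" and sz: "size \<alpha> = n" "size \<beta> = n"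
  shows "r \<in> carrier H \<Longrightarrow> u \<in> weight_space \<alpha> \<Longrightarrow> f (A.rho r u) = A.rho r (f u)"
proof (induction rule: hecke_induct)
  case (scalar c)
  then show ?case using A.rho_simps(1)[OF weight_space_word_space[OF scalar sz(1)]] A.rho_simps(1)[OF weight_space_word_space[OF whomD(1)[OF f scalar] sz(2)]] whomD(3)[OF f scalar] by simp
next
  case (gen i Y)
  note v = weight_space_word_space[OF gen(5) sz(1)] and v' = weight_space_word_space[OF whomD(1)[OF f gen(5)] sz(2)]
  have e: "A.rho (hecke_gen n q i \<otimes>\<^bsub>H\<^esub> Y) y = twisted_T sg q i (A.rho Y y)" if "y \<in> word_space n" for y
    using A.rho_simps(5)[OF that hecke_gen_carrier[OF gen(1,2)] gen(3)] A.rho_simps(2)[OF A.rho_simps(6)[OF that gen(3)] gen(1,2)] by simp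
  have rW: "A.rho Y u \<in> weight_space \<alpha>" by (rule rho_weight_space[OF gen(3,5) sz(1)])
  have ft: "f (T q (i - 1) y) = T q (i - 1) (f y)" if "y \<in> weight_space \<alpha>" for y
    by (rule whomD(4)[OF f _ that]) (use gen sz in simp)
  have "f (twisted_T sg q i y) = twisted_T sg q i (f y)" if y: "y \<in> weight_space \<alpha>" for y
    using ft[OF y] whomD(3)[OF f y] wlinD(5)[OF hecke_hom_weight_linear[OF f] weight_space_scl[OF y] weight_space_T[OF y]] by (simp add: twisted_T_def S_def)
  note this[OF rW]
  then show ?case using e[OF v] e[OF v'] gen(4)[OF gen(5)] by simp
next
  case (add X Y)
  note v = weight_space_word_space[OF add(5) sz(1)] and v' = weight_space_word_space[OF whomD(1)[OF f add(5)] sz(2)]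
  show ?case using A.rho_simps(4)[OF v add(1,2)] A.rho_simps(4)[OF v' add(1,2)] add(3,4)[OF add(5)]
      whomD(2)[OF f rho_weight_space[OF add(1,5) sz(1)] rho_weight_space[OF add(2,5) sz(1)]] by simp
qed

lemma gen_orbit_map:
  assumes x: "x \<in> I" and i: "1 \<le> i" "i < n" and u: "u \<in> weight_space (wt x)"
  shows "hecke_gen n q i \<odot>\<^bsub>V\<^esub> orbit_map x u = orbit_map x (twisted_T sg q i u)"
proof -
  obtain j where j: "i = Suc j" "Suc j < n" using i by (cases i) auto
  note t = twisted_gen_carrier[OF j(2), of sg q]
  show ?thesis
  proof (cases sg)
    case False
    then show ?thesis using orbit_map_twisted_gen[OF x j(2) u] gen_twisted_gen(1)[OF j(2), of q] j(1) by (simp add: twisted_T_def)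
  next
    case True
    have e: "hecke_gen n q (Suc j) = sc (q - 1) \<oplus>\<^bsub>H\<^esub> (sc (- 1) \<otimes>\<^bsub>H\<^esub> twisted_gen sg n q j)"
      using gen_twisted_gen(3)[OF j(2), of q] True by simp
    have "hecke_gen n q i \<odot>\<^bsub>V\<^esub> orbit_map x u = sc (q - 1) \<odot>\<^bsub>V\<^esub> orbit_map x u \<oplus>\<^bsub>V\<^esub> sc (- 1) \<odot>\<^bsub>V\<^esub> (twisted_gen sg n q j \<odot>\<^bsub>V\<^esub> orbit_map x u)"
      unfolding j(1) e using t orbit_map_closed[OF x] by (simp add: smult_l_distr smult_assoc)
    also have "\<dots> = orbit_map x (scl (q - 1) u + scl (- 1) (T q j u))"
      using orbit_map_twisted_gen[OF x j(2) u] by (simp add: orbit_map_add[OF x] orbit_map_scl[OF x])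
    also have "scl (q - 1) u + scl (- 1) (T q j u) = twisted_T sg q i u" using True j(1) by (simp add: twisted_T_def S_def scl_minus)
    finally show ?thesis .
  qed
qed

lemma rho_orbit_map:
  assumes x: "x \<in> I"
  shows "r \<in> carrier H \<Longrightarrow> u \<in> weight_space (wt x) \<Longrightarrow> r \<odot>\<^bsub>V\<^esub> orbit_map x u = orbit_map x (A.rho r u)"
proof (induction rule: hecke_induct)
  case (scalar c) then show ?case using A.rho_simps(1)[OF weight_space_word_space_wt[OF x]] orbit_map_scl[OF x] by simp
next
  case (gen i Y)
  note v = weight_space_word_space_wt[OF x gen(5)]
  have "(hecke_gen n q i \<otimes>\<^bsub>H\<^esub> Y) \<odot>\<^bsub>V\<^esub> orbit_map x u = hecke_gen n q i \<odot>\<^bsub>V\<^esub> orbit_map x (A.rho Y u)"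
    using gen orbit_map_closed[OF x] by (simp add: smult_assoc)
  also have "\<dots> = orbit_map x (twisted_T sg q i (A.rho Y u))" by (rule gen_orbit_map[OF x gen(1,2) rho_weight_space[OF gen(3,5) size_wt[OF x]]])
  also have "twisted_T sg q i (A.rho Y u) = A.rho (hecke_gen n q i \<otimes>\<^bsub>H\<^esub> Y) u"
    using A.rho_simps(5)[OF v hecke_gen_carrier[OF gen(1,2)] gen(3)] A.rho_simps(2)[OF A.rho_simps(6)[OF v gen(3)] gen(1,2)] by simp
  finally show ?case .
next
  case (add X Y)
  then show ?case using A.rho_simps(4)[OF weight_space_word_space_wt[OF x add(5)] add(1,2)] orbit_map_closed[OF x]
    by (simp add: smult_l_distr orbit_map_add[OF x])
qed

lemma p_zero: "y \<in> I \<Longrightarrow> p y \<zero>\<^bsub>V\<^esub> = 0"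
  using p_add[of y "\<zero>\<^bsub>V\<^esub>" "\<zero>\<^bsub>V\<^esub>"] by simp

lemma rho_twisted_gen: "Suc j < n \<Longrightarrow> u \<in> word_space n \<Longrightarrow> A.rho (twisted_gen sg n q j) u = T q j u"
  unfolding twisted_gen_def
  by (subst A.rho_hecke_class[OF twisted_poly_carrier]) (auto simp: twisted_poly_def act_minus act_single twisted_T_def S_def)

text \<open>True at \<open>cyc x\<close> by duality, and carried along ascents since
  \<open>p y\<close> turns the twisted generator into \<open>T q j\<close>.\<close>

lemma p_orbit_elem:
  assumes x: "x \<in> I" and y: "y \<in> I" and w: "mset w = wt x"
  shows "p y (orbit_elem x w) = (if x = y then word_vec w else 0)"
proof -
  have "mset w = mset (initial_word (lam x))" "sorted (initial_word (lam x))" using w by simp_all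
  then show ?thesis
  proof (induction rule: word_induct)
    case sorted show ?case using orbit_elem(1)[OF x] p_cyc[OF x y] by simp
  next
    case (step w j)
    have w: "mset w = wt x" using step(1) by simp
    then have len: "length w = n" using size_wt[OF x] by (metis size_mset)
    have j: "Suc j < n" using step(2) len by simp
    have "p y (orbit_elem x (swap_at j w)) = p y (twisted_gen sg n q j \<odot>\<^bsub>V\<^esub> orbit_elem x w)" using orbit_elem(3)[OF x w j step(3)] by simp
    also have "\<dots> = A.rho (twisted_gen sg n q j) (p y (orbit_elem x w))" by (rule p_rho[OF y twisted_gen_carrier[OF j] orbit_elem(2)[OF x w]])
    also have "\<dots> = T q j (p y (orbit_elem x w))" by (rule rho_twisted_gen[OF j weight_space_word_space_wt[OF y p_weight_space[OF y orbit_elem(2)[OF x w]]]])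
    finally show ?case using step(4) T_word_vec(1)[OF step(2,3), of q] by simp
  qed
qed

lemma p_orbit_map:
  assumes x: "x \<in> I" and y: "y \<in> I" and u: "u \<in> weight_space (wt x)"
  shows "p y (orbit_map x u) = (if x = y then u else 0)"
  using u
proof (induction rule: weight_space_induct)
  case zero show ?case using orbit_map_0[OF x] p_zero[OF y] by simp
next
  case (add u c w)
  note mw = orbit_elem(2)[OF x add(2)]
  have "p y (orbit_map x (u + scl c (word_vec w))) = p y (orbit_map x u) + p y (sc c \<odot>\<^bsub>V\<^esub> orbit_elem x w)"
    using p_add[OF y orbit_map_closed[OF x], of "sc c \<odot>\<^bsub>V\<^esub> orbit_elem x w" u] mw add(2) by (simp add: orbit_map_add[OF x] orbit_map_scl[OF x] orbit_map_word_vec[OF x])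
  also have "p y (sc c \<odot>\<^bsub>V\<^esub> orbit_elem x w) = scl c (p y (orbit_elem x w))"
    using p_rho[OF y _ mw, of "sc c"] A.rho_simps(1)[OF weight_space_word_space_wt[OF y p_weight_space[OF y mw]]] by simp
  finally show ?case using add(3) p_orbit_elem[OF x y add(2)] by simp
qed

lemma realise: "D \<in> alg q {j. Suc j < n} \<Longrightarrow> \<exists>r\<in>carrier H. \<forall>v\<in>word_space n. A.rho r v = D v"
proof (induction rule: alg.induct)
  case alg_id
  then show ?case using A.rho_simps(3) R.one_closed by blast
next
  case (alg_T D j)
  then obtain r where r: "r \<in> carrier H" "\<And>v. v \<in> word_space n \<Longrightarrow> A.rho r v = D v" by blast
  have j: "Suc j < n" using alg_T by simp
  have "A.rho (twisted_gen sg n q j \<otimes>\<^bsub>H\<^esub> r) v = T q j (D v)" if "v \<in> word_space n" for v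
    using A.rho_simps(5)[OF that twisted_gen_carrier[OF j] r(1)] rho_twisted_gen[OF j A.rho_simps(6)[OF that r(1)]] r(2)[OF that] by simp
  then show ?case using R.m_closed[OF twisted_gen_carrier[OF j] r(1)] by blast
next
  case (alg_add D D')
  then obtain r r' where r: "r \<in> carrier H" "\<And>v. v \<in> word_space n \<Longrightarrow> A.rho r v = D v"
    "r' \<in> carrier H" "\<And>v. v \<in> word_space n \<Longrightarrow> A.rho r' v = D' v" by blast
  have "A.rho (r \<oplus>\<^bsub>H\<^esub> r') v = D v + D' v" if "v \<in> word_space n" for v
    using A.rho_simps(4)[OF that r(1,3)] r(2,4)[OF that] by simp
  then show ?case using R.a_closed[OF r(1,3)] by blast
next
  case (alg_scl D c)
  then obtain r where r: "r \<in> carrier H" "\<And>v. v \<in> word_space n \<Longrightarrow> A.rho r v = D v" by blast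
  have "A.rho (sc c \<otimes>\<^bsub>H\<^esub> r) v = scl c (D v)" if "v \<in> word_space n" for v
    using A.rho_simps(5)[OF that hecke_scalar_carrier r(1)] A.rho_simps(1)[OF A.rho_simps(6)[OF that r(1)]] r(2)[OF that] by simp
  then show ?case using R.m_closed[OF hecke_scalar_carrier r(1)] by blast
qed

lemma hom_minus:
  assumes "g \<in> hom (add_monoid V) (add_monoid V)" "a \<in> carrier V"
  shows "g (\<ominus>\<^bsub>V\<^esub> a) = \<ominus>\<^bsub>V\<^esub> g a" "g \<zero>\<^bsub>V\<^esub> = \<zero>\<^bsub>V\<^esub>"
proof -
  have add: "g (a \<oplus>\<^bsub>V\<^esub> b) = g a \<oplus>\<^bsub>V\<^esub> g b" "g a \<in> carrier V" if "a \<in> carrier V" "b \<in> carrier V" for a b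
    using assms(1) that by (auto simp: hom_def)
  show z: "g \<zero>\<^bsub>V\<^esub> = \<zero>\<^bsub>V\<^esub>"
    using add[of "\<zero>\<^bsub>V\<^esub>" "\<zero>\<^bsub>V\<^esub>"] by (metis M.r_zero M.zero_closed M.add.l_cancel_one)
  have "g (\<ominus>\<^bsub>V\<^esub> a) \<oplus>\<^bsub>V\<^esub> g a = \<zero>\<^bsub>V\<^esub>"
    using add(1)[of "\<ominus>\<^bsub>V\<^esub> a" a] assms(2) z by (simp add: M.l_neg)
  then show "g (\<ominus>\<^bsub>V\<^esub> a) = \<ominus>\<^bsub>V\<^esub> g a"
    using M.minus_equality[of "g (\<ominus>\<^bsub>V\<^esub> a)" "g a"] add(2)[of a a] add(2)[of "\<ominus>\<^bsub>V\<^esub> a" a] assms(2) by simp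
qed

text \<open>The endomorphisms \<open>orbit_map y \<circ> F \<circ> p x\<close> of \<open>V\<close>
  are enough: commuting with them makes the restrictions of \<open>g\<close> to the summands a
  family to which \<open>commuting_family_in_alg\<close> applies.\<close>

theorem double_centraliser:
  assumes cosat: "co_saturated n (coarsenings n (lam ` I))"
  shows "double_centraliser_property H V"
  unfolding double_centraliser_property_def
proof (intro equalityI subsetI)
  fix h assume "h \<in> (\<lambda>a. \<lambda>v\<in>carrier V. a \<odot>\<^bsub>V\<^esub> v) ` carrier H"
  then obtain a where a: "a \<in> carrier H" "h = (\<lambda>v\<in>carrier V. a \<odot>\<^bsub>V\<^esub> v)" by blast
  show "h \<in> DEnd H V"
    unfolding DEnd_def a(2)
    using a(1) by (auto simp: hom_def lmod_hom_def smult_r_distr)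
next
  fix g assume g: "g \<in> DEnd H V"
  have gext: "g \<in> extensional (carrier V)" and ghom: "g \<in> hom (add_monoid V) (add_monoid V)"
    and gcomm: "\<And>f v. f \<in> lmod_hom H V V \<Longrightarrow> v \<in> carrier V \<Longrightarrow> g (f v) = f (g v)"
    using g unfolding DEnd_def by auto
  have gV: "g v \<in> carrier V" if "v \<in> carrier V" for v using ghom that by (auto simp: hom_def)
  have gadd: "g (a \<oplus>\<^bsub>V\<^esub> b) = g a \<oplus>\<^bsub>V\<^esub> g b" if "a \<in> carrier V" "b \<in> carrier V" for a b
    using ghom that by (auto simp: hom_def)
  \<comment> \<open>The commutation of \<open>g\<close> with this endomorphism, evaluated at
    \<open>orbit_map x u\<close>, where \<open>p x\<close> gives back \<open>u\<close>.\<close>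
  have key: "g (orbit_map y (F u)) = orbit_map y (F (p x (g (orbit_map x u))))"
    if x: "x \<in> I" and y: "y \<in> I" and F: "hecke_hom q (wt x) (wt y) F" and u: "u \<in> weight_space (wt x)" for x y F u
  proof -
    have "(\<lambda>v. orbit_map y (F (p x v))) \<in> lmod_hom H V V"
      unfolding lmod_hom_def
    proof (intro CollectI conjI ballI)
      show "(\<lambda>v. orbit_map y (F (p x v))) \<in> hom (add_monoid V) (add_monoid V)"
        using orbit_map_closed[OF y] by (auto simp: hom_def p_add[OF x] whomD(2)[OF F p_weight_space[OF x] p_weight_space[OF x]] orbit_map_add[OF y])
      fix r v assume r: "r \<in> carrier H" and v: "v \<in> carrier V"
      show "orbit_map y (F (p x (r \<odot>\<^bsub>V\<^esub> v))) = r \<odot>\<^bsub>V\<^esub> orbit_map y (F (p x v))"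
        using p_rho[OF x r v] hecke_hom_rho[OF F size_wt[OF x] size_wt[OF y] r p_weight_space[OF x v]]
          rho_orbit_map[OF y r whomD(1)[OF F p_weight_space[OF x v]]] by simp
    qed
    from gcomm[OF this orbit_map_closed[OF x, of u]] show ?thesis using p_orbit_map[OF x x u] by simp
  qed
  \<comment> \<open>One representative index for each partition; the other copies are recovered from
    it by \<open>key\<close> with the identity for \<open>F\<close>.\<close>
  define ix where "ix l = (SOME x. x \<in> I \<and> lam x = l)" for l
  have ix: "ix l \<in> I \<and> lam (ix l) = l" if "l \<in> lam ` I" for l
    unfolding ix_def by (rule someI_ex) (use that in blast)
  define gg where "gg l u = p (ix l) (g (orbit_map (ix l) u))" for l u
  have id: "hecke_hom q \<beta> \<beta> (\<lambda>u. u)" for \<beta> by (simp add: hecke_hom_def)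
  \<comment> \<open>A priori \<open>g\<close> is only additive. Linearity over the field comes from
    commuting with scalar multiplications, which are homomorphisms.\<close>
  have sclh: "hecke_hom q \<beta> \<beta> (scl c)" for c \<beta>
    unfolding hecke_hom_def by (auto simp: weight_space_scl scl_add T_scl mult.commute)
  have gg_weight_space: "gg l u \<in> weight_space (content l)" if "l \<in> lam ` I" "u \<in> weight_space (content l)" for l u
    unfolding gg_def using p_weight_space[of "ix l"] ix[OF that(1)] gV[OF orbit_map_closed] by metis
  have comm: "gg l' (F u) = F (gg l u)"
    if l: "l \<in> lam ` I" "l' \<in> lam ` I" and F: "hecke_hom q (content l) (content l') F" and u: "u \<in> weight_space (content l)" for l l' F u
  proof -
    have x: "ix l \<in> I" "lam (ix l) = l" and y: "ix l' \<in> I" "lam (ix l') = l'" using ix l by auto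
    have F': "hecke_hom q (wt (ix l)) (wt (ix l')) F" and u': "u \<in> weight_space (wt (ix l))" using F u x y by simp_all
    have "F (gg l u) \<in> weight_space (wt (ix l'))" using whomD(1)[OF F gg_weight_space[OF l(1) u]] y by simp
    then show ?thesis using key[OF x(1) y(1) F' u'] p_orbit_map[OF y(1) y(1)] by (simp add: gg_def)
  qed
  have lin: "weight_linear (content l) (content l) (gg l)" if l: "l \<in> lam ` I" for l
    unfolding weight_linear_def
  proof (intro conjI ballI allI)
    have x: "ix l \<in> I" using ix l by auto
    fix u :: "nat list \<Rightarrow> 'f" assume u: "u \<in> weight_space (content l)"
    show "gg l u \<in> weight_space (content l)" by (rule gg_weight_space[OF l u])
    show "gg l (u + v) = gg l u + gg l v" for v
      unfolding gg_def orbit_map_add[OF x] using gadd[OF orbit_map_closed[OF x] orbit_map_closed[OF x]] p_add[OF x gV[OF orbit_map_closed[OF x]] gV[OF orbit_map_closed[OF x]]] by simp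
    show "gg l (scl c u) = scl c (gg l u)" for c by (rule comm[OF l l sclh u])
  qed
  obtain D where D: "D \<in> alg q {j. Suc j < n}" "\<And>l u. l \<in> lam ` I \<Longrightarrow> u \<in> weight_space (content l) \<Longrightarrow> gg l u = D u"
    using commuting_family_in_alg[OF q0 _ cosat, of gg] lamP lin comm by blast
  obtain r where r: "r \<in> carrier H" "\<And>v. v \<in> word_space n \<Longrightarrow> A.rho r v = D v" using realise[OF D(1)] by blast
  have gJ: "g (orbit_map y u) = r \<odot>\<^bsub>V\<^esub> orbit_map y u" if y: "y \<in> I" and u: "u \<in> weight_space (wt y)" for y u
  proof -
    have l: "lam y \<in> lam ` I" using y by blast
    have x: "ix (lam y) \<in> I" "lam (ix (lam y)) = lam y" using ix[OF l] by auto
    have "g (orbit_map y u) = orbit_map y (gg (lam y) u)"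
      using key[OF x(1) y, of "\<lambda>u. u" u] id u x(2) by (simp add: gg_def)
    also have "\<dots> = orbit_map y (A.rho r u)" using D(2)[OF l u] r(2)[OF weight_space_word_space_wt[OF y u]] by simp
    finally show ?thesis using rho_orbit_map[OF y r(1) u] by simp
  qed
  have "g v = r \<odot>\<^bsub>V\<^esub> v" if v: "v \<in> carrier V" for v
  proof (rule generated[OF v])
    show "g \<zero>\<^bsub>V\<^esub> = r \<odot>\<^bsub>V\<^esub> \<zero>\<^bsub>V\<^esub>" using hom_minus(2)[OF ghom M.zero_closed] smult_zero_right[OF r(1)] by simp
  next
    fix s y assume s: "s \<in> carrier H" and y: "y \<in> I"
    have d: "word_vec (initial_word (lam y)) \<in> weight_space (wt y)" by (rule weight_space_word_vec) simp
    have "s \<odot>\<^bsub>V\<^esub> cyc y = orbit_map y (A.rho s (word_vec (initial_word (lam y))))"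
      using rho_orbit_map[OF y s d] orbit_map_word_vec[OF y, of "initial_word (lam y)"] orbit_elem(1)[OF y] by simp
    then show "g (s \<odot>\<^bsub>V\<^esub> cyc y) = r \<odot>\<^bsub>V\<^esub> (s \<odot>\<^bsub>V\<^esub> cyc y)"
      using gJ[OF y rho_weight_space[OF s d size_wt[OF y]]] by simp
  next
    fix a b assume "a \<in> carrier V" "b \<in> carrier V" "g a = r \<odot>\<^bsub>V\<^esub> a" "g b = r \<odot>\<^bsub>V\<^esub> b"
    then show "g (a \<oplus>\<^bsub>V\<^esub> b) = r \<odot>\<^bsub>V\<^esub> (a \<oplus>\<^bsub>V\<^esub> b)" using gadd smult_r_distr r(1) by simp
  next
    fix a assume a: "a \<in> carrier V" "g a = r \<odot>\<^bsub>V\<^esub> a"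
    have "r \<odot>\<^bsub>V\<^esub> (\<ominus>\<^bsub>V\<^esub> a) \<oplus>\<^bsub>V\<^esub> r \<odot>\<^bsub>V\<^esub> a = \<zero>\<^bsub>V\<^esub>"
      using smult_r_distr[OF r(1), of "\<ominus>\<^bsub>V\<^esub> a" a] a(1) smult_zero_right[OF r(1)] by (simp add: M.l_neg)
    then have "\<ominus>\<^bsub>V\<^esub> (r \<odot>\<^bsub>V\<^esub> a) = r \<odot>\<^bsub>V\<^esub> (\<ominus>\<^bsub>V\<^esub> a)"
      using M.minus_equality[of "r \<odot>\<^bsub>V\<^esub> (\<ominus>\<^bsub>V\<^esub> a)" "r \<odot>\<^bsub>V\<^esub> a"] r(1) a(1) by simp
    then show "g (\<ominus>\<^bsub>V\<^esub> a) = r \<odot>\<^bsub>V\<^esub> (\<ominus>\<^bsub>V\<^esub> a)" using hom_minus(1)[OF ghom a(1)] a(2) by simp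
  qed
  then have "g = (\<lambda>v\<in>carrier V. r \<odot>\<^bsub>V\<^esub> v)" using gext by (auto simp: extensional_def fun_eq_iff)
  then show "g \<in> (\<lambda>a. \<lambda>v\<in>carrier V. a \<odot>\<^bsub>V\<^esub> v) ` carrier H" using r(1) by blast
qed

end

section \<open>Modules induced from a subring\<close>

lemma comm_group_UNIV: "comm_group \<lparr>carrier = UNIV :: 'g::ab_group_add set, monoid.mult = (+), one = 0\<rparr>"
  by (rule comm_groupI) (auto simp: add.assoc add.commute intro: exI[of _ "- x" for x])

locale tensor_induction = ring R for R :: "('r, 'm) ring_scheme" (structure) +
  fixes A :: "'r set" and N :: "('r, 'a, 'k) module_scheme"
  assumes A_sub: "a \<in> A \<Longrightarrow> a \<in> carrier R"
    and N_add: "v \<in> carrier N \<Longrightarrow> w \<in> carrier N \<Longrightarrow> v \<oplus>\<^bsub>N\<^esub> w \<in> carrier N"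
    and N_smult: "a \<in> A \<Longrightarrow> v \<in> carrier N \<Longrightarrow> a \<odot>\<^bsub>N\<^esub> v \<in> carrier N"
begin

abbreviation G where "G \<equiv> free_Abelian_group (carrier R \<times> carrier N)"
abbreviation K where "K \<equiv> generate G (tensor_relations R A N)"
abbreviation M where "M \<equiv> induced_module R A N"
abbreviation phi where "phi r \<equiv> frag_extend (\<lambda>(x, v). frag_of (r \<otimes> x, v))"
definition cls where "cls y = K #>\<^bsub>G\<^esub> y"

lemma frag_keys: "x \<in> carrier R \<Longrightarrow> v \<in> carrier N \<Longrightarrow> Poly_Mapping.keys (frag_of (x, v)) \<subseteq> carrier R \<times> carrier N"
  by simp

lemma keys_diff_G: "Poly_Mapping.keys y \<subseteq> B \<Longrightarrow> Poly_Mapping.keys z \<subseteq> B \<Longrightarrow> Poly_Mapping.keys (y - z) \<subseteq> B"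
  for y z :: "_ \<Rightarrow>\<^sub>0 int"
  using keys_diff[of y z] by blast

lemma keys_add_G: "Poly_Mapping.keys y \<subseteq> B \<Longrightarrow> Poly_Mapping.keys z \<subseteq> B \<Longrightarrow> Poly_Mapping.keys (y + z) \<subseteq> B"
  for y z :: "_ \<Rightarrow>\<^sub>0 int"
  using keys_add[of y z] by blast

lemma relations_carrier: "tensor_relations R A N \<subseteq> carrier G"
  unfolding tensor_relations_def
  by (intro Un_least subsetI; unfold carrier_free_Abelian_group_iff; elim CollectE exE conjE; hypsubst)
    (intro keys_diff_G frag_keys a_closed m_closed[OF _ A_sub] N_add N_smult; assumption)+

lemma subgroup_K: "subgroup K G"
  by (rule group.generate_is_subgroup[OF group_free_Abelian_group relations_carrier])

lemma normal_K: "normal K G"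
  by (rule comm_group.normal_iff_subgroup[OF abelian_free_Abelian_group, THEN iffD2, OF subgroup_K])

lemma K_keys: "k \<in> K \<Longrightarrow> Poly_Mapping.keys k \<subseteq> carrier R \<times> carrier N"
  using subsetD[OF subgroup.subset[OF subgroup_K]] unfolding carrier_free_Abelian_group_iff .

lemma cls_mem: "z \<in> cls y \<longleftrightarrow> (\<exists>k\<in>K. z = k + y)"
  by (auto simp: cls_def r_coset_def)

lemma cls_self: "y \<in> cls y"
  using subgroup.one_closed[OF subgroup_K] by (auto simp: cls_mem)

lemma K_plus: "k \<in> K \<Longrightarrow> l \<in> K \<Longrightarrow> k + l \<in> K"
  using subgroup.m_closed[OF subgroup_K] by simp

lemma K_uminus: "k \<in> K \<Longrightarrow> - k \<in> K"
  using subgroup.m_inv_closed[OF subgroup_K, of k] K_keys[of k] by simp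

lemma cls_eqI:
  assumes "y - z \<in> K" shows "cls y = cls z"
proof (intro equalityI subsetI)
  fix u assume "u \<in> cls y"
  then obtain k where "k \<in> K" "u = k + y" by (auto simp: cls_mem)
  then have "k + (y - z) \<in> K" "u = k + (y - z) + z" using K_plus[OF _ assms] by auto
  then show "u \<in> cls z" unfolding cls_mem by blast
next
  fix u assume "u \<in> cls z"
  then obtain k where "k \<in> K" "u = k + z" by (auto simp: cls_mem)
  then have "k + - (y - z) \<in> K" "u = k + - (y - z) + y" using K_plus[OF _ K_uminus[OF assms]] by auto
  then show "u \<in> cls y" unfolding cls_mem by blast
qed

lemma carrier_M: "X \<in> carrier M \<longleftrightarrow> (\<exists>y\<in>carrier G. X = cls y)"
  unfolding induced_module_def Let_def FactGroup_def RCOSETS_def cls_def by auto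

lemma cls_closed: "Poly_Mapping.keys y \<subseteq> carrier R \<times> carrier N \<Longrightarrow> cls y \<in> carrier M"
  unfolding carrier_M by auto

lemma M_add:
  assumes "Poly_Mapping.keys y \<subseteq> carrier R \<times> carrier N" "Poly_Mapping.keys z \<subseteq> carrier R \<times> carrier N"
  shows "cls y \<oplus>\<^bsub>M\<^esub> cls z = cls (y + z)"
  using normal.rcos_sum[OF normal_K, of y z] assms
  by (simp add: induced_module_def Let_def FactGroup_def cls_def)

lemma M_zero: "\<zero>\<^bsub>M\<^esub> = cls 0"
  using group.coset_join2[OF group_free_Abelian_group _ subgroup_K, of 0] subgroup.one_closed[OF subgroup_K]
  by (simp add: induced_module_def Let_def FactGroup_def cls_def)

lemma phi_keys:
  assumes "r \<in> carrier R" "Poly_Mapping.keys y \<subseteq> carrier R \<times> carrier N"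
  shows "Poly_Mapping.keys (phi r y) \<subseteq> carrier R \<times> carrier N"
proof
  fix k assume "k \<in> Poly_Mapping.keys (phi r y)"
  then obtain z where "z \<in> Poly_Mapping.keys y" "k \<in> Poly_Mapping.keys ((\<lambda>(x, v). frag_of (r \<otimes> x, v)) z)"
    using keys_frag_extend[of "\<lambda>(x, v). frag_of (r \<otimes> x, v)" y] by blast
  then show "k \<in> carrier R \<times> carrier N" using assms by (cases z) auto
qed

lemma phi_relations:
  assumes r: "r \<in> carrier R" and c: "c \<in> tensor_relations R A N"
  shows "phi r c \<in> tensor_relations R A N"
proof -
  from c consider
    x y v where "c = frag_of (x \<oplus> y, v) - frag_of (x, v) - frag_of (y, v)" "x \<in> carrier R" "y \<in> carrier R" "v \<in> carrier N"
    | x v w where "c = frag_of (x, v \<oplus>\<^bsub>N\<^esub> w) - frag_of (x, v) - frag_of (x, w)" "x \<in> carrier R" "v \<in> carrier N" "w \<in> carrier N"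
    | x a v where "c = frag_of (x \<otimes> a, v) - frag_of (x, a \<odot>\<^bsub>N\<^esub> v)" "x \<in> carrier R" "a \<in> A" "v \<in> carrier N"
    unfolding tensor_relations_def by blast
  then show ?thesis
  proof cases
    case 1
    have "phi r c = frag_of (r \<otimes> x \<oplus> r \<otimes> y, v) - frag_of (r \<otimes> x, v) - frag_of (r \<otimes> y, v)"
      using 1 r by (simp add: frag_extend_diff r_distr)
    then show ?thesis using 1(2-4) m_closed[OF r] unfolding tensor_relations_def by blast
  next
    case 2
    have "phi r c = frag_of (r \<otimes> x, v \<oplus>\<^bsub>N\<^esub> w) - frag_of (r \<otimes> x, v) - frag_of (r \<otimes> x, w)"
      using 2 r by (simp add: frag_extend_diff)
    then show ?thesis using 2(2-4) m_closed[OF r] unfolding tensor_relations_def by blast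
  next
    case 3
    have "phi r c = frag_of ((r \<otimes> x) \<otimes> a, v) - frag_of (r \<otimes> x, a \<odot>\<^bsub>N\<^esub> v)"
      using 3 r A_sub by (simp add: frag_extend_diff m_assoc)
    then show ?thesis using 3(2-4) m_closed[OF r] unfolding tensor_relations_def by blast
  qed
qed

lemma phi_K:
  assumes r: "r \<in> carrier R" and "k \<in> K"
  shows "phi r k \<in> K"
  using assms(2)
proof induction
  case one then show ?case using generate.one[of G] by simp
next
  case (incl h) then show ?case by (intro generate.incl phi_relations r)
next
  case (inv h)
  then have "Poly_Mapping.keys h \<subseteq> carrier R \<times> carrier N" using subsetD[OF relations_carrier] unfolding carrier_free_Abelian_group_iff by blast
  then show ?case using K_uminus[OF generate.incl[OF phi_relations[OF r inv]]] by (simp add: frag_extend_minus)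
next
  case (eng h1 h2) then show ?case using K_plus by (simp add: frag_extend_add)
qed

lemma M_smult:
  assumes r: "r \<in> carrier R" and y: "Poly_Mapping.keys y \<subseteq> carrier R \<times> carrier N"
  shows "r \<odot>\<^bsub>M\<^esub> cls y = cls (phi r y)"
proof -
  have "cls (phi r c) = cls (phi r y)" if "c \<in> cls y" for c
    using that by (intro cls_eqI) (auto simp: cls_mem frag_extend_add phi_K[OF r])
  then have "(\<Union>c\<in>cls y. cls (phi r c)) = cls (phi r y)" using cls_self[of y] by blast
  then show ?thesis by (simp add: induced_module_def Let_def cls_def)
qed

text \<open>The universal property of the tensor product: the additive extension of \<open>f\<close>
  to the free abelian group kills the relations, hence the subgroup \<open>K\<close>, and is
  constant on cosets.\<close>

lemma induced_hom:
  fixes f :: "'r \<times> 'a \<Rightarrow> 'g::ab_group_add"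
  assumes f1: "\<And>x y v. x \<in> carrier R \<Longrightarrow> y \<in> carrier R \<Longrightarrow> v \<in> carrier N \<Longrightarrow> f (x \<oplus> y, v) = f (x, v) + f (y, v)"
    and f2: "\<And>x v w. x \<in> carrier R \<Longrightarrow> v \<in> carrier N \<Longrightarrow> w \<in> carrier N \<Longrightarrow> f (x, v \<oplus>\<^bsub>N\<^esub> w) = f (x, v) + f (x, w)"
    and f3: "\<And>x a v. x \<in> carrier R \<Longrightarrow> a \<in> A \<Longrightarrow> v \<in> carrier N \<Longrightarrow> f (x \<otimes> a, v) = f (x, a \<odot>\<^bsub>N\<^esub> v)"
  obtains \<theta> where "\<And>x v. x \<in> carrier R \<Longrightarrow> v \<in> carrier N \<Longrightarrow> \<theta> (cls (frag_of (x, v))) = f (x, v)"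
    "\<And>y z. Poly_Mapping.keys y \<subseteq> carrier R \<times> carrier N \<Longrightarrow> Poly_Mapping.keys z \<subseteq> carrier R \<times> carrier N \<Longrightarrow>
      \<theta> (cls (y + z)) = \<theta> (cls y) + \<theta> (cls z)"
proof -
  let ?U = "\<lparr>carrier = UNIV :: 'g set, monoid.mult = (+), one = 0\<rparr>"
  obtain h where h: "h \<in> hom G ?U" and hf: "\<And>x. x \<in> carrier R \<times> carrier N \<Longrightarrow> h (frag_of x) = f x"
    using comm_group.free_Abelian_group_universal[OF comm_group_UNIV, of f "carrier R \<times> carrier N"] by auto
  interpret h: group_hom G ?U h
    by (rule group_hom.intro[OF group_free_Abelian_group]) (use comm_group_UNIV comm_group.axioms(2) h in \<open>auto simp: group_hom_axioms_def\<close>)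
  have h0: "h 0 = 0" using h.hom_one by simp
  have hadd: "h (y + z) = h y + h z" if "Poly_Mapping.keys y \<subseteq> carrier R \<times> carrier N" "Poly_Mapping.keys z \<subseteq> carrier R \<times> carrier N" for y z
    using h.hom_mult[of y z] that by simp
  have hdiff: "h (y - z) = h y - h z" if "Poly_Mapping.keys y \<subseteq> carrier R \<times> carrier N" "Poly_Mapping.keys z \<subseteq> carrier R \<times> carrier N" for y z
    using hadd[OF keys_diff_G[OF that] that(2)] by simp
  have rel: "h c = 0" if c: "c \<in> tensor_relations R A N" for c
  proof -
    have d3: "h (u - s - t) = h u - h s - h t" if "Poly_Mapping.keys u \<subseteq> carrier R \<times> carrier N"
      "Poly_Mapping.keys s \<subseteq> carrier R \<times> carrier N" "Poly_Mapping.keys t \<subseteq> carrier R \<times> carrier N" for u s t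
      using hdiff[OF that(1,2)] hdiff[OF keys_diff_G[OF that(1,2)] that(3)] by simp
    show ?thesis
      using c unfolding tensor_relations_def
      by (safe) (auto simp: d3 hdiff hf f1 f2 f3 A_sub N_add N_smult)
  qed
  have K0: "h k = 0" if "k \<in> K" for k
    using that
  proof induction
    case (inv k)
    then have k: "Poly_Mapping.keys k \<subseteq> carrier R \<times> carrier N" using subsetD[OF relations_carrier] unfolding carrier_free_Abelian_group_iff by blast
    then show ?case using hdiff[of 0 k] rel[OF inv] h0 by simp
  next
    case (eng k l) then show ?case using hadd K_keys by simp
  qed (use h0 rel in auto)
  define \<theta> where "\<theta> X = h (SOME y. y \<in> X)" for X
  have \<theta>: "\<theta> (cls y) = h y" if "Poly_Mapping.keys y \<subseteq> carrier R \<times> carrier N" for y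
  proof -
    have "(SOME z. z \<in> cls y) \<in> cls y" using cls_self by (rule someI)
    then obtain k where "k \<in> K" "(SOME z. z \<in> cls y) = k + y" by (auto simp: cls_mem)
    then show ?thesis using hadd[OF K_keys that] K0 by (simp add: \<theta>_def)
  qed
  show ?thesis
    by (rule that[of \<theta>]) (simp_all add: \<theta> hf hadd keys_add_G)
qed

end

section \<open>Young modules\<close>

text \<open>The sorted word whose letters start at \<open>k\<close>, with multiplicities given by
  the list; at \<open>k = 0\<close> it is \<open>initial_word\<close>.\<close>

fun blocks :: "nat \<Rightarrow> nat list \<Rightarrow> nat list" where
  "blocks k [] = []"
| "blocks k (a # l) = replicate a k @ blocks (Suc k) l"

lemma set_blocks: "x \<in> set (blocks k l) \<Longrightarrow> k \<le> x"
  by (induction l arbitrary: k) (auto simp: set_replicate_conv_if split: if_splits dest!: Suc_leD)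

lemma sorted_blocks: "sorted (blocks k l)"
  by (induction l arbitrary: k) (auto simp: sorted_append set_replicate_conv_if dest!: set_blocks)

lemma length_blocks: "length (blocks k l) = sum_list l"
  by (induction l arbitrary: k) auto

lemma count_blocks: "count (mset (blocks k l)) i = (if k \<le> i \<and> i < k + length l then l ! (i - k) else 0)"
proof (induction l arbitrary: k)
  case (Cons a l)
  have "count (mset (blocks (Suc k) l)) k = 0" using set_blocks[of k "Suc k" l] by (auto simp: count_eq_zero_iff)
  moreover have "i - k = Suc (i - Suc k)" if "k < i" using that by auto
  ultimately show ?case using Cons[of "Suc k"] by (cases "k = i") auto
qed simp

lemma initial_word_blocks: "initial_word l = blocks 0 l"
proof -
  have c: "content l = mset (blocks 0 l)" by (rule multiset_eqI) (simp add: count_content count_blocks)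
  show ?thesis unfolding initial_word_def c sorted_list_of_multiset_mset by (rule sorted_sort_id[OF sorted_blocks])
qed

text \<open>Matches the generators of the Young subalgebra with the equal neighbours of the sorted
  word: the generator of index \<open>j + 1\<close> acts at positions \<open>j\<close> and
  \<open>j + 1\<close>, counted from 0, and letters change exactly after a partial sum.\<close>

lemma blocks_nth_eq_iff:
  assumes "0 \<notin> set l" "Suc j < sum_list l"
  shows "blocks k l ! j = blocks k l ! Suc j \<longleftrightarrow> Suc j \<notin> (\<lambda>i. sum_list (take i l)) ` {1..length l}"
  using assms
proof (induction l arbitrary: j k)
  case (Cons a l)
  let ?S = "(\<lambda>i. sum_list (take i l)) ` {1..length l}"
  have "{1..length (a # l)} = Suc ` insert 0 {1..length l}"
  proof
    show "{1..length (a # l)} \<subseteq> Suc ` insert 0 {1..length l}"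
    proof
      fix i assume "i \<in> {1..length (a # l)}"
      then show "i \<in> Suc ` insert 0 {1..length l}" by (cases i) (auto simp: image_iff)
    qed
  qed auto
  then have S: "(\<lambda>i. sum_list (take i (a # l))) ` {1..length (a # l)} = (+) a ` insert 0 ?S"
    by (simp only: image_image image_insert) simp
  have a: "a > 0" using Cons.prems by auto
  consider "Suc j < a" | "Suc j = a" | "a \<le> j" by linarith
  then show ?case
  proof cases
    case 1
    then show ?thesis unfolding S by (auto simp: nth_append)
  next
    case 2
    then have "0 < length (blocks (Suc k) l)" using Cons.prems length_blocks[of "Suc k" l] by simp
    then have "blocks (Suc k) l ! 0 \<noteq> k" using set_blocks[OF nth_mem] by fastforce
    then show ?thesis using 2 unfolding S by (auto simp: nth_append)
  next
    case 3
    then obtain j' where 3: "j = a + j'" using le_Suc_ex by blast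
    have "Suc (a + j') \<in> (+) a ` insert 0 ?S \<longleftrightarrow> Suc j' \<in> ?S"
      by (auto simp: image_iff simp flip: add_Suc_right)
    then show ?thesis using Cons.IH[of j' "Suc k"] Cons.prems 3 unfolding S by (auto simp: nth_append)
  qed
qed simp

lemma initial_word_nth_eq_iff:
  assumes "lam \<in> Par n" "Suc j < n"
  shows "initial_word lam ! j = initial_word lam ! Suc j \<longleftrightarrow> Suc j \<notin> (\<lambda>i. sum_list (take i lam)) ` {1..length lam}"
  unfolding initial_word_blocks by (rule blocks_nth_eq_iff) (use assms in \<open>auto simp: Par_def\<close>)

text \<open>A one-dimensional character as an action on words, every generator acting by the scalar
  \<open>c\<close>. The general results on actions then show that evaluation at \<open>c\<close> is
  well defined on cosets.\<close>

lemma hecke_action_scl: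
  assumes c: "c * c = (q - 1) * c + q"
  shows "hecke_action (\<lambda>_. scl c) q n"
  by unfold_locales (auto simp: scl_add word_space_closed mult.commute c scl_add_left[symmetric] algebra_simps)

lemma act_scl: "act (\<lambda>_. scl c) f v = scl (free_algebra_eval c f) v"
proof -
  have fold: "foldr (\<lambda>_. scl c) u v = scl (c ^ length u) v" for u :: "nat list" and v
    by (induction u) auto
  have "scl (sum g B) v = (\<Sum>x\<in>B. scl (g x) v)" for g :: "nat list \<Rightarrow> 'a" and B
    by (induction B rule: infinite_finite_induct) (auto simp: scl_add_left)
  then show ?thesis by (simp add: act_def fold free_algebra_eval_def)
qed

lemma free_algebra_eval_coset:
  assumes c: "c * c = (q - 1) * c + q" and f: "f \<in> carrier (FA n)"
  shows "the_elem (free_algebra_eval c ` hecke_class n q f) = free_algebra_eval c f"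
proof -
  interpret A: hecke_action "\<lambda>_. scl c" q n by (rule hecke_action_scl[OF c])
  \<comment> \<open>A test vector of the right length; its value at its own word reads off the
    scalar.\<close>
  let ?d = "word_vec (replicate n 0)"
  have d: "?d \<in> word_space n" by (rule weight_space_word_space[OF weight_space_word_vec[OF refl]]) simp
  have ev: "free_algebra_eval c g = act (\<lambda>_. scl c) g ?d (replicate n 0)" for g
    unfolding act_scl by (simp add: fun_apply_simps word_vec_def)
  have "free_algebra_eval c g = free_algebra_eval c f" if "g \<in> hecke_class n q f" for g
    using that A.act_ideal[OF _ d] unfolding ev by (auto simp: hecke_class_mem act_add)
  then have "free_algebra_eval c ` hecke_class n q f = {free_algebra_eval c f}" using hecke_class_self[OF f] by blast
  then show ?thesis by simp
qed

lemma rho_scl: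
  assumes c: "c * c = (q - 1) * c + q" and X: "X \<in> carrier (hecke n q)" and v: "v \<in> word_space n"
  shows "hecke_action.rho (\<lambda>_. scl c) X v = scl (the_elem (free_algebra_eval c ` X)) v"
proof -
  obtain f where f: "f \<in> carrier (FA n)" "X = hecke_class n q f" using X by (rule hecke_carrierE)
  show ?thesis
    unfolding f(2) hecke_action.rho_hecke_class[OF hecke_action_scl[OF c] f(1) v] act_scl free_algebra_eval_coset[OF c f(1)] ..
qed

lemma eval_scalar:
  fixes c :: "'f::field"
  assumes c: "c * c = (q - 1) * c + q"
  shows "the_elem (free_algebra_eval c ` hecke_scalar n q a) = a"
proof -
  let ?d = "word_vec (replicate n 0) :: nat list \<Rightarrow> 'f"
  have d: "?d \<in> word_space n" by (rule weight_space_word_space[OF weight_space_word_vec[OF refl]]) simp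
  have "scl (the_elem (free_algebra_eval c ` hecke_scalar n q a)) ?d (replicate n 0) = scl a ?d (replicate n 0)"
    using rho_scl[OF c hecke_scalar_carrier d] hecke_action.rho_simps(1)[OF hecke_action_scl[OF c] d] by metis
  then show ?thesis by (simp add: fun_apply_simps word_vec_def)
qed

lemma hecke_line_simps [simp]: "carrier (hecke_line c) = UNIV" "add (hecke_line c) = (+)"
  "module.smult (hecke_line c) X x = the_elem (free_algebra_eval c ` X) * x"
  by (simp_all add: hecke_line_def)

lemma eigenvalue_quad: "eigenvalue sg q * eigenvalue sg q = (q - 1) * eigenvalue sg q + q"
  by (simp add: eigenvalue_def algebra_simps)

lemma (in hecke_action) rho_zero_uminus:
  assumes v: "v \<in> word_space n"
  shows "rho \<zero>\<^bsub>hecke n q\<^esub> v = 0" "X \<in> carrier (hecke n q) \<Longrightarrow> rho (\<ominus>\<^bsub>hecke n q\<^esub> X) v = - rho X v"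
proof -
  interpret R: ring "hecke n q" by (rule ring_hecke)
  show z: "rho \<zero>\<^bsub>hecke n q\<^esub> v = 0" using rho_simps(4)[OF v R.zero_closed R.zero_closed] by simp
  show "rho (\<ominus>\<^bsub>hecke n q\<^esub> X) v = - rho X v" if "X \<in> carrier (hecke n q)"
    using rho_simps(4)[OF v R.a_inv_closed[OF that] that] z that by (simp add: R.l_neg eq_neg_iff_add_eq_0)
qed

lemma hecke_young_carrier: "a \<in> hecke_young n q lam \<Longrightarrow> a \<in> carrier (hecke n q)"
  unfolding hecke_young_def
  by (rule subsetD[OF ring.generate_ring_incl[OF ring_hecke]]) auto

lemma twisted_T_eigen:
  assumes "Suc j < length w" "w ! j = w ! Suc j"
  shows "twisted_T sg q (Suc j) (word_vec w) = scl (eigenvalue sg q) (word_vec w)"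
  using T_word_vec(2)[OF assms] by (cases sg) (auto simp: twisted_T_def S_def eigenvalue_def fun_eq_iff fun_apply_simps algebra_simps)

text \<open>Two actions on the sorted word are compared, the given one and the scalar one. They
  agree on the generators of the Young subalgebra, and agreement passes to products because a scalar
  can be pulled through either action.\<close>

lemma rho_hecke_young:
  fixes q :: "'f::field"
  assumes lam: "lam \<in> Par n" and a: "a \<in> hecke_young n q lam"
  shows "hecke_action.rho (twisted_T sg q) a (word_vec (initial_word lam)) =
    scl (the_elem (free_algebra_eval (eigenvalue sg q) ` a)) (word_vec (initial_word lam))"
proof -
  let ?c = "eigenvalue sg q"
  let ?d = "word_vec (initial_word lam) :: nat list \<Rightarrow> 'f"
  interpret R: ring "hecke n q" by (rule ring_hecke)
  interpret A: hecke_action "twisted_T sg q" q n by (rule hecke_action_twisted_T)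
  interpret B: hecke_action "\<lambda>_. scl ?c" q n by (rule hecke_action_scl[OF eigenvalue_quad])
  note B = rho_scl[OF eigenvalue_quad[of sg q]]
  have d: "?d \<in> word_space n" by (rule weight_space_word_space[OF weight_space_word_vec[OF refl]]) (simp add: size_content_Par[OF lam])
  have car: "x \<in> carrier (hecke n q)" if "x \<in> generate_ring (hecke n q)
       (range (hecke_scalar n q) \<union>
        hecke_gen n q ` {i. 1 \<le> i \<and> i < n \<and> i \<notin> (\<lambda>k. sum_list (take k lam)) ` {1..length lam}})" for x
    using hecke_young_carrier[of x] that unfolding hecke_young_def .
  have "A.rho a ?d = B.rho a ?d"
    using a unfolding hecke_young_def
  proof induction
    case one show ?case using A.rho_simps(3)[OF d] B.rho_simps(3)[OF d] by simp
  next
    case (incl h)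
    then consider b where "h = hecke_scalar n q b"
      | i where "1 \<le> i" "i < n" "i \<notin> (\<lambda>k. sum_list (take k lam)) ` {1..length lam}" "h = hecke_gen n q i" by blast
    then show ?case
    proof cases
      case 1 then show ?thesis using A.rho_simps(1)[OF d] B.rho_simps(1)[OF d] by simp
    next
      case 2
      then obtain j where j: "i = Suc j" by (cases i) auto
      have "initial_word lam ! j = initial_word lam ! Suc j" using initial_word_nth_eq_iff[OF lam, of j] 2 j by simp
      then have "twisted_T sg q i ?d = scl ?c ?d" unfolding j by (intro twisted_T_eigen) (use 2 j length_initial_word[OF lam] in auto)
      then show ?thesis unfolding 2(4) using A.rho_simps(2)[OF d 2(1,2)] B.rho_simps(2)[OF d 2(1,2)] by simp
    qed
  next
    case (a_inv h)
    then show ?case using A.rho_zero_uminus(2)[OF d car[OF a_inv(1)]] B.rho_zero_uminus(2)[OF d car[OF a_inv(1)]] by simp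
  next
    case (eng_add h k)
    then show ?case using A.rho_simps(4)[OF d car car] B.rho_simps(4)[OF d car car] by simp
  next
    case (eng_mult h k)
    have "A.rho (h \<otimes>\<^bsub>hecke n q\<^esub> k) ?d = A.rho h (B.rho k ?d)"
      using A.rho_simps(5)[OF d car[OF eng_mult(1)] car[OF eng_mult(2)]] eng_mult by simp
    also have "\<dots> = B.rho h (B.rho k ?d)"
      unfolding B[OF car[OF eng_mult(2)] d] A.rho_linear B.rho_linear using eng_mult by simp
    also have "\<dots> = B.rho (h \<otimes>\<^bsub>hecke n q\<^esub> k) ?d"
      using B.rho_simps(5)[OF d car[OF eng_mult(1)] car[OF eng_mult(2)]] by simp
    finally show ?case .
  qed
  then show ?thesis using B[OF hecke_young_carrier[OF a] d] by simp
qed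


definition young_module :: "bool \<Rightarrow> nat \<Rightarrow> 'f::field \<Rightarrow> nat list \<Rightarrow> ((nat list \<Rightarrow>\<^sub>0 'f) set, 'f hecke_induced) module" where
  "young_module sg n q lam = induced_module (hecke n q) (hecke_young n q lam) (hecke_line (eigenvalue sg q))"

lemma young_module_simps: "young_module False n q = young_M n q" "young_module True n q = signed_young_M n q"
  by (simp_all add: fun_eq_iff young_module_def young_M_def signed_young_M_def eigenvalue_def)

text \<open>The canonical generator \<open>1 \<otimes> 1\<close> of the induced module.\<close>

definition young_one :: "bool \<Rightarrow> nat \<Rightarrow> 'f::field \<Rightarrow> nat list \<Rightarrow> 'f hecke_induced" where
  "young_one sg n q lam = tensor_induction.cls (hecke n q) (hecke_young n q lam) (hecke_line (eigenvalue sg q))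
     (frag_of (\<one>\<^bsub>hecke n q\<^esub>, 1))"

lemma (in tensor_induction) cls_assoc:
  "x \<in> carrier R \<Longrightarrow> a \<in> A \<Longrightarrow> v \<in> carrier N \<Longrightarrow> cls (frag_of (x \<otimes> a, v)) = cls (frag_of (x, a \<odot>\<^bsub>N\<^esub> v))"
  by (rule cls_eqI, rule generate.incl, unfold tensor_relations_def, rule UnI2) blast

lemma (in tensor_induction) K_distrib:
  "x \<in> carrier R \<Longrightarrow> v \<in> carrier N \<Longrightarrow> w \<in> carrier N \<Longrightarrow>
    frag_of (x, v \<oplus>\<^bsub>N\<^esub> w) - frag_of (x, v) - frag_of (x, w) \<in> K"
  by (rule generate.incl, unfold tensor_relations_def, rule UnI1, rule UnI2) blast

lemma tensor_induction_young: "tensor_induction (hecke n q) (hecke_young n q lam) (hecke_line c)"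
  unfolding tensor_induction_def tensor_induction_axioms_def using ring_hecke hecke_young_carrier by auto

context
  fixes sg :: bool and n :: nat and q :: "'f::field" and lam :: "nat list"
begin

abbreviation (input) H where "H \<equiv> hecke n q"
abbreviation (input) Y where "Y \<equiv> young_module sg n q lam"
abbreviation (input) ev where "ev X \<equiv> the_elem (free_algebra_eval (eigenvalue sg q) ` X)"

interpretation tensor_induction H "hecke_young n q lam" "hecke_line (eigenvalue sg q)"
  by (rule tensor_induction_young)

lemma young_module_closed:
  shows "\<zero>\<^bsub>Y\<^esub> \<in> carrier Y" "x \<in> carrier Y \<Longrightarrow> y \<in> carrier Y \<Longrightarrow> x \<oplus>\<^bsub>Y\<^esub> y \<in> carrier Y"
    "r \<in> carrier H \<Longrightarrow> x \<in> carrier Y \<Longrightarrow> r \<odot>\<^bsub>Y\<^esub> x \<in> carrier Y"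
    "young_one sg n q lam \<in> carrier Y"
proof -
  show "\<zero>\<^bsub>Y\<^esub> \<in> carrier Y" "young_one sg n q lam \<in> carrier Y"
    unfolding young_module_def young_one_def M_zero by (rule cls_closed; simp)+
  show "x \<oplus>\<^bsub>Y\<^esub> y \<in> carrier Y" if "x \<in> carrier Y" "y \<in> carrier Y"
    using that unfolding young_module_def carrier_M[of x] carrier_M[of y]
    by (auto simp: M_add simp del: hecke_line_simps intro!: cls_closed[OF keys_add_G])
  show "r \<odot>\<^bsub>Y\<^esub> x \<in> carrier Y" if "r \<in> carrier H" "x \<in> carrier Y"
    using that unfolding young_module_def carrier_M[of x]
    by (auto simp: M_smult simp del: hecke_line_simps intro!: cls_closed[OF phi_keys])
qed

lemma young_module_zero:
  shows "x \<in> carrier Y \<Longrightarrow> x \<oplus>\<^bsub>Y\<^esub> \<zero>\<^bsub>Y\<^esub> = x" "x \<in> carrier Y \<Longrightarrow> \<zero>\<^bsub>Y\<^esub> \<oplus>\<^bsub>Y\<^esub> x = x"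
    "r \<in> carrier H \<Longrightarrow> r \<odot>\<^bsub>Y\<^esub> \<zero>\<^bsub>Y\<^esub> = \<zero>\<^bsub>Y\<^esub>"
  unfolding young_module_def carrier_M M_zero by (auto simp: M_add M_smult)

lemma young_tensor:
  assumes a: "a \<in> hecke_young n q lam"
  shows "a \<odot>\<^bsub>Y\<^esub> young_one sg n q lam = cls (frag_of (\<one>\<^bsub>H\<^esub>, ev a))"
proof -
  have aH: "a \<in> carrier H" by (rule hecke_young_carrier[OF a])
  have "a \<odot>\<^bsub>Y\<^esub> young_one sg n q lam = cls (frag_of (\<one>\<^bsub>H\<^esub> \<otimes>\<^bsub>H\<^esub> a, 1))"
    unfolding young_module_def young_one_def using aH by (simp add: M_smult)
  also have "\<dots> = cls (frag_of (\<one>\<^bsub>H\<^esub>, a \<odot>\<^bsub>hecke_line (eigenvalue sg q)\<^esub> 1))"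
    by (rule cls_assoc) (use a in auto)
  finally show ?thesis by simp
qed

lemma young_eigen:
  assumes lam: "lam \<in> Par n" and j: "Suc j < n" "initial_word lam ! j = initial_word lam ! Suc j"
  shows "hecke_gen n q (Suc j) \<odot>\<^bsub>Y\<^esub> young_one sg n q lam = hecke_scalar n q (eigenvalue sg q) \<odot>\<^bsub>Y\<^esub> young_one sg n q lam"
proof -
  have "hecke_gen n q (Suc j) \<in> hecke_young n q lam" "hecke_scalar n q (eigenvalue sg q) \<in> hecke_young n q lam"
    unfolding hecke_young_def using initial_word_nth_eq_iff[OF lam j(1)] j by (auto intro!: generate_ring.incl)
  moreover have "ev (hecke_gen n q (Suc j)) = eigenvalue sg q"
    unfolding hecke_gen_hecke_class
    by (subst free_algebra_eval_coset[OF eigenvalue_quad single_carrier]) (use j in \<open>auto simp: free_algebra_eval_def\<close>)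
  ultimately show ?thesis by (simp add: young_tensor eval_scalar[OF eigenvalue_quad])
qed

text \<open>Scalars lie in the Young subalgebra and can be moved across the tensor sign, so every
  pure tensor is a multiple of \<open>young_one\<close>.\<close>

lemma young_frag:
  assumes x: "x \<in> carrier H"
  shows "cls (frag_of (x, a)) = (x \<otimes>\<^bsub>H\<^esub> hecke_scalar n q a) \<odot>\<^bsub>Y\<^esub> young_one sg n q lam"
proof -
  have s: "hecke_scalar n q a \<in> hecke_young n q lam" unfolding hecke_young_def by (auto intro!: generate_ring.incl)
  have "cls (frag_of (x \<otimes>\<^bsub>H\<^esub> hecke_scalar n q a, 1)) =
      cls (frag_of (x, hecke_scalar n q a \<odot>\<^bsub>hecke_line (eigenvalue sg q)\<^esub> 1))"
    by (rule cls_assoc) (use s x in auto)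
  then have "cls (frag_of (x, a)) = cls (frag_of (x \<otimes>\<^bsub>H\<^esub> hecke_scalar n q a, 1))"
    by (simp add: eval_scalar[OF eigenvalue_quad])
  also have "\<dots> = (x \<otimes>\<^bsub>H\<^esub> hecke_scalar n q a) \<odot>\<^bsub>Y\<^esub> young_one sg n q lam"
    unfolding young_module_def young_one_def using x by (simp add: M_smult)
  finally show ?thesis .
qed

lemma young_uminus_frag:
  assumes x: "x \<in> carrier H"
  shows "cls (- frag_of (x, a)) = cls (frag_of (x, - a))"
proof (rule cls_eqI)
  \<comment> \<open>The relation for \<open>a + - a\<close> leaves the tensor
    \<open>frag_of (x, 0)\<close>; the relation for \<open>0 + 0\<close> removes it.\<close>
  have "(frag_of (x, a + - a) - frag_of (x, a) - frag_of (x, - a)) + (frag_of (x, 0 + 0) - frag_of (x, 0) - frag_of (x, 0)) \<in> K"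
    using K_plus[OF K_distrib[OF x, of a "- a"] K_distrib[OF x, of 0 0]] by simp
  then show "- frag_of (x, a) - frag_of (x, - a) \<in> K" by simp
qed

text \<open>Negatives of pure tensors are pure tensors by \<open>young_uminus_frag\<close>, so
  multiples of \<open>young_one\<close> and sums reach everything.\<close>

lemma young_induct [consumes 1, case_names zero smult add]:
  assumes x: "x \<in> carrier Y" and zero: "P \<zero>\<^bsub>Y\<^esub>"
    and smult: "\<And>r. r \<in> carrier H \<Longrightarrow> P (r \<odot>\<^bsub>Y\<^esub> young_one sg n q lam)"
    and add: "\<And>x y. x \<in> carrier Y \<Longrightarrow> y \<in> carrier Y \<Longrightarrow> P x \<Longrightarrow> P y \<Longrightarrow> P (x \<oplus>\<^bsub>Y\<^esub> y)"
  shows "P x"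
proof -
  let ?B = "carrier H \<times> (UNIV :: 'f set)"
  obtain y where y: "Poly_Mapping.keys y \<subseteq> ?B" "x = cls y"
    using x unfolding young_module_def carrier_M by auto
  have padd: "P (cls (y + z))" if "Poly_Mapping.keys y \<subseteq> ?B" "Poly_Mapping.keys z \<subseteq> ?B" "P (cls y)" "P (cls z)" for y z
    using add[unfolded young_module_def, OF cls_closed[of y] cls_closed[of z]] that by (simp add: M_add)
  have frag: "P (cls (frag_of (r, a)))" if "r \<in> carrier H" for r a
    unfolding young_frag[OF that] by (rule smult) (use that in simp)
  \<comment> \<open>Induction in the free abelian group proceeds by differences, hence
    \<open>y\<close> and \<open>- y\<close> are treated together.\<close>
  have "P (cls y) \<and> P (cls (- y))"
  proof (rule free_Abelian_group_induct[OF y(1), where P = "\<lambda>y. P (cls y) \<and> P (cls (- y))"])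
    show "P (cls 0) \<and> P (cls (- 0))" using zero unfolding young_module_def M_zero by simp
  next
    fix u v assume "Poly_Mapping.keys u \<subseteq> ?B" "Poly_Mapping.keys v \<subseteq> ?B"
      "P (cls u) \<and> P (cls (- u))" "P (cls v) \<and> P (cls (- v))"
    then show "P (cls (u - v)) \<and> P (cls (- (u - v)))" using padd[of u "- v"] padd[of "- u" v] by simp
  next
    fix z :: "(nat list \<Rightarrow>\<^sub>0 'f) set \<times> 'f" assume "z \<in> ?B"
    then show "P (cls (frag_of z)) \<and> P (cls (- frag_of z))" by (cases z) (auto simp: frag young_uminus_frag)
  qed
  then show ?thesis using y(2) by simp
qed

text \<open>The tensor of \<open>x\<close> and \<open>a\<close> goes to \<open>x\<close> acting on
  \<open>a\<close> times the sorted word; \<open>rho_hecke_young\<close> says that this is balanced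
  over the Young subalgebra.\<close>

lemma young_realisation:
  assumes lam: "lam \<in> Par n"
  obtains \<theta> where "\<And>x. x \<in> carrier Y \<Longrightarrow> \<theta> x \<in> weight_space (content lam)"
    "\<And>x y. x \<in> carrier Y \<Longrightarrow> y \<in> carrier Y \<Longrightarrow> \<theta> (x \<oplus>\<^bsub>Y\<^esub> y) = \<theta> x + \<theta> y"
    "\<And>r x. r \<in> carrier H \<Longrightarrow> x \<in> carrier Y \<Longrightarrow> \<theta> (r \<odot>\<^bsub>Y\<^esub> x) = hecke_action.rho (twisted_T sg q) r (\<theta> x)"
    "\<theta> (young_one sg n q lam) = word_vec (initial_word lam)"
proof -
  let ?d = "word_vec (initial_word lam) :: nat list \<Rightarrow> 'f"
  let ?B = "carrier H \<times> (UNIV :: 'f set)"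
  interpret A: hecke_action "twisted_T sg q" q n by (rule hecke_action_twisted_T)
  have dW: "?d \<in> weight_space (content lam)" by (rule weight_space_word_vec) simp
  have word_space: "u \<in> word_space n" if "u \<in> weight_space (content lam)" for u :: "nat list \<Rightarrow> 'f" by (rule weight_space_word_space[OF that size_content_Par[OF lam]])
  note rW = rho_weight_space[OF _ _ size_content_Par[OF lam], where q = q and sg = sg]
  define f where "f = (\<lambda>(x, a). A.rho x (scl a ?d))"
  have sd: "scl a ?d \<in> weight_space (content lam)" for a by (rule weight_space_scl[OF dW])
  note sv = word_space[OF sd]
  obtain \<theta> where t1: "\<And>x v. x \<in> carrier H \<Longrightarrow> v \<in> UNIV \<Longrightarrow> \<theta> (cls (frag_of (x, v))) = f (x, v)"
    and t2: "\<And>y z. Poly_Mapping.keys y \<subseteq> ?B \<Longrightarrow> Poly_Mapping.keys z \<subseteq> ?B \<Longrightarrow>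
      \<theta> (cls (y + z)) = \<theta> (cls y) + \<theta> (cls z)"
  proof (rule induced_hom[of f, unfolded hecke_line_simps])
    show "f (x \<oplus>\<^bsub>H\<^esub> y, v) = f (x, v) + f (y, v)" if "x \<in> carrier H" "y \<in> carrier H" for x y v
      unfolding f_def using A.rho_simps(4)[OF sv that] by simp
    show "f (x, v + w) = f (x, v) + f (x, w)" for x v w
      unfolding f_def by (simp add: scl_add_left A.rho_linear)
    show "f (x \<otimes>\<^bsub>H\<^esub> a, v) = f (x, ev a * v)" if "x \<in> carrier H" "a \<in> hecke_young n q lam" for x a v
      unfolding f_def using A.rho_simps(5)[OF sv that(1) hecke_young_carrier[OF that(2)]] rho_hecke_young[OF lam that(2), of sg]
      by (simp add: A.rho_linear mult.commute)
  qed auto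
  have add: "\<theta> (x \<oplus>\<^bsub>Y\<^esub> y) = \<theta> x + \<theta> y" if "x \<in> carrier Y" "y \<in> carrier Y" for x y
    using that unfolding young_module_def carrier_M by (auto simp: M_add t2)
  have zero: "\<theta> \<zero>\<^bsub>Y\<^esub> = 0"
    using t2[of 0 0] unfolding young_module_def M_zero by simp
  have one: "\<theta> (young_one sg n q lam) = ?d"
    unfolding young_one_def using t1[of "\<one>\<^bsub>H\<^esub>" 1] A.rho_simps(3)[OF word_space[OF dW]] by (simp add: f_def)
  have base: "\<theta> (r \<odot>\<^bsub>Y\<^esub> young_one sg n q lam) = A.rho r ?d" if "r \<in> carrier H" for r
    unfolding young_one_def young_module_def using that t1[of r 1] by (simp add: M_smult f_def)
  have WMt: "\<theta> x \<in> weight_space (content lam)" if "x \<in> carrier Y" for x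
    using that
  proof (induction rule: young_induct)
    case (smult r) then show ?case using base rW dW by simp
  qed (auto simp: zero add intro: weight_space_add)
  have smultd: "r \<odot>\<^bsub>Y\<^esub> (x \<oplus>\<^bsub>Y\<^esub> y) = r \<odot>\<^bsub>Y\<^esub> x \<oplus>\<^bsub>Y\<^esub> r \<odot>\<^bsub>Y\<^esub> y"
    if "r \<in> carrier H" "x \<in> carrier Y" "y \<in> carrier Y" for r x y
    using that unfolding young_module_def carrier_M[of x] carrier_M[of y]
    by (auto simp: M_add M_smult phi_keys keys_add_G frag_extend_add simp del: hecke_line_simps)
  have smulta: "r \<odot>\<^bsub>Y\<^esub> (s \<odot>\<^bsub>Y\<^esub> young_one sg n q lam) = (r \<otimes>\<^bsub>H\<^esub> s) \<odot>\<^bsub>Y\<^esub> young_one sg n q lam"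
    if "r \<in> carrier H" "s \<in> carrier H" for r s
    unfolding young_module_def young_one_def using that by (simp add: M_smult)
  have equi: "\<theta> (r \<odot>\<^bsub>Y\<^esub> x) = A.rho r (\<theta> x)" if r: "r \<in> carrier H" and x: "x \<in> carrier Y" for r x
    using x
  proof (induction rule: young_induct)
    case zero then show ?case using young_module_zero(3)[OF r] \<open>\<theta> \<zero>\<^bsub>Y\<^esub> = 0\<close> A.rho_linear(3) by simp
  next
    case (smult s) then show ?case using smulta r base A.rho_simps(5)[OF word_space[OF dW] r] by simp
  next
    case (add x y) then show ?case
      using smultd[OF r] \<open>\<And>x y. x \<in> carrier Y \<Longrightarrow> y \<in> carrier Y \<Longrightarrow> \<theta> (x \<oplus>\<^bsub>Y\<^esub> y) = \<theta> x + \<theta> y\<close> A.rho_linear(1)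
        young_module_closed(3)[OF r] by simp
  qed
  show ?thesis by (rule that[of \<theta>]) (simp_all add: WMt add equi one)
qed

end

section \<open>The double centraliser property\<close>

text \<open>Transport through the isomorphism \<open>\<Psi>\<close>: the components of its inverse
  followed by the realisations serve as coordinates, and the images of the generators
  \<open>young_one\<close> of the summands as cyclic vectors.\<close>

lemma double_centraliser_young:
  fixes q :: "'f::field" and V :: "((nat list \<Rightarrow>\<^sub>0 'f) set, 'v) module"
  assumes q: "q \<noteq> 0" and V: "left_module (hecke n q) V"
    and iso: "lmod_iso (hecke n q)
       (lmod_direct_sum (SIGMA lam:Par n. {..<d lam}) (\<lambda>(lam, i). young_module sg n q lam)) V"
    and cosat: "co_saturated n (coarsenings n (zeta n d))"
  shows "double_centraliser_property (hecke n q) V"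
proof -
  interpret V: left_module "hecke n q" V by (rule V)
  let ?H = "hecke n q"
  define I where "I = (SIGMA lam:Par n. {..<d lam})"
  define M where "M x = young_module sg n q (fst x)" for x :: "nat list \<times> nat"
  define e where "e x = young_one sg n q (fst x)" for x :: "nat list \<times> nat"
  define D where "D = lmod_direct_sum I M"
  have fI: "finite I" unfolding I_def using finite_Par by (rule finite_SigmaI) simp
  have lamI: "fst x \<in> Par n" if "x \<in> I" for x using that by (auto simp: I_def)
  have cl: "\<zero>\<^bsub>M x\<^esub> \<in> carrier (M x)" "a \<in> carrier (M x) \<Longrightarrow> b \<in> carrier (M x) \<Longrightarrow> a \<oplus>\<^bsub>M x\<^esub> b \<in> carrier (M x)"
    "r \<in> carrier ?H \<Longrightarrow> a \<in> carrier (M x) \<Longrightarrow> r \<odot>\<^bsub>M x\<^esub> a \<in> carrier (M x)" "e x \<in> carrier (M x)" for x a b r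
    unfolding M_def e_def by (rule young_module_closed; assumption)+
  have zs: "a \<in> carrier (M x) \<Longrightarrow> a \<oplus>\<^bsub>M x\<^esub> \<zero>\<^bsub>M x\<^esub> = a" "a \<in> carrier (M x) \<Longrightarrow> \<zero>\<^bsub>M x\<^esub> \<oplus>\<^bsub>M x\<^esub> a = a"
    "r \<in> carrier ?H \<Longrightarrow> r \<odot>\<^bsub>M x\<^esub> \<zero>\<^bsub>M x\<^esub> = \<zero>\<^bsub>M x\<^esub>" for x a r
    unfolding M_def by (rule young_module_zero; assumption)+
  have D_carrier: "z \<in> carrier D \<longleftrightarrow> z \<in> (\<Pi>\<^sub>E x\<in>I. carrier (M x))" for z
    using fI by (simp add: D_def lmod_direct_sum_def)
  have D_add: "z \<oplus>\<^bsub>D\<^esub> z' = (\<lambda>x\<in>I. z x \<oplus>\<^bsub>M x\<^esub> z' x)" and D_smult: "r \<odot>\<^bsub>D\<^esub> z = (\<lambda>x\<in>I. r \<odot>\<^bsub>M x\<^esub> z x)"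
    and D_zero: "\<zero>\<^bsub>D\<^esub> = (\<lambda>x\<in>I. \<zero>\<^bsub>M x\<^esub>)" for z z' r
    by (simp_all add: D_def lmod_direct_sum_def)
  have D_closed: "z \<in> carrier D \<Longrightarrow> z' \<in> carrier D \<Longrightarrow> z \<oplus>\<^bsub>D\<^esub> z' \<in> carrier D"
    "r \<in> carrier ?H \<Longrightarrow> z \<in> carrier D \<Longrightarrow> r \<odot>\<^bsub>D\<^esub> z \<in> carrier D" "\<zero>\<^bsub>D\<^esub> \<in> carrier D" for z z' r
    unfolding D_carrier D_add D_smult D_zero by (auto intro!: cl)
  have "(\<lambda>(lam, i). young_module sg n q lam) = M" by (auto simp: M_def fun_eq_iff)
  then obtain \<Psi> where \<Psi>: "\<Psi> \<in> lmod_hom ?H D V" and bij: "bij_betw \<Psi> (carrier D) (carrier V)"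
    using iso unfolding lmod_iso_def D_def I_def by auto
  have \<Psi>_closed: "\<Psi> z \<in> carrier V" if "z \<in> carrier D" for z using bij_betw_apply[OF bij that] .
  have \<Psi>_add: "\<Psi> (z \<oplus>\<^bsub>D\<^esub> z') = \<Psi> z \<oplus>\<^bsub>V\<^esub> \<Psi> z'" if "z \<in> carrier D" "z' \<in> carrier D" for z z'
    using \<Psi> that by (auto simp: lmod_hom_def hom_def)
  have \<Psi>_smult: "\<Psi> (r \<odot>\<^bsub>D\<^esub> z) = r \<odot>\<^bsub>V\<^esub> \<Psi> z" if "r \<in> carrier ?H" "z \<in> carrier D" for r z
    using \<Psi> that by (auto simp: lmod_hom_def)
  have "\<zero>\<^bsub>D\<^esub> \<oplus>\<^bsub>D\<^esub> \<zero>\<^bsub>D\<^esub> = \<zero>\<^bsub>D\<^esub>" unfolding D_add D_zero by (rule restrict_ext) (simp add: zs cl)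
  then have \<Psi>_zero: "\<Psi> \<zero>\<^bsub>D\<^esub> = \<zero>\<^bsub>V\<^esub>"
    using \<Psi>_add[OF D_closed(3) D_closed(3)] \<Psi>_closed[OF D_closed(3)] by (metis V.M.add.l_cancel_one)
  define C where "C = inv_into (carrier D) \<Psi>"
  have C_closed: "C v \<in> carrier D" and \<Psi>_C: "\<Psi> (C v) = v" if "v \<in> carrier V" for v
    using that bij unfolding C_def by (auto simp: bij_betw_def inv_into_into f_inv_into_f)
  have C_\<Psi>: "C (\<Psi> z) = z" if "z \<in> carrier D" for z
    unfolding C_def using bij that by (simp add: bij_betw_def)
  have C_add: "C (v \<oplus>\<^bsub>V\<^esub> v') = C v \<oplus>\<^bsub>D\<^esub> C v'" if "v \<in> carrier V" "v' \<in> carrier V" for v v'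
    using C_\<Psi>[OF D_closed(1)[OF C_closed[OF that(1)] C_closed[OF that(2)]]] that
    by (simp add: \<Psi>_add C_closed \<Psi>_C)
  have C_smult: "C (r \<odot>\<^bsub>V\<^esub> v) = r \<odot>\<^bsub>D\<^esub> C v" if "r \<in> carrier ?H" "v \<in> carrier V" for r v
    using C_\<Psi>[OF D_closed(2)[OF that(1) C_closed[OF that(2)]]] that by (simp add: \<Psi>_smult C_closed \<Psi>_C)
  define inx where "inx x a = (\<lambda>y\<in>I. if y = x then a else \<zero>\<^bsub>M y\<^esub>)" for x a
  have inx_closed: "inx x a \<in> carrier D" if "a \<in> carrier (M x)" for x a
    unfolding D_carrier inx_def using that cl by auto
  have inx_add: "inx x (a \<oplus>\<^bsub>M x\<^esub> b) = inx x a \<oplus>\<^bsub>D\<^esub> inx x b" if "a \<in> carrier (M x)" "b \<in> carrier (M x)" for x a b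
    unfolding D_add inx_def by (rule restrict_ext) (simp add: zs cl)
  have inx_smult: "inx x (r \<odot>\<^bsub>M x\<^esub> a) = r \<odot>\<^bsub>D\<^esub> inx x a" if "r \<in> carrier ?H" for x r a
    unfolding D_smult inx_def by (rule restrict_ext) (simp add: zs that)
  have inx_zero: "inx x \<zero>\<^bsub>M x\<^esub> = \<zero>\<^bsub>D\<^esub>" for x
    unfolding D_zero inx_def by (rule restrict_ext) simp
  define realises where "realises x \<theta> \<longleftrightarrow> (\<forall>a\<in>carrier (M x). \<theta> a \<in> weight_space (content (fst x))) \<and>
    (\<forall>a\<in>carrier (M x). \<forall>b\<in>carrier (M x). \<theta> (a \<oplus>\<^bsub>M x\<^esub> b) = \<theta> a + \<theta> b) \<and>
    (\<forall>r\<in>carrier ?H. \<forall>a\<in>carrier (M x). \<theta> (r \<odot>\<^bsub>M x\<^esub> a) = hecke_action.rho (twisted_T sg q) r (\<theta> a)) \<and>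
    \<theta> (e x) = word_vec (initial_word (fst x))" for x \<theta>
  have "\<exists>\<theta>. realises x \<theta>" if x: "x \<in> I" for x
  proof -
    obtain \<theta> where "\<And>a. a \<in> carrier (M x) \<Longrightarrow> \<theta> a \<in> weight_space (content (fst x))"
      "\<And>a b. a \<in> carrier (M x) \<Longrightarrow> b \<in> carrier (M x) \<Longrightarrow> \<theta> (a \<oplus>\<^bsub>M x\<^esub> b) = \<theta> a + \<theta> b"
      "\<And>r a. r \<in> carrier ?H \<Longrightarrow> a \<in> carrier (M x) \<Longrightarrow> \<theta> (r \<odot>\<^bsub>M x\<^esub> a) = hecke_action.rho (twisted_T sg q) r (\<theta> a)"
      "\<theta> (e x) = word_vec (initial_word (fst x))"
      using young_realisation[where sg = sg and q = q, OF lamI[OF x], folded M_def e_def] that by blast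
    then have "realises x \<theta>" unfolding realises_def by (intro conjI ballI)
    then show ?thesis by blast
  qed
  then obtain \<theta> where "\<And>x. x \<in> I \<Longrightarrow> realises x (\<theta> x)" using bchoice[of I realises] by blast
  note rl = this[unfolded realises_def]
  have \<theta>: "a \<in> carrier (M x) \<Longrightarrow> \<theta> x a \<in> weight_space (content (fst x))"
    "a \<in> carrier (M x) \<Longrightarrow> b \<in> carrier (M x) \<Longrightarrow> \<theta> x (a \<oplus>\<^bsub>M x\<^esub> b) = \<theta> x a + \<theta> x b"
    "r \<in> carrier ?H \<Longrightarrow> a \<in> carrier (M x) \<Longrightarrow> \<theta> x (r \<odot>\<^bsub>M x\<^esub> a) = hecke_action.rho (twisted_T sg q) r (\<theta> x a)"
    "\<theta> x (e x) = word_vec (initial_word (fst x))" if "x \<in> I" for x a b r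
    using rl[OF that] by (elim conjE; blast)+
  have \<theta>_zero: "\<theta> x \<zero>\<^bsub>M x\<^esub> = 0" if "x \<in> I" for x
    using \<theta>(2)[OF that cl(1) cl(1)] by (simp add: zs cl)
  have C_app: "C v x \<in> carrier (M x)" if "v \<in> carrier V" "x \<in> I" for v x
    using C_closed[OF that(1)] that(2) unfolding D_carrier by auto
  interpret hecke_structure n q V sg I fst "\<lambda>x v. \<theta> x (C v x)" "\<lambda>x. \<Psi> (inx x (e x))"
  proof
    show "q \<noteq> 0" by (rule q)
    show "fst x \<in> Par n" if "x \<in> I" for x by (rule lamI[OF that])
    show "\<theta> x (C v x) \<in> weight_space (content (fst x))" if "x \<in> I" "v \<in> carrier V" for x v
      by (rule \<theta>(1)[OF that(1) C_app[OF that(2,1)]])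
    show "\<theta> x (C (v \<oplus>\<^bsub>V\<^esub> v') x) = \<theta> x (C v x) + \<theta> x (C v' x)" if "x \<in> I" "v \<in> carrier V" "v' \<in> carrier V" for x v v'
      using \<theta>(2)[OF that(1) C_app[OF that(2,1)] C_app[OF that(3,1)]] that by (simp add: C_add D_add)
    show "\<theta> x (C (r \<odot>\<^bsub>V\<^esub> v) x) = hecke_action.rho (twisted_T sg q) r (\<theta> x (C v x))"
      if "x \<in> I" "r \<in> carrier ?H" "v \<in> carrier V" for x r v
      using \<theta>(3)[OF that(1,2) C_app[OF that(3,1)]] that by (simp add: C_smult D_smult)
    show "\<Psi> (inx x (e x)) \<in> carrier V" if "x \<in> I" for x
      by (rule \<Psi>_closed[OF inx_closed[OF cl(4)]])
    show "hecke_gen n q (Suc j) \<odot>\<^bsub>V\<^esub> \<Psi> (inx x (e x)) = hecke_scalar n q (eigenvalue sg q) \<odot>\<^bsub>V\<^esub> \<Psi> (inx x (e x))"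
      if "x \<in> I" "Suc j < n" "initial_word (fst x) ! j = initial_word (fst x) ! Suc j" for x j
    proof -
      have g: "hecke_gen n q (Suc j) \<in> carrier ?H" using that by simp
      have "hecke_gen n q (Suc j) \<odot>\<^bsub>M x\<^esub> e x = hecke_scalar n q (eigenvalue sg q) \<odot>\<^bsub>M x\<^esub> e x"
        unfolding M_def e_def by (rule young_eigen[OF lamI[OF that(1)] that(2,3)])
      then have "hecke_gen n q (Suc j) \<odot>\<^bsub>D\<^esub> inx x (e x) = hecke_scalar n q (eigenvalue sg q) \<odot>\<^bsub>D\<^esub> inx x (e x)"
        using inx_smult[OF g] inx_smult[OF hecke_scalar_carrier] by metis
      then show ?thesis
        using \<Psi>_smult[OF g inx_closed[OF cl(4)]] \<Psi>_smult[OF hecke_scalar_carrier inx_closed[OF cl(4)]] by metis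
    qed
    show "\<theta> y (C (\<Psi> (inx x (e x))) y) = (if x = y then word_vec (initial_word (fst x)) else 0)" if "x \<in> I" "y \<in> I" for x y
      unfolding C_\<Psi>[OF inx_closed[OF cl(4)]] using that by (auto simp: inx_def \<theta>(4) \<theta>_zero)
  next
    fix P v
    assume v: "v \<in> carrier V" and P0: "P \<zero>\<^bsub>V\<^esub>"
      and Pr: "\<And>r x. r \<in> carrier ?H \<Longrightarrow> x \<in> I \<Longrightarrow> P (r \<odot>\<^bsub>V\<^esub> \<Psi> (inx x (e x)))"
      and Pa: "\<And>a b. a \<in> carrier V \<Longrightarrow> b \<in> carrier V \<Longrightarrow> P a \<Longrightarrow> P b \<Longrightarrow> P (a \<oplus>\<^bsub>V\<^esub> b)"
    have Pin: "P (\<Psi> (inx x a))" if x: "x \<in> I" and a: "a \<in> carrier (M x)" for x a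
      using a unfolding M_def
    proof (induction rule: young_induct)
      case zero show ?case using P0 inx_zero[of x] \<Psi>_zero unfolding M_def by simp
    next
      case (smult r)
      then show ?case
        using Pr[OF smult x] \<Psi>_smult[OF smult inx_closed[OF cl(4), of x]] inx_smult[OF smult, of x "e x"]
        unfolding M_def e_def by simp
    next
      case (add a b)
      note ab = add(1,2)[folded M_def]
      have "\<Psi> (inx x (a \<oplus>\<^bsub>M x\<^esub> b)) = \<Psi> (inx x a) \<oplus>\<^bsub>V\<^esub> \<Psi> (inx x b)"
        unfolding inx_add[OF ab] by (rule \<Psi>_add[OF inx_closed[OF ab(1)] inx_closed[OF ab(2)]])
      then show ?case
        using Pa[OF \<Psi>_closed[OF inx_closed[OF ab(1)]] \<Psi>_closed[OF inx_closed[OF ab(2)]] add(3,4)] unfolding M_def by simp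
    qed
    let ?z = "C v"
    \<comment> \<open>Truncations of the coordinate vector to a set of indices; enlarging the set by
      one index adds one component of \<open>v\<close>.\<close>
    let ?t = "\<lambda>A. \<lambda>y\<in>I. if y \<in> A then ?z y else \<zero>\<^bsub>M y\<^esub>"
    have t_closed: "?t A \<in> carrier D" for A
      unfolding D_carrier using C_app[OF v] cl by auto
    have "P (\<Psi> (?t A))" if "A \<subseteq> I" for A
      using finite_subset[OF that fI] that
    proof (induction A rule: finite_induct)
      case empty
      have "?t {} = \<zero>\<^bsub>D\<^esub>" unfolding D_zero by (rule restrict_ext) simp
      then show ?case using P0 \<Psi>_zero by metis
    next
      case (insert x A)
      then have x: "x \<in> I" by simp
      have t: "?t (insert x A) = inx x (?z x) \<oplus>\<^bsub>D\<^esub> ?t A"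
        unfolding D_add inx_def
      proof (rule restrict_ext)
        fix y assume y: "y \<in> I"
        show "(if y \<in> insert x A then ?z y else \<zero>\<^bsub>M y\<^esub>) =
          (\<lambda>y\<in>I. if y = x then ?z x else \<zero>\<^bsub>M y\<^esub>) y \<oplus>\<^bsub>M y\<^esub> ?t A y"
          using zs(1)[OF C_app[OF v y]] zs(2)[OF C_app[OF v y]] zs(1)[OF cl(1)] insert(2) y by (cases "y = x") simp_all
      qed
      have IH: "P (\<Psi> (?t A))" by (rule insert.IH) (use insert.prems in simp)
      show ?case
        unfolding t \<Psi>_add[OF inx_closed[OF C_app[OF v x]] t_closed[of A]]
        by (rule Pa[OF \<Psi>_closed[OF inx_closed[OF C_app[OF v x]]] \<Psi>_closed[OF t_closed] Pin[OF x C_app[OF v x]] IH])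
    qed
    from this[OF subset_refl] have "P (\<Psi> (?t I))" .
    moreover have "?t I = ?z"
    proof
      fix y show "?t I y = ?z y"
        using PiE_arb[OF C_closed[OF v, unfolded D_carrier], of y] by (cases "y \<in> I") simp_all
    qed
    ultimately show "P v" by (simp only: \<Psi>_C[OF v])
  qed
  have "fst ` I = zeta n d" by (force simp: I_def zeta_def image_iff)
  then show ?thesis using double_centraliser cosat by simp
qed

theorem proposition5p7:
  fixes q :: "'f::field" and n :: nat and d :: "nat list \<Rightarrow> nat"
    and V :: "((nat list \<Rightarrow>\<^sub>0 'f) set, 'v) module"
  assumes "q \<noteq> 0" and "n \<ge> 1"
  shows "(young_permutation_module n q d V \<and> co_saturated n (coarsenings n (zeta n d))
            \<longrightarrow> double_centraliser_property (hecke n q) V)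
       \<and> (signed_young_permutation_module n q d V \<and> co_saturated n (coarsenings n (zeta n d))
            \<longrightarrow> double_centraliser_property (hecke n q) V)"
  using double_centraliser_young[OF assms(1), of n V d False] double_centraliser_young[OF assms(1), of n V d True]
  unfolding young_permutation_module_def signed_young_permutation_module_def young_module_simps by blast

end
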